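(* Let $(T,h)$ be an arborescent poset with consistent linearization $h:T\hookrightarrow[1,n]$, let $\lambda$ be a partition with $l(\lambda)\le\#T$, and let $a\in\mathbb D_T(\lambda)$. The character of the minimal subquotient $K_{T,a}=D_a/\sum_{c\in\mathbb D_T(\lambda),\,c\prec a}D_c$ has the following two descriptions: $$\mathrm{ch}(K_{T,a})(x)=\sum_{c\in\mathbb D_T(\lambda),\ c\preceq a}\mu^{\mathbb D_T(\lambda)}(c,a)\,\kappa_c(x)=\sum_{b\in\mathbb S_n\lambda:\ \mathrm{bs}_T^{op}(b)=a}a_b(x).$$
   Context: Ground field algebraically closed of characteristic $0$; partitions are padded by zeros to length $n$; $\mathfrak b_n\subset\mathfrak{gl}_n$ is the algebra of upper triangular matrices. $V_\lambda$ is the irreducible $\mathfrak{gl}_n$-module of highest weight $\lambda$; for $b\in\mathbb S_n\lambda$ (rearrangements of $\lambda$), $D_b=U(\mathfrak b_n)v_b$ with $v_b$ an extremal vector of weight $b$. The Bruhat order on $\mathbb S_n\lambda$ is the reflexive transitive closure of $a\prec(ij)a$ whenever $i<j$ and $a_i>a_j$ ($(ij)a$ exchanges entries $i$ and $j$). $K_b=D_b/\sum_{c\in\mathbb S_n\lambda,\ c\prec b}D_c$. $\mathrm{ch}\,M=\sum_\mu\dim M(\mu)\,x^\mu$ over weights of the diagonal subalgebra; $\kappa_b(x)=\mathrm{ch}\,D_b$ (key polynomial), $a_b(x)=\mathrm{ch}\,K_b$ (Demazure atom). A consistent linearization of a finite poset $(T,\preceq)$ is an injective map $h:T\to[1,n]$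 with $s\prec t\Rightarrow h(s)<h(t)$ and such that each set $\{t:t\succeq s\}$ equals $h^{-1}([a_s,b_s])$ for some $a_s\le b_s$. $\mathbb D_T(\lambda)$ is the set, with induced Bruhat order, of $T$-dominant $d\in\mathbb S_n\lambda$: $d_l=0$ for $l\notin h(T)$ and $d_{h(s)}\ge d_{h(t)}$ whenever $s\succ t$. The Möbius function of a finite poset: $\mu(x,x)=1$, $\mu(x,y)=-\sum_{x\le z<y}\mu(x,z)$ for $x<y$, $\mu(x,y)=0$ if $x\not\le y$. Opposite bubble sort. Put $v(s)=n+1-h(s)$ and for $b\in\mathbb Z^n$ let $b^{op}=(b_n,\dots,b_1)$. Call $d\in\mathbb Z_{\ge0}^n$ admissible if $\#\{j\le k:d_j>0\}\le\#v^{-1}([1,k])$ for all $k$. Call $d$ $[l]$-dominant if: $l\notin v(T)$ implies $d_l=0$; $l\in v(T)$ implies $d_{v(s)}\ge d_l$ for all $s\succ v^{-1}(l)$. For admissible $d$ that is $[l]$-dominant for all $l<k$, $\mathrm{bs}^k(d)$ is the output of: while $d$ is not $[k]$-dominant, let $M$ be the set of $\preceq$-maximal elements of $\{s\in T:v(s)<k,\ d_{v(s)}<d_k\}$, $j=\max v(M)$, and exchange $d_j$ and $d_k$. Then $\mathrm{bs}_T^{op}(b)=\big(\mathrm{bs}^n\circ\dots\circ\mathrm{bs}^1(b^{op})\big)^{op}$, defined for those $b\in\mathbb S_n\lambda$ with $b^{op}$ admissible; the last sum runs over such $b$. *)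

theory Defs
  imports
    "HOL-Computational_Algebra.Computational_Algebra"
    "HOL-Library.Poly_Mapping"
    "HOL-Library.Multiset"
    "HOL-Library.Set_Algebras"
    "HOL-Library.While_Combinator"
    "Jordan_Normal_Form.Matrix"
begin

text \<open>
  Positions \<open>1, \<dots>, n\<close> are numbered \<open>0, \<dots>, n - 1\<close> throughout, as list and matrix indices are.
  Elements of \<open>\<nat>\<^sup>n\<close> are lists of length \<open>n\<close>.
\<close>

subsection \<open>Modules over \<open>gl_n\<close>\<close>

text \<open>
  The module is the whole type \<open>'v\<close>. Only the values of \<open>rho\<close> on \<open>carrier_mat n n\<close> matter.
\<close>

locale gl_module = vector_space scale
  for scale :: "'k::field \<Rightarrow> 'v::ab_group_add \<Rightarrow> 'v" (infixr \<open>*s\<close> 75) +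
  fixes n :: nat and rho :: "'k mat \<Rightarrow> 'v \<Rightarrow> 'v"
  assumes rho_linear: "X \<in> carrier_mat n n \<Longrightarrow> Vector_Spaces.linear scale scale (rho X)"
    and rho_add: "X \<in> carrier_mat n n \<Longrightarrow> Y \<in> carrier_mat n n \<Longrightarrow> rho (X + Y) w = rho X w + rho Y w"
    and rho_smult: "X \<in> carrier_mat n n \<Longrightarrow> rho (c \<cdot>\<^sub>m X) w = c *s rho X w"
    and rho_bracket: "X \<in> carrier_mat n n \<Longrightarrow> Y \<in> carrier_mat n n \<Longrightarrow>
      rho (X * Y - Y * X) w = rho X (rho Y w) - rho Y (rho X w)"
begin

definition irreducible_module :: bool where
  "irreducible_module \<longleftrightarrow> (\<exists>w::'v. w \<noteq> 0) \<and>
     (\<forall>W. subspace W \<and> (\<forall>X\<in>carrier_mat n n. rho X ` W \<subseteq> W) \<longrightarrow> W = {0} \<or> W = UNIV)"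

definition diagonal_subalgebra :: "'k mat set" where
  "diagonal_subalgebra = {H \<in> carrier_mat n n. diagonal_mat H}"

definition upper_borel :: "'k mat set" where
  "upper_borel = {X \<in> carrier_mat n n. upper_triangular X}"

definition wt_eval :: "(nat \<Rightarrow> int) \<Rightarrow> 'k mat \<Rightarrow> 'k" where
  "wt_eval \<mu> H = (\<Sum>i<n. of_int (\<mu> i) * H $$ (i, i))"

definition weight_space :: "'v set \<Rightarrow> (nat \<Rightarrow> int) \<Rightarrow> 'v set" where
  "weight_space W \<mu> = {w \<in> W. \<forall>H\<in>diagonal_subalgebra. rho H w = wt_eval \<mu> H *s w}"

definition has_highest_weight :: "nat list \<Rightarrow> bool" where
  "has_highest_weight lam \<longleftrightarrow> (\<exists>w. w \<noteq> 0 \<and> w \<in> weight_space UNIV (\<lambda>i. int (lam ! i)) \<and>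
     (\<forall>X\<in>carrier_mat n n. (\<forall>i<n. \<forall>j\<le>i. X $$ (i, j) = 0) \<longrightarrow> rho X w = 0))"

text \<open>
  For \<open>b\<close> a rearrangement of the highest weight of an irreducible module, the extremal vectors of
  weight \<open>b\<close> are exactly the nonzero vectors of weight \<open>b\<close>; they are unique up to a scalar.
\<close>

definition extremal_vector :: "nat list \<Rightarrow> 'v \<Rightarrow> bool" where
  "extremal_vector b w \<longleftrightarrow> w \<noteq> 0 \<and> w \<in> weight_space UNIV (\<lambda>i. int (b ! i))"

text \<open>
  \<open>U(b_n) v\<close>: the enveloping algebra is spanned by the products \<open>X\<^sub>1 \<dots> X\<^sub>r\<close> with all \<open>X\<^sub>i\<close> upper
  triangular.
\<close>

definition borel_submodule :: "'v \<Rightarrow> 'v set" where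
  "borel_submodule v = span {foldr rho Xs v | Xs. set Xs \<subseteq> upper_borel}"

text \<open>
  Characters are Laurent polynomials with integer coefficients: a monomial \<open>x\<^sup>\<mu>\<close> is given by its
  exponent vector of type \<open>nat \<Rightarrow>\<^sub>0 int\<close>, supported on \<open>{..<n}\<close>. All weights of an irreducible
  module whose highest weight is a partition are integral and there are finitely many of them, so
  the sum over integral weights is the full character.
\<close>

definition character :: "'v set \<Rightarrow> (nat \<Rightarrow>\<^sub>0 int) \<Rightarrow>\<^sub>0 int" where
  "character W =
     (\<Sum>\<mu> | Poly_Mapping.keys \<mu> \<subseteq> {..<n} \<and> weight_space W (Poly_Mapping.lookup \<mu>) \<noteq> {0}.
        Poly_Mapping.single \<mu> (int (dim (weight_space W (Poly_Mapping.lookup \<mu>)))))"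

text \<open>
  Elements of a quotient \<open>W / N\<close> (with \<open>N \<subseteq> W\<close> subspaces stable under the diagonal subalgebra) are
  the cosets \<open>w +o N\<close> with \<open>w \<in> W\<close>, on which \<open>H\<close> acts by \<open>H (w +o N) = rho H w +o N\<close>.
  The dimension of a subspace \<open>Q\<close> of the space of cosets of \<open>N\<close> is the least size of a finite set
  of vectors whose classes generate \<open>Q\<close>.
\<close>

definition quot_weight_space :: "'v set \<Rightarrow> 'v set \<Rightarrow> (nat \<Rightarrow> int) \<Rightarrow> 'v set set" where
  "quot_weight_space W N \<mu> =
     {w +o N | w. w \<in> W \<and> (\<forall>H\<in>diagonal_subalgebra. rho H w +o N = (wt_eval \<mu> H *s w) +o N)}"

definition quot_dim :: "'v set \<Rightarrow> 'v set set \<Rightarrow> nat" where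
  "quot_dim N Q = (LEAST k. \<exists>S. finite S \<and> card S = k \<and> (\<lambda>w. w +o N) ` span S = Q)"

definition quot_character :: "'v set \<Rightarrow> 'v set \<Rightarrow> (nat \<Rightarrow>\<^sub>0 int) \<Rightarrow>\<^sub>0 int" where
  "quot_character W N =
     (\<Sum>\<mu> | Poly_Mapping.keys \<mu> \<subseteq> {..<n} \<and> quot_weight_space W N (Poly_Mapping.lookup \<mu>) \<noteq> {N}.
        Poly_Mapping.single \<mu> (int (quot_dim N (quot_weight_space W N (Poly_Mapping.lookup \<mu>)))))"

end

subsection \<open>Bruhat order on rearrangements\<close>

definition partition_of_length :: "nat \<Rightarrow> nat list \<Rightarrow> bool" where
  "partition_of_length n lam \<longleftrightarrow> length lam = n \<and> sorted_wrt (\<ge>) lam"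

definition num_parts :: "nat list \<Rightarrow> nat" where
  "num_parts lam = length (filter (\<lambda>p. p > 0) lam)"

definition rearrangements :: "nat list \<Rightarrow> nat list set" where
  "rearrangements lam = {b. mset b = mset lam}"

definition exchange :: "nat \<Rightarrow> nat \<Rightarrow> nat list \<Rightarrow> nat list" where
  "exchange i j d = d[i := d ! j, j := d ! i]"

definition bruhat_step :: "nat list \<Rightarrow> nat list \<Rightarrow> bool" where
  "bruhat_step a b \<longleftrightarrow> (\<exists>i j. i < j \<and> j < length a \<and> a ! i > a ! j \<and> b = exchange i j a)"

definition bruhat_le :: "nat list \<Rightarrow> nat list \<Rightarrow> bool" where
  "bruhat_le = bruhat_step\<^sup>*\<^sup>*"

definition bruhat_less :: "nat list \<Rightarrow> nat list \<Rightarrow> bool" where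
  "bruhat_less a b \<longleftrightarrow> bruhat_le a b \<and> a \<noteq> b"

subsection \<open>Demazure modules, key polynomials and atoms\<close>

text \<open>
  In the next three definitions \<open>ev b\<close> is an extremal vector of weight \<open>b\<close>, for each
  rearrangement \<open>b\<close> of the highest weight \<open>lam\<close>.
\<close>

definition demazure ::
  "('k::field \<Rightarrow> 'v::ab_group_add \<Rightarrow> 'v) \<Rightarrow> nat \<Rightarrow> ('k mat \<Rightarrow> 'v \<Rightarrow> 'v) \<Rightarrow> (nat list \<Rightarrow> 'v) \<Rightarrow>
   nat list \<Rightarrow> 'v set" where
  "demazure scale n rho ev b = gl_module.borel_submodule scale n rho (ev b)"

definition key_polynomial ::
  "('k::field \<Rightarrow> 'v::ab_group_add \<Rightarrow> 'v) \<Rightarrow> nat \<Rightarrow> ('k mat \<Rightarrow> 'v \<Rightarrow> 'v) \<Rightarrow> (nat list \<Rightarrow> 'v) \<Rightarrow>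
   nat list \<Rightarrow> (nat \<Rightarrow>\<^sub>0 int) \<Rightarrow>\<^sub>0 int" where
  "key_polynomial scale n rho ev b = gl_module.character scale n rho (demazure scale n rho ev b)"

text \<open>
  The character of \<open>D\<^sub>b / \<Sum>c. D\<^sub>c\<close>, the sum being over \<open>c \<in> C\<close> with \<open>c \<prec> b\<close>.
\<close>

definition subquotient_character ::
  "('k::field \<Rightarrow> 'v::ab_group_add \<Rightarrow> 'v) \<Rightarrow> nat \<Rightarrow> ('k mat \<Rightarrow> 'v \<Rightarrow> 'v) \<Rightarrow> (nat list \<Rightarrow> 'v) \<Rightarrow>
   nat list set \<Rightarrow> nat list \<Rightarrow> (nat \<Rightarrow>\<^sub>0 int) \<Rightarrow>\<^sub>0 int" where
  "subquotient_character scale n rho ev C b =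
     gl_module.quot_character scale n rho (demazure scale n rho ev b)
       (module.span scale (\<Union>c\<in>{c \<in> C. bruhat_less c b}. demazure scale n rho ev c))"

definition demazure_atom ::
  "('k::field \<Rightarrow> 'v::ab_group_add \<Rightarrow> 'v) \<Rightarrow> nat \<Rightarrow> ('k mat \<Rightarrow> 'v \<Rightarrow> 'v) \<Rightarrow> (nat list \<Rightarrow> 'v) \<Rightarrow>
   nat list \<Rightarrow> nat list \<Rightarrow> (nat \<Rightarrow>\<^sub>0 int) \<Rightarrow>\<^sub>0 int" where
  "demazure_atom scale n rho ev lam b =
     subquotient_character scale n rho ev (rearrangements lam) b"

subsection \<open>Arborescent posets and dominance\<close>

text \<open>
  A finite poset is a finite subset of an ordered type with the induced order. Arborescent: the
  Hasse diagram is a forest whose roots are the minimal elements.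
\<close>

definition arborescent :: "'t::order set \<Rightarrow> bool" where
  "arborescent T \<longleftrightarrow> finite T \<and>
     (\<forall>t\<in>T. \<forall>r\<in>T. \<forall>s\<in>T. r \<le> t \<and> s \<le> t \<longrightarrow> r \<le> s \<or> s \<le> r)"

definition consistent_linearization :: "nat \<Rightarrow> 't::order set \<Rightarrow> ('t \<Rightarrow> nat) \<Rightarrow> bool" where
  "consistent_linearization n T h \<longleftrightarrow> inj_on h T \<and> h ` T \<subseteq> {..<n} \<and>
     (\<forall>s\<in>T. \<forall>t\<in>T. s < t \<longrightarrow> h s < h t) \<and>
     (\<forall>s\<in>T. \<exists>a b. a \<le> b \<and> {t \<in> T. s \<le> t} = {t \<in> T. h t \<in> {a..b}})"

definition T_dominant :: "nat \<Rightarrow> 't::order set \<Rightarrow> ('t \<Rightarrow> nat) \<Rightarrow> nat list \<Rightarrow> bool" where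
  "T_dominant n T h d \<longleftrightarrow> (\<forall>l<n. l \<notin> h ` T \<longrightarrow> d ! l = 0) \<and>
     (\<forall>s\<in>T. \<forall>t\<in>T. t < s \<longrightarrow> d ! h t \<le> d ! h s)"

definition dominant_rearrangements ::
  "nat \<Rightarrow> 't::order set \<Rightarrow> ('t \<Rightarrow> nat) \<Rightarrow> nat list \<Rightarrow> nat list set" where
  "dominant_rearrangements n T h lam = {d \<in> rearrangements lam. T_dominant n T h d}"

subsection \<open>Moebius function of a finite poset\<close>

definition finite_poset :: "'a set \<Rightarrow> ('a \<Rightarrow> 'a \<Rightarrow> bool) \<Rightarrow> bool" where
  "finite_poset P leq \<longleftrightarrow> finite P \<and> reflp_on P leq \<and> antisymp_on P leq \<and> transp_on P leq"

text \<open>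
  The test for \<open>finite_poset\<close> is needed for termination only.
\<close>

function moebius :: "'a set \<Rightarrow> ('a \<Rightarrow> 'a \<Rightarrow> bool) \<Rightarrow> 'a \<Rightarrow> 'a \<Rightarrow> int" where
  "moebius P leq x y =
     (if \<not> finite_poset P leq \<or> x \<notin> P \<or> y \<notin> P \<or> \<not> leq x y then 0
      else if x = y then 1
      else - (\<Sum>z\<in>{z \<in> P. leq x z \<and> leq z y \<and> z \<noteq> y}. moebius P leq x z))"
  by pat_completeness auto
termination
proof (relation "measure (\<lambda>(P, leq, x, y). card {w \<in> P. leq x w \<and> leq w y})", goal_cases)
  case 1
  show ?case by simp
next
  case (2 P leq x y z)
  have P: "finite_poset P leq" and y: "y \<in> P" "leq x y" using 2 by auto
  have z: "z \<in> P" "leq x z" "leq z y" "z \<noteq> y" using 2 by auto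
  have t: "leq w y" if "w \<in> P" "leq w z" for w
    using P that z y unfolding finite_poset_def transp_on_def by blast
  have "\<not> leq y z"
    using P z y unfolding finite_poset_def antisymp_on_def by blast
  then have "{w \<in> P. leq x w \<and> leq w z} \<subset> {w \<in> P. leq x w \<and> leq w y}"
    using t y P unfolding finite_poset_def reflp_on_def by blast
  moreover have "finite {w \<in> P. leq x w \<and> leq w y}"
    using P unfolding finite_poset_def by simp
  ultimately show ?case by (simp add: psubset_card_mono)
qed

declare moebius.simps [simp del]

subsection \<open>Opposite bubble sort\<close>

definition op_pos :: "nat \<Rightarrow> ('t \<Rightarrow> nat) \<Rightarrow> 't \<Rightarrow> nat" where
  "op_pos n h s = n - 1 - h s"

text \<open>
  The first \<open>k\<close> positions are \<open>{..<k}\<close>.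
\<close>

definition admissible :: "nat \<Rightarrow> 't set \<Rightarrow> ('t \<Rightarrow> nat) \<Rightarrow> nat list \<Rightarrow> bool" where
  "admissible n T h d \<longleftrightarrow>
     (\<forall>k\<le>n. card {j. j < k \<and> d ! j > 0} \<le> card {s \<in> T. op_pos n h s < k})"

definition pos_dominant :: "nat \<Rightarrow> 't::order set \<Rightarrow> ('t \<Rightarrow> nat) \<Rightarrow> nat \<Rightarrow> nat list \<Rightarrow> bool" where
  "pos_dominant n T h l d \<longleftrightarrow>
     (l \<notin> op_pos n h ` T \<longrightarrow> d ! l = 0) \<and>
     (\<forall>t\<in>T. op_pos n h t = l \<longrightarrow> (\<forall>s\<in>T. t < s \<longrightarrow> d ! op_pos n h s \<ge> d ! l))"

definition bs_step :: "nat \<Rightarrow> 't::order set \<Rightarrow> ('t \<Rightarrow> nat) \<Rightarrow> nat \<Rightarrow> nat list \<Rightarrow> nat list" where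
  "bs_step n T h k d =
     (let S = {s \<in> T. op_pos n h s < k \<and> d ! op_pos n h s < d ! k};
          M = {s \<in> S. \<forall>t\<in>S. \<not> s < t};
          j = Max (op_pos n h ` M)
      in exchange j k d)"

definition bs :: "nat \<Rightarrow> 't::order set \<Rightarrow> ('t \<Rightarrow> nat) \<Rightarrow> nat \<Rightarrow> nat list \<Rightarrow> nat list" where
  "bs n T h k = while (\<lambda>d. \<not> pos_dominant n T h k d) (bs_step n T h k)"

text \<open>
  \<open>fold\<close> applies \<open>bs n T h 0\<close> first.
\<close>

definition bs_op :: "nat \<Rightarrow> 't::order set \<Rightarrow> ('t \<Rightarrow> nat) \<Rightarrow> nat list \<Rightarrow> nat list" where
  "bs_op n T h b = rev (fold (bs n T h) [0..<n] (rev b))"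

end

theory Submission
  imports Defs "HOL-Library.Function_Algebras" "HOL-Library.Nat_Bijection" "HOL-Library.Product_Plus"
begin

text \<open>
  The \<open>k\<close>-th column of \<open>b\<close> is the set of positions \<open>i\<close> with \<open>b\<^sub>i \<ge> k\<close>, and \<open>V\<^sub>\<lambda>\<close> embeds into a tensor
  power of the natural module in such a way that \<open>v\<^sub>b\<close> becomes the tensor product, over the columns of
  \<open>b\<close>, of decomposable antisymmetric tensors. The submodule of the direct sum that is generated by the
  two highest weight vectors is the graph of this embedding, because the standard bilinear form on the
  tensor power, for which \<open>E\<^sub>i\<^sub>j\<close> and \<open>E\<^sub>j\<^sub>i\<close> are adjoint, is positive definite over the rationals.

  For a lower set \<open>I\<close> of the Bruhat order let \<open>D\<^sub>I\<close> be the sum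
  of the \<open>D\<^sub>b\<close> with \<open>b \<in> I\<close>. Taking leading terms in the tensor factors of the last column \<open>k\<close> bounds
  \<open>ch D\<^sub>I\<close> below by a sum over all sets \<open>S\<close> of \<open>x\<^sup>S\<close> times the characters, for \<open>k - 1\<close> columns, of the
  lower sets of those \<open>d\<close> below some \<open>c \<in> I\<close> with \<open>k\<close>-th column \<open>S\<close>. By a lemma of Deodhar, taking these
  lower sets commutes with intersections, so the bound is modular in \<open>I\<close> by induction on \<open>k\<close>; it also
  satisfies the recursion given by Demazure operators. Representations of \<open>sl\<^sub>2\<close> show that
  \<open>ch D\<^bsub>s b\<^esub>\<close> is at most the image of \<open>ch D\<^sub>b\<close> under the Demazure operator of \<open>s\<close>, so the bound is attained.

  Hence \<open>I \<mapsto> ch D\<^sub>I\<close> is modular, and \<open>ch D\<^sub>I\<close> is the sum of the atoms of the elements of \<open>I\<close>. Bubble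
  sort sends \<open>b\<close> to the least \<open>T\<close>-dominant element above it; so \<open>ch K\<^bsub>T,a\<^esub>\<close> is the sum of the atoms over
  the fibre of \<open>a\<close>, and \<open>\<kappa>\<^sub>c\<close> is the sum of the \<open>ch K\<^bsub>T,a\<^esub>\<close> with \<open>a \<preceq> c\<close>, to which Moebius inversion applies.
\<close>

text \<open>The delicate point is that sums of Demazure modules should intersect in the sum over the
  common indices. Only D_{I \<inter> J} \<subseteq> D_I \<inter> D_J is evident; it makes the
  dimension of each weight space submodular in I. A lower bound that is exactly modular turns this
  around: once it is attained for principal lower sets, submodularity forces it to be attained for
  every lower set, by removing a maximal element. Principal sets come first because each of them
  arises from the set of \<lambda> alone by closures I \<union> s I, which correspond to Demazure
  operators.

  The induction on columns truncates \<lambda> to min(\<lambda>, k) but keeps the rearrangements of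
  \<lambda> as indices, so that one Bruhat order serves all k; distinct indices may then give the
  same module.

  The bilinear form is a sum of products of coordinates. Over an algebraically closed field it has
  isotropic vectors, so positivity has to be confined to tensors with rational coordinates; products
  of matrix units keep the highest weight tensor within these.\<close>

lemma length_exchange [simp]: "length (exchange i j d) = length d"
  by (simp add: exchange_def)

lemma nth_exchange:
  "\<lbrakk>i < length d; j < length d; l < length d\<rbrakk> \<Longrightarrow>
    exchange i j d ! l = (if l = i then d ! j else if l = j then d ! i else d ! l)"
  by (auto simp: exchange_def nth_list_update)

lemma mset_exchange [simp]: "\<lbrakk>i < length d; j < length d\<rbrakk> \<Longrightarrow> mset (exchange i j d) = mset d"
  by (simp add: exchange_def mset_swap)

lemma exchange_exchange [simp]:
  "\<lbrakk>i < length d; j < length d\<rbrakk> \<Longrightarrow> exchange i j (exchange i j d) = d"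
  by (rule nth_equalityI) (auto simp: nth_exchange)

lemma exchange_commute: "exchange i j d = exchange j i d"
  by (cases "i = j") (simp_all add: exchange_def list_update_swap)

lemma exchange_in_rearrangements:
  "\<lbrakk>b \<in> rearrangements lam; i < length b; j < length b\<rbrakk> \<Longrightarrow> exchange i j b \<in> rearrangements lam"
  by (simp add: rearrangements_def)

lemma length_rearrangements: "b \<in> rearrangements lam \<Longrightarrow> length b = length lam"
  by (metis mem_Collect_eq rearrangements_def size_mset)

lemma finite_rearrangements: "finite (rearrangements lam)"
  unfolding rearrangements_def
  by (rule finite_subset[of _ "{xs. set xs \<subseteq> set lam \<and> length xs = length lam}"])
     (auto dest: mset_eq_setD mset_eq_length intro: finite_lists_length_eq)

section \<open>The Bruhat order as domination of prefix counts\<close>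

definition cnt :: "nat list \<Rightarrow> nat \<Rightarrow> nat \<Rightarrow> int" where
  "cnt b q m = (\<Sum>l<q. of_bool (m \<le> b ! l))"

definition prefix_sum :: "nat list \<Rightarrow> nat \<Rightarrow> int" where
  "prefix_sum b q = (\<Sum>l<q. int (b ! l))"

lemma cnt_0 [simp]: "cnt b 0 m = 0"
  and cnt_Suc: "cnt b (Suc q) m = cnt b q m + of_bool (m \<le> b ! q)"
  by (simp_all add: cnt_def)

lemma cnt_exchange:
  assumes "i < j" "j < length d" "q \<le> length d"
  shows "cnt (exchange i j d) q m =
    cnt d q m + (if i < q \<and> q \<le> j then of_bool (m \<le> d ! j) - of_bool (m \<le> d ! i) else 0)"
  using assms(3)
proof (induction q)
  case (Suc q)
  then show ?case using assms(1,2) by (cases "q = j") (auto simp: cnt_Suc nth_exchange less_Suc_eq)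
qed simp

lemma prefix_sum_exchange:
  assumes "i < j" "j < length d" "q \<le> length d"
  shows "prefix_sum (exchange i j d) q =
    prefix_sum d q + (if i < q \<and> q \<le> j then int (d ! j) - int (d ! i) else 0)"
  using assms(3)
proof (induction q)
  case (Suc q)
  then show ?case using assms(1,2) by (cases "q = j") (auto simp: prefix_sum_def nth_exchange less_Suc_eq)
qed (simp add: prefix_sum_def)

lemma cnt_length: "cnt b (length b) m = int (size (filter_mset (\<lambda>x. m \<le> x) (mset b)))"
proof -
  have "cnt b (length b) m = (\<Sum>l<length b. of_bool (m \<le> b ! l))" by (simp add: cnt_def)
  also have "\<dots> = int (card {l. l < length b \<and> m \<le> b ! l})"
    by (simp add: sum.If_cases of_bool_def Collect_conj_eq lessThan_def Int_commute)
  also have "\<dots> = int (length (filter (\<lambda>x. m \<le> x) b))"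
    by (simp add: length_filter_conv_card)
  also have "\<dots> = int (size (filter_mset (\<lambda>x. m \<le> x) (mset b)))"
    by (metis mset_filter size_mset)
  finally show ?thesis .
qed

text \<open>The tableau criterion. Going up in the Bruhat order moves large entries to the right, so
  for every threshold a prefix can only lose entries that reach it. Comparisons become inequalities
  between counts, on which lifting properties are easy to check.\<close>

definition dom_le :: "nat list \<Rightarrow> nat list \<Rightarrow> bool" where
  "dom_le b c \<longleftrightarrow> mset b = mset c \<and> (\<forall>q\<le>length b. \<forall>m. cnt c q m \<le> cnt b q m)"

lemma dom_le_refl [simp]: "dom_le b b"
  by (simp add: dom_le_def)

lemma dom_le_trans: "dom_le a b \<Longrightarrow> dom_le b c \<Longrightarrow> dom_le a c"
  unfolding dom_le_def by (metis mset_eq_length order_trans)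

lemma dom_le_length: "dom_le b c \<Longrightarrow> length b = length c"
  by (auto simp: dom_le_def dest: mset_eq_length)

lemma dom_leD: "dom_le b c \<Longrightarrow> q \<le> length b \<Longrightarrow> cnt c q m \<le> cnt b q m"
  by (simp add: dom_le_def)

lemma bruhat_step_dom_le: "bruhat_step a b \<Longrightarrow> dom_le a b"
  unfolding bruhat_step_def dom_le_def
  by (auto simp: cnt_exchange)

text \<open>The sum of all prefix sums bounds the length of chains and gives antisymmetry: a step
  moves a larger entry to the right, so no prefix sum grows, and the one of length \<open>j\<close>
  drops.\<close>

lemma bruhat_step_measure:
  assumes "bruhat_step a b"
  shows "sum (prefix_sum b) {..length a} < sum (prefix_sum a) {..length a}"
proof -
  obtain i j where ij: "i < j" "j < length a" "a ! j < a ! i" "b = exchange i j a"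
    using assms by (auto simp: bruhat_step_def)
  show ?thesis
    by (rule sum_strict_mono_ex1) (use ij in \<open>auto simp: prefix_sum_exchange intro!: bexI[of _ j]\<close>)
qed

lemma measure_nonneg: "0 \<le> sum (prefix_sum a) A"
  by (auto simp: prefix_sum_def intro!: sum_nonneg)

text \<open>At the first place \<open>i\<close> where the words differ, \<open>x\<close> has the
  larger entry. It is exchanged with the nearest later entry of \<open>x\<close> whose value lies in
  [y_i, x_i); nearest, so that no entry passed over has a value in this range.\<close>

lemma dom_le_step:
  assumes "dom_le x y" "x \<noteq> y"
  shows "\<exists>x'. bruhat_step x x' \<and> dom_le x' y"
proof -
  let ?n = "length x"
  have len: "length y = ?n" and ms: "mset x = mset y"
    using assms dom_le_length by (auto simp: dom_le_def)
  have ex: "\<exists>i. i < ?n \<and> x ! i \<noteq> y ! i"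
    using assms(2) len by (metis nth_equalityI)
  define i where "i = (LEAST i. i < ?n \<and> x ! i \<noteq> y ! i)"
  have i: "i < ?n" "x ! i \<noteq> y ! i" using LeastI_ex[OF ex] by (auto simp: i_def)
  have pre: "x ! l = y ! l" if "l < i" for l
    using that i(1) not_less_Least[of l "\<lambda>i. i < ?n \<and> x ! i \<noteq> y ! i"] by (auto simp: i_def)
  have cpre: "cnt x i m = cnt y i m" for m
    unfolding cnt_def using pre by (intro sum.cong) auto
  have gt: "y ! i < x ! i"
  proof (rule ccontr)
    assume "\<not> ?thesis"
    then have "x ! i < y ! i" using i by linarith
    then show False
      using dom_leD[OF assms(1), of "Suc i" "y ! i"] i(1) cpre by (simp add: cnt_Suc)
  qed
  have tk: "take i x = take i y"
    by (rule nth_equalityI) (use pre i len in auto)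
  have "mset (drop i x) = mset (drop i y)"
    using ms tk by (metis add_left_cancel append_take_drop_id mset_append)
  moreover have "y ! i \<in> set (drop i y)"
    using i len by (metis Cons_nth_drop_Suc list.set_intros(1))
  ultimately have "y ! i \<in> set (drop i x)" by (metis set_mset_mset)
  then obtain l where l: "l < ?n - i" "x ! (i + l) = y ! i"
    by (auto simp: in_set_conv_nth)
  define Q where "Q = (\<lambda>j. i < j \<and> j < ?n \<and> y ! i \<le> x ! j \<and> x ! j < x ! i)"
  have exQ: "\<exists>j. Q j"
  proof
    show "Q (i + l)" unfolding Q_def using l gt i by (cases l) auto
  qed
  define j where "j = (LEAST j. Q j)"
  have j: "i < j" "j < ?n" "y ! i \<le> x ! j" "x ! j < x ! i"
    using LeastI_ex[OF exQ] unfolding j_def[symmetric] by (auto simp: Q_def)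
  have jmin: "\<not> Q r" if "r < j" for r using that not_less_Least by (auto simp: j_def)
  have step: "bruhat_step x (exchange i j x)"
    using j by (auto simp: bruhat_step_def)
  have "dom_le (exchange i j x) y"
    unfolding dom_le_def
  proof (intro conjI allI impI)
    show "mset (exchange i j x) = mset y" using ms j i by simp
    fix q m assume q: "q \<le> length (exchange i j x)"
    show "cnt y q m \<le> cnt (exchange i j x) q m"
    proof (cases "i < q \<and> q \<le> j \<and> x ! j < m \<and> m \<le> x ! i")
      case False
      then show ?thesis using q j dom_leD[OF assms(1), of q m] by (auto simp: cnt_exchange)
    next
      case True
      have "cnt y q m + 1 \<le> cnt x q m"
      proof -
        \<comment> \<open>No entry of \<open>x\<close> strictly between \<open>i\<close> and
          \<open>q\<close> has a value in [y_i, m), so from \<open>i\<close> on the thresholds y_i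
          and m count the same positions of \<open>x\<close>. In \<open>y\<close>, position
          \<open>i\<close> is counted for y_i only. Domination at y_i therefore leaves one entry to
          spare at m.\<close>
        have a: "cnt x q' (y ! i) = cnt x i (y ! i) + 1 + (cnt x q' m - cnt x i m - 1)
            \<and> cnt y q' (y ! i) \<ge> cnt y i (y ! i) + 1 + (cnt y q' m - cnt y i m)"
          if "i < q'" "q' \<le> q" for q'
          using that
        proof (induction q')
          case (Suc r)
          show ?case
          proof (cases "r = i")
            case True
            then show ?thesis using \<open>i < q \<and> q \<le> j \<and> x ! j < m \<and> m \<le> x ! i\<close> gt j by (auto simp: cnt_Suc)
          next
            case False
            then have r: "i < r" "r < q" "r < ?n" using Suc.prems q by auto
            have "\<not> Q r" using r True jmin by auto
            then have "y ! i \<le> x ! r \<longleftrightarrow> m \<le> x ! r" using r True j by (auto simp: Q_def)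
            then show ?thesis using Suc.IH r True j by (auto simp: cnt_Suc)
          qed
        qed simp
        have qn: "q \<le> length x" using q by simp
        show ?thesis using a[of q] True dom_leD[OF assms(1) qn, of "y ! i"]
          unfolding cpre by linarith
      qed
      then show ?thesis using True q j by (simp add: cnt_exchange)
    qed
  qed
  then show ?thesis using step by blast
qed

lemma bruhat_le_iff_dom_le: "bruhat_le = dom_le"
proof (intro ext iffI)
  fix x y assume "bruhat_le x y"
  then show "dom_le x y" unfolding bruhat_le_def
    by (induction rule: rtranclp_induct) (auto intro: dom_le_trans bruhat_step_dom_le)
next
  fix x y assume "dom_le x y"
  then show "bruhat_le x y"
  proof (induction "nat (sum (prefix_sum x) {..length x})" arbitrary: x rule: less_induct)
    case less
    show ?case
    proof (cases "x = y")
      case False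
      then obtain x' where x': "bruhat_step x x'" "dom_le x' y" using dom_le_step less.prems by blast
      have "length x' = length x" using x'(1) by (auto simp: bruhat_step_def)
      then have "nat (sum (prefix_sum x') {..length x'}) < nat (sum (prefix_sum x) {..length x})"
        using bruhat_step_measure[OF x'(1)] measure_nonneg[of x' "{..length x}"] by auto
      from less.hyps[OF this x'(2)] show ?thesis
        using x'(1) unfolding bruhat_le_def by (rule converse_rtranclp_into_rtranclp[rotated])
    qed (simp add: bruhat_le_def)
  qed
qed

lemma bruhat_le_refl [simp]: "bruhat_le a a"
  by (simp add: bruhat_le_def)

lemma bruhat_le_trans: "bruhat_le a b \<Longrightarrow> bruhat_le b c \<Longrightarrow> bruhat_le a c"
  by (simp add: bruhat_le_def)

lemma bruhat_le_measure:
  "bruhat_le a b \<Longrightarrow> length b = length a \<and> (a = b \<or> sum (prefix_sum b) {..length a} < sum (prefix_sum a) {..length a})"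
  unfolding bruhat_le_def
proof (induction rule: rtranclp_induct)
  case (step y z)
  then show ?case using bruhat_step_measure[OF step(2)] by (auto simp: bruhat_step_def)
qed simp

lemma bruhat_le_antisym: "bruhat_le a b \<Longrightarrow> bruhat_le b a \<Longrightarrow> a = b"
  using bruhat_le_measure[of a b] bruhat_le_measure[of b a] by auto

lemma bruhat_le_mset: "bruhat_le a b \<Longrightarrow> mset a = mset b"
  by (simp add: bruhat_le_iff_dom_le dom_le_def)

lemma bruhat_le_rearrangements: "bruhat_le a b \<Longrightarrow> a \<in> rearrangements lam \<longleftrightarrow> b \<in> rearrangements lam"
  using bruhat_le_mset by (simp add: rearrangements_def)

lemma bruhat_le_exchange_up:
  "\<lbrakk>Suc i < length b; b ! Suc i \<le> b ! i\<rbrakk> \<Longrightarrow> bruhat_le b (exchange i (Suc i) b)"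
  unfolding bruhat_le_iff_dom_le dom_le_def by (auto simp: cnt_exchange)

lemma bruhat_le_exchange_down:
  "\<lbrakk>Suc i < length b; b ! i \<le> b ! Suc i\<rbrakk> \<Longrightarrow> bruhat_le (exchange i (Suc i) b) b"
  unfolding bruhat_le_iff_dom_le dom_le_def by (auto simp: cnt_exchange)

text \<open>Lifting property. Only the prefix of length \<open>Suc i\<close> changes. As y_i \<le>
  y_{i+1}, a threshold not reached at position \<open>i\<close> of \<open>y\<close> is controlled by
  the prefix of length \<open>i\<close>; one that is reached there is reached at the next position
  too and is controlled by the prefix of length \<open>i + 2\<close>.\<close>

lemma bruhat_lift_left:
  assumes "bruhat_le x y" "Suc i < length y" "y ! i \<le> y ! Suc i"
  shows "bruhat_le (exchange i (Suc i) x) y"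
  unfolding bruhat_le_iff_dom_le dom_le_def
proof (intro conjI allI impI)
  have d: "dom_le x y" using assms by (simp add: bruhat_le_iff_dom_le)
  have len: "length x = length y" using d dom_le_length by blast
  show "mset (exchange i (Suc i) x) = mset y"
    using assms(2) len d by (simp add: dom_le_def)
  fix q m assume q: "q \<le> length (exchange i (Suc i) x)"
  show "cnt y q m \<le> cnt (exchange i (Suc i) x) q m"
  proof (cases "q = Suc i")
    case False
    then show ?thesis using dom_leD[OF d, of q m] q len assms(2) by (auto simp: cnt_exchange)
  next
    case True
    have "cnt y i m \<le> cnt x i m" "cnt y (Suc i) m \<le> cnt x (Suc i) m"
      "cnt y (Suc (Suc i)) m \<le> cnt x (Suc (Suc i)) m"
      using dom_leD[OF d] assms(2) len by auto
    then show ?thesis using True len assms(2,3) by (auto simp: cnt_exchange cnt_Suc nth_exchange of_bool_def split: if_splits)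
  qed
qed

lemma bruhat_lift_right:
  assumes "bruhat_le x y" "Suc i < length y" "x ! Suc i \<le> x ! i"
  shows "bruhat_le x (exchange i (Suc i) y)"
  unfolding bruhat_le_iff_dom_le dom_le_def
proof (intro conjI allI impI)
  have d: "dom_le x y" using assms by (simp add: bruhat_le_iff_dom_le)
  have len: "length x = length y" using d dom_le_length by blast
  show "mset x = mset (exchange i (Suc i) y)"
    using assms(2) len d by (simp add: dom_le_def)
  fix q m assume q: "q \<le> length x"
  show "cnt (exchange i (Suc i) y) q m \<le> cnt x q m"
  proof (cases "q = Suc i")
    case False
    then show ?thesis using dom_leD[OF d, of q m] q len assms(2) by (auto simp: cnt_exchange)
  next
    case True
    have "cnt y i m \<le> cnt x i m" "cnt y (Suc i) m \<le> cnt x (Suc i) m"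
      "cnt y (Suc (Suc i)) m \<le> cnt x (Suc (Suc i)) m"
      using dom_leD[OF d] assms(2) len by auto
    then show ?thesis using True len assms(2,3) by (auto simp: cnt_exchange cnt_Suc nth_exchange of_bool_def split: if_splits)
  qed
qed

lemma bruhat_exchange_mono:
  assumes "bruhat_le x y" "Suc i < length y" "y ! Suc i \<le> y ! i"
  shows "bruhat_le (exchange i (Suc i) x) (exchange i (Suc i) y)"
proof (rule bruhat_lift_left)
  show "bruhat_le x (exchange i (Suc i) y)"
    using assms bruhat_le_trans bruhat_le_exchange_up by blast
qed (use assms in \<open>auto simp: nth_exchange\<close>)

lemma bruhat_exchange_mono':
  assumes "bruhat_le x y" "Suc i < length y" "x ! i \<le> x ! Suc i"
  shows "bruhat_le (exchange i (Suc i) x) (exchange i (Suc i) y)"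
proof -
  have len: "length x = length y" using assms(1) bruhat_le_measure by auto
  have "bruhat_le (exchange i (Suc i) x) y"
    using bruhat_le_trans[OF bruhat_le_exchange_down assms(1)] len assms(2,3) by auto
  then show ?thesis by (rule bruhat_lift_right) (use assms len in \<open>auto simp: nth_exchange\<close>)
qed

subsection \<open>Columns\<close>

definition column :: "nat \<Rightarrow> nat list \<Rightarrow> nat set" where
  "column k b = {i. i < length b \<and> k \<le> b ! i}"

lemma finite_column [simp]: "finite (column k b)"
  by (simp add: column_def)

lemma column_subset: "column k b \<subseteq> {..<length b}"
  by (auto simp: column_def)

lemma cnt_column: "q \<le> length b \<Longrightarrow> cnt b q k = int (card (column k b \<inter> {..<q}))"
proof -
  assume q: "q \<le> length b"
  have "cnt b q k = int (card ({..<q} \<inter> {l. k \<le> b ! l}))"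
    by (simp add: cnt_def sum.If_cases of_bool_def)
  also have "{..<q} \<inter> {l. k \<le> b ! l} = column k b \<inter> {..<q}"
    using q by (auto simp: column_def)
  finally show ?thesis .
qed

lemma card_column_cong: "mset b = mset c \<Longrightarrow> card (column k b) = card (column k c)"
proof -
  assume a: "mset b = mset c"
  have "column k x \<inter> {..<length x} = column k x" for x by (auto simp: column_def)
  then have "int (card (column k x)) = cnt x (length x) k" for x
    using cnt_column[of "length x" x k] by simp
  then have "int (card (column k b)) = int (card (column k c))" using a by (simp add: cnt_length)
  then show ?thesis by simp
qed

lemma in_column_exchange:
  assumes "i < length b" "j < length b"
  shows "l \<in> column k (exchange i j b) \<longleftrightarrow> transpose i j l \<in> column k b"
  using assms by (auto simp: column_def nth_exchange transpose_def)

lemma column_exchange: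
  assumes "i < length b" "j < length b"
  shows "column k (exchange i j b) = transpose i j ` column k b"
proof (rule Set.set_eqI)
  fix l
  show "l \<in> column k (exchange i j b) \<longleftrightarrow> l \<in> transpose i j ` column k b"
    unfolding in_column_exchange[OF assms] by (simp add: in_transpose_image_iff)
qed

text \<open>If S contains i + 1 but not i, both upper elements have an ascent at i; exchanging there
  lowers the sum of S, and the lifting property carries \<open>d\<close> along. If there is no such
  i, then S is an initial segment, which forces the column of \<open>d\<close> to be S as well, and
  \<open>d\<close> itself serves.\<close>

lemma bruhat_deodhar:
  assumes "bruhat_le d c1" "bruhat_le d c2" "column k c1 = S" "column k c2 = S"
  shows "\<exists>c. bruhat_le d c \<and> bruhat_le c c1 \<and> bruhat_le c c2 \<and> column k c = S"
  using assms
proof (induction "\<Sum>S" arbitrary: S d c1 c2 rule: less_induct)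
  case less
  let ?n = "length d"
  have len: "length c1 = ?n" "length c2 = ?n"
    using less.prems bruhat_le_measure by auto
  have finS: "finite S" using less.prems(3) by auto
  show ?case
  proof (cases "\<exists>i. Suc i \<in> S \<and> i \<notin> S")
    case True
    then obtain i where i: "Suc i \<in> S" "i \<notin> S" by blast
    let ?s = "exchange i (Suc i)"
    have "Suc i \<in> column k c1" "i \<notin> column k c1" "Suc i \<in> column k c2" "i \<notin> column k c2"
      using i unfolding less.prems(3,4) by auto
    then have n: "Suc i < ?n" and c: "c1 ! i < c1 ! Suc i" "c2 ! i < c2 ! Suc i"
      unfolding column_def len mem_Collect_eq by auto
    let ?S = "transpose i (Suc i) ` S"
    have S': "?S = insert i (S - {Suc i})"
      using i by (intro Set.set_eqI) (simp only: in_transpose_image_iff, auto simp: transpose_def)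
    have "\<Sum>S = Suc i + \<Sum>(S - {Suc i})" using i finS by (intro sum.remove) auto
    moreover have "\<Sum>(insert i (S - {Suc i})) = i + \<Sum>(S - {Suc i})"
      using i finS by (intro sum.insert) auto
    ultimately have lt: "\<Sum>?S < \<Sum>S" unfolding S' by linarith
    have cols: "column k (?s c1) = ?S" "column k (?s c2) = ?S"
      using less.prems(3,4) column_exchange[of i c1 "Suc i" k] column_exchange[of i c2 "Suc i" k] n len
      by simp_all
    \<comment> \<open>The smaller of \<open>d\<close> and its exchange. It has no ascent at
      \<open>i\<close>, as lifting to the exchanged upper elements requires.\<close>
    define d' where "d' = (if d ! Suc i \<le> d ! i then d else ?s d)"
    have lift: "bruhat_le d' (?s c)" if "bruhat_le d c" "length c = ?n" for c
    proof (cases "d ! Suc i \<le> d ! i")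
      case True
      then show ?thesis using bruhat_lift_right[OF that(1)] that(2) n by (simp add: d'_def)
    next
      case False
      then show ?thesis using bruhat_exchange_mono'[OF that(1)] that(2) n by (simp add: d'_def)
    qed
    have d': "bruhat_le d' (?s c1)" "bruhat_le d' (?s c2)"
      using lift[OF less.prems(1) len(1)] lift[OF less.prems(2) len(2)] .
    obtain e where e: "bruhat_le d' e" "bruhat_le e (?s c1)" "bruhat_le e (?s c2)" "column k e = ?S"
      using less.hyps[OF lt d' cols] by blast
    have "length d' = ?n" by (simp add: d'_def)
    then have lene: "length e = ?n" using bruhat_le_measure[OF e(1)] by simp
    have "i \<in> column k e" "Suc i \<notin> column k e" unfolding e(4) S' by auto
    then have ee: "e ! Suc i < e ! i" using n unfolding column_def lene mem_Collect_eq by auto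
    have "bruhat_le (?s e) (?s (?s c1))"
      by (rule bruhat_exchange_mono[OF e(2)]) (use c n len in \<open>simp_all add: nth_exchange\<close>)
    moreover have "bruhat_le (?s e) (?s (?s c2))"
      by (rule bruhat_exchange_mono[OF e(3)]) (use c n len in \<open>simp_all add: nth_exchange\<close>)
    ultimately have 1: "bruhat_le (?s e) c1" "bruhat_le (?s e) c2" using n len by simp_all
    have "column k (?s e) = transpose i (Suc i) ` ?S"
      using column_exchange[of i e "Suc i" k] n lene e(4) by simp
    then have 2: "column k (?s e) = S" by (simp add: image_image)
    have "bruhat_le e (?s e)" using bruhat_le_exchange_up ee n lene by simp
    then have 3: "bruhat_le d' (?s e)" using e(1) bruhat_le_trans by blast
    have "bruhat_le d (?s e)"
    proof (cases "d ! Suc i \<le> d ! i")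
      case True then show ?thesis using 3 by (simp add: d'_def)
    next
      case False
      then have "bruhat_le (?s d) (?s e)" using 3 by (simp add: d'_def)
      then have "bruhat_le (?s (?s d)) (?s e)"
        by (rule bruhat_lift_left) (use ee n lene in \<open>auto simp: nth_exchange\<close>)
      then show ?thesis using n by simp
    qed
    then show ?thesis using 1 2 by blast
  next
    case False
    have down: "j \<in> S \<Longrightarrow> i \<le> j \<Longrightarrow> i \<in> S" for i j
    proof (induction "j - i" arbitrary: i)
      case (Suc x)
      then have "Suc i \<in> S" by (metis Suc_diff_Suc Suc_leI diff_Suc_1 nat_less_le zero_less_Suc zero_less_diff)
      then show ?case using False by blast
    qed auto
    have eq: "card (column k d) = card S"
      using card_column_cong[OF bruhat_le_mset[OF less.prems(1)]] less.prems(3) by auto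
    \<comment> \<open>In \<open>c1\<close> every prefix that ends in a position of the initial
      segment S consists of entries at least \<open>k\<close>; domination passes this on to
      \<open>d\<close>.\<close>
    have "S \<subseteq> column k d"
    proof
      fix j assume j: "j \<in> S"
      then have jn: "j < ?n" using less.prems(3) len by (auto simp: column_def)
      have "{..<Suc j} \<subseteq> S" using down j by auto
      then have "cnt c1 (Suc j) k = int (Suc j)"
        using cnt_column[of "Suc j" c1 k] jn len less.prems(3) by (simp add: Int_absorb1)
      then have "int (Suc j) \<le> cnt d (Suc j) k"
        using dom_leD[of d c1 "Suc j" k] less.prems(1) jn by (simp add: bruhat_le_iff_dom_le)
      also have "cnt d (Suc j) k = int (card (column k d \<inter> {..<Suc j}))"
        using cnt_column jn by simp
      finally have "card {..<Suc j} \<le> card (column k d \<inter> {..<Suc j})" by simp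
      then have "column k d \<inter> {..<Suc j} = {..<Suc j}"
        by (intro card_seteq) auto
      then show "j \<in> column k d" by auto
    qed
    then have "column k d = S" using eq by (intro card_subset_eq[symmetric]) auto
    then show ?thesis using less.prems by (intro exI[of _ d]) simp
  qed
qed

subsection \<open>Opposite bubble sort\<close>

lemma cnt_rev:
  assumes "q \<le> length b"
  shows "cnt (rev b) q m = cnt b (length b) m - cnt b (length b - q) m"
  using assms
proof (induction q)
  case (Suc q)
  have "length b - q = Suc (length b - Suc q)" using Suc.prems by simp
  then show ?case using Suc by (simp add: cnt_Suc rev_nth)
qed simp

text \<open>Suffix counts are complements of prefix counts, so reversal turns the order around. The
  least dominant element above \<open>b\<close> thus becomes the \<open>dom_le\<close>-greatest
  dominant word below the reversal of \<open>b\<close>.\<close>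

lemma bruhat_le_rev: "bruhat_le (rev d) (rev e) \<longleftrightarrow> dom_le e d"
proof -
  have "dom_le (rev d) (rev e) \<longleftrightarrow> dom_le e d"
  proof (cases "mset d = mset e")
    case True
    then have l: "length d = length e" by (rule mset_eq_length)
    have t: "cnt d (length e) m = cnt e (length e) m" for m using cnt_length[of d m] cnt_length[of e m] True l by simp
    have "(\<forall>q\<le>length e. \<forall>m. cnt (rev e) q m \<le> cnt (rev d) q m) \<longleftrightarrow>
      (\<forall>q\<le>length e. \<forall>m. cnt d (length e - q) m \<le> cnt e (length e - q) m)"
      using l t by (auto simp: cnt_rev)
    also have "\<dots> \<longleftrightarrow> (\<forall>q\<le>length e. \<forall>m. cnt d q m \<le> cnt e q m)"
      by (metis diff_diff_cancel diff_le_self)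
    finally show ?thesis using True l by (auto simp: dom_le_def)
  qed (auto simp: dom_le_def)
  then show ?thesis by (simp add: bruhat_le_iff_dom_le)
qed

lemma card_pos_cnt: "int (card {j. j < k \<and> 0 < d ! j}) = cnt d k (Suc 0)"
proof -
  have "cnt d k (Suc 0) = int (card ({..<k} \<inter> {l. Suc 0 \<le> d ! l}))"
    by (simp add: cnt_def sum.If_cases of_bool_def)
  also have "{..<k} \<inter> {l. Suc 0 \<le> d ! l} = {j. j < k \<and> 0 < d ! j}" by auto
  finally show ?thesis by simp
qed

section \<open>The sorted word as the least dominant element above a given one\<close>

locale linearized_poset =
  fixes n :: nat and T :: "'t::order set" and h :: "'t \<Rightarrow> nat"
  assumes lin: "consistent_linearization n T h"
begin

abbreviation v :: "'t \<Rightarrow> nat" where "v \<equiv> op_pos n h"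

lemma finT: "finite T"
  using lin finite_imageD finite_subset by (auto simp: consistent_linearization_def)

lemma h_less: "s \<in> T \<Longrightarrow> h s < n"
  using lin by (auto simp: consistent_linearization_def)

lemma v_less: "s \<in> T \<Longrightarrow> v s < n"
  using h_less[of s] by (auto simp: op_pos_def)

lemma v_eq_iff: "s \<in> T \<Longrightarrow> t \<in> T \<Longrightarrow> v s = v t \<longleftrightarrow> s = t"
proof -
  assume "s \<in> T" "t \<in> T"
  moreover have "inj_on h T" using lin by (simp add: consistent_linearization_def)
  moreover have "v s = v t \<longleftrightarrow> h s = h t"
    using h_less[OF \<open>s \<in> T\<close>] h_less[OF \<open>t \<in> T\<close>] by (auto simp: op_pos_def)
  ultimately show ?thesis by (simp add: inj_on_eq_iff)
qed

lemma v_strict: "s \<in> T \<Longrightarrow> t \<in> T \<Longrightarrow> s < t \<Longrightarrow> v t < v s"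
proof -
  assume a: "s \<in> T" "t \<in> T" "s < t"
  then have "h s < h t" using lin by (auto simp: consistent_linearization_def)
  then show ?thesis using h_less[of t] a by (auto simp: op_pos_def)
qed

text \<open>What consistency means for the sort: the elements above \<open>u\<close> occupy
  consecutive positions, of which \<open>u\<close> itself has the last.\<close>

lemma v_interval:
  assumes "u \<in> T" "y \<in> T" "w \<in> T" "u \<le> y" "v y \<le> v w" "v w \<le> v u"
  shows "u \<le> w"
proof -
  obtain a b where ab: "{t \<in> T. u \<le> t} = {t \<in> T. h t \<in> {a..b}}"
    using lin assms(1) unfolding consistent_linearization_def by blast
  have "u \<in> {t \<in> T. u \<le> t}" "y \<in> {t \<in> T. u \<le> t}" using assms by auto
  then have "a \<le> h u" "h y \<le> b" unfolding ab by auto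
  moreover have "h u \<le> h w" "h w \<le> h y"
    using assms h_less[of u] h_less[of y] h_less[of w] by (auto simp: op_pos_def)
  ultimately have "w \<in> {t \<in> T. h t \<in> {a..b}}" using assms by auto
  then show ?thesis unfolding ab[symmetric] by simp
qed

definition up_to_dominant :: "nat \<Rightarrow> nat list \<Rightarrow> bool" where
  "up_to_dominant k d \<longleftrightarrow> (\<forall>l<k. pos_dominant n T h l d)"

lemma up_to_dominantD1: "up_to_dominant k d \<Longrightarrow> l < k \<Longrightarrow> l \<notin> v ` T \<Longrightarrow> d ! l = 0"
  by (auto simp: up_to_dominant_def pos_dominant_def)

lemma up_to_dominantD2:
  "up_to_dominant k d \<Longrightarrow> t \<in> T \<Longrightarrow> s \<in> T \<Longrightarrow> t \<le> s \<Longrightarrow> v t < k \<Longrightarrow> d ! v t \<le> d ! v s"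
  by (cases "t = s") (auto simp: up_to_dominant_def pos_dominant_def)

lemma up_to_dominant_cnt_le:
  assumes "up_to_dominant k d" "q \<le> k"
  shows "cnt d q 1 \<le> int (card {s \<in> T. v s < q})"
proof -
  have "{j. j < q \<and> 0 < d ! j} \<subseteq> v ` {s \<in> T. v s < q}"
  proof
    fix j assume j: "j \<in> {j. j < q \<and> 0 < d ! j}"
    then have "j \<in> v ` T" using up_to_dominantD1[OF assms(1), of j] assms(2) by auto
    then show "j \<in> v ` {s \<in> T. v s < q}" using j by auto
  qed
  then have "card {j. j < q \<and> 0 < d ! j} \<le> card (v ` {s \<in> T. v s < q})"
    using finT by (intro card_mono) auto
  also have "\<dots> \<le> card {s \<in> T. v s < q}" using finT by (intro card_image_le) auto
  finally show ?thesis by (simp flip: card_pos_cnt)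
qed

lemma admissible_cnt: "admissible n T h d \<longleftrightarrow> (\<forall>q\<le>n. cnt d q 1 \<le> int (card {s \<in> T. v s < q}))"
  unfolding admissible_def by (simp flip: card_pos_cnt)

text \<open>If no element of T sits at \<open>k\<close>, admissibility leaves a zero at some
  position of T before \<open>k\<close>, so there is a candidate. Taking the maximal candidate with
  the last position puts every later candidate, and the element at \<open>k\<close>, below it,
  because up-sets are intervals.\<close>

lemma bs_step_obtain:
  assumes len: "length d = n" and k: "k < n" and dom: "up_to_dominant k d"
    and adm: "admissible n T h d" and nd: "\<not> pos_dominant n T h k d"
  obtains s where "s \<in> T" "v s < k" "d ! v s < d ! k" "bs_step n T h k d = exchange (v s) k d"
    and "\<And>t. t \<in> T \<Longrightarrow> s < t \<Longrightarrow> d ! k \<le> d ! v t"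
    and "\<And>t. t \<in> T \<Longrightarrow> v t = k \<Longrightarrow> t < s"
    and "\<And>u. u \<in> T \<Longrightarrow> v s < v u \<Longrightarrow> v u < k \<Longrightarrow> d ! v u < d ! k \<Longrightarrow> u < s"
proof -
  define S where "S = {s \<in> T. v s < k \<and> d ! v s < d ! k}"
  define M where "M = {s \<in> S. \<forall>t\<in>S. \<not> s < t}"
  have fin: "finite S" "finite M" using finT by (auto simp: S_def M_def)
  have "S \<noteq> {}"
  proof (cases "k \<in> v ` T")
    case True
    then obtain t s where "t \<in> T" "v t = k" "s \<in> T" "t < s" "d ! v s < d ! k"
      using nd by (auto simp: pos_dominant_def not_le)
    then show ?thesis using v_strict unfolding S_def by blast
  next
    case False
    then have dk: "0 < d ! k" using nd by (auto simp: pos_dominant_def)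
    show ?thesis
    proof
      assume "S = {}"
      then have pos: "0 < d ! v s" if "s \<in> T" "v s < k" for s using that dk by (force simp: S_def)
      have eq: "{s \<in> T. v s < Suc k} = {s \<in> T. v s < k}" using False by (auto simp: less_Suc_eq)
      have "v ` {s \<in> T. v s < k} \<subseteq> {j. j < k \<and> 0 < d ! j}" using pos by auto
      then have "card (v ` {s \<in> T. v s < k}) \<le> card {j. j < k \<and> 0 < d ! j}" by (intro card_mono) auto
      moreover have "card (v ` {s \<in> T. v s < k}) = card {s \<in> T. v s < k}"
        by (rule card_image) (auto simp: inj_on_def v_eq_iff)
      ultimately have "int (card {s \<in> T. v s < k}) \<le> cnt d k 1" by (simp flip: card_pos_cnt)
      moreover have "cnt d (Suc k) 1 \<le> int (card {s \<in> T. v s < Suc k})"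
        using adm k by (simp add: admissible_cnt)
      ultimately show False using dk eq by (simp add: cnt_Suc)
    qed
  qed
  have above: "\<exists>m\<in>M. y \<le> m" if "y \<in> S" for y
    using finite_has_maximal2[OF fin(1) that] by (force simp: M_def)
  then have "M \<noteq> {}" using \<open>S \<noteq> {}\<close> by blast
  then have "Max (v ` M) \<in> v ` M" using fin by (intro Max_in) auto
  then obtain s where s: "s \<in> M" "v s = Max (v ` M)" by auto
  have max: "v m \<le> v s" if "m \<in> M" for m using s(2) that fin by simp
  have MT: "m \<in> T" if "m \<in> M" for m using that by (auto simp: M_def S_def)
  have sT: "s \<in> T" "v s < k" "d ! v s < d ! k" using s by (auto simp: M_def S_def)
  \<comment> \<open>A maximal candidate \<open>m\<close> above \<open>y\<close> sits no later than
    \<open>s\<close>, and \<open>s\<close> sits before \<open>u\<close>. Since u \<le> m, the up-set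
    of \<open>u\<close> covers the positions in between, hence contains \<open>s\<close>.\<close>
  have below: "u < s" if u: "u \<in> T" "v s < v u" "y \<in> S" "u \<le> y" for u y
  proof -
    obtain m where m: "m \<in> M" "y \<le> m" using above u by blast
    then have "u \<le> s" using v_interval[of u m s] u max[of m] MT sT by auto
    then show ?thesis using u by (auto simp: less_le)
  qed
  show ?thesis
  proof (rule that[OF sT])
    show "bs_step n T h k d = exchange (v s) k d"
      unfolding bs_step_def Let_def s(2) M_def S_def ..
    fix t assume t: "t \<in> T"
    { assume st: "s < t"
      then have "t \<notin> S" using s by (auto simp: M_def)
      moreover have "v t < k" using v_strict[OF sT(1) t st] sT by simp
      ultimately show "d ! k \<le> d ! v t" using t by (auto simp: S_def not_less) }
    { assume tk: "v t = k"
      then obtain y where "y \<in> T" "t < y" "d ! v y < d ! k"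
        using nd t by (auto simp: pos_dominant_def not_le v_eq_iff)
      then have "y \<in> S" "t \<le> y" using v_strict[OF t] tk by (auto simp: S_def)
      then show "t < s" using below t tk sT by blast }
    { assume "v s < v t" "v t < k" "d ! v t < d ! k"
      then show "t < s" using below[of t t] t by (auto simp: S_def) }
  qed
qed

text \<open>The exchange raises counts of \<open>d\<close> by one, for prefixes that end between the
  two positions and thresholds between the two values. Domination by a dominant \<open>c\<close>
  survives because it is strict in exactly this range.\<close>

lemma bs_step_lower_bound:
  assumes len: "length d = n" and k: "k < n" and dom: "up_to_dominant k d"
    and adm: "admissible n T h d" and nd: "\<not> pos_dominant n T h k d"
    and c: "up_to_dominant n c" and le: "dom_le c d"
  shows "dom_le c (bs_step n T h k d)"
proof -
  obtain s where s: "s \<in> T" "v s < k" "d ! v s < d ! k" "bs_step n T h k d = exchange (v s) k d"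
    and s1: "\<And>t. t \<in> T \<Longrightarrow> v t = k \<Longrightarrow> t < s"
    and s2: "\<And>u. u \<in> T \<Longrightarrow> v s < v u \<Longrightarrow> v u < k \<Longrightarrow> d ! v u < d ! k \<Longrightarrow> u < s"
    using bs_step_obtain[OF len k dom adm nd] by metis
  have lc: "length c = n" using dom_le_length[OF le] len by simp
  have strict: "cnt d q m < cnt c q m" if q: "v s < q" "q \<le> k" and m: "d ! v s < m" "m \<le> d ! k" for q m
  proof (cases "\<exists>u\<in>T. u \<le> s \<and> q \<le> v u \<and> m \<le> c ! v u")
    \<comment> \<open>Dominance spreads the large entry of \<open>c\<close> at \<open>u\<close> to
      everything above \<open>u\<close>, hence to all positions of T from \<open>v s\<close> up to
      \<open>q\<close>. So \<open>c\<close> gains on \<open>d\<close> at \<open>v s\<close> and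
      loses nowhere else before \<open>q\<close>.\<close>
    case True
    then obtain u where u: "u \<in> T" "u \<le> s" "q \<le> v u" "m \<le> c ! v u" by blast
    have up: "m \<le> c ! v w" if "w \<in> T" "u \<le> w" for w
      using up_to_dominantD2[OF c u(1) that(1,2)] v_less[OF u(1)] u(4) by simp
    have "cnt d q' m - cnt d (v s) m + 1 \<le> cnt c q' m - cnt c (v s) m" if "v s < q'" "q' \<le> q" for q'
      using that
    proof (induction q')
      case (Suc r)
      show ?case
      proof (cases "r = v s")
        case True
        then show ?thesis using up[OF s(1) u(2)] m by (simp add: cnt_Suc)
      next
        case False
        then have r: "v s < r" "r < q" using Suc.prems by auto
        have "of_bool (m \<le> d ! r) \<le> (of_bool (m \<le> c ! r) :: int)"
        proof (cases "r \<in> v ` T")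
          case True
          then obtain w where w: "w \<in> T" "r = v w" by blast
          have "u \<le> w" using v_interval[OF u(1) s(1) w(1) u(2)] r w u(3) by simp
          then show ?thesis using up w by simp
        next
          case False
          then have "d ! r = 0" using up_to_dominantD1[OF dom] r q by simp
          then show ?thesis using m by simp
        qed
        then show ?thesis using Suc.IH r by (simp add: cnt_Suc)
      qed
    qed simp
    from this[of q] show ?thesis using q dom_leD[OF le, of "v s" m] s lc k by simp
  next
    \<comment> \<open>Here the count runs from the right end. An entry of \<open>c\<close> from
      \<open>q\<close> to \<open>k\<close> that reaches m does not belong to an element below
      \<open>s\<close>; so before \<open>k\<close> the word \<open>d\<close> reaches m there too,
      and at \<open>k\<close> only \<open>d\<close> does. What \<open>c\<close> lacks on this
      stretch it must have in excess before \<open>q\<close>.\<close>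
    case False
    have mid: "cnt c r m - cnt c q m \<le> cnt d r m - cnt d q m" if "q \<le> r" "r \<le> k" for r
      using that
    proof (induction r rule: dec_induct)
      case (step r)
      have "m \<le> d ! r" if cr: "m \<le> c ! r"
      proof (rule ccontr)
        assume nm: "\<not> m \<le> d ! r"
        have "c ! r \<noteq> 0" using cr m by auto
        then obtain w where w: "w \<in> T" "r = v w"
          using up_to_dominantD1[OF c, of r] step k by force
        then have "w < s" using s2[OF w(1)] nm m step q by simp
        then show False using False w cr step by auto
      qed
      then show ?case using step by (auto simp: cnt_Suc)
    qed simp
    have ck: "\<not> m \<le> c ! k"
    proof
      assume ck: "m \<le> c ! k"
      then have "c ! k \<noteq> 0" using m by auto
      then obtain t where "t \<in> T" "k = v t"
        using up_to_dominantD1[OF c, of k] k by force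
      then show False using s1[of t] False ck q by (auto simp: less_imp_le)
    qed
    have "cnt d (Suc k) m \<le> cnt c (Suc k) m" using dom_leD[OF le, of "Suc k"] lc k by simp
    then show ?thesis using mid[of k] q m ck by (simp add: cnt_Suc)
  qed
  show ?thesis
    unfolding s(4) dom_le_def
  proof (intro conjI allI impI)
    show "mset c = mset (exchange (v s) k d)" using le s(2) k len by (simp add: dom_le_def)
    fix q m assume "q \<le> length c"
    then have q: "q \<le> length d" using lc len by simp
    have "cnt d q m \<le> cnt c q m" using dom_leD[OF le] q lc len by simp
    then show "cnt (exchange (v s) k d) q m \<le> cnt c q m"
      using cnt_exchange[OF s(2), of d q m] strict[of q m] k len q by (auto simp: of_bool_def split: if_splits)
  qed
qed

text \<open>The value at \<open>k\<close> drops, which makes the loop terminate. Dominance before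
  \<open>k\<close> survives because all elements above the partner already carry at least the value
  moved there. Admissibility follows from dominance for prefixes up to \<open>k\<close>, and longer
  prefixes keep their counts.\<close>

lemma bs_step_invariant:
  assumes len: "length d = n" and k: "k < n" and dom: "up_to_dominant k d"
    and adm: "admissible n T h d" and nd: "\<not> pos_dominant n T h k d"
  shows "length (bs_step n T h k d) = n" "up_to_dominant k (bs_step n T h k d)"
    "admissible n T h (bs_step n T h k d)" "dom_le (bs_step n T h k d) d"
    "bs_step n T h k d ! k < d ! k"
proof -
  obtain s where s: "s \<in> T" "v s < k" "d ! v s < d ! k" "bs_step n T h k d = exchange (v s) k d"
    and s0: "\<And>t. t \<in> T \<Longrightarrow> s < t \<Longrightarrow> d ! k \<le> d ! v t"
    using bs_step_obtain[OF len k dom adm nd] by metis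
  let ?d = "exchange (v s) k d"
  have vn: "v s < n" using s k by simp
  have nth: "?d ! l = (if l = v s then d ! k else if l = k then d ! v s else d ! l)" if "l < n" for l
    using nth_exchange[of "v s" d k l] that len k vn by simp
  show "length (bs_step n T h k d) = n" using s len by simp
  show "bs_step n T h k d ! k < d ! k" using s nth[OF k] by simp
  show dom': "up_to_dominant k (bs_step n T h k d)"
    unfolding up_to_dominant_def
  proof (intro allI impI)
    fix l assume l: "l < k"
    show "pos_dominant n T h l (bs_step n T h k d)"
      unfolding pos_dominant_def s(4)
    proof (intro conjI impI ballI)
      assume "l \<notin> v ` T"
      then show "?d ! l = 0" using up_to_dominantD1[OF dom l] nth[of l] l k s(1) by auto
    next
      fix t r assume t: "t \<in> T" "v t = l" "r \<in> T" "t < r"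
      have vr: "v r < l" using v_strict t by blast
      show "?d ! l \<le> ?d ! v r"
      proof (cases "l = v s")
        case True
        then have "t = s" using t s v_eq_iff by blast
        then show ?thesis using s0[of r] t nth[of l] nth[of "v r"] True vr l k by simp
      next
        case False
        have "d ! l \<le> d ! v r" using up_to_dominantD2[OF dom t(1,3)] t l by simp
        then show ?thesis using nth[of l] nth[of "v r"] False vr l k s(3) by auto
      qed
    qed
  qed
  show "dom_le (bs_step n T h k d) d"
    unfolding s(4) dom_le_def using cnt_exchange[OF s(2), of d] s k len vn by auto
  show "admissible n T h (bs_step n T h k d)"
    unfolding admissible_cnt
  proof (intro allI impI)
    fix q assume q: "q \<le> n"
    show "cnt (bs_step n T h k d) q 1 \<le> int (card {s \<in> T. v s < q})"
    proof (cases "q \<le> k")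
      case True
      then show ?thesis using up_to_dominant_cnt_le[OF dom'] by blast
    next
      case False
      then have "cnt (bs_step n T h k d) q 1 = cnt d q 1"
        using s(4) cnt_exchange[OF s(2), of d q 1] k len q by simp
      then show ?thesis using adm q by (simp add: admissible_cnt)
    qed
  qed
qed

text \<open>The last conjunct carries the universal property through the loops: at
  \<open>k = n\<close> it makes \<open>d\<close> the greatest dominant word below
  \<open>d0\<close>.\<close>

definition bs_inv :: "nat list \<Rightarrow> nat \<Rightarrow> nat list \<Rightarrow> bool" where
  "bs_inv d0 k d \<longleftrightarrow> length d = n \<and> up_to_dominant k d \<and> admissible n T h d \<and> dom_le d d0 \<and>
     (\<forall>c. up_to_dominant n c \<and> dom_le c d0 \<longrightarrow> dom_le c d)"

lemma bs_inv_bs: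
  assumes "bs_inv d0 k d" "k < n"
  shows "bs_inv d0 (Suc k) (bs n T h k d)"
  unfolding bs_def
proof (rule while_rule[where P = "bs_inv d0 k" and r = "measure (\<lambda>d. d ! k)"])
  fix e assume e: "bs_inv d0 k e" "\<not> pos_dominant n T h k e"
  note i = e(1)[unfolded bs_inv_def]
  show "bs_inv d0 k (bs_step n T h k e)"
    using bs_step_invariant[of e k] bs_step_lower_bound[of e k] i e(2) assms(2) dom_le_trans
    unfolding bs_inv_def by blast
  show "(bs_step n T h k e, e) \<in> measure (\<lambda>d. d ! k)"
    using bs_step_invariant(5)[of e k] i e(2) assms(2) by simp
next
  fix e assume "bs_inv d0 k e" "\<not> \<not> pos_dominant n T h k e"
  then show "bs_inv d0 (Suc k) e"
    by (auto simp: bs_inv_def up_to_dominant_def less_Suc_eq)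
qed (use assms in auto)

lemma bs_inv_fold:
  assumes "length d = n" "admissible n T h d" "k \<le> n"
  shows "bs_inv d k (fold (bs n T h) [0..<k] d)"
  using assms(3)
proof (induction k)
  case 0
  then show ?case using assms by (simp add: bs_inv_def up_to_dominant_def)
next
  case (Suc k)
  then show ?case using bs_inv_bs by simp
qed

lemma T_dominant_rev:
  assumes "length c = n"
  shows "T_dominant n T h c \<longleftrightarrow> up_to_dominant n (rev c)"
proof -
  have r: "rev c ! v s = c ! h s" if "s \<in> T" for s
    using h_less[OF that] assms by (simp add: op_pos_def rev_nth)
  have 1: "(\<forall>l<n. l \<notin> h ` T \<longrightarrow> c ! l = 0) \<longleftrightarrow> (\<forall>l<n. l \<notin> v ` T \<longrightarrow> rev c ! l = 0)" (is "?A \<longleftrightarrow> ?B")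
  proof
    assume A: ?A
    show ?B
    proof (intro allI impI)
      fix l assume l: "l < n" "l \<notin> v ` T"
      have "n - Suc l \<notin> h ` T" using l by (auto simp: op_pos_def image_iff)
      then show "rev c ! l = 0" using A l assms by (simp add: rev_nth)
    qed
  next
    assume B: ?B
    show ?A
    proof (intro allI impI)
      fix l assume l: "l < n" "l \<notin> h ` T"
      have "n - Suc l \<notin> v ` T"
      proof
        assume "n - Suc l \<in> v ` T"
        then obtain t where t: "t \<in> T" "n - Suc l = n - 1 - h t" by (auto simp: op_pos_def)
        then have "l = h t" using l h_less[of t] by linarith
        then show False using l t by blast
      qed
      then have "rev c ! (n - Suc l) = 0" using B l by simp
      then show "c ! l = 0" using l assms by (simp add: rev_nth)
    qed
  qed
  have 2: "(\<forall>s\<in>T. \<forall>t\<in>T. t < s \<longrightarrow> c ! h t \<le> c ! h s) \<longleftrightarrow>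
      (\<forall>l<n. \<forall>t\<in>T. v t = l \<longrightarrow> (\<forall>s\<in>T. t < s \<longrightarrow> rev c ! l \<le> rev c ! v s))"
    using r v_less by metis
  show ?thesis
    unfolding T_dominant_def up_to_dominant_def pos_dominant_def 1 2 by blast
qed

theorem bs_op_least:
  assumes "length b = n" "admissible n T h (rev b)"
  shows "T_dominant n T h (bs_op n T h b)" "bruhat_le b (bs_op n T h b)"
    "\<And>c. T_dominant n T h c \<Longrightarrow> bruhat_le b c \<Longrightarrow> bruhat_le (bs_op n T h b) c"
proof -
  let ?e = "fold (bs n T h) [0..<n] (rev b)"
  have i: "bs_inv (rev b) n ?e" using bs_inv_fold[of "rev b" n] assms by simp
  then have len: "length (bs_op n T h b) = n" by (simp add: bs_inv_def bs_op_def)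
  show "T_dominant n T h (bs_op n T h b)"
    using T_dominant_rev[OF len] i by (simp add: bs_inv_def bs_op_def)
  show "bruhat_le b (bs_op n T h b)"
    using i bruhat_le_rev[of "rev b" ?e] by (simp add: bs_inv_def bs_op_def)
  fix c assume c: "T_dominant n T h c" "bruhat_le b c"
  then have lc: "length c = n" using bruhat_le_measure assms(1) by auto
  have "dom_le (rev c) (rev b)" using bruhat_le_rev[of "rev b" "rev c"] c by simp
  then have "dom_le (rev c) ?e" using i T_dominant_rev[OF lc] c by (simp add: bs_inv_def)
  then show "bruhat_le (bs_op n T h b) c"
    using bruhat_le_rev[of ?e "rev c"] by (simp add: bs_op_def)
qed

text \<open>The reversal of a dominant word has its positive entries at positions of T only, and
  reversing turns the order around, so the prefixes of \<open>rev b\<close> have no more positive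
  entries. Thus the domain of the sort contains everything below a dominant element.\<close>

lemma admissible_below_dominant:
  assumes "length b = n" "T_dominant n T h c" "bruhat_le b c"
  shows "admissible n T h (rev b)"
proof -
  have lc: "length c = n" using assms bruhat_le_measure by auto
  have d: "dom_le (rev c) (rev b)" using bruhat_le_rev[of "rev b" "rev c"] assms by simp
  have u: "up_to_dominant n (rev c)" using T_dominant_rev[OF lc] assms by simp
  show ?thesis
    unfolding admissible_cnt
  proof (intro allI impI)
    fix q assume q: "q \<le> n"
    then have "cnt (rev b) q 1 \<le> cnt (rev c) q 1" using dom_leD[OF d] lc by simp
    also have "\<dots> \<le> int (card {s \<in> T. v s < q})" using up_to_dominant_cnt_le[OF u q] .
    finally show "cnt (rev b) q 1 \<le> int (card {s \<in> T. v s < q})" .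
  qed
qed

end

subsection \<open>Dimensions of finite-dimensional subspaces\<close>

text \<open>
  A copy of \<open>vector_space\<close>, because facts added to \<open>vector_space\<close> itself would be shadowed by their
  instances for the global interpretation \<open>real_vector\<close>.
\<close>

locale vspace = vector_space scale
  for scale :: "'a::field \<Rightarrow> 'b::ab_group_add \<Rightarrow> 'b" (infixr \<open>*s\<close> 75)
begin

text \<open>The space of all functions on words is infinite-dimensional, and the irreducible module
  is seen to be finite-dimensional only after its realization. Finiteness is therefore a property of
  subsets.\<close>

definition fin_dim :: "'b set \<Rightarrow> bool" where
  "fin_dim S \<longleftrightarrow> (\<exists>B. finite B \<and> S \<subseteq> span B)"

lemma fin_dim_subset: "fin_dim T \<Longrightarrow> S \<subseteq> T \<Longrightarrow> fin_dim S"
  by (auto simp: fin_dim_def)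

lemma fin_dim_span: "fin_dim S \<Longrightarrow> fin_dim (span S)"
  by (metis fin_dim_def span_minimal subspace_span)

lemma fin_dim_Un: "fin_dim S \<Longrightarrow> fin_dim T \<Longrightarrow> fin_dim (S \<union> T)"
  unfolding fin_dim_def
  by (meson finite_Un Un_least order_trans span_mono sup_ge1 sup_ge2)

lemma fin_dim_basis:
  assumes "fin_dim S"
  obtains B where "finite B" "independent B" "B \<subseteq> S" "S \<subseteq> span B" "card B = dim S"
  using assms basis_exists[of S] independent_span_bound
  by (metis fin_dim_def subset_trans)

lemma fin_dim_independent_card:
  assumes "fin_dim S" "independent C" "C \<subseteq> span S"
  shows "finite C \<and> card C \<le> dim S"
proof -
  obtain B where B: "finite B" "S \<subseteq> span B" "card B = dim S"
    using fin_dim_basis[OF assms(1)] by metis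
  have "span S \<subseteq> span B" using B by (simp add: span_minimal)
  then show ?thesis using independent_span_bound[OF B(1) assms(2)] assms(3) B(3) by auto
qed

lemma dim_mono_fin_dim: "fin_dim T \<Longrightarrow> S \<subseteq> span T \<Longrightarrow> dim S \<le> dim T"
  by (metis basis_exists fin_dim_independent_card subset_trans)

lemma dim_subset_fin_dim: "fin_dim T \<Longrightarrow> S \<subseteq> T \<Longrightarrow> dim S \<le> dim T"
  by (meson dim_mono_fin_dim span_superset subset_trans)

lemma dim_eq_imp_eq:
  assumes "fin_dim T" "subspace S" "S \<subseteq> T" "dim T \<le> dim S"
  shows "S = T"
proof (rule ccontr)
  assume "S \<noteq> T"
  then obtain x where x: "x \<in> T" "x \<notin> S" using assms by blast
  obtain B where B: "finite B" "independent B" "B \<subseteq> S" "S \<subseteq> span B" "card B = dim S"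
    using fin_dim_basis[OF fin_dim_subset[OF assms(1,3)]] by metis
  have "x \<notin> span B" using x B assms(2) by (meson span_minimal subsetD)
  then have "independent (insert x B)" using B by (simp add: independent_insertI)
  moreover have "insert x B \<subseteq> span T" using x B assms(3) by (meson insert_subset span_superset subset_trans subsetD)
  ultimately have "card (insert x B) \<le> dim T" using fin_dim_independent_card[OF assms(1)] by blast
  moreover have "x \<notin> B" using \<open>x \<notin> span B\<close> span_base by blast
  ultimately show False using B assms(4) by simp
qed

lemma dim_zero_subspace: "dim {0} = 0"
proof -
  have "dim {0} = dim (span {})" by simp
  then show ?thesis by (metis card.empty dim_span_eq_card_independent independent_empty)
qed

lemma dim_singleton_space: "x \<noteq> 0 \<Longrightarrow> dim (span {x}) = 1"
  by (subst dim_span_eq_card_independent) auto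

text \<open>The map kills a basis of \<open>T\<close> and fixes the vectors that extend it to a
  basis of the space. It stands for the projection to the quotient by \<open>T\<close>, with values
  in the same space.\<close>

lemma complement_map:
  assumes T: "subspace T"
  obtains g where "Vector_Spaces.linear scale scale g" "{x. g x = 0} = T" "\<And>x. x - g x \<in> T"
proof -
  interpret p: vector_space_pair scale scale ..
  obtain B where B: "B \<subseteq> T" "independent B" "T \<subseteq> span B"
    using maximal_independent_subset by metis
  obtain C where C: "B \<subseteq> C" "independent C" "UNIV \<subseteq> span C"
    using maximal_independent_subset_extend[of B UNIV] B by auto
  obtain g where g: "Vector_Spaces.linear scale scale g" "\<forall>x\<in>C. g x = (if x \<in> B then 0 else x)"
    using p.linear_independent_extend[OF C(2), of "\<lambda>x. if x \<in> B then 0 else x"] by blast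
  interpret g: Vector_Spaces.linear scale scale g by (fact g(1))
  have TB: "T = span B" using B T by (metis span_subspace)
  have zero: "g x = 0" if "x \<in> T" for x
    by (rule g.eq_0_on_span[of B]) (use that g(2) C(1) TB in auto)
  have diff: "x - g x \<in> T" for x
  proof -
    have "x \<in> span C" using C by auto
    then show ?thesis
    proof (induction rule: span_induct)
      case base
      show ?case
        using T by (auto simp: subspace_def g.add g.scale scale_right_diff_distrib[symmetric]
          intro!: subspaceI) (metis add_diff_add)
    next
      case (step x)
      then show ?case using g(2) B(1) T subspace_0 by auto
    qed
  qed
  have "g x = 0 \<longleftrightarrow> x \<in> T" for x using zero diff[of x] by auto
  then show ?thesis using that[OF g(1)] diff by auto
qed

end

locale vspace_pair = vs1: vspace s1 + vs2: vspace s2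
  for s1 :: "'a::field \<Rightarrow> 'b::ab_group_add \<Rightarrow> 'b"
    and s2 :: "'a::field \<Rightarrow> 'c::ab_group_add \<Rightarrow> 'c"
begin

sublocale vector_space_pair s1 s2 ..


text \<open>A basis of the kernel is extended to a basis of \<open>S\<close>. A map that fixes the
  first part and kills the added vectors shows that their spans meet in 0 only, so \<open>f\<close>
  is injective on the span of the added vectors.\<close>

lemma rank_nullity_fin_dim:
  assumes f: "Vector_Spaces.linear s1 s2 f" and S: "vs1.subspace S" "vs1.fin_dim S"
  shows "vs1.dim (S \<inter> {x. f x = 0}) + vs2.dim (f ` S) = vs1.dim S" "vs2.fin_dim (f ` S)"
proof -
  interpret f: Vector_Spaces.linear s1 s2 f by fact
  interpret q: vector_space_pair s1 s1 ..
  let ?K = "S \<inter> {x. f x = 0}"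
  have K: "vs1.subspace ?K" using vs1.subspace_inter[OF S(1) f.subspace_kernel] .
  obtain B where B: "finite B" "vs1.independent B" "B \<subseteq> ?K" "?K \<subseteq> vs1.span B" "card B = vs1.dim ?K"
    by (rule vs1.fin_dim_basis[OF vs1.fin_dim_subset[OF S(2) Int_lower1]])
  obtain C where C: "B \<subseteq> C" "C \<subseteq> S" "vs1.independent C" "S \<subseteq> vs1.span C"
    by (rule vs1.maximal_independent_subset_extend[of B S]) (use B in auto)
  have finC: "finite C" using vs1.fin_dim_independent_card[OF S(2) C(3)] C(2) vs1.span_superset by blast
  have cardC: "card C = vs1.dim S" using vs1.basis_card_eq_dim C by metis
  obtain g where g: "Vector_Spaces.linear s1 s1 g" "\<forall>x\<in>C. g x = (if x \<in> B then x else 0)"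
    using q.linear_independent_extend[OF C(3), of "\<lambda>x. if x \<in> B then x else 0"] by blast
  interpret g: Vector_Spaces.linear s1 s1 g by (fact g(1))
  have disj: "x = 0" if "x \<in> vs1.span B" "x \<in> vs1.span (C - B)" for x
  proof -
    have "g x = 0" by (rule g.eq_0_on_span[of "C - B"]) (use that g(2) in auto)
    moreover have "g x = x"
      using that(1)
    proof (induction rule: vs1.span_induct)
      case base
      show ?case by (rule vs1.subspaceI) (auto simp: g.add g.scale)
    next
      case (step x)
      then show ?case using g(2) C(1) by auto
    qed
    ultimately show ?thesis by simp
  qed
  have spS: "vs1.span C = S" using C S by (metis vs1.span_subspace)
  have inj: "inj_on f (vs1.span (C - B))"
    unfolding f.inj_on_iff_eq_0[OF vs1.subspace_span]
  proof (intro ballI impI)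
    fix x assume x: "x \<in> vs1.span (C - B)" "f x = 0"
    have "x \<in> S" using x vs1.span_mono[of "C - B" C] spS by blast
    then show "x = 0" using disj[of x] x B(4) by blast
  qed
  have ind: "vs2.independent (f ` (C - B))"
    using f.independent_injective_image[OF vs1.independent_mono[OF C(3)] inj] by blast
  have "f ` S = vs2.span (f ` C)" using spS f.span_image by metis
  also have "\<dots> = vs2.span (f ` (C - B))"
  proof (rule antisym)
    have "f ` C \<subseteq> insert 0 (f ` (C - B))" using B(3) by auto
    also have "\<dots> \<subseteq> vs2.span (f ` (C - B))" by (simp add: vs2.span_zero vs2.span_superset)
    finally have "f ` C \<subseteq> vs2.span (f ` (C - B))" .
    then show "vs2.span (f ` C) \<subseteq> vs2.span (f ` (C - B))" by (simp add: vs2.span_minimal)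
  qed (auto intro!: vs2.span_mono)
  finally have im: "f ` S = vs2.span (f ` (C - B))" .
  then show "vs2.fin_dim (f ` S)" using finC unfolding vs2.fin_dim_def by (metis finite_Diff finite_imageI order_refl)
  have "inj_on f (C - B)" using inj by (rule inj_on_subset) (rule vs1.span_superset)
  then have "vs2.dim (f ` S) = card (C - B)"
    using im vs2.dim_span_eq_card_independent[OF ind] by (simp add: card_image)
  then show "vs1.dim ?K + vs2.dim (f ` S) = vs1.dim S"
    using B C finC cardC card_mono[OF finC C(1)] by (simp add: card_Diff_subset)
qed

lemma dim_image_inj_fin_dim:
  assumes f: "Vector_Spaces.linear s1 s2 f" and S: "vs1.subspace S" "vs1.fin_dim S"
    and inj: "\<And>x. x \<in> S \<Longrightarrow> f x = 0 \<Longrightarrow> x = 0"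
  shows "vs2.dim (f ` S) = vs1.dim S"
proof -
  interpret f: Vector_Spaces.linear s1 s2 f by fact
  have "S \<inter> {x. f x = 0} = {0}" using inj vs1.subspace_0[OF S(1)] by auto
  then show ?thesis using rank_nullity_fin_dim(1)[OF f S] vs1.dim_zero_subspace by simp
qed

end

context vspace
begin

text \<open>Rank-nullity for a map with kernel \<open>T\<close>, applied to S and to S + T, which
  have the same image.\<close>

lemma dim_Un_Int_fin_dim:
  assumes S: "subspace S" "fin_dim S" and T: "subspace T" "fin_dim T"
  shows "dim (span (S \<union> T)) + dim (S \<inter> T) = dim S + dim T"
proof -
  interpret p: vspace_pair scale scale ..
  obtain g where g: "Vector_Spaces.linear scale scale g" "{x. g x = 0} = T"
    using complement_map[OF T(1)] by metis
  interpret g: Vector_Spaces.linear scale scale g by (fact g(1))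
  have "g ` span (S \<union> T) = span (g ` (S \<union> T))" by (simp add: g.span_image)
  also have "\<dots> = span (g ` S)"
  proof (rule antisym)
    have "g ` (S \<union> T) \<subseteq> insert 0 (g ` S)" using g(2) by auto
    also have "\<dots> \<subseteq> span (g ` S)" by (simp add: span_zero span_superset)
    finally have "g ` (S \<union> T) \<subseteq> span (g ` S)" .
    then show "span (g ` (S \<union> T)) \<subseteq> span (g ` S)" by (simp add: span_minimal)
  qed (auto intro!: span_mono)
  finally have im: "g ` span (S \<union> T) = g ` S"
    using span_subspace[OF order_refl span_superset S(1)] by (simp add: g.span_image)
  have "span (S \<union> T) \<inter> {x. g x = 0} = T" unfolding g(2) using span_superset[of "S \<union> T"] by auto
  moreover have "fin_dim (span (S \<union> T))" using fin_dim_span fin_dim_Un S T by blast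
  ultimately have "dim T + dim (g ` S) = dim (span (S \<union> T))"
    using p.rank_nullity_fin_dim(1)[OF g(1), of "span (S \<union> T)"] im by simp
  moreover have "dim (S \<inter> T) + dim (g ` S) = dim S"
    using p.rank_nullity_fin_dim(1)[OF g(1) S] g(2) by simp
  ultimately show ?thesis by simp
qed

end

subsection \<open>Modules given by operators for the matrix units\<close>

text \<open>Operators for matrix units on an arbitrary space put the abstract module, the tensor
  space and the direct sum of both under the same lemmas.\<close>

locale gl_rep = vspace scale
  for scale :: "'a::field \<Rightarrow> 'b::ab_group_add \<Rightarrow> 'b" (infixr \<open>*s\<close> 75) +
  fixes E :: "nat \<Rightarrow> nat \<Rightarrow> 'b \<Rightarrow> 'b" and n :: nat
  assumes E_linear: "i < n \<Longrightarrow> j < n \<Longrightarrow> Vector_Spaces.linear scale scale (E i j)"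
    and E_bracket: "i < n \<Longrightarrow> j < n \<Longrightarrow> k < n \<Longrightarrow> l < n \<Longrightarrow>
      E i j (E k l x) - E k l (E i j x) = (if j = k then E i l x else 0) - (if l = i then E k j x else 0)"
begin

lemma E_add: "i < n \<Longrightarrow> j < n \<Longrightarrow> E i j (x + y) = E i j x + E i j y"
  and E_scale: "i < n \<Longrightarrow> j < n \<Longrightarrow> E i j (c *s x) = c *s E i j x"
  and E_0: "i < n \<Longrightarrow> j < n \<Longrightarrow> E i j 0 = 0"
proof -
  assume "i < n" "j < n"
  then interpret l: Vector_Spaces.linear scale scale "E i j" by (rule E_linear)
  show "E i j (x + y) = E i j x + E i j y" "E i j (c *s x) = c *s E i j x" "E i j 0 = 0"
    by (simp_all add: l.add l.scale)
qed

lemma E_swap: "i < n \<Longrightarrow> j < n \<Longrightarrow> k < n \<Longrightarrow> l < n \<Longrightarrow>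
    E i j (E k l x) = E k l (E i j x) + (if j = k then E i l x else 0) - (if l = i then E k j x else 0)"
  using E_bracket[of i j k l x] by (simp add: algebra_simps)

definition submod :: "(nat \<times> nat) set \<Rightarrow> 'b \<Rightarrow> 'b set" where
  "submod R x = span {foldr (\<lambda>(i, j). E i j) ps x | ps. set ps \<subseteq> R}"

lemma subspace_submod: "subspace (submod R x)"
  by (simp add: submod_def)

lemma submod_base: "x \<in> submod R x"
  unfolding submod_def by (rule span_base) (auto intro!: exI[of _ "[]"])

lemma submod_E:
  assumes "R \<subseteq> {..<n} \<times> {..<n}" "(i, j) \<in> R" "y \<in> submod R x"
  shows "E i j y \<in> submod R x"
proof -
  have ij: "i < n" "j < n" using assms by auto
  show ?thesis
    using assms(3) unfolding submod_def
  proof (induction rule: span_induct)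
    case base
    show ?case using ij by (intro subspaceI) (auto simp: E_add E_scale E_0 intro: span_add span_scale span_zero)
  next
    case (step y)
    then obtain ps where "set ps \<subseteq> R" "y = foldr (\<lambda>(i, j). E i j) ps x" by auto
    then show ?case using assms(2) by (intro span_base) (auto intro!: exI[of _ "(i, j) # ps"])
  qed
qed

lemma submod_minimal:
  assumes "subspace S" "x \<in> S" "\<And>i j y. (i, j) \<in> R \<Longrightarrow> y \<in> S \<Longrightarrow> E i j y \<in> S"
  shows "submod R x \<subseteq> S"
  unfolding submod_def
proof (rule span_minimal)
  have "foldr (\<lambda>(i, j). E i j) ps x \<in> S" if "set ps \<subseteq> R" for ps
    using that by (induction ps) (auto simp: assms)
  then show "{foldr (\<lambda>(i, j). E i j) ps x | ps. set ps \<subseteq> R} \<subseteq> S" by auto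
qed fact

end

subsection \<open>Tensor powers of the natural module\<close>

text \<open>
  A tensor in the \<open>d\<close>-th tensor power of the natural module is given by its coordinates, a function on
  words of length \<open>d\<close>.
\<close>

definition fscale :: "'k::field \<Rightarrow> (nat list \<Rightarrow> 'k) \<Rightarrow> nat list \<Rightarrow> 'k" where
  "fscale c \<phi> = (\<lambda>w. c * \<phi> w)"

lemma fscale_apply: "fscale c \<phi> w = c * \<phi> w"
  by (simp add: fscale_def)

text \<open>The Leibniz rule in coordinates. The matrix unit sends e_j to e_i, so the new coordinate
  at a word with a letter \<open>i\<close> reads the old one at the word with \<open>j\<close> in
  its place. Words of all lengths are treated at once.\<close>

fun act :: "nat \<Rightarrow> nat \<Rightarrow> (nat list \<Rightarrow> 'k::field) \<Rightarrow> nat list \<Rightarrow> 'k" where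
  "act i j \<phi> [] = 0"
| "act i j \<phi> (x # w) = (if x = i then \<phi> (j # w) else 0) + act i j (\<lambda>u. \<phi> (x # u)) w"

lemma act_add: "act i j (\<phi> + \<psi>) = act i j \<phi> + act i j \<psi>"
proof
  show "act i j (\<phi> + \<psi>) w = (act i j \<phi> + act i j \<psi>) w" for w
    by (induction w arbitrary: \<phi> \<psi>)
       (auto simp: plus_fun_def algebra_simps)
qed

lemma act_fscale: "act i j (fscale c \<phi>) = fscale c (act i j \<phi>)"
proof
  show "act i j (fscale c \<phi>) w = fscale c (act i j \<phi>) w" for w
    by (induction w arbitrary: \<phi>) (auto simp: fscale_def algebra_simps)
qed

lemma act_zero [simp]: "act i j 0 = 0"
proof
  show "act i j 0 w = 0 w" for w
    by (induction w) (auto simp: zero_fun_def)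
qed

lemma act_zero' [simp]: "act i j (\<lambda>_. 0) = (\<lambda>_. 0)"
  using act_zero[of i j] unfolding zero_fun_def .

lemma act_bracket:
  "act i j (act k l \<phi>) - act k l (act i j \<phi>) =
    (if j = k then act i l \<phi> else 0) - (if l = i then act k j \<phi> else 0)"
proof
  fix w
  have step: "act i j (\<lambda>u. act k l \<phi> (x # u)) w =
      (if x = k then act i j (\<lambda>u. \<phi> (l # u)) w else 0) + act i j (act k l (\<lambda>u. \<phi> (x # u))) w"
    for x i j k l and w and \<phi> :: "nat list \<Rightarrow> 'a"
  proof -
    have "(\<lambda>u. act k l \<phi> (x # u)) = (if x = k then (\<lambda>u. \<phi> (l # u)) else 0) + act k l (\<lambda>u. \<phi> (x # u))"
      by (auto simp: fun_eq_iff fscale_apply)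
    then show ?thesis by (simp add: act_add)
  qed
  show "(act i j (act k l \<phi>) - act k l (act i j \<phi>)) w =
      ((if j = k then act i l \<phi> else 0) - (if l = i then act k j \<phi> else 0)) w"
  proof (induction w arbitrary: \<phi>)
    case (Cons x w)
    have "act i j (act k l \<phi>) (x # w) =
        (if x = i then act k l \<phi> (j # w) else 0) + act i j (\<lambda>u. act k l \<phi> (x # u)) w"
      and "act k l (act i j \<phi>) (x # w) =
        (if x = k then act i j \<phi> (l # w) else 0) + act k l (\<lambda>u. act i j \<phi> (x # u)) w"
      by (rule act.simps)+
    then show ?case using Cons.IH[of "\<lambda>u. \<phi> (x # u)"]
      unfolding minus_apply step by (auto simp: algebra_simps)
  qed simp
qed

lemma vspace_fscale: "vspace fscale"
  by unfold_locales (auto simp: fun_eq_iff fscale_apply algebra_simps)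

lemma act_linear: "Vector_Spaces.linear fscale fscale (act i j)"
  unfolding Vector_Spaces.linear_iff using act_add act_fscale vspace_fscale[unfolded vspace_def] by blast

interpretation W: gl_rep fscale act n for n
  by (intro gl_rep.intro gl_rep_axioms.intro vspace_fscale act_linear act_bracket)

lemma act_append:
  "act i j \<phi> (u @ w) = act i j (\<lambda>u'. \<phi> (u' @ w)) u + act i j (\<lambda>w'. \<phi> (u @ w')) w"
  by (induction u arbitrary: \<phi>) (auto simp: algebra_simps)

lemma act_nonzero_word:
  assumes "act i j \<phi> w \<noteq> 0"
  shows "\<exists>u v. w = u @ i # v \<and> \<phi> (u @ j # v) \<noteq> 0"
  using assms
proof (induction w arbitrary: \<phi>)
  case (Cons x w)
  show ?case
  proof (cases "act i j (\<lambda>u. \<phi> (x # u)) w = 0")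
    case True
    then have "x = i" "\<phi> (j # w) \<noteq> 0" using Cons.prems by (auto split: if_splits)
    then show ?thesis by (intro exI[of _ "[]"] exI[of _ w]) simp
  next
    case False
    then obtain u v where "w = u @ i # v" "\<phi> (x # u @ j # v) \<noteq> 0" using Cons.IH by blast
    then show ?thesis by (intro exI[of _ "x # u"] exI[of _ v]) simp
  qed
qed simp

lemma act_eq_0:
  assumes "\<And>u. length u = length w \<Longrightarrow> \<phi> u = 0"
  shows "act i j \<phi> w = 0"
  using act_nonzero_word[of i j \<phi> w] assms by fastforce

lemma act_cong:
  assumes "\<And>u. length u = length w \<Longrightarrow> \<phi> u = \<psi> u"
  shows "act i j \<phi> w = act i j \<psi> w"
  using assms
proof (induction w arbitrary: \<phi> \<psi>)
  case (Cons x w)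
  have "act i j (\<lambda>u. \<phi> (x # u)) w = act i j (\<lambda>u. \<psi> (x # u)) w"
    by (rule Cons.IH) (simp add: Cons.prems)
  moreover have "\<phi> (j # w) = \<psi> (j # w)" by (rule Cons.prems) simp
  ultimately show ?case by simp
qed simp

subsection \<open>Weights\<close>

definition unit :: "nat \<Rightarrow> nat \<Rightarrow> int" where
  "unit i = (\<lambda>l. of_bool (l = i))"

definition wcont :: "nat list \<Rightarrow> nat \<Rightarrow> int" where
  "wcont w = (\<lambda>i. int (count_list w i))"

definition wts :: "(nat \<Rightarrow> int) \<Rightarrow> (nat list \<Rightarrow> 'k::field) set" where
  "wts \<nu> = {\<phi>. \<forall>w. \<phi> w \<noteq> 0 \<longrightarrow> wcont w = \<nu>}"

lemma wcont_Nil [simp]: "wcont [] = 0"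
  and wcont_Cons: "wcont (x # w) = unit x + wcont w"
  and wcont_append: "wcont (u @ w) = wcont u + wcont w"
  by (auto simp: wcont_def unit_def fun_eq_iff fscale_apply)

lemma act_wts: "\<phi> \<in> wts \<nu> \<Longrightarrow> act i j \<phi> \<in> wts (\<nu> + unit i - unit j)"
  unfolding wts_def using act_nonzero_word
  by (fastforce simp: wcont_append wcont_Cons algebra_simps)

lemma act_diag: "act i i \<phi> w = of_nat (count_list w i) * \<phi> w"
  by (induction w arbitrary: \<phi>) (auto simp: algebra_simps)

lemma act_diag_wts:
  assumes "\<phi> \<in> wts \<nu>" shows "act i i \<phi> = fscale (of_int (\<nu> i)) \<phi>"
proof
  fix w
  show "act i i \<phi> w = fscale (of_int (\<nu> i)) \<phi> w"
    using assms by (cases "\<phi> w = 0") (auto simp: act_diag wts_def wcont_def fscale_apply)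
qed

lemma subspace_wts: "W.subspace (wts \<nu>)"
proof (rule W.subspaceI)
  fix x y :: "nat list \<Rightarrow> 'a" assume xy: "x \<in> wts \<nu>" "y \<in> wts \<nu>"
  have "wcont w = \<nu>" if "x w + y w \<noteq> 0" for w
    using xy that by (cases "x w = 0") (auto simp: wts_def)
  then show "x + y \<in> wts \<nu>" by (simp add: wts_def)
qed (auto simp: wts_def fscale_apply)

lemma wts_disjoint: "\<phi> \<in> wts \<mu> \<Longrightarrow> \<phi> \<in> wts \<nu> \<Longrightarrow> \<mu> \<noteq> \<nu> \<Longrightarrow> \<phi> = 0"
  by (auto simp: wts_def fun_eq_iff fscale_apply)

lemma wts_negative:
  assumes "\<nu> i < 0" shows "wts \<nu> = {0}"
proof -
  have "wcont w \<noteq> \<nu>" for w using assms by (auto simp: wcont_def)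
  then have "(wts \<nu> :: (nat list \<Rightarrow> 'a) set) = {\<phi>. \<forall>w. \<phi> w = 0}" unfolding wts_def by simp
  then show ?thesis by (auto simp: zero_fun_def)
qed

definition wproj :: "(nat \<Rightarrow> int) \<Rightarrow> (nat list \<Rightarrow> 'k::field) \<Rightarrow> nat list \<Rightarrow> 'k" where
  "wproj \<nu> \<phi> = (\<lambda>w. if wcont w = \<nu> then \<phi> w else 0)"

lemma wproj_in_wts: "wproj \<nu> \<phi> \<in> wts \<nu>"
  by (auto simp: wproj_def wts_def)

lemma wproj_wts: "\<phi> \<in> wts \<mu> \<Longrightarrow> wproj \<nu> \<phi> = (if \<mu> = \<nu> then \<phi> else 0)"
  by (auto simp: wproj_def wts_def fun_eq_iff fscale_apply)

lemma wproj_linear: "Vector_Spaces.linear fscale fscale (wproj \<nu>)"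
  unfolding Vector_Spaces.linear_iff using W.vector_space_axioms
  by (auto simp: wproj_def fun_eq_iff fscale_apply)

definition graded :: "(nat list \<Rightarrow> 'k::field) set \<Rightarrow> bool" where
  "graded U \<longleftrightarrow> (\<forall>\<phi>\<in>U. \<forall>\<nu>. wproj \<nu> \<phi> \<in> U)"

lemma graded_span:
  assumes "\<And>x. x \<in> X \<Longrightarrow> \<exists>\<nu>. x \<in> wts \<nu>"
  shows "graded (W.span X)"
  unfolding graded_def
proof (intro ballI allI)
  fix x \<nu> assume "x \<in> W.span X"
  then show "wproj \<nu> x \<in> W.span X"
  proof (induction rule: W.span_induct)
    case base
    interpret l: Vector_Spaces.linear fscale fscale "wproj \<nu>" by (rule wproj_linear)
    show ?case by (rule l.subspace_linear_preimage[OF W.subspace_span])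
  next
    case (step x)
    then obtain \<mu> where "x \<in> wts \<mu>" using assms by blast
    then show ?case using step by (auto simp: wproj_wts W.span_base W.span_zero)
  qed
qed

lemma graded_span_graded:
  assumes "graded X"
  shows "graded (W.span X)"
  unfolding graded_def
proof (intro ballI allI)
  fix x \<nu> assume "x \<in> W.span X"
  then show "wproj \<nu> x \<in> W.span X"
  proof (induction rule: W.span_induct)
    case base
    interpret l: Vector_Spaces.linear fscale fscale "wproj \<nu>" by (rule wproj_linear)
    show ?case by (rule l.subspace_linear_preimage[OF W.subspace_span])
  next
    case (step x)
    then show ?case using assms by (auto simp: graded_def intro!: W.span_base)
  qed
qed

lemma graded_submod:
  assumes "x \<in> wts \<nu>"
  shows "graded (W.submod R x)"
  unfolding W.submod_def
proof (rule graded_span)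
  have "\<exists>\<nu>. foldr (\<lambda>(i, j). act i j) ps x \<in> wts \<nu>" for ps
  proof (induction ps)
    case (Cons p ps)
    then show ?case using act_wts by (cases p) fastforce
  qed (use assms in auto)
  then show "\<And>y. y \<in> {foldr (\<lambda>(i, j). act i j) ps x |ps. set ps \<subseteq> R} \<Longrightarrow> \<exists>\<nu>. y \<in> wts \<nu>" by auto
qed

subsection \<open>Words of bounded size\<close>

definition words :: "nat \<Rightarrow> nat \<Rightarrow> nat list set" where
  "words n d = {w. set w \<subseteq> {..<n} \<and> length w = d}"

definition supp_words :: "nat \<Rightarrow> nat \<Rightarrow> (nat list \<Rightarrow> 'k::field) set" where
  "supp_words n d = {\<phi>. \<forall>w. \<phi> w \<noteq> 0 \<longrightarrow> w \<in> words n d}"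

lemma finite_words: "finite (words n d)"
  unfolding words_def by (rule finite_lists_length_eq) simp

lemma subspace_supp_words: "W.subspace (supp_words n d)"
proof (rule W.subspaceI)
  fix x y :: "nat list \<Rightarrow> 'a" assume xy: "x \<in> supp_words n d" "y \<in> supp_words n d"
  have "w \<in> words n d" if "x w + y w \<noteq> 0" for w
    using xy that by (cases "x w = 0") (auto simp: supp_words_def)
  then show "x + y \<in> supp_words n d" by (simp add: supp_words_def)
qed (auto simp: supp_words_def fscale_apply)

lemma act_supp_words: "i < n \<Longrightarrow> \<phi> \<in> supp_words n d \<Longrightarrow> act i j \<phi> \<in> supp_words n d"
  unfolding supp_words_def words_def using act_nonzero_word by fastforce

lemma fin_dim_supp_words: "W.fin_dim (supp_words n d)"
proof -
  let ?\<delta> = "\<lambda>w u. of_bool (u = w) :: 'a"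
  have "supp_words n d \<subseteq> W.span (?\<delta> ` words n d)"
  proof
    fix \<phi> :: "nat list \<Rightarrow> 'a" assume a: "\<phi> \<in> supp_words n d"
    have "\<phi> = (\<Sum>w\<in>words n d. fscale (\<phi> w) (?\<delta> w))"
    proof
      fix u
      have "(\<Sum>w\<in>words n d. fscale (\<phi> w) (?\<delta> w)) u = (\<Sum>w\<in>words n d. fscale (\<phi> w) (?\<delta> w) u)"
        using finite_words[of n d] by (induction rule: finite_induct) (auto simp: fscale_apply)
      also have "\<dots> = (\<Sum>w\<in>words n d. if w = u then \<phi> w else 0)"
        by (intro sum.cong) (auto simp: fscale_apply)
      also have "\<dots> = \<phi> u"
        using a finite_words[of n d] by (auto simp: supp_words_def)
      finally show "\<phi> u = (\<Sum>w\<in>words n d. fscale (\<phi> w) (?\<delta> w)) u" by simp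
    qed
    then show "\<phi> \<in> W.span (?\<delta> ` words n d)"
      by (metis (no_types, lifting) W.span_base W.span_scale W.span_sum imageI)
  qed
  then show ?thesis unfolding W.fin_dim_def using finite_words by blast
qed

subsection \<open>Extremal vectors\<close>

text \<open>Coordinates of the wedge product of the e_s, s in \<open>S\<close>, in increasing order,
  expanded along the first letter; the exponent counts the factors that e_x has to pass.\<close>

fun alt :: "nat set \<Rightarrow> nat list \<Rightarrow> 'k::field" where
  "alt S [] = of_bool (S = {})"
| "alt S (x # u) = (if x \<in> S then (-1) ^ card {y \<in> S. y < x} * alt (S - {x}) u else 0)"

lemma alt_nonzero:
  "finite S \<Longrightarrow> alt S u \<noteq> 0 \<Longrightarrow> length u = card S \<and> set u = S \<and> wcont u = (\<lambda>i. of_bool (i \<in> S))"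
proof (induction u arbitrary: S)
  case (Cons x u)
  then have x: "x \<in> S" "alt (S - {x}) u \<noteq> (0::'a)" by (auto split: if_splits)
  have "length u = card (S - {x}) \<and> set u = S - {x} \<and> wcont u = (\<lambda>i. of_bool (i \<in> S - {x}))"
    using Cons.IH[OF _ x(2)] Cons.prems by simp
  moreover have "0 < card S" using x Cons.prems by (auto simp: card_gt_0_iff)
  ultimately show ?case using x Cons.prems by (auto simp: wcont_Cons unit_def fun_eq_iff fscale_apply)
qed (auto simp: fun_eq_iff fscale_apply split: if_splits)

lemma alt_sorted: "finite S \<Longrightarrow> alt S (sorted_list_of_set S) = 1"
proof (induction "card S" arbitrary: S)
  case (Suc c)
  then have ne: "S \<noteq> {}" by auto
  have 1: "sorted_list_of_set S = Min S # sorted_list_of_set (S - {Min S})"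
    using sorted_list_of_set_nonempty[OF Suc.prems ne] .
  have 2: "{y \<in> S. y < Min S} = {}" using Suc.prems by (auto simp: not_less)
  have 3: "alt (S - {Min S}) (sorted_list_of_set (S - {Min S})) = (1::'a)"
    by (rule Suc.hyps) (use Suc ne in auto)
  have "Min S \<in> S" using Suc.prems ne by simp
  then show ?case unfolding 1 alt.simps 2 3 by simp
qed simp

text \<open>No element lies strictly between neighbouring p and q, so replacing one by the other
  keeps every sign. If both belong to \<open>S\<close>, the result would be a wedge with a repeated
  factor; in coordinates two terms of opposite sign cancel.\<close>

lemma act_alt:
  assumes "finite S" and adj: "p = Suc q \<or> q = Suc p"
  shows "act q p (alt S) = (if p \<in> S \<and> q \<notin> S then alt (insert q (S - {p})) else 0 :: nat list \<Rightarrow> 'k::field)"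
proof
  fix w
  show "act q p (alt S) w = (if p \<in> S \<and> q \<notin> S then alt (insert q (S - {p})) else 0 :: nat list \<Rightarrow> 'k) w"
    using assms(1)
  proof (induction w arbitrary: S)
    case Nil
    then show ?case by auto
  next
    case (Cons x w)
    have pq: "p \<noteq> q" using adj by auto
    let ?\<sigma> = "\<lambda>x S. (-1) ^ card {y \<in> S. y < x} :: 'k"
    have f: "(\<lambda>u. alt S (x # u)) = (if x \<in> S then fscale (?\<sigma> x S) (alt (S - {x})) else 0)"
      by (auto simp: fun_eq_iff fscale_apply)
    have eq: "act q p (alt S) (x # w) = (if x = q then alt S (p # w) else 0) +
        (if x \<in> S then ?\<sigma> x S * act q p (alt (S - {x})) w else 0)"
      unfolding act.simps f by (simp add: act_fscale fscale_apply)
    show ?case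
    proof (cases "p \<in> S")
      case False
      then show ?thesis unfolding eq using Cons.IH[of "S - {x}"] Cons.prems by simp
    next
      case pS: True
      show ?thesis
      proof (cases "q \<in> S")
        case qS: True
        show ?thesis
        proof (cases "x = q")
          case True
          have "?\<sigma> q S = - ?\<sigma> p S"
          proof -
            consider "q = Suc p" | "p = Suc q" using adj by blast
            then have "card {y \<in> S. y < q} = Suc (card {y \<in> S. y < p}) \<or>
                card {y \<in> S. y < p} = Suc (card {y \<in> S. y < q})"
            proof cases
              case 1
              then have "{y \<in> S. y < q} = insert p {y \<in> S. y < p}" using pS by auto
              then show ?thesis by simp
            next
              case 2
              then have "{y \<in> S. y < p} = insert q {y \<in> S. y < q}" using qS by auto
              then show ?thesis by simp
            qed
            then show ?thesis by auto
          qed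
          moreover have "insert q (S - {q} - {p}) = S - {p}" using qS pq by auto
          ultimately show ?thesis unfolding eq using Cons.IH[of "S - {q}"] Cons.prems True pS qS pq by simp
        next
          case False
          then show ?thesis unfolding eq using Cons.IH[of "S - {x}"] Cons.prems pS qS by simp
        qed
      next
        case qS: False
        let ?S = "insert q (S - {p})"
        consider "x = q" | "x = p" | "x \<noteq> p" "x \<noteq> q" by blast
        then show ?thesis
        proof cases
          case 1
          have "{y \<in> S. y < p} = {y \<in> ?S. y < q}" using adj qS by (auto simp: less_Suc_eq)
          moreover have "?S - {q} = S - {p}" using qS by auto
          ultimately show ?thesis unfolding eq using 1 pS qS by simp
        next
          case 2
          then show ?thesis unfolding eq using Cons.IH[of "S - {p}"] Cons.prems pS qS pq by simp
        next
          case 3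
          have "?\<sigma> x S = ?\<sigma> x ?S"
          proof -
            have px: "p < x \<longleftrightarrow> q < x" using adj 3 by auto
            have "card {y \<in> S. y < x} = card {y \<in> ?S. y < x}"
            proof (cases "p < x")
              case True
              have "{y \<in> ?S. y < x} = insert q ({y \<in> S. y < x} - {p})" using px True by auto
              moreover have "card (insert q ({y \<in> S. y < x} - {p})) = Suc (card ({y \<in> S. y < x} - {p}))"
                using Cons.prems qS by (intro card_insert_disjoint) auto
              moreover have "Suc (card ({y \<in> S. y < x} - {p})) = card {y \<in> S. y < x}"
                using Cons.prems pS True by (intro card_Suc_Diff1) auto
              ultimately show ?thesis by simp
            next
              case False
              then have "{y \<in> ?S. y < x} = {y \<in> S. y < x}" using px by auto
              then show ?thesis by simp
            qed
            then show ?thesis by simp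
          qed
          moreover have "insert q (S - {x} - {p}) = ?S - {x}" using 3 by auto
          ultimately show ?thesis unfolding eq using Cons.IH[of "S - {x}"] Cons.prems 3 pS qS by simp
        qed
      qed
    qed
  qed
qed

definition tens :: "nat \<Rightarrow> (nat list \<Rightarrow> 'k::field) \<Rightarrow> (nat list \<Rightarrow> 'k) \<Rightarrow> nat list \<Rightarrow> 'k" where
  "tens p \<phi> \<psi> = (\<lambda>w. \<phi> (take p w) * \<psi> (drop p w))"

lemma act_tens:
  assumes "\<forall>u. \<phi> u \<noteq> 0 \<longrightarrow> length u = p"
  shows "act i j (tens p \<phi> \<psi>) = tens p (act i j \<phi>) \<psi> + tens p \<phi> (act i j \<psi>)"
proof
  fix w
  have len: "\<phi> u = 0" if "length u \<noteq> p" for u using assms that by blast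
  have "act i j (tens p \<phi> \<psi>) (take p w @ drop p w) = tens p (act i j \<phi>) \<psi> w + tens p \<phi> (act i j \<psi>) w"
  proof (cases "length w < p")
    case True
    have "act i j (tens p \<phi> \<psi>) w = 0" "act i j \<phi> (take p w) = 0" "\<phi> (take p w) = 0"
      by (rule act_eq_0 len, use True len in \<open>simp add: tens_def\<close>)+
    then show ?thesis by (simp add: tens_def)
  next
    case False
    have "act i j (\<lambda>u'. tens p \<phi> \<psi> (u' @ drop p w)) (take p w) =
        act i j (fscale (\<psi> (drop p w)) \<phi>) (take p w)"
      by (rule act_cong) (use False in \<open>auto simp: tens_def fscale_apply\<close>)
    moreover have "(\<lambda>w'. tens p \<phi> \<psi> (take p w @ w')) = fscale (\<phi> (take p w)) \<psi>"
      using False by (auto simp: tens_def fun_eq_iff fscale_apply)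
    ultimately show ?thesis
      unfolding act_append by (simp add: act_fscale tens_def fscale_apply mult.commute)
  qed
  then show "act i j (tens p \<phi> \<psi>) w = (tens p (act i j \<phi>) \<psi> + tens p \<phi> (act i j \<psi>)) w" by simp
qed

text \<open>
  \<open>ext b k\<close> is the extremal vector of weight \<open>min b k\<close>, the tensor product of the decomposable
  antisymmetric tensors that belong to the first \<open>k\<close> columns of \<open>b\<close>; the last column comes first.
\<close>

primrec ext :: "nat list \<Rightarrow> nat \<Rightarrow> nat list \<Rightarrow> 'k::field" where
  "ext b 0 = (\<lambda>w. of_bool (w = []))"
| "ext b (Suc k) = tens (card (column (Suc k) b)) (alt (column (Suc k) b)) (ext b k)"

definition trunc :: "nat list \<Rightarrow> nat \<Rightarrow> nat \<Rightarrow> int" where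
  "trunc b k = (\<lambda>i. if i < length b then int (min (b ! i) k) else 0)"

lemma trunc_0: "trunc b 0 = 0"
  by (auto simp: trunc_def fun_eq_iff fscale_apply)

lemma trunc_Suc: "trunc b (Suc k) = (\<lambda>i. of_bool (i \<in> column (Suc k) b)) + trunc b k"
  by (auto simp: trunc_def column_def fun_eq_iff fscale_apply)

lemma ext_wts: "ext b k \<in> wts (trunc b k)"
proof (induction k)
  case 0
  then show ?case by (auto simp: wts_def trunc_0)
next
  case (Suc k)
  show ?case
    unfolding wts_def
  proof safe
    fix w assume "ext b (Suc k) w \<noteq> (0::'a)"
    then have 1: "alt (column (Suc k) b) (take (card (column (Suc k) b)) w) \<noteq> (0::'a)"
      and 2: "ext b k (drop (card (column (Suc k) b)) w) \<noteq> (0::'a)" by (auto simp: tens_def)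
    show "wcont w = trunc b (Suc k)"
      using alt_nonzero[OF finite_column 1] 2 Suc wcont_append[of "take (card (column (Suc k) b)) w" "drop (card (column (Suc k) b)) w"]
      unfolding trunc_Suc by (auto simp: wts_def)
  qed
qed

lemma ext_supp_words: "ext b k \<in> supp_words (length b) (\<Sum>l<k. card (column (Suc l) b))"
proof (induction k)
  case 0
  then show ?case by (auto simp: supp_words_def words_def)
next
  case (Suc k)
  show ?case
    unfolding supp_words_def
  proof safe
    let ?c = "column (Suc k) b"
    fix w assume "ext b (Suc k) w \<noteq> (0::'a)"
    then have 1: "alt ?c (take (card ?c) w) \<noteq> (0::'a)"
      and 2: "ext b k (drop (card ?c) w) \<noteq> (0::'a)" by (auto simp: tens_def)
    have "drop (card ?c) w \<in> words (length b) (\<Sum>l<k. card (column (Suc l) b))"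
      using Suc 2 by (auto simp: supp_words_def)
    moreover have "length (take (card ?c) w) = card ?c" "set (take (card ?c) w) = ?c"
      using alt_nonzero[OF finite_column 1] by auto
    ultimately show "w \<in> words (length b) (\<Sum>l<Suc k. card (column (Suc l) b))"
      using column_subset[of "Suc k" b] set_append[of "take (card ?c) w" "drop (card ?c) w"]
        length_append[of "take (card ?c) w" "drop (card ?c) w"]
      unfolding words_def by auto
  qed
qed

lemma ext_nonzero: "ext b k \<noteq> 0"
proof -
  have "\<exists>w. ext b k w \<noteq> (0::'a)"
  proof (induction k)
    case (Suc k)
    then obtain w where "ext b k w \<noteq> (0::'a)" by blast
    then have "ext b (Suc k) (sorted_list_of_set (column (Suc k) b) @ w) \<noteq> (0::'a)"
      by (simp add: tens_def alt_sorted)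
    then show ?case by blast
  qed auto
  then show ?thesis by (auto simp: fun_eq_iff fscale_apply)
qed

lemma tens_0 [simp]: "tens p 0 \<psi> = 0" "tens p \<phi> 0 = 0"
  and tens_scale: "tens p \<phi> (fscale c \<psi>) = fscale c (tens p \<phi> \<psi>)"
  by (auto simp: tens_def fun_eq_iff fscale_apply)

lemma act_power_tens_0:
  assumes "\<forall>u. \<phi> u \<noteq> 0 \<longrightarrow> length u = p" "act i j \<phi> = 0"
  shows "(act i j ^^ m) (tens p \<phi> \<psi>) = tens p \<phi> ((act i j ^^ m) \<psi>)"
  by (induction m) (use assms in \<open>simp_all add: act_tens\<close>)

text \<open>The binomial Leibniz formula for a first factor on which the operator squares to zero:
  two terms remain.\<close>

lemma act_power_tens_1:
  assumes "\<forall>u. \<phi> u \<noteq> 0 \<longrightarrow> length u = p" "\<forall>u. act i j \<phi> u \<noteq> 0 \<longrightarrow> length u = p"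
    "act i j (act i j \<phi>) = 0"
  shows "(act i j ^^ Suc m) (tens p \<phi> \<psi>) = tens p \<phi> ((act i j ^^ Suc m) \<psi>) +
    fscale (of_nat (Suc m)) (tens p (act i j \<phi>) ((act i j ^^ m) \<psi>))"
proof (induction m)
  case 0
  then show ?case by (simp add: act_tens[OF assms(1)] fun_eq_iff fscale_apply)
next
  case (Suc m)
  show ?case
    unfolding funpow.simps(2)[of "Suc m"] comp_apply Suc.IH
    unfolding act_add act_fscale act_tens[OF assms(1)] act_tens[OF assms(2)] assms(3)
    by (simp add: fun_eq_iff fscale_apply algebra_simps)
qed

text \<open>\<open>m k\<close> is the number of columns up to \<open>k\<close> that contain p but
  not q. On each of them the operator acts nontrivially once, replacing p by q; no column contains q
  alone, since b_q \<le> b_p. So \<open>m k\<close> applications exchange all of them, in (m k)!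
  orders, and one more gives zero.\<close>

lemma ext_exchange:
  fixes b :: "nat list"
  assumes pq: "p < length b" "q < length b" "p = Suc q \<or> q = Suc p" "b ! q \<le> b ! p"
  defines "m \<equiv> \<lambda>k. min (b ! p) k - min (b ! q) k"
  shows "(act q p ^^ m k) (ext b k) = fscale (fact (m k)) (ext (exchange p q b) k :: nat list \<Rightarrow> 'k::field_char_0)
    \<and> (act q p ^^ Suc (m k)) (ext b k :: nat list \<Rightarrow> 'k) = 0"
proof (induction k)
  case 0
  have "act q p (\<lambda>w. of_bool (w = [])) w = (0 :: 'k)" for w by (cases w) auto
  then show ?case by (simp add: m_def fun_eq_iff fscale_apply)
next
  case (Suc k)
  let ?D = "act q p :: (nat list \<Rightarrow> 'k) \<Rightarrow> _"
  let ?S = "column (Suc k) b"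
  let ?c = "card ?S"
  have S': "column (Suc k) (exchange p q b) = transpose p q ` ?S" using column_exchange pq by simp
  have neq: "p \<noteq> q" using pq by auto
  have len: "alt S u \<noteq> (0::'k) \<Longrightarrow> finite S \<Longrightarrow> length u = card S" for S u using alt_nonzero by blast
  have lenS: "\<forall>u. alt ?S u \<noteq> (0::'k) \<longrightarrow> length u = ?c" using len by simp
  have D: "?D (alt ?S) = (if p \<in> ?S \<and> q \<notin> ?S then alt (insert q (?S - {p})) else 0)"
    by (rule act_alt) (use pq in auto)
  show ?case
  proof (cases "p \<in> ?S \<and> q \<notin> ?S")
    case True
    have eqS: "transpose p q ` ?S = insert q (?S - {p})"
      by (rule Set.set_eqI) (simp only: in_transpose_image_iff, use True in \<open>auto simp: transpose_def\<close>)
    have cS: "card (insert q (?S - {p})) = ?c" using True by (simp add: card_Suc_Diff1 del: card_Diff_insert)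
    have m: "m (Suc k) = Suc (m k)" using True pq by (auto simp: m_def column_def)
    have D1: "?D (alt ?S) = alt (insert q (?S - {p}))" using True D by simp
    have lenD: "\<forall>u. ?D (alt ?S) u \<noteq> 0 \<longrightarrow> length u = ?c"
      using len[of "insert q (?S - {p})"] cS unfolding D1 by simp
    have DD: "?D (?D (alt ?S)) = 0"
      unfolding D1 by (subst act_alt) (use pq in auto)
    have ex: "ext (exchange p q b) (Suc k) = tens ?c (alt (insert q (?S - {p}))) (ext (exchange p q b) k :: nat list \<Rightarrow> 'k)"
      by (simp add: S' eqS cS)
    note P = act_power_tens_1[of "alt ?S" ?c q p _ "ext b k", OF lenS lenD DD]
    have z1: "(?D ^^ Suc (m k)) (ext b k) = 0" and z2: "(?D ^^ m k) (ext b k) = fscale (fact (m k)) (ext (exchange p q b) k)"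
      using Suc.IH by blast+
    have z3: "(?D ^^ Suc (Suc (m k))) (ext b k) = 0" using z1 by simp
    have e1: "(?D ^^ Suc (m k)) (ext b (Suc k)) = fscale (fact (Suc (m k))) (ext (exchange p q b) (Suc k))"
    proof -
      have "(?D ^^ Suc (m k)) (ext b (Suc k)) =
          tens ?c (alt ?S) 0 + fscale (of_nat (Suc (m k))) (tens ?c (alt (insert q (?S - {p})))
            (fscale (fact (m k)) (ext (exchange p q b) k)))"
        using P[of "m k"] unfolding z1 z2 D1 by simp
      then show ?thesis unfolding ex tens_scale by (simp add: fun_eq_iff fscale_apply del: funpow.simps)
    qed
    have e2: "(?D ^^ Suc (Suc (m k))) (ext b (Suc k)) = 0"
      unfolding ext.simps P z1 z3 by (simp add: fun_eq_iff fscale_apply)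
    show ?thesis unfolding m using e1 e2 by blast
  next
    case False
    then have D0: "?D (alt ?S) = 0" using D by auto
    have "p \<in> ?S \<longleftrightarrow> q \<in> ?S" using False pq by (auto simp: column_def)
    then have eqS: "transpose p q ` ?S = ?S" by (rule transpose_image_eq)
    have m: "m (Suc k) = m k" using False pq by (auto simp: m_def column_def)
    have z1: "(?D ^^ Suc (m k)) (ext b k) = 0" and z2: "(?D ^^ m k) (ext b k) = fscale (fact (m k)) (ext (exchange p q b) k)"
      using Suc.IH by blast+
    show ?thesis
      unfolding m ext.simps act_power_tens_0[OF lenS D0] S' eqS z1 z2 tens_scale tens_0 by simp
  qed
qed

interpretation WW: vspace_pair fscale fscale ..

subsection \<open>Representations of the subalgebra sl_2\<close>

text \<open>Adds m times the root e_p - e_q. Below, e is \<open>act p q\<close>, f is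
  \<open>act q p\<close>, and the weight of h is \<nu>_p - \<nu>_q.\<close>

definition rshift :: "nat \<Rightarrow> nat \<Rightarrow> int \<Rightarrow> (nat \<Rightarrow> int) \<Rightarrow> nat \<Rightarrow> int" where
  "rshift p q m \<nu> = (\<lambda>l. \<nu> l + m * (unit p l - unit q l))"

lemma rshift_0 [simp]: "rshift p q 0 \<nu> = \<nu>"
  and rshift_rshift: "rshift p q m (rshift p q l \<nu>) = rshift p q (m + l) \<nu>"
  and rshift_swap: "rshift q p m \<nu> = rshift p q (- m) \<nu>"
  by (auto simp: rshift_def fun_eq_iff algebra_simps)

lemma rshift_at: "p \<noteq> q \<Longrightarrow> rshift p q m \<nu> p = \<nu> p + m" "p \<noteq> q \<Longrightarrow> rshift p q m \<nu> q = \<nu> q - m"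
  by (auto simp: rshift_def unit_def)

lemma rshift_reflect: "p \<noteq> q \<Longrightarrow> rshift p q (\<nu> q - \<nu> p) \<nu> = \<nu> \<circ> transpose p q"
  by (auto simp: rshift_def unit_def fun_eq_iff transpose_def)

lemma act_wts_rshift: "\<phi> \<in> wts \<nu> \<Longrightarrow> act p q \<phi> \<in> wts (rshift p q 1 \<nu>)"
  using act_wts[of \<phi> \<nu> p q] by (simp add: rshift_def plus_fun_def fun_diff_def algebra_simps)

lemma act_power_wts: "\<phi> \<in> wts \<nu> \<Longrightarrow> (act p q ^^ m) \<phi> \<in> wts (rshift p q (int m) \<nu>)"
proof (induction m)
  case (Suc m)
  then have "(act p q ^^ m) \<phi> \<in> wts (rshift p q (int m) \<nu>)" by blast
  from act_wts_rshift[OF this, of p q] show ?case by (simp add: rshift_rshift)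
qed simp

lemma act_power_linear: "Vector_Spaces.linear fscale fscale (act p q ^^ m)"
proof (induction m)
  case 0
  show ?case using W.linear_ident by (simp add: id_def)
next
  case (Suc m)
  then show ?case using Vector_Spaces.linear_compose[OF Suc act_linear] by (simp add: comp_def)
qed

lemma act_power_0 [simp]: "(act p q ^^ m) 0 = 0"
  by (induction m) auto

text \<open>The relation e f^{m+1} = f^{m+1} e + (m+1) f^m (h - m) in the enveloping algebra of
  sl_2, evaluated on a weight vector.\<close>

lemma raise_lower:
  fixes \<phi> :: "nat list \<Rightarrow> 'k::field_char_0"
  assumes pq: "p \<noteq> q" and \<phi>: "\<phi> \<in> wts \<nu>"
  shows "act p q ((act q p ^^ Suc m) \<phi>) = (act q p ^^ Suc m) (act p q \<phi>) +
    fscale (of_int ((int m + 1) * (\<nu> p - \<nu> q - int m))) ((act q p ^^ m) \<phi>)"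
proof -
  have base: "act p q (act q p \<psi>) = act q p (act p q \<psi>) + fscale (of_int (\<mu> p - \<mu> q)) \<psi>"
    if "\<psi> \<in> wts \<mu>" for \<psi> :: "nat list \<Rightarrow> 'k" and \<mu>
    using act_bracket[of p q q p \<psi>] pq act_diag_wts[OF that]
    by (simp add: fun_eq_iff fscale_apply algebra_simps)
  show ?thesis
  proof (induction m)
    case 0
    show ?case using base[OF \<phi>] by simp
  next
    case (Suc m)
    have w: "(act q p ^^ Suc m) \<phi> \<in> wts (rshift q p (int (Suc m)) \<nu>)"
      using act_power_wts[OF \<phi>] by blast
    have "act p q ((act q p ^^ Suc (Suc m)) \<phi>) = act p q (act q p ((act q p ^^ Suc m) \<phi>))" by simp
    also have "\<dots> = act q p (act p q ((act q p ^^ Suc m) \<phi>)) +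
        fscale (of_int (\<nu> p - \<nu> q - 2 * (int m + 1))) ((act q p ^^ Suc m) \<phi>)"
      unfolding base[OF w] using pq by (simp add: rshift_at algebra_simps)
    also have "\<dots> = (act q p ^^ Suc (Suc m)) (act p q \<phi>) +
        fscale (of_int ((int m + 1) * (\<nu> p - \<nu> q - int m))) ((act q p ^^ Suc m) \<phi>) +
        fscale (of_int (\<nu> p - \<nu> q - 2 * (int m + 1))) ((act q p ^^ Suc m) \<phi>)"
      unfolding Suc.IH act_add act_fscale by simp
    also have "\<dots> = (act q p ^^ Suc (Suc m)) (act p q \<phi>) +
        fscale (of_int ((int (Suc m) + 1) * (\<nu> p - \<nu> q - int (Suc m)))) ((act q p ^^ Suc m) \<phi>)"
      by (simp add: fun_eq_iff fscale_apply algebra_simps)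
    finally show ?case .
  qed
qed

text \<open>Induction up the weight string, which ends because \<nu>_q cannot be negative. If f^t
  kills \<phi>, then f^{t+2} kills e \<phi>, whose h-weight is t + 2, so e \<phi> = 0. For \<phi>
  killed by e the coefficients in \<open>raise_lower\<close> are nonzero for m < t, and the powers
  of f can be stripped off one by one.\<close>

lemma lower_power_inj:
  fixes \<phi> :: "nat list \<Rightarrow> 'k::field_char_0"
  assumes pq: "p \<noteq> q" and "\<phi> \<in> wts \<nu>" "\<nu> p - \<nu> q = int t" "(act q p ^^ t) \<phi> = 0"
  shows "\<phi> = 0"
  using assms(2-)
proof (induction "nat (\<nu> q + 1)" arbitrary: \<phi> \<nu> t rule: less_induct)
  case less
  show ?case
  proof (cases "\<nu> q < 0")
    case True
    then show ?thesis using wts_negative less.prems(1) by blast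
  next
    case False
    let ?e = "act p q \<phi>"
    have f: "(act q p ^^ m) \<phi> = 0" if "t \<le> m" for m
    proof -
      have "(act q p ^^ (m - t + t)) \<phi> = 0" unfolding funpow_add comp_apply less.prems(3) by simp
      then show ?thesis using that by simp
    qed
    have e: "?e = 0"
    proof (rule less.hyps)
      show "?e \<in> wts (rshift p q 1 \<nu>)" using act_wts_rshift less.prems(1) by blast
      show "nat (rshift p q 1 \<nu> q + 1) < nat (\<nu> q + 1)" using False pq by (simp add: rshift_at)
      show "rshift p q 1 \<nu> p - rshift p q 1 \<nu> q = int (Suc (Suc t))" using less.prems(2) pq by (simp add: rshift_at)
      have "0 = (act q p ^^ Suc (Suc t)) ?e + 0"
        using raise_lower[OF pq less.prems(1), of "Suc t"]
        unfolding f[of "Suc t", simplified] f[of "Suc (Suc t)", simplified] W.scale_zero_right act_zero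
        by (simp del: funpow.simps add: f)
      then show "(act q p ^^ Suc (Suc t)) ?e = 0" by (simp del: funpow.simps)
    qed
    have "(act q p ^^ (t - m)) \<phi> = 0" if "m \<le> t" for m
      using that
    proof (induction m)
      case 0
      then show ?case using less.prems(3) by simp
    next
      case (Suc m)
      then have m: "t - m = Suc (t - Suc m)" by simp
      have z: "(act q p ^^ Suc (t - Suc m)) \<phi> = 0"
        using Suc.IH[OF Suc_leD[OF Suc.prems]] unfolding m .
      have "0 = fscale (of_int ((int (t - Suc m) + 1) * (\<nu> p - \<nu> q - int (t - Suc m)))) ((act q p ^^ (t - Suc m)) \<phi>)"
        using raise_lower[OF pq less.prems(1), of "t - Suc m"] unfolding z e by simp
      moreover have "(int (t - Suc m) + 1) * (\<nu> p - \<nu> q - int (t - Suc m)) \<noteq> 0"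
        using less.prems(2) Suc.prems by (simp add: of_nat_diff)
      ultimately show ?case
        using of_int_eq_0_iff[where ?'a = 'k] by (metis W.scale_eq_0_iff)
    qed
    from this[of t] show ?thesis by simp
  qed
qed

lemma rshift_reflect': "p \<noteq> q \<Longrightarrow> \<nu> p - \<nu> q = int t \<Longrightarrow> rshift q p (int t) \<nu> = \<nu> \<circ> transpose p q"
  using rshift_reflect[of p q \<nu>] rshift_swap[of q p "int t" \<nu>] by (simp add: algebra_simps)

locale sl2_module =
  fixes H :: "(nat list \<Rightarrow> 'k::field_char_0) set" and n d p q :: nat
  assumes sub: "W.subspace H" and supp: "H \<subseteq> supp_words n d" and pq: "p \<noteq> q"
    and e_stable: "\<And>x. x \<in> H \<Longrightarrow> act p q x \<in> H"
    and f_stable: "\<And>x. x \<in> H \<Longrightarrow> act q p x \<in> H"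
begin

lemma flip: "sl2_module H n d q p"
  using sub supp pq e_stable f_stable by unfold_locales auto

lemma f_power: "x \<in> H \<Longrightarrow> (act q p ^^ m) x \<in> H"
  by (induction m) (auto intro: f_stable)

lemma fin: "W.fin_dim H"
  using fin_dim_supp_words supp W.fin_dim_subset by blast

lemma fin_wts: "W.fin_dim (H \<inter> wts \<nu>)"
  using fin W.fin_dim_subset by blast

lemma sub_wts: "W.subspace (H \<inter> wts \<nu>)"
  using sub subspace_wts W.subspace_inter by blast

lemma weight_le:
  assumes t: "\<nu> p - \<nu> q = int t"
  shows "(act q p ^^ t) ` (H \<inter> wts \<nu>) \<subseteq> H \<inter> wts (\<nu> \<circ> transpose p q)"
    "W.dim ((act q p ^^ t) ` (H \<inter> wts \<nu>)) = W.dim (H \<inter> wts \<nu>)"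
    "W.dim (H \<inter> wts \<nu>) \<le> W.dim (H \<inter> wts (\<nu> \<circ> transpose p q))"
proof -
  show 1: "(act q p ^^ t) ` (H \<inter> wts \<nu>) \<subseteq> H \<inter> wts (\<nu> \<circ> transpose p q)"
  proof
    fix y assume "y \<in> (act q p ^^ t) ` (H \<inter> wts \<nu>)"
    then obtain x where x: "x \<in> H" "x \<in> wts \<nu>" "y = (act q p ^^ t) x" by blast
    have "(act q p ^^ t) x \<in> wts (rshift q p (int t) \<nu>)" using x(2) by (rule act_power_wts)
    then show "y \<in> H \<inter> wts (\<nu> \<circ> transpose p q)"
      using f_power[OF x(1)] x(3) rshift_reflect'[of p q \<nu> t] pq t by simp
  qed
  show 2: "W.dim ((act q p ^^ t) ` (H \<inter> wts \<nu>)) = W.dim (H \<inter> wts \<nu>)"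
    by (rule WW.dim_image_inj_fin_dim[OF act_power_linear sub_wts fin_wts])
       (use lower_power_inj[OF pq _ t] in blast)
  show "W.dim (H \<inter> wts \<nu>) \<le> W.dim (H \<inter> wts (\<nu> \<circ> transpose p q))"
    using W.dim_subset_fin_dim[OF fin_wts 1] 2 by simp
qed

lemma reflect_twice: "\<nu> \<circ> transpose p q \<circ> transpose q p = \<nu>"
  by (auto simp: fun_eq_iff transpose_def)

text \<open>f^t is injective in one direction and e^t in the other, so the dimensions agree and f^t
  is onto. The surjectivity produces preimages in the Demazure inequality.\<close>

lemma weight_eq_nonneg:
  assumes t: "\<nu> p - \<nu> q = int t"
  shows "W.dim (H \<inter> wts (\<nu> \<circ> transpose p q)) = W.dim (H \<inter> wts \<nu>)"
    "(act q p ^^ t) ` (H \<inter> wts \<nu>) = H \<inter> wts (\<nu> \<circ> transpose p q)"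
proof -
  interpret f: sl2_module H n d q p by (rule flip)
  have "W.dim (H \<inter> wts (\<nu> \<circ> transpose p q)) \<le> W.dim (H \<inter> wts (\<nu> \<circ> transpose p q \<circ> transpose q p))"
    by (rule f.weight_le(3)[of _ t]) (use t pq in auto)
  then have le: "W.dim (H \<inter> wts (\<nu> \<circ> transpose p q)) \<le> W.dim (H \<inter> wts \<nu>)"
    unfolding reflect_twice .
  then show "W.dim (H \<inter> wts (\<nu> \<circ> transpose p q)) = W.dim (H \<inter> wts \<nu>)"
    using weight_le(3)[OF t] by simp
  interpret l: Vector_Spaces.linear fscale fscale "act q p ^^ t :: (nat list \<Rightarrow> 'k) \<Rightarrow> _" by (rule act_power_linear)
  show "(act q p ^^ t) ` (H \<inter> wts \<nu>) = H \<inter> wts (\<nu> \<circ> transpose p q)"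
    by (rule W.dim_eq_imp_eq[OF fin_wts _ weight_le(1)[OF t]])
       (use le weight_le(2)[OF t] l.subspace_image[OF sub_wts] in simp_all)
qed

lemma weight_eq: "W.dim (H \<inter> wts (\<nu> \<circ> transpose p q)) = W.dim (H \<inter> wts \<nu>)"
proof (cases "\<nu> q \<le> \<nu> p")
  case True
  then show ?thesis by (intro weight_eq_nonneg(1)[of _ "nat (\<nu> p - \<nu> q)"]) simp
next
  case False
  interpret f: sl2_module H n d q p by (rule flip)
  show ?thesis using False f.weight_eq_nonneg(1)[of \<nu> "nat (\<nu> q - \<nu> p)"] by (simp add: transpose_commute)
qed

text \<open>Each e that is moved through the powers of f uses up one of them; the correction has the
  same weight as the vector and is merged into it.\<close>

lemma raise_power_lower_power:
  assumes "y \<in> H \<inter> wts \<mu>" "a \<le> b"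
  shows "\<exists>y'\<in>H \<inter> wts \<mu>. (act p q ^^ a) ((act q p ^^ b) y) = (act q p ^^ (b - a)) y'"
  using assms(2)
proof (induction a)
  case 0
  then show ?case using assms by auto
next
  case (Suc a)
  then obtain y' where y': "y' \<in> H \<inter> wts \<mu>" "(act p q ^^ a) ((act q p ^^ b) y) = (act q p ^^ (b - a)) y'"
    by auto
  define m where "m = b - Suc a"
  have m: "b - a = Suc m" using Suc.prems by (simp add: m_def)
  let ?c = "of_int ((int m + 1) * (\<mu> p - \<mu> q - int m)) :: 'k"
  let ?y = "act q p (act p q y') + fscale ?c y'"
  have "?y \<in> H" using y' e_stable f_stable sub by (auto intro!: W.subspace_add W.subspace_scale)
  moreover have "act q p (act p q y') \<in> wts (rshift q p 1 (rshift p q 1 \<mu>))"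
    using y' by (intro act_wts_rshift) auto
  then have "act q p (act p q y') \<in> wts \<mu>" by (simp add: rshift_rshift rshift_swap[of q p])
  then have "?y \<in> wts \<mu>" using y' subspace_wts by (auto intro!: W.subspace_add W.subspace_scale)
  moreover have "(act p q ^^ Suc a) ((act q p ^^ b) y) = (act q p ^^ m) ?y"
  proof -
    interpret l: Vector_Spaces.linear fscale fscale "act q p ^^ m :: (nat list \<Rightarrow> 'k) \<Rightarrow> _" by (rule act_power_linear)
    have "(act p q ^^ Suc a) ((act q p ^^ b) y) = act p q ((act q p ^^ Suc m) y')"
      using y'(2) m by simp
    also have "\<dots> = (act q p ^^ Suc m) (act p q y') + fscale ?c ((act q p ^^ m) y')"
      using raise_lower[OF pq, of y' \<mu> m] y'(1) by blast
    also have "\<dots> = (act q p ^^ m) ?y"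
      unfolding l.add l.scale funpow_Suc_right comp_apply ..
    finally show ?thesis .
  qed
  ultimately show ?case unfolding m_def by blast
qed

text \<open>One coefficient of the estimate of ch \<open>H\<close> by the Demazure operator applied
  to ch \<open>M\<close>. With \<alpha> = e_p - e_q, \<eta> = \<nu> + \<alpha> and \<zeta> the
  reflection of \<eta>, the space H_\<nu> is M_\<nu> + f H_\<eta>, and f is injective on H_\<eta>.
  The two summands overlap in at least a copy of M_\<zeta>, embedded by e^{t+1}.\<close>

lemma demazure_inequality:
  assumes M: "W.subspace M" "M \<subseteq> H" and eM: "\<And>x. x \<in> M \<Longrightarrow> act p q x \<in> M"
    and gen: "H \<inter> wts \<nu> \<subseteq> W.span (M \<inter> wts \<nu> \<union> act q p ` (H \<inter> wts (rshift p q 1 \<nu>)))"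
    and t: "\<nu> p - \<nu> q = int t"
  shows "W.dim (H \<inter> wts \<nu>) + W.dim (M \<inter> wts (rshift p q (-1) (\<nu> \<circ> transpose p q)))
    \<le> W.dim (M \<inter> wts \<nu>) + W.dim (H \<inter> wts (rshift p q 1 \<nu>))"
proof -
  interpret f: sl2_module H n d q p by (rule flip)
  interpret fl: Vector_Spaces.linear fscale fscale "act q p :: (nat list \<Rightarrow> 'k) \<Rightarrow> _" by (rule act_linear)
  let ?\<eta> = "rshift p q 1 \<nu>" and ?\<zeta> = "rshift p q (-1) (\<nu> \<circ> transpose p q)"
  let ?Hf = "act q p ` (H \<inter> wts ?\<eta>)"
  have t2: "?\<eta> p - ?\<eta> q = int (t + 2)" using t pq by (simp add: rshift_at)
  have dimf: "W.dim ?Hf = W.dim (H \<inter> wts ?\<eta>)"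
  proof (rule WW.dim_image_inj_fin_dim[OF act_linear sub_wts fin_wts])
    fix x assume x: "x \<in> H \<inter> wts ?\<eta>" "act q p x = 0"
    have "(act q p ^^ (t + 2)) x = (act q p ^^ (t + 1)) (act q p x)" by (simp add: funpow_swap1)
    then have "(act q p ^^ (t + 2)) x = 0" unfolding x(2) by simp
    then show "x = 0" using lower_power_inj[OF pq _ t2] x by blast
  qed
  have subf: "W.subspace ?Hf" using fl.subspace_image[OF sub_wts] .
  have finf: "W.fin_dim ?Hf" using WW.rank_nullity_fin_dim(2)[OF act_linear sub_wts fin_wts] .
  have subM: "W.subspace (M \<inter> wts \<mu>)" for \<mu> using M subspace_wts W.subspace_inter by blast
  have finM: "W.fin_dim (M \<inter> wts \<mu>)" for \<mu>
    by (rule W.fin_dim_subset[OF fin_wts[of \<mu>]]) (use M in auto)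
  have "W.dim (H \<inter> wts \<nu>) \<le> W.dim (W.span (M \<inter> wts \<nu> \<union> ?Hf))"
    by (rule W.dim_subset_fin_dim[OF _ gen]) (intro W.fin_dim_span W.fin_dim_Un finM finf)
  moreover have "W.dim (W.span (M \<inter> wts \<nu> \<union> ?Hf)) + W.dim (M \<inter> wts \<nu> \<inter> ?Hf) = W.dim (M \<inter> wts \<nu>) + W.dim ?Hf"
    by (rule W.dim_Un_Int_fin_dim[OF subM finM subf finf])
  moreover have "W.dim (M \<inter> wts ?\<zeta>) \<le> W.dim (M \<inter> wts \<nu> \<inter> ?Hf)"
  proof -
    have \<zeta>: "?\<zeta> = ?\<eta> \<circ> transpose p q"
      using pq by (auto simp: rshift_def fun_eq_iff transpose_def unit_def)
    have \<zeta>t: "?\<zeta> q - ?\<zeta> p = int (t + 2)" using t pq by (simp add: rshift_at)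
    have "W.dim ((act p q ^^ Suc t) ` (M \<inter> wts ?\<zeta>)) = W.dim (M \<inter> wts ?\<zeta>)"
    proof (rule WW.dim_image_inj_fin_dim[OF act_power_linear subM finM])
      fix x assume x: "x \<in> M \<inter> wts ?\<zeta>" "(act p q ^^ Suc t) x = 0"
      then have "(act p q ^^ (t + 2)) x = 0" by simp
      then show "x = 0" using lower_power_inj[OF pq[symmetric] _ \<zeta>t] x by blast
    qed
    moreover have "(act p q ^^ Suc t) ` (M \<inter> wts ?\<zeta>) \<subseteq> M \<inter> wts \<nu> \<inter> ?Hf"
    proof (intro subsetI, elim imageE)
      fix z x assume z: "z = (act p q ^^ Suc t) x" and x: "x \<in> M \<inter> wts ?\<zeta>"
      have "(act p q ^^ m) x \<in> M" for m by (induction m) (use x eM in auto)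
      then have "z \<in> M" unfolding z .
      moreover have "z \<in> wts (rshift p q (int (Suc t)) ?\<zeta>)"
        unfolding z using act_power_wts x by blast
      moreover have "rshift p q (int (Suc t)) ?\<zeta> = \<nu>"
        using t pq by (auto simp: rshift_def fun_eq_iff transpose_def unit_def)
      moreover have "z \<in> ?Hf"
      proof -
        \<comment> \<open>Surjectivity of f^{t+2} gives x = f^{t+2} y with y of weight \<eta>;
          moving t + 1 factors e through leaves one f in front, which puts e^{t+1} x into f
          H_\<eta>.\<close>
        have "x \<in> H \<inter> wts (?\<eta> \<circ> transpose p q)" using x M \<zeta> by auto
        then obtain y where y: "y \<in> H \<inter> wts ?\<eta>" "x = (act q p ^^ (t + 2)) y"
          unfolding weight_eq_nonneg(2)[OF t2, symmetric] by blast
        then obtain y' where "y' \<in> H \<inter> wts ?\<eta>" "z = (act q p ^^ (t + 2 - Suc t)) y'"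
          using raise_power_lower_power[OF y(1), of "Suc t" "t + 2"] z by auto
        then show ?thesis by simp
      qed
      ultimately show "z \<in> M \<inter> wts \<nu> \<inter> ?Hf" by simp
    qed
    ultimately show ?thesis
      using W.dim_subset_fin_dim[OF W.fin_dim_subset[OF finM], of "M \<inter> wts \<nu> \<inter> ?Hf" \<nu>] by (metis Int_lower1)
  qed
  ultimately show ?thesis using dimf by linarith
qed

end

subsection \<open>The module generated from a subspace by a lowering operator\<close>

lemma wproj_act: "wproj \<nu> (act q p \<phi>) = act q p (wproj (rshift p q 1 \<nu>) \<phi>)"
proof
  fix w
  let ?\<psi> = "wproj (rshift p q 1 \<nu>) \<phi>"
  show "wproj \<nu> (act q p \<phi>) w = act q p ?\<psi> w"
  proof (cases "wcont w = \<nu>")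
    case True
    have "act q p (\<phi> - ?\<psi>) w = 0"
    proof (rule ccontr)
      assume "act q p (\<phi> - ?\<psi>) w \<noteq> 0"
      then obtain u v where uv: "w = u @ q # v" "(\<phi> - ?\<psi>) (u @ p # v) \<noteq> 0"
        using act_nonzero_word by blast
      have "wcont (u @ p # v) = rshift p q 1 \<nu>"
      proof
        fix l
        have "wcont u l + (unit q l + wcont v l) = \<nu> l"
          using True uv(1) by (auto simp: wcont_append wcont_Cons)
        then show "wcont (u @ p # v) l = rshift p q 1 \<nu> l"
          by (simp add: wcont_append wcont_Cons rshift_def)
      qed
      then show False using uv(2) by (simp add: wproj_def)
    qed
    moreover have "act q p \<phi> = act q p (\<phi> - ?\<psi>) + act q p ?\<psi>"
      by (simp flip: act_add)
    ultimately show ?thesis using True by (simp add: wproj_def)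
  next
    case False
    have "act q p ?\<psi> \<in> wts (rshift q p 1 (rshift p q 1 \<nu>))"
      by (intro act_wts_rshift wproj_in_wts)
    then have "act q p ?\<psi> \<in> wts \<nu>" by (simp add: rshift_rshift rshift_swap[of q p])
    then show ?thesis using False by (auto simp: wproj_def wts_def)
  qed
qed

text \<open>The smallest f-stable subspace containing \<open>M\<close>. If \<open>M\<close> is
  stable under e and spanned by its weight vectors, this is already a module for the whole
  sl_2.\<close>

definition lowering_span :: "nat \<Rightarrow> nat \<Rightarrow> (nat list \<Rightarrow> 'k::field) set \<Rightarrow> (nat list \<Rightarrow> 'k) set" where
  "lowering_span p q M = W.span (\<Union>m. (act q p ^^ m) ` M)"

lemma lowering_span_superset: "M \<subseteq> lowering_span p q M"
  unfolding lowering_span_def by (intro subsetI W.span_base UN_I[of 0]) auto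

lemma lowering_span_power: "x \<in> M \<Longrightarrow> (act q p ^^ m) x \<in> lowering_span p q M"
  unfolding lowering_span_def by (intro W.span_base) auto

lemma subspace_lowering_span: "W.subspace (lowering_span p q M)"
  by (simp add: lowering_span_def)

lemma lowering_span_induct:
  assumes "x \<in> lowering_span p q M" "W.subspace S" "\<And>m x. x \<in> M \<Longrightarrow> (act q p ^^ m) x \<in> S"
  shows "x \<in> S"
proof -
  have "lowering_span p q M \<subseteq> S"
    unfolding lowering_span_def by (rule W.span_minimal) (use assms in auto)
  then show ?thesis using assms(1) by blast
qed

lemma act_preimage_subspace: "W.subspace S \<Longrightarrow> W.subspace {x. act i j x \<in> S}"
proof -
  assume S: "W.subspace S"
  interpret l: Vector_Spaces.linear fscale fscale "act i j :: (nat list \<Rightarrow> 'a) \<Rightarrow> _" by (rule act_linear)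
  show ?thesis by (rule l.subspace_linear_preimage[OF S])
qed

lemma lowering_span_lower: "x \<in> lowering_span p q M \<Longrightarrow> act q p x \<in> lowering_span p q M"
proof -
  assume x: "x \<in> lowering_span p q M"
  have "(act q p ^^ Suc m) y \<in> lowering_span p q M" if "y \<in> M" for m y
    using that by (rule lowering_span_power)
  then show ?thesis
    using lowering_span_induct[OF x act_preimage_subspace[OF subspace_lowering_span, of q p p q M]] by simp
qed

lemma lowering_span_supp:
  assumes "M \<subseteq> supp_words n d" "q < n"
  shows "lowering_span p q M \<subseteq> supp_words n d"
proof
  fix x assume "x \<in> lowering_span p q M"
  then show "x \<in> supp_words n d"
  proof (rule lowering_span_induct[OF _ subspace_supp_words])
    show "(act q p ^^ m) y \<in> supp_words n d" if "y \<in> M" for m y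
      by (induction m) (use that assms act_supp_words in auto)
  qed
qed

lemma graded_lowering_span:
  assumes "graded M"
  shows "graded (lowering_span p q M)"
  unfolding lowering_span_def
proof (rule graded_span_graded)
  have "wproj \<nu> ((act q p ^^ m) x) \<in> (act q p ^^ m) ` M" if "x \<in> M" for m x \<nu>
  proof (induction m arbitrary: \<nu>)
    case 0
    then show ?case using that assms by (auto simp: graded_def)
  next
    case (Suc m)
    from Suc[of "rshift p q 1 \<nu>"] show ?case by (auto simp: wproj_act)
  qed
  then show "graded (\<Union>m. (act q p ^^ m) ` M)" unfolding graded_def by blast
qed

lemma lowering_span_raise:
  fixes M :: "(nat list \<Rightarrow> 'k::field_char_0) set"
  assumes M: "graded M" "M \<subseteq> W.span (\<Union>\<nu>. M \<inter> wts \<nu>)" and e: "\<And>x. x \<in> M \<Longrightarrow> act p q x \<in> M" and pq: "p \<noteq> q"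
    and x: "x \<in> lowering_span p q M"
  shows "act p q x \<in> lowering_span p q M"
proof -
  let ?H = "lowering_span p q M"
  have "act p q ((act q p ^^ m) y) \<in> ?H" if "y \<in> M" for m y
  proof -
    have sub: "W.subspace {y. act p q ((act q p ^^ m) y) \<in> ?H}"
    proof -
      interpret l: Vector_Spaces.linear fscale fscale "act q p ^^ m :: (nat list \<Rightarrow> 'k) \<Rightarrow> _" by (rule act_power_linear)
      show ?thesis using l.subspace_linear_preimage[OF act_preimage_subspace[OF subspace_lowering_span]] by simp
    qed
    have "W.span (\<Union>\<nu>. M \<inter> wts \<nu>) \<subseteq> {y. act p q ((act q p ^^ m) y) \<in> ?H}"
    proof (rule W.span_minimal[OF _ sub], safe)
      fix y \<nu> assume y: "y \<in> M" "y \<in> wts \<nu>"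
      show "act p q ((act q p ^^ m) y) \<in> ?H"
      proof (cases m)
        case 0
        then show ?thesis using e[OF y(1)] lowering_span_superset by auto
      next
        case (Suc m')
        show ?thesis unfolding Suc raise_lower[OF pq y(2)]
          by (intro W.subspace_add[OF subspace_lowering_span] W.subspace_scale[OF subspace_lowering_span]
              lowering_span_power y e)
      qed
    qed
    then show ?thesis using that M by blast
  qed
  then show ?thesis
    using lowering_span_induct[OF x act_preimage_subspace[OF subspace_lowering_span]] by blast
qed

text \<open>Weight projections commute with f up to a shift of the weight, so the component of a
  positive power f^m y is f applied to a component one step up the string. This is the generation
  hypothesis of the Demazure inequality.\<close>

lemma lowering_span_generated:
  assumes M: "graded M"
  shows "lowering_span p q M \<inter> wts \<nu> \<subseteq>
    W.span (M \<inter> wts \<nu> \<union> act q p ` (lowering_span p q M \<inter> wts (rshift p q 1 \<nu>)))"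
proof
  let ?H = "lowering_span p q M" and ?R = "W.span (M \<inter> wts \<nu> \<union> act q p ` (lowering_span p q M \<inter> wts (rshift p q 1 \<nu>)))"
  fix x assume x: "x \<in> ?H \<inter> wts \<nu>"
  interpret l: Vector_Spaces.linear fscale fscale "wproj \<nu>" by (rule wproj_linear)
  have "wproj \<nu> x \<in> ?R"
  proof -
    have "x \<in> {x. wproj \<nu> x \<in> ?R}"
    proof (rule lowering_span_induct)
      show "x \<in> ?H" using x by simp
      show "W.subspace {x. wproj \<nu> x \<in> ?R}" by (rule l.subspace_linear_preimage[OF W.subspace_span])
      fix m y assume y: "y \<in> M"
      have "wproj \<nu> ((act q p ^^ m) y) \<in> M \<inter> wts \<nu> \<union> act q p ` (lowering_span p q M \<inter> wts (rshift p q 1 \<nu>))"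
      proof (cases m)
        case 0
        then show ?thesis using y M wproj_in_wts by (auto simp: graded_def)
      next
        case (Suc m')
        have "wproj (rshift p q 1 \<nu>) ((act q p ^^ m') y) \<in> ?H \<inter> wts (rshift p q 1 \<nu>)"
          using graded_lowering_span[OF M, of p q] lowering_span_power[OF y] wproj_in_wts
          unfolding graded_def by blast
        then show ?thesis unfolding Suc funpow.simps comp_apply wproj_act by blast
      qed
      then show "(act q p ^^ m) y \<in> {x. wproj \<nu> x \<in> ?R}" by (simp add: W.span_base)
    qed
    then show ?thesis by simp
  qed
  moreover have "wproj \<nu> x = x" using x wproj_wts[of x \<nu> \<nu>] by simp
  ultimately show "x \<in> ?R" by simp
qed

subsection \<open>Demazure modules inside tensor powers\<close>

lemma sum_fun_apply: "finite A \<Longrightarrow> (\<Sum>x\<in>A. f x) w = (\<Sum>x\<in>A. f x w)"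
  by (induction rule: finite_induct) auto

lemma wproj_sum:
  assumes "\<phi> \<in> supp_words n d"
  shows "\<phi> = (\<Sum>\<nu>\<in>wcont ` words n d. wproj \<nu> \<phi>)"
proof
  fix w
  have "(\<Sum>\<nu>\<in>wcont ` words n d. wproj \<nu> \<phi>) w = (\<Sum>\<nu>\<in>wcont ` words n d. if wcont w = \<nu> then \<phi> w else 0)"
    by (simp add: sum_fun_apply finite_words wproj_def)
  also have "\<dots> = \<phi> w"
    using assms by (auto simp: finite_words supp_words_def)
  finally show "\<phi> w = (\<Sum>\<nu>\<in>wcont ` words n d. wproj \<nu> \<phi>) w" by simp
qed

lemma graded_weight_span:
  assumes "graded M" "M \<subseteq> supp_words n d"
  shows "M \<subseteq> W.span (\<Union>\<nu>. M \<inter> wts \<nu>)"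
proof
  fix x assume x: "x \<in> M"
  have "(\<Sum>\<nu>\<in>wcont ` words n d. wproj \<nu> x) \<in> W.span (\<Union>\<nu>. M \<inter> wts \<nu>)"
  proof (intro W.span_sum W.span_base)
    fix \<nu>
    show "wproj \<nu> x \<in> (\<Union>\<nu>. M \<inter> wts \<nu>)" using x assms(1) wproj_in_wts[of \<nu> x] by (auto simp: graded_def)
  qed
  then show "x \<in> W.span (\<Union>\<nu>. M \<inter> wts \<nu>)" using wproj_sum[of x n d] x assms(2) by auto
qed

definition borel_pairs :: "nat \<Rightarrow> (nat \<times> nat) set" where
  "borel_pairs n = {(i, j). i \<le> j \<and> j < n}"

lemma borel_pairs_subset: "borel_pairs n \<subseteq> {..<n} \<times> {..<n}"
  by (auto simp: borel_pairs_def)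

definition dem :: "nat list \<Rightarrow> nat \<Rightarrow> (nat list \<Rightarrow> 'k::field) set" where
  "dem b k = W.submod (borel_pairs (length b)) (ext b k)"

definition demI :: "nat list set \<Rightarrow> nat \<Rightarrow> (nat list \<Rightarrow> 'k::field) set" where
  "demI I k = W.span (\<Union>b\<in>I. dem b k)"

lemma subspace_dem: "W.subspace (dem b k)"
  by (simp add: dem_def W.subspace_submod)

lemma subspace_demI: "W.subspace (demI I k)"
  by (simp add: demI_def)

lemma dem_subset_demI: "b \<in> I \<Longrightarrow> dem b k \<subseteq> demI I k"
  unfolding demI_def by (auto intro: W.span_base)

lemma demI_mono: "I \<subseteq> J \<Longrightarrow> demI I k \<subseteq> demI J k"
  unfolding demI_def by (intro W.span_mono) auto

lemma demI_Un: "demI (I \<union> J) k = W.span (demI I k \<union> demI J k)"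
proof (rule antisym)
  show "demI (I \<union> J) k \<subseteq> W.span (demI I k \<union> demI J k)"
    unfolding demI_def[of "I \<union> J"]
    using dem_subset_demI by (intro W.span_minimal) (auto intro!: W.span_base)
  show "W.span (demI I k \<union> demI J k) \<subseteq> demI (I \<union> J) k"
    using demI_mono[of _ "I \<union> J"] by (intro W.span_minimal subspace_demI) auto
qed

lemma demI_empty: "demI {} k = {0}"
  by (simp add: demI_def)

lemma ext_in_dem: "ext b k \<in> dem b k"
  by (simp add: dem_def W.submod_base)

lemma act_dem: "i \<le> j \<Longrightarrow> j < length b \<Longrightarrow> x \<in> dem b k \<Longrightarrow> act i j x \<in> dem b k"
  unfolding dem_def by (rule W.submod_E[OF borel_pairs_subset]) (auto simp: borel_pairs_def)

lemma dem_minimal: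
  assumes "W.subspace S" "ext b k \<in> S" "\<And>i j y. i \<le> j \<Longrightarrow> j < length b \<Longrightarrow> y \<in> S \<Longrightarrow> act i j y \<in> S"
  shows "dem b k \<subseteq> S"
  unfolding dem_def by (rule W.submod_minimal) (use assms in \<open>auto simp: borel_pairs_def\<close>)

lemma graded_dem: "graded (dem b k)"
  unfolding dem_def by (rule graded_submod[OF ext_wts])

lemma graded_demI: "graded (demI I k)"
proof -
  have "wproj \<nu> \<phi> \<in> dem b k" if "\<phi> \<in> dem b k" for b \<nu> and \<phi> :: "nat list \<Rightarrow> 'a"
    using graded_dem[of b k] that by (auto simp: graded_def)
  then show ?thesis
    unfolding demI_def by (intro graded_span_graded) (unfold graded_def, blast)
qed

lemma act_demI:
  assumes "i \<le> j" "\<And>b. b \<in> I \<Longrightarrow> j < length b" "x \<in> demI I k"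
  shows "act i j x \<in> demI I k"
proof -
  have "(\<Union>b\<in>I. dem b k) \<subseteq> {x. act i j x \<in> demI I k}"
    using act_dem[OF assms(1,2)] dem_subset_demI by blast
  then have "demI I k \<subseteq> {x. act i j x \<in> demI I k}"
    unfolding demI_def[of I] using act_preimage_subspace[OF W.subspace_span] by (intro W.span_minimal) auto
  then show ?thesis using assms(3) by blast
qed

definition wdeg :: "nat list \<Rightarrow> nat \<Rightarrow> nat" where
  "wdeg lam k = (\<Sum>l<k. card (column (Suc l) lam))"

lemma dem_supp:
  assumes "b \<in> rearrangements lam"
  shows "dem b k \<subseteq> supp_words (length lam) (wdeg lam k)"
proof (rule dem_minimal[OF subspace_supp_words])
  have "card (column (Suc l) b) = card (column (Suc l) lam)" for l
    by (rule card_column_cong) (use assms in \<open>simp add: rearrangements_def\<close>)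
  then show "ext b k \<in> supp_words (length lam) (wdeg lam k)"
    using ext_supp_words[of b k] length_rearrangements[OF assms] by (simp add: wdeg_def)
  show "act i j y \<in> supp_words (length lam) (wdeg lam k)"
    if "i \<le> j" "j < length b" "y \<in> supp_words (length lam) (wdeg lam k)" for i j y
    using that length_rearrangements[OF assms] by (intro act_supp_words) auto
qed

lemma demI_supp: "I \<subseteq> rearrangements lam \<Longrightarrow> demI I k \<subseteq> supp_words (length lam) (wdeg lam k)"
  unfolding demI_def using dem_supp by (intro W.span_minimal subspace_supp_words) blast

lemma fin_dim_demI: "I \<subseteq> rearrangements lam \<Longrightarrow> W.fin_dim (demI I k)"
  by (rule W.fin_dim_subset[OF fin_dim_supp_words demI_supp])

lemma fin_dim_demI_wts: "I \<subseteq> rearrangements lam \<Longrightarrow> W.fin_dim (demI I k \<inter> wts \<nu>)"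
  by (rule W.fin_dim_subset[OF fin_dim_demI]) auto

lemma subspace_demI_wts: "W.subspace (demI I k \<inter> wts \<nu>)"
  by (intro W.subspace_inter subspace_demI subspace_wts)

text \<open>Integer valued, because modularity and the Demazure relation involve differences; the
  type argument records the field.\<close>

definition hdim :: "'k::field itself \<Rightarrow> nat list set \<Rightarrow> nat \<Rightarrow> (nat \<Rightarrow> int) \<Rightarrow> int" where
  "hdim _ I k \<nu> = int (W.dim (demI I k \<inter> wts \<nu> :: (nat list \<Rightarrow> 'k) set))"

section \<open>Lower sets of the Bruhat order and monotonicity of Demazure modules\<close>

definition lower_set :: "nat list \<Rightarrow> nat list set \<Rightarrow> bool" where
  "lower_set lam I \<longleftrightarrow> I \<subseteq> rearrangements lam \<and> (\<forall>b\<in>I. \<forall>c. bruhat_le c b \<longrightarrow> c \<in> I)"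

definition below :: "nat list \<Rightarrow> nat list set" where
  "below b = {c. bruhat_le c b}"

lemma lower_set_below:
  assumes "b \<in> rearrangements lam"
  shows "lower_set lam (below b)"
proof -
  have "c \<in> rearrangements lam" if "bruhat_le c b" for c
    using bruhat_le_rearrangements[OF that] assms by blast
  moreover have "bruhat_le d b" if "bruhat_le c b" "bruhat_le d c" for c d
    using bruhat_le_trans[OF that(2,1)] .
  ultimately show ?thesis by (auto simp: lower_set_def below_def)
qed

lemma lower_set_Un: "lower_set lam I \<Longrightarrow> lower_set lam J \<Longrightarrow> lower_set lam (I \<union> J)"
  and lower_set_Int: "lower_set lam I \<Longrightarrow> lower_set lam J \<Longrightarrow> lower_set lam (I \<inter> J)"
  by (auto simp: lower_set_def)

lemma lower_set_finite: "lower_set lam I \<Longrightarrow> finite I"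
  using finite_rearrangements finite_subset by (auto simp: lower_set_def)

abbreviation sx :: "nat \<Rightarrow> nat list \<Rightarrow> nat list" where
  "sx i \<equiv> exchange i (Suc i)"

lemma below_sx:
  assumes "Suc i < length b" "b ! i < b ! Suc i" "c \<in> below b"
  shows "(c ! Suc i \<le> c ! i \<longrightarrow> c \<in> below (sx i b)) \<and> (c ! i \<le> c ! Suc i \<longrightarrow> sx i c \<in> below (sx i b))"
  using assms bruhat_lift_right[of c b i] bruhat_exchange_mono'[of c b i] by (simp add: below_def)

lemma exists_ascent:
  assumes "sorted_wrt (\<ge>) lam" "b \<in> rearrangements lam" "b \<noteq> lam"
  shows "\<exists>i. Suc i < length b \<and> b ! i < b ! Suc i"
proof (rule ccontr)
  assume "\<not> ?thesis"
  then have "\<forall>i. Suc i < length b \<longrightarrow> b ! Suc i \<le> b ! i" by (meson not_less)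
  then have "sorted_wrt (\<ge>) b"
    by (subst sorted_wrt_iff_nth_Suc_transp) (auto simp: transp_def)
  then have "sorted (rev b)" "sorted (rev lam)" using assms(1) by (auto simp: sorted_wrt_rev)
  moreover have "mset (rev b) = mset (rev lam)" using assms(2) by (simp add: rearrangements_def)
  ultimately have "rev b = rev lam" by (metis properties_for_sort)
  then show False using assms(3) by simp
qed

text \<open>A word without ascents is the partition itself, and undoing an ascent shrinks the
  principal lower set. So every rearrangement is reached from \<lambda> by exchanges of neighbours
  that go up, the steps that Demazure operators describe.\<close>

lemma bruhat_induct [consumes 2, case_names base step]:
  assumes "sorted_wrt (\<ge>) lam" "b \<in> rearrangements lam"
    and base: "Q lam"
    and step: "\<And>b i. b \<in> rearrangements lam \<Longrightarrow> Suc i < length b \<Longrightarrow> b ! i < b ! Suc i \<Longrightarrow> Q (sx i b) \<Longrightarrow> Q b"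
  shows "Q b"
  using assms(2)
proof (induction "card (below b)" arbitrary: b rule: less_induct)
  case less
  show ?case
  proof (cases "b = lam")
    case True
    then show ?thesis using base by simp
  next
    case False
    then obtain i where i: "Suc i < length b" "b ! i < b ! Suc i"
      using exists_ascent[OF assms(1) less.prems] by blast
    have le: "bruhat_le (sx i b) b" using bruhat_le_exchange_down i by simp
    have ne: "sx i b \<noteq> b" using i nth_exchange[of i b "Suc i" i] by auto
    have "below (sx i b) \<subset> below b"
      unfolding below_def using le ne bruhat_le_trans bruhat_le_antisym bruhat_le_refl by blast
    moreover have "finite (below b)" using lower_set_below lower_set_finite less.prems by blast
    ultimately have "card (below (sx i b)) < card (below b)" by (rule psubset_card_mono[rotated])
    then have "Q (sx i b)" using less.hyps less.prems i exchange_in_rearrangements[of b lam i "Suc i"] by simp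
    then show ?thesis using step less.prems i by blast
  qed
qed

lemma bruhat_minimum:
  assumes "sorted_wrt (\<ge>) lam" "b \<in> rearrangements lam"
  shows "bruhat_le lam b"
  using assms
proof (induction rule: bruhat_induct)
  case (step b i)
  then show ?case using bruhat_le_exchange_down[of i b] bruhat_le_trans by simp
qed simp

text \<open>By \<open>ext_exchange\<close> the tensor is, up to a nonzero factor, the last
  nonvanishing power of the lowering operator applied to the exchanged tensor.\<close>

lemma ext_lower_0:
  assumes "Suc i < length b" "b ! i \<le> b ! Suc i"
  shows "act (Suc i) i (ext b k :: nat list \<Rightarrow> 'k::field_char_0) = 0"
proof -
  let ?b = "sx i b"
  let ?m = "min (?b ! i) k - min (?b ! Suc i) k"
  have "?b ! Suc i \<le> ?b ! i" using assms by (simp add: nth_exchange)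
  then have e: "(act (Suc i) i ^^ ?m) (ext ?b k) = fscale (fact ?m) (ext b k :: nat list \<Rightarrow> 'k)"
    "(act (Suc i) i ^^ Suc ?m) (ext ?b k :: nat list \<Rightarrow> 'k) = 0"
    using ext_exchange[of i ?b "Suc i" k, where ?'k = 'k] assms by (simp_all del: funpow.simps)
  have "fscale (fact ?m) (act (Suc i) i (ext b k :: nat list \<Rightarrow> 'k)) = 0"
    using e(2) unfolding funpow.simps comp_apply e(1) act_fscale .
  then show ?thesis by (metis W.scale_eq_0_iff fact_nonzero)
qed

text \<open>At an ascent the lowering operator kills the generator, and its brackets with upper
  triangular matrix units stay in the span of these and itself. So the module is stable under a
  minimal parabolic subalgebra.\<close>

lemma dem_lower_stable:
  fixes y :: "nat list \<Rightarrow> 'k::field_char_0"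
  assumes i: "Suc i < length b" "b ! i \<le> b ! Suc i" and y: "y \<in> dem b k"
  shows "act (Suc i) i y \<in> dem b k"
proof -
  let ?D = "dem b k :: (nat list \<Rightarrow> 'k) set"
  let ?f = "act (Suc i) i :: (nat list \<Rightarrow> 'k) \<Rightarrow> _"
  interpret l: Vector_Spaces.linear fscale fscale ?f by (rule act_linear)
  have "?D \<subseteq> ?D \<inter> {y. ?f y \<in> ?D}"
  proof (rule dem_minimal)
    show "W.subspace (?D \<inter> {y. ?f y \<in> ?D})"
      by (intro W.subspace_inter subspace_dem l.subspace_linear_preimage)
    show "ext b k \<in> ?D \<inter> {y. ?f y \<in> ?D}"
      using ext_in_dem[of b k] ext_lower_0[OF i, of k, where ?'k = 'k] W.subspace_0[OF subspace_dem[of b k]] by simp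
    fix j l y assume jl: "j \<le> l" "l < length b" and y: "y \<in> ?D \<inter> {y. ?f y \<in> ?D}"
    have up: "act j' l' y \<in> ?D" if "j' \<le> l'" "l' < length b" for j' l' using act_dem that y by blast
    have "?f (act j l y) = act j l (?f y) - (if l = Suc i then act j i y else 0) + (if i = j then act (Suc i) l y else 0)"
      using act_bracket[of j l "Suc i" i y] by (auto simp: algebra_simps split: if_splits)
    moreover have "act j l (?f y) \<in> ?D" using act_dem jl y by blast
    moreover have "(if l = Suc i then act j i y else 0) \<in> ?D"
      using up[of j i] y i jl W.subspace_0[OF subspace_dem] by (cases "j = Suc i") auto
    moreover have "(if i = j then act (Suc i) l y else 0) \<in> ?D"
      using up[of "Suc i" l] y i jl W.subspace_0[OF subspace_dem] by (cases "l = i") auto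
    ultimately have "?f (act j l y) \<in> ?D"
      by (simp only:) (intro W.subspace_add W.subspace_diff subspace_dem)
    then show "act j l y \<in> ?D \<inter> {y. ?f y \<in> ?D}" using up jl by blast
  qed
  then show ?thesis using y by blast
qed

lemma ext_exchange_in_dem:
  assumes "p < length b" "q < length b" "p = Suc q \<or> q = Suc p" "b ! q \<le> b ! p"
    and S: "W.subspace S" "ext b k \<in> S" "\<And>y. y \<in> S \<Longrightarrow> act q p y \<in> S"
  shows "ext (exchange p q b) k \<in> (S :: (nat list \<Rightarrow> 'k::field_char_0) set)"
proof -
  let ?m = "min (b ! p) k - min (b ! q) k"
  have "(act q p ^^ m) (ext b k) \<in> S" for m by (induction m) (use S in auto)
  then have "fscale (fact ?m) (ext (exchange p q b) k) \<in> S"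
    using ext_exchange[of p b q k, OF assms(1-4), where ?'k = 'k] by metis
  then have "fscale (inverse (fact ?m)) (fscale (fact ?m) (ext (exchange p q b) k)) \<in> S"
    by (rule W.subspace_scale[OF S(1)])
  then show ?thesis by (simp add: fscale_def mult.assoc[symmetric])
qed

lemma dem_ascent:
  assumes "Suc i < length b" "b ! i \<le> b ! Suc i"
  shows "dem (sx i b) k \<subseteq> (dem b k :: (nat list \<Rightarrow> 'k::field_char_0) set)"
proof (rule dem_minimal[OF subspace_dem])
  have "ext (exchange (Suc i) i b) k \<in> (dem b k :: (nat list \<Rightarrow> 'k) set)"
    by (rule ext_exchange_in_dem[OF _ _ _ _ subspace_dem ext_in_dem])
       (use assms act_dem[of i "Suc i" b] in auto)
  then show "ext (sx i b) k \<in> (dem b k :: (nat list \<Rightarrow> 'k) set)"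
    by (simp add: exchange_commute[of i])
next
  show "act i' j y \<in> dem b k" if "i' \<le> j" "j < length (sx i b)" "y \<in> dem b k" for i' j and y :: "nat list \<Rightarrow> 'k"
    using act_dem[of i' j b y k] that by simp
qed

text \<open>By the lifting property either \<open>c\<close> or its exchange lies below the exchange
  of \<open>b\<close>. In the second case the stability of D_b under the lowering operator recovers
  the extremal tensor of \<open>c\<close>.\<close>

lemma dem_mono:
  assumes "sorted_wrt (\<ge>) lam" "b \<in> rearrangements lam" "bruhat_le c b"
  shows "dem c k \<subseteq> (dem b k :: (nat list \<Rightarrow> 'k::field_char_0) set)"
  using assms
proof (induction arbitrary: c rule: bruhat_induct)
  case base
  have "c \<in> rearrangements lam" using base bruhat_le_rearrangements[of c lam lam] by (simp add: rearrangements_def)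
  then have "c = lam" using bruhat_minimum[OF assms(1)] base bruhat_le_antisym by blast
  then show ?case by simp
next
  case (step b i)
  have len: "length c = length b" using bruhat_le_measure step.prems by auto
  have sb: "dem (sx i b) k \<subseteq> (dem b k :: (nat list \<Rightarrow> 'k) set)"
    by (rule dem_ascent) (use step.hyps in auto)
  show ?case
  proof (cases "c ! Suc i \<le> c ! i")
    case True
    then have "dem c k \<subseteq> (dem (sx i b) k :: (nat list \<Rightarrow> 'k) set)"
      using below_sx[of i b c] step by (auto simp: below_def)
    then show ?thesis using sb by blast
  next
    case False
    then have s: "dem (sx i c) k \<subseteq> (dem (sx i b) k :: (nat list \<Rightarrow> 'k) set)"
      using below_sx[of i b c] step by (auto simp: below_def)
    show ?thesis
    proof (rule dem_minimal[OF subspace_dem])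
      have "ext (exchange i (Suc i) (sx i c)) k \<in> (dem b k :: (nat list \<Rightarrow> 'k) set)"
        by (rule ext_exchange_in_dem[OF _ _ _ _ subspace_dem])
           (use False len step.hyps s sb ext_in_dem[of "sx i c" k] dem_lower_stable[of i b] in
             \<open>auto simp: nth_exchange\<close>)
      then show "ext c k \<in> (dem b k :: (nat list \<Rightarrow> 'k) set)"
        using step.hyps len by simp
    next
      show "act i' j y \<in> dem b k" if "i' \<le> j" "j < length c" "y \<in> dem b k" for i' j and y :: "nat list \<Rightarrow> 'k"
        using act_dem[of i' j b y k] that len by simp
    qed
  qed
qed

lemma demI_below:
  assumes "sorted_wrt (\<ge>) lam" "b \<in> rearrangements lam"
  shows "demI (below b) k = (dem b k :: (nat list \<Rightarrow> 'k::field_char_0) set)"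
proof (rule antisym)
  show "demI (below b) k \<subseteq> (dem b k :: (nat list \<Rightarrow> 'k) set)"
    unfolding demI_def using dem_mono[OF assms] by (intro W.span_minimal subspace_dem) (auto simp: below_def)
qed (rule dem_subset_demI, simp add: below_def)

subsection \<open>The upper bound\<close>

text \<open>The sum over I \<union> s I need not be known to be an sl_2-module; it is enclosed in
  one that is generated from D_I by the lowering operator, and the Demazure inequality applies to
  the latter.\<close>

lemma demI_exchange_upper:
  fixes k :: nat
  assumes I: "lower_set lam I" and i: "Suc i < length lam"
  defines "H \<equiv> lowering_span i (Suc i) (demI I k :: (nat list \<Rightarrow> 'k::field_char_0) set)"
  shows "sl2_module H (length lam) (wdeg lam k) i (Suc i)" (is ?sl2)
    and "demI (I \<union> sx i ` I) k \<subseteq> H" (is ?sub)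
    and "\<nu> i - \<nu> (Suc i) = int t \<Longrightarrow>
      int (W.dim (H \<inter> wts \<nu>)) + hdim TYPE('k) I k (rshift i (Suc i) (-1) (\<nu> \<circ> transpose i (Suc i)))
        \<le> hdim TYPE('k) I k \<nu> + int (W.dim (H \<inter> wts (rshift i (Suc i) 1 \<nu>)))" (is "_ \<Longrightarrow> ?ineq")
proof -
  let ?M = "demI I k :: (nat list \<Rightarrow> 'k) set"
  have IP: "I \<subseteq> rearrangements lam" using I by (simp add: lower_set_def)
  have len: "length b = length lam" if "b \<in> I" for b using IP that length_rearrangements by blast
  have supp: "?M \<subseteq> supp_words (length lam) (wdeg lam k)" using demI_supp[OF IP] .
  have up: "act j l x \<in> ?M" if "x \<in> ?M" "j \<le> l" "l < length lam" for j l x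
    using act_demI[of j l I x k] that len by auto
  have fH: "act (Suc i) i x \<in> H" if "x \<in> H" for x using that lowering_span_lower unfolding H_def by blast
  have subH: "W.subspace H" by (simp add: H_def subspace_lowering_span)
  have MH: "?M \<subseteq> H" by (simp add: H_def lowering_span_superset)
  show sl2: ?sl2
  proof
    show "act i (Suc i) x \<in> H" if "x \<in> H" for x
      unfolding H_def
      by (rule lowering_span_raise[OF graded_demI graded_weight_span[OF graded_demI supp]])
         (use up i that H_def in auto)
    show "H \<subseteq> supp_words (length lam) (wdeg lam k)"
      unfolding H_def by (rule lowering_span_supp[OF supp i])
  qed (use fH subH in auto)
  \<comment> \<open>Brackets of upper triangular matrix units with the lowering operator are again
    upper triangular or the lowering operator itself. The induction on the power therefore
    quantifies over all j \<le> l.\<close>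
  have bH: "act j l ((act (Suc i) i ^^ m) x) \<in> H" if x: "x \<in> ?M" and jl: "j \<le> l" "l < length lam" for m x j l
    using jl
  proof (induction m arbitrary: j l)
    case 0
    then show ?case using up[OF x] MH by auto
  next
    case (Suc m)
    let ?y = "(act (Suc i) i ^^ m) x"
    have yH: "?y \<in> H" using lowering_span_power[OF x] by (simp add: H_def)
    have "act j l (act (Suc i) i ?y) = act (Suc i) i (act j l ?y) + (if l = Suc i then act j i ?y else 0)
        - (if i = j then act (Suc i) l ?y else 0)"
      using act_bracket[of j l "Suc i" i ?y] by (simp add: algebra_simps)
    moreover have "act (Suc i) i (act j l ?y) \<in> H" using Suc fH by blast
    moreover have "(if l = Suc i then act j i ?y else 0) \<in> H"
      using Suc.IH[of j i] Suc.prems i fH[OF yH] W.subspace_0[OF subH] by (cases "j = Suc i") auto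
    moreover have "(if i = j then act (Suc i) l ?y else 0) \<in> H"
      using Suc.IH[of "Suc i" l] Suc.prems i fH[OF yH] W.subspace_0[OF subH] by (cases "l = i") auto
    ultimately show ?case
      by (simp only: funpow.simps comp_apply) (intro W.subspace_add W.subspace_diff subH)
  qed
  have actH: "act j l x \<in> H" if "x \<in> H" "j \<le> l" "l < length lam" for j l x
    using lowering_span_induct[of x i "Suc i" ?M "{x. act j l x \<in> H}"] act_preimage_subspace[OF subH, of j l] bH that
    by (auto simp: H_def)
  show ?sub
    unfolding demI_def
  proof (rule W.span_minimal[OF _ subH])
    have "dem (sx i b) k \<subseteq> H" if b: "b \<in> I" for b
    proof (cases "b ! Suc i \<le> b ! i")
      case False
      then have "sx i b \<in> I" using I b bruhat_le_exchange_down[of i b] len[OF b] i by (simp add: lower_set_def)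
      then show ?thesis using dem_subset_demI[of "sx i b" I k] MH by blast
    next
      case True
      show ?thesis
      proof (rule dem_minimal[OF subH])
        show "ext (sx i b) k \<in> H"
          by (rule ext_exchange_in_dem[OF _ _ _ True subH])
             (use len[OF b] i fH MH dem_subset_demI[OF b, of k] ext_in_dem[of b k] in auto)
      qed (use actH len[OF b] in auto)
    qed
    moreover have "dem b k \<subseteq> H" if "b \<in> I" for b using dem_subset_demI[OF that] MH by blast
    ultimately show "(\<Union>b\<in>I \<union> sx i ` I. dem b k) \<subseteq> H" by blast
  qed
  show ?ineq if t: "\<nu> i - \<nu> (Suc i) = int t"
  proof -
    interpret s: sl2_module H "length lam" "wdeg lam k" i "Suc i" by (rule sl2)
    have "W.dim (H \<inter> wts \<nu>) + W.dim (?M \<inter> wts (rshift i (Suc i) (-1) (\<nu> \<circ> transpose i (Suc i))))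
        \<le> W.dim (?M \<inter> wts \<nu>) + W.dim (H \<inter> wts (rshift i (Suc i) 1 \<nu>))"
    proof (rule s.demazure_inequality[OF subspace_demI MH _ _ t])
      show "act i (Suc i) x \<in> ?M" if "x \<in> ?M" for x using up that i by simp
      show "H \<inter> wts \<nu> \<subseteq> W.span (?M \<inter> wts \<nu> \<union> act (Suc i) i ` (H \<inter> wts (rshift i (Suc i) 1 \<nu>)))"
        unfolding H_def by (rule lowering_span_generated[OF graded_demI])
    qed
    then show ?thesis unfolding hdim_def by linarith
  qed
qed

subsection \<open>The lower bound\<close>

text \<open>Block triangularity: the map of the largest index annihilates all other blocks, so their
  span lies in its kernel, while its image has at least the dimension contributed by its own
  block.\<close>

lemma triangular_dim:
  fixes X :: "'s \<Rightarrow> (nat list \<Rightarrow> 'k::field) set"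
  assumes "finite F" "\<And>S. S \<in> F \<Longrightarrow> W.subspace (X S)" "\<And>S. S \<in> F \<Longrightarrow> W.fin_dim (X S)"
    and lin: "\<And>S. S \<in> F \<Longrightarrow> Vector_Spaces.linear fscale fscale (ev S)"
    and tri: "\<And>S S' x. S \<in> F \<Longrightarrow> S' \<in> F \<Longrightarrow> f S < f S' \<Longrightarrow> x \<in> X S \<Longrightarrow> ev S' x = 0"
    and inj: "inj_on (f :: 's \<Rightarrow> nat) F"
  shows "(\<Sum>S\<in>F. W.dim (ev S ` X S)) \<le> W.dim (W.span (\<Union>S\<in>F. X S)) \<and> W.fin_dim (W.span (\<Union>S\<in>F. X S))"
  using assms
proof (induction "card F" arbitrary: F)
  case 0
  then have "F = {}" by simp
  then show ?case by (auto simp: W.fin_dim_def)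
next
  case (Suc m)
  then have ne: "F \<noteq> {}" by auto
  have "Max (f ` F) \<in> f ` F" using Suc.prems(1) ne by simp
  then obtain S where S: "S \<in> F" "f S = Max (f ` F)" by auto
  have max: "f S' < f S" if "S' \<in> F - {S}" for S'
  proof -
    have "f S' \<le> f S" using S Suc.prems(1) that by simp
    moreover have "f S' \<noteq> f S" using inj_onD[OF Suc.prems(6)] S(1) that by blast
    ultimately show ?thesis by simp
  qed
  let ?F = "F - {S}"
  let ?A = "W.span (\<Union>S\<in>F. X S)" and ?A' = "W.span (\<Union>S\<in>?F. X S)"
  interpret l: Vector_Spaces.linear fscale fscale "ev S" using Suc.prems(4) S(1) by blast
  have IH: "(\<Sum>S\<in>?F. W.dim (ev S ` X S)) \<le> W.dim ?A' \<and> W.fin_dim ?A'"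
  proof (rule Suc.hyps(1))
    show "m = card ?F" using Suc.hyps(2) S(1) Suc.prems(1) by simp
    show "inj_on f ?F" using Suc.prems(6) inj_on_diff by blast
  qed (use Suc.prems in auto)
  have un: "(\<Union>S\<in>F. X S) = (\<Union>S\<in>?F. X S) \<union> X S" using S(1) by auto
  have "W.fin_dim (\<Union>S\<in>?F. X S)" using IH W.fin_dim_subset[OF _ W.span_superset] by blast
  then have finA: "W.fin_dim ?A" unfolding un using W.fin_dim_span W.fin_dim_Un Suc.prems(3)[OF S(1)] by blast
  have "?A' \<subseteq> ?A \<inter> {x. ev S x = 0}"
  proof (rule W.span_minimal)
    show "(\<Union>S\<in>?F. X S) \<subseteq> ?A \<inter> {x. ev S x = 0}"
    proof
      fix x assume "x \<in> (\<Union>S\<in>?F. X S)"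
      then obtain S' where S': "S' \<in> ?F" "x \<in> X S'" by blast
      then have "ev S x = 0" using Suc.prems(5)[of S' S x] S(1) max by blast
      moreover have "x \<in> ?A" using S' by (auto intro: W.span_base)
      ultimately show "x \<in> ?A \<inter> {x. ev S x = 0}" by simp
    qed
  qed (intro W.subspace_inter W.subspace_span l.subspace_kernel)
  then have "W.dim ?A' \<le> W.dim (?A \<inter> {x. ev S x = 0})"
    by (intro W.dim_subset_fin_dim W.fin_dim_subset[OF finA]) auto
  moreover have "W.dim (ev S ` X S) \<le> W.dim (ev S ` ?A)"
  proof (rule W.dim_subset_fin_dim)
    show "W.fin_dim (ev S ` ?A)"
      using WW.rank_nullity_fin_dim(2)[OF Suc.prems(4)[OF S(1)] W.subspace_span finA] .
    show "ev S ` X S \<subseteq> ev S ` ?A" using S(1) by (intro image_mono) (auto intro: W.span_base)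
  qed
  moreover have "W.dim (?A \<inter> {x. ev S x = 0}) + W.dim (ev S ` ?A) = W.dim ?A"
    by (rule WW.rank_nullity_fin_dim(1)[OF Suc.prems(4)[OF S(1)] W.subspace_span finA])
  moreover have "(\<Sum>S\<in>F. W.dim (ev S ` X S)) = W.dim (ev S ` X S) + (\<Sum>S\<in>?F. W.dim (ev S ` X S))"
    using Suc.prems(1) S(1) by (simp add: sum.remove)
  ultimately show ?case using IH finA by linarith
qed

lemma wcont_distinct: "distinct w \<Longrightarrow> wcont w = (\<lambda>i. of_bool (i \<in> set w))"
  by (induction w) (auto simp: wcont_Cons unit_def fun_eq_iff)

text \<open>
  An operator \<open>act i j\<close> with \<open>i \<le> j\<close> replaces a letter \<open>j\<close> by \<open>i\<close>, so it does not raise the code. On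
  strictly increasing words the code is injective.
\<close>

definition code :: "nat list \<Rightarrow> nat" where
  "code u = sum_list (map (\<lambda>i. 2 ^ i) u)"

lemma code_sorted: "finite S \<Longrightarrow> code (sorted_list_of_set S) = set_encode S"
  unfolding code_def set_encode_def
  by (subst sum_list_distinct_conv_sum_set) auto

text \<open>The leading coefficient: the part of the tensor whose first block is the increasing word
  of \<open>S\<close>, as a tensor in the remaining factors.\<close>

definition ev_column :: "nat set \<Rightarrow> (nat list \<Rightarrow> 'k::field) \<Rightarrow> nat list \<Rightarrow> 'k" where
  "ev_column S \<phi> = (\<lambda>w. \<phi> (sorted_list_of_set S @ w))"

lemma ev_column_linear: "Vector_Spaces.linear fscale fscale (ev_column S)"
  unfolding Vector_Spaces.linear_iff using W.vector_space_axioms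
  by (auto simp: ev_column_def fun_eq_iff fscale_apply)

definition code_le :: "nat set \<Rightarrow> (nat list \<Rightarrow> 'k::field) set" where
  "code_le S = {\<phi>. \<forall>u w. length u = card S \<and> set_encode S < code u \<longrightarrow> \<phi> (u @ w) = 0}"

lemma subspace_code_le: "W.subspace (code_le S)"
  by (rule W.subspaceI) (auto simp: code_le_def fscale_apply)

text \<open>The coordinate of \<open>act i j\<close> at a word reads a word with i replaced by j,
  whose code is larger if i < j. On tensors with leading block \<open>S\<close> such a change inside
  the block reads zero, and a diagonal operator acts on the block by a scalar. So taking the leading
  coefficient is equivariant up to that scalar.\<close>

lemma act_code_le:
  fixes \<phi> :: "nat list \<Rightarrow> 'k::field"
  assumes S: "finite S" and \<phi>: "\<phi> \<in> code_le S" and ij: "i \<le> j"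
  shows "act i j \<phi> \<in> code_le S"
    "ev_column S (act i j \<phi>) = act i j (ev_column S \<phi>) + fscale (of_bool (i = j \<and> i \<in> S)) (ev_column S \<phi>)"
proof -
  have zero: "act i j (\<lambda>u'. \<phi> (u' @ w)) u = 0"
    if "length u = card S" "set_encode S < code u \<or> set_encode S \<le> code u \<and> i < j" for u w
  proof (rule ccontr)
    assume "act i j (\<lambda>u'. \<phi> (u' @ w)) u \<noteq> 0"
    then obtain a v where av: "u = a @ i # v" "\<phi> ((a @ j # v) @ w) \<noteq> 0" using act_nonzero_word by blast
    have eq: "code (a @ j # v) + 2 ^ i = code u + 2 ^ j" using av(1) by (simp add: code_def)
    have le: "(2::nat) ^ i \<le> 2 ^ j" using ij by (simp add: power_increasing)
    have lt: "(2::nat) ^ i < 2 ^ j" if "i < j" using that by (simp add: power_strict_increasing)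
    have "set_encode S < code (a @ j # v)" using that(2)
    proof
      assume "set_encode S < code u"
      then show ?thesis using eq le by linarith
    next
      assume "set_encode S \<le> code u \<and> i < j"
      then show ?thesis using eq lt by linarith
    qed
    moreover have "length (a @ j # v) = card S" using that(1) av(1) by simp
    ultimately show False using \<phi> av(2) unfolding code_le_def by blast
  qed
  show "act i j \<phi> \<in> code_le S"
    unfolding code_le_def
  proof safe
    fix u w assume u: "length u = card S" "set_encode S < code u"
    then have "(\<lambda>w'. \<phi> (u @ w')) = (\<lambda>_. 0)" using \<phi> by (auto simp: code_le_def)
    then show "act i j \<phi> (u @ w) = 0" unfolding act_append using zero[of u w] u by simp
  qed
  show "ev_column S (act i j \<phi>) = act i j (ev_column S \<phi>) + fscale (of_bool (i = j \<and> i \<in> S)) (ev_column S \<phi>)"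
  proof
    fix w
    have "act i j (\<lambda>u'. \<phi> (u' @ w)) (sorted_list_of_set S) = of_bool (i = j \<and> i \<in> S) * \<phi> (sorted_list_of_set S @ w)"
    proof (cases "i = j")
      case False
      then show ?thesis using zero[of "sorted_list_of_set S" w] ij S by (simp add: code_sorted)
    next
      case True
      have "count_list (sorted_list_of_set S) i = of_bool (i \<in> S)"
      proof -
        have "wcont (sorted_list_of_set S) = (\<lambda>i. of_bool (i \<in> S))"
          using wcont_distinct[of "sorted_list_of_set S"] S by simp
        then have "int (count_list (sorted_list_of_set S) i) = of_bool (i \<in> S)"
          by (simp add: wcont_def fun_eq_iff)
        then show ?thesis by (cases "i \<in> S") auto
      qed
      then show ?thesis using True by (simp add: act_diag)
    qed
    then show "ev_column S (act i j \<phi>) w =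
        (act i j (ev_column S \<phi>) + fscale (of_bool (i = j \<and> i \<in> S)) (ev_column S \<phi>)) w"
      unfolding ev_column_def act_append by (simp add: fscale_apply)
  qed
qed

lemma ext_code_le:
  assumes "column (Suc k) b = S"
  shows "ext b (Suc k) \<in> (code_le S :: (nat list \<Rightarrow> 'k::field) set)"
    "ev_column S (ext b (Suc k)) = (ext b k :: nat list \<Rightarrow> 'k)"
proof -
  have fin: "finite S" using assms by auto
  have "alt S u = (0::'k)" if "set_encode S < code u" for u
  proof (rule ccontr)
    assume a: "alt S u \<noteq> (0::'k)"
    have "set u = S" "length u = card S" using alt_nonzero[OF fin a] by auto
    then have "distinct u" by (metis card_distinct)
    then have "code u = set_encode S"
      unfolding code_def set_encode_def \<open>set u = S\<close>[symmetric] by (simp add: sum_list_distinct_conv_sum_set)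
    then show False using that by simp
  qed
  then show "ext b (Suc k) \<in> (code_le S :: (nat list \<Rightarrow> 'k) set)" by (auto simp: code_le_def tens_def assms)
  show "ev_column S (ext b (Suc k)) = (ext b k :: nat list \<Rightarrow> 'k)"
    using fin by (auto simp: ev_column_def tens_def assms alt_sorted)
qed

text \<open>The leading coefficient of the extremal tensor is the extremal tensor with one column
  less. By equivariance the leading coefficients form a module for b_n, which contains the module
  generated by that tensor.\<close>

lemma dem_code_le:
  assumes "column (Suc k) b = S"
  shows "dem b (Suc k) \<subseteq> (code_le S :: (nat list \<Rightarrow> 'k::field) set)"
    "dem b k \<subseteq> (ev_column S ` dem b (Suc k) :: (nat list \<Rightarrow> 'k) set)"
proof -
  have fin: "finite S" using assms by auto
  show sub: "dem b (Suc k) \<subseteq> (code_le S :: (nat list \<Rightarrow> 'k) set)"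
    by (rule dem_minimal[OF subspace_code_le]) (use ext_code_le[OF assms] act_code_le[OF fin] in auto)
  interpret l: Vector_Spaces.linear fscale fscale "ev_column S :: (nat list \<Rightarrow> 'k) \<Rightarrow> _" by (rule ev_column_linear)
  let ?X = "ev_column S ` dem b (Suc k) :: (nat list \<Rightarrow> 'k) set"
  have subX: "W.subspace ?X" by (rule l.subspace_image[OF subspace_dem])
  show "dem b k \<subseteq> ?X"
  proof (rule dem_minimal[OF subX])
    show "ext b k \<in> ?X" using ext_code_le(2)[OF assms] ext_in_dem by (metis imageI)
    fix i j y assume ij: "i \<le> j" "j < length b" and "y \<in> ?X"
    then obtain \<phi> where \<phi>: "\<phi> \<in> dem b (Suc k)" "y = ev_column S \<phi>" by blast
    have c: "\<phi> \<in> code_le S" using \<phi>(1) sub by blast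
    have "act i j y = ev_column S (act i j \<phi>) - fscale (of_bool (i = j \<and> i \<in> S)) y"
      using act_code_le(2)[OF fin c ij(1)] \<phi>(2) by simp
    moreover have "ev_column S (act i j \<phi>) \<in> ?X" using act_dem[OF ij \<phi>(1)] by blast
    ultimately show "act i j y \<in> ?X"
      using \<open>y \<in> ?X\<close> by (simp only:) (intro W.subspace_diff[OF subX] W.subspace_scale[OF subX])
  qed
qed

text \<open>The indices whose modules appear among the leading coefficients for \<open>S\<close>:
  elements of \<open>I\<close> with column \<open>S\<close>, and by \<open>dem_mono\<close>
  everything below them.\<close>

definition column_section :: "nat list set \<Rightarrow> nat \<Rightarrow> nat set \<Rightarrow> nat list set" where
  "column_section I k S = {d. \<exists>c\<in>I. bruhat_le d c \<and> column k c = S}"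

definition indicator_weight :: "nat set \<Rightarrow> nat \<Rightarrow> int" where
  "indicator_weight S = (\<lambda>i. of_bool (i \<in> S))"

definition hdim_columns :: "'k::field_char_0 itself \<Rightarrow> nat \<Rightarrow> nat list set \<Rightarrow> nat \<Rightarrow> (nat \<Rightarrow> int) \<Rightarrow> int" where
  "hdim_columns ty n I k \<nu> =
    (\<Sum>S\<in>Pow {..<n}. hdim ty (column_section I (Suc k) S) k (\<nu> - indicator_weight S))"

text \<open>The generators of D_I are sorted by their last column. Different columns of the same
  size have different codes, so their contributions add up by \<open>triangular_dim\<close>, and the
  leading coefficients for \<open>S\<close> contain the sum over the section of \<open>S\<close>
  with one column less.\<close>

lemma hdim_lower_bound:
  assumes sorted: "sorted_wrt (\<ge>) lam" and I: "lower_set lam I"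
  shows "hdim_columns TYPE('k::field_char_0) (length lam) I k \<nu> \<le> hdim TYPE('k) I (Suc k) \<nu>"
proof -
  let ?P = "Pow {..<length lam}"
  let ?F = "{S \<in> ?P. card S = card (column (Suc k) lam)}"
  define D where "D S = (demI {c \<in> I. column (Suc k) c = S} (Suc k) :: (nat list \<Rightarrow> 'k) set)" for S
  define X where "X S = D S \<inter> wts \<nu>" for S
  have IP: "I \<subseteq> rearrangements lam" using I by (simp add: lower_set_def)
  have subI: "{c \<in> I. column (Suc k) c = S} \<subseteq> rearrangements lam" for S using IP by auto
  have finS: "finite S" if "S \<in> ?F" for S using that finite_subset by auto
  have codeD: "D S \<subseteq> code_le S" for S
    unfolding D_def demI_def using dem_code_le(1) by (intro W.span_minimal subspace_code_le) auto
  have main: "hdim TYPE('k) (column_section I (Suc k) S) k (\<nu> - indicator_weight S) \<le> int (W.dim (ev_column S ` X S))"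
    if S: "S \<in> ?F" for S
  proof -
    let ?J = "column_section I (Suc k) S"
    interpret l: Vector_Spaces.linear fscale fscale "ev_column S :: (nat list \<Rightarrow> 'k) \<Rightarrow> _" by (rule ev_column_linear)
    have 1: "demI ?J k \<subseteq> ev_column S ` D S"
      unfolding demI_def
    proof (rule W.span_minimal)
      show "W.subspace (ev_column S ` D S)" unfolding D_def by (rule l.subspace_image[OF subspace_demI])
      show "(\<Union>b\<in>?J. dem b k) \<subseteq> ev_column S ` D S"
      proof
        fix x :: "nat list \<Rightarrow> 'k" assume "x \<in> (\<Union>b\<in>?J. dem b k)"
        then obtain d c where dc: "x \<in> dem d k" "c \<in> I" "bruhat_le d c" "column (Suc k) c = S"
          by (auto simp: column_section_def)
        have "x \<in> dem c k" using dem_mono[OF sorted _ dc(3)] dc IP by blast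
        then have "x \<in> ev_column S ` dem c (Suc k)" using dem_code_le(2)[OF dc(4)] by blast
        moreover have "dem c (Suc k) \<subseteq> D S"
          unfolding D_def by (rule dem_subset_demI) (use dc in simp)
        ultimately show "x \<in> ev_column S ` D S" by blast
      qed
    qed
    have "demI ?J k \<inter> wts (\<nu> - indicator_weight S) \<subseteq> ev_column S ` X S"
    proof
      fix y :: "nat list \<Rightarrow> 'k" assume y: "y \<in> demI ?J k \<inter> wts (\<nu> - indicator_weight S)"
      then obtain x where x: "x \<in> D S" "y = ev_column S x" using 1 by blast
      have wc: "wcont (sorted_list_of_set S @ w) = \<nu> \<longleftrightarrow> wcont w = \<nu> - indicator_weight S" for w
      proof -
        have "wcont (sorted_list_of_set S) = indicator_weight S"
          using wcont_distinct[of "sorted_list_of_set S"] finS[OF S] by (simp add: indicator_weight_def)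
        then show ?thesis by (auto simp: wcont_append algebra_simps)
      qed
      have "y = wproj (\<nu> - indicator_weight S) y"
        using y wproj_wts[of y "\<nu> - indicator_weight S" "\<nu> - indicator_weight S"] by simp
      also have "\<dots> = ev_column S (wproj \<nu> x)" using wc by (simp add: x(2) ev_column_def wproj_def)
      finally have "y = ev_column S (wproj \<nu> x)" .
      moreover have "wproj \<nu> x \<in> X S"
        using x(1) graded_demI wproj_in_wts unfolding X_def D_def graded_def by blast
      ultimately show "y \<in> ev_column S ` X S" by blast
    qed
    moreover have "W.fin_dim (ev_column S ` X S)"
      unfolding X_def D_def
      by (rule WW.rank_nullity_fin_dim(2)[OF ev_column_linear subspace_demI_wts fin_dim_demI_wts[OF subI]])
    ultimately show ?thesis unfolding hdim_def using W.dim_subset_fin_dim by auto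
  qed
  have tri: "(\<Sum>S\<in>?F. W.dim (ev_column S ` X S)) \<le> W.dim (W.span (\<Union>S\<in>?F. X S)) \<and> W.fin_dim (W.span (\<Union>S\<in>?F. X S))"
  proof (rule triangular_dim[where f = set_encode])
    show "finite ?F" by simp
    show "W.subspace (X S)" for S unfolding X_def D_def by (rule subspace_demI_wts)
    show "W.fin_dim (X S)" for S unfolding X_def D_def by (rule fin_dim_demI_wts[OF subI])
    show "inj_on set_encode ?F" by (rule inj_onI) (use finS in \<open>metis set_encode_inverse\<close>)
    fix S S' x assume S: "S \<in> ?F" "S' \<in> ?F" "set_encode S < set_encode S'" "x \<in> X S"
    have "x \<in> code_le S" using S(4) codeD by (auto simp: X_def)
    moreover have "length (sorted_list_of_set S') = card S" "set_encode S < code (sorted_list_of_set S')"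
      using S(1,2,3) finS[OF S(2)] by (simp_all add: code_sorted)
    ultimately have "x (sorted_list_of_set S' @ w) = 0" for w unfolding code_le_def by blast
    then show "ev_column S' x = 0" by (simp add: ev_column_def zero_fun_def)
  qed (rule ev_column_linear)
  have sub: "W.span (\<Union>S\<in>?F. X S) \<subseteq> demI I (Suc k) \<inter> wts \<nu>"
  proof (rule W.span_minimal[OF _ subspace_demI_wts])
    show "(\<Union>S\<in>?F. X S) \<subseteq> demI I (Suc k) \<inter> wts \<nu>"
      using demI_mono[of "{c \<in> I. column (Suc k) c = _}" I "Suc k"] unfolding X_def D_def by blast
  qed
  have "W.dim (W.span (\<Union>S\<in>?F. X S)) \<le> W.dim (demI I (Suc k) \<inter> wts \<nu> :: (nat list \<Rightarrow> 'k) set)"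
    by (rule W.dim_subset_fin_dim[OF _ sub], rule fin_dim_demI_wts[OF IP])
  then have "int (\<Sum>S\<in>?F. W.dim (ev_column S ` X S)) \<le> hdim TYPE('k) I (Suc k) \<nu>"
    unfolding hdim_def using tri by linarith
  moreover have "hdim_columns TYPE('k) (length lam) I k \<nu> \<le> int (\<Sum>S\<in>?F. W.dim (ev_column S ` X S))"
  proof -
    \<comment> \<open>Sets of the wrong cardinality are not columns of rearrangements; their
      sections are empty and contribute 0.\<close>
    have "hdim_columns TYPE('k) (length lam) I k \<nu> =
        (\<Sum>S\<in>?F. hdim TYPE('k) (column_section I (Suc k) S) k (\<nu> - indicator_weight S))"
      unfolding hdim_columns_def
    proof (rule sum.mono_neutral_right)
      show "\<forall>S\<in>?P - ?F. hdim TYPE('k) (column_section I (Suc k) S) k (\<nu> - indicator_weight S) = 0"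
      proof
        fix S assume "S \<in> ?P - ?F"
        then have "column (Suc k) c \<noteq> S" if "c \<in> I" for c
          using card_column_cong[of c lam "Suc k"] IP that by (auto simp: rearrangements_def)
        then have "column_section I (Suc k) S = {}" by (auto simp: column_section_def)
        moreover have "demI {} k \<inter> wts (\<nu> - indicator_weight S) = ({0} :: (nat list \<Rightarrow> 'k) set)"
          using W.subspace_0[OF subspace_wts] by (auto simp: demI_empty)
        ultimately show "hdim TYPE('k) (column_section I (Suc k) S) k (\<nu> - indicator_weight S) = 0"
          by (simp add: hdim_def W.dim_zero_subspace)
      qed
    qed auto
    also have "\<dots> \<le> int (\<Sum>S\<in>?F. W.dim (ev_column S ` X S))"
      unfolding of_nat_sum by (rule sum_mono) (rule main)
    finally show ?thesis .
  qed
  ultimately show ?thesis by linarith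
qed

subsection \<open>Demazure operators on weight multiplicities\<close>

text \<open>
  The relation between a character \<open>g\<close> and its image \<open>g'\<close> under the Demazure operator
  \<open>f \<mapsto> (x\<^sub>i f - x\<^sub>i\<^sub>+\<^sub>1 s\<^sub>i f) / (x\<^sub>i - x\<^sub>i\<^sub>+\<^sub>1)\<close>, with denominators cleared.
\<close>

definition demazure_rel :: "nat \<Rightarrow> ((nat \<Rightarrow> int) \<Rightarrow> int) \<Rightarrow> ((nat \<Rightarrow> int) \<Rightarrow> int) \<Rightarrow> bool" where
  "demazure_rel i g g' \<longleftrightarrow> (\<forall>\<nu>. g' (\<nu> \<circ> transpose i (Suc i)) = g' \<nu> \<and>
     g' \<nu> - g' (rshift i (Suc i) 1 \<nu>) = g \<nu> - g (rshift i (Suc i) (-1) (\<nu> \<circ> transpose i (Suc i))))"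

lemma demazure_relD:
  assumes "demazure_rel i g g'"
  shows "g' (\<nu> \<circ> transpose i (Suc i)) = g' \<nu>"
    "g' \<nu> - g' (rshift i (Suc i) 1 \<nu>) = g \<nu> - g (rshift i (Suc i) (-1) (\<nu> \<circ> transpose i (Suc i)))"
  using assms by (auto simp: demazure_rel_def)

lemma demazure_rel_sum:
  assumes "\<And>S. S \<in> F \<Longrightarrow> demazure_rel i (g S) (g' S)"
  shows "demazure_rel i (\<lambda>\<nu>. \<Sum>S\<in>F. g S \<nu>) (\<lambda>\<nu>. \<Sum>S\<in>F. g' S \<nu>)"
  using assms unfolding demazure_rel_def by (simp flip: sum_subtractf)

lemma demazure_rel_add:
  "demazure_rel i g1 g1' \<Longrightarrow> demazure_rel i g2 g2' \<Longrightarrow>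
    demazure_rel i (\<lambda>\<nu>. g1 \<nu> + g2 \<nu>) (\<lambda>\<nu>. g1' \<nu> + g2' \<nu>)"
  unfolding demazure_rel_def by (simp add: algebra_simps)

lemma rshift_comp_transpose:
  "p \<noteq> q \<Longrightarrow> rshift p q m \<nu> \<circ> transpose p q = rshift p q (- m) (\<nu> \<circ> transpose p q)"
  by (auto simp: rshift_def fun_eq_iff transpose_def unit_def)

lemma rshift_diff: "rshift p q m (\<nu> - \<mu>) = rshift p q m \<nu> - \<mu>"
  by (auto simp: rshift_def fun_eq_iff)

lemma comp_diff: "(\<nu> - \<mu>) \<circ> f = (\<nu> \<circ> f) - (\<mu> \<circ> f :: nat \<Rightarrow> int)"
  by (auto simp: fun_eq_iff)

lemma indicator_weight_transpose: "indicator_weight (transpose i j ` S) = indicator_weight S \<circ> transpose i j"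
  by (auto simp: indicator_weight_def fun_eq_iff in_transpose_image_iff)

text \<open>x^S is symmetric in the two variables, and Demazure operators are linear over symmetric
  functions.\<close>

lemma demazure_rel_shift_fixed:
  assumes "i \<in> S \<longleftrightarrow> Suc i \<in> S" "demazure_rel i f F"
  shows "demazure_rel i (\<lambda>\<nu>. f (\<nu> - indicator_weight S)) (\<lambda>\<nu>. F (\<nu> - indicator_weight S))"
proof -
  have "indicator_weight S \<circ> transpose i (Suc i) = indicator_weight S"
    using indicator_weight_transpose[of i "Suc i" S] transpose_image_eq[OF assms(1)] by simp
  then have eq: "(\<nu> - indicator_weight S) \<circ> transpose i (Suc i) = (\<nu> \<circ> transpose i (Suc i)) - indicator_weight S" for \<nu>
    by (simp add: comp_diff)
  show ?thesis
    unfolding demazure_rel_def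
  proof (intro allI conjI)
    fix \<nu>
    note D = demazure_relD[OF assms(2), of "\<nu> - indicator_weight S", unfolded eq rshift_diff]
    show "F ((\<nu> \<circ> transpose i (Suc i)) - indicator_weight S) = F (\<nu> - indicator_weight S)"
      by (rule D(1))
    show "F (\<nu> - indicator_weight S) - F (rshift i (Suc i) 1 \<nu> - indicator_weight S) =
        f (\<nu> - indicator_weight S) - f (rshift i (Suc i) (-1) (\<nu> \<circ> transpose i (Suc i)) - indicator_weight S)"
      by (rule D(2))
  qed
qed

text \<open>With \<pi> the Demazure operator, this is \<pi>(x_i f) = x_i f + x_{i+1} \<pi>(f)
  together with \<pi>(x_{i+1} g) = 0 for symmetric g, up to a common symmetric factor. The relation
  of g to itself expresses its symmetry.\<close>

lemma demazure_rel_shift_pair: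
  assumes S: "i \<in> S" "Suc i \<notin> S" and fF: "demazure_rel i f F" and gg: "demazure_rel i g g"
  defines "S' \<equiv> transpose i (Suc i) ` S"
  shows "demazure_rel i (\<lambda>\<nu>. f (\<nu> - indicator_weight S) + g (\<nu> - indicator_weight S'))
    (\<lambda>\<nu>. f (\<nu> - indicator_weight S) + F (\<nu> - indicator_weight S'))"
  unfolding demazure_rel_def
proof (intro allI conjI)
  fix \<nu>
  let ?s = "transpose i (Suc i)"
  let ?w = "indicator_weight S" and ?w' = "indicator_weight S'"
  have w': "?w' = ?w \<circ> ?s" by (simp add: S'_def indicator_weight_transpose)
  have w: "?w = ?w' \<circ> ?s" by (simp add: w' fun_eq_iff)
  have ww': "?w' = rshift i (Suc i) (-1) ?w"
    unfolding w' using S by (auto simp: indicator_weight_def rshift_def unit_def transpose_def fun_eq_iff)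
  have a: "rshift i (Suc i) 1 (\<mu> - ?w) = \<mu> - ?w'" for \<mu>
    unfolding ww' by (auto simp: rshift_def fun_eq_iff)
  have b: "rshift i (Suc i) (-1) (\<mu> - ?w') = \<mu> - ?w" for \<mu>
    unfolding ww' by (auto simp: rshift_def fun_eq_iff)
  have c: "(\<mu> - ?w) \<circ> ?s = (\<mu> \<circ> ?s) - ?w'" and d: "(\<mu> - ?w') \<circ> ?s = (\<mu> \<circ> ?s) - ?w" for \<mu>
    unfolding comp_diff w[symmetric] w'[symmetric] by simp_all
  note F1 = demazure_relD(1)[OF fF, of "\<nu> - ?w"] demazure_relD(1)[OF fF, of "\<nu> - ?w'"]
  note F2 = demazure_relD(2)[OF fF, of "\<nu> - ?w"] demazure_relD(2)[OF fF, of "\<nu> - ?w'"]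
  show "f ((\<nu> \<circ> ?s) - ?w) + F ((\<nu> \<circ> ?s) - ?w') = f (\<nu> - ?w) + F (\<nu> - ?w')"
    using F1(1) F2(1) unfolding a c b by linarith
  have g: "g (((rshift i (Suc i) (-1) (\<nu> \<circ> ?s)) - ?w')) = g (\<nu> - ?w')"
  proof -
    have "(rshift i (Suc i) (-1) (\<nu> \<circ> ?s)) - ?w' = (\<nu> \<circ> ?s) - ?w"
      using b[of "\<nu> \<circ> ?s"] by (simp add: rshift_diff)
    also have "\<dots> = (\<nu> - ?w') \<circ> ?s" by (simp add: d)
    finally show ?thesis using demazure_relD(1)[OF gg, of "\<nu> - ?w'"] by simp
  qed
  have e: "rshift i (Suc i) 1 \<nu> - ?w = \<nu> - ?w'" using a[of \<nu>] by (simp add: rshift_diff)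
  have h: "rshift i (Suc i) (-1) (\<nu> \<circ> ?s) - ?w = rshift i (Suc i) (-1) ((\<nu> - ?w') \<circ> ?s)"
    unfolding d by (simp add: rshift_diff)
  have k: "rshift i (Suc i) 1 \<nu> - ?w' = rshift i (Suc i) 1 (\<nu> - ?w')" by (simp add: rshift_diff)
  show "f (\<nu> - ?w) + F (\<nu> - ?w') - (f (rshift i (Suc i) 1 \<nu> - ?w) + F (rshift i (Suc i) 1 \<nu> - ?w'))
      = f (\<nu> - ?w) + g (\<nu> - ?w') - (f (rshift i (Suc i) (-1) (\<nu> \<circ> ?s) - ?w)
        + g (rshift i (Suc i) (-1) (\<nu> \<circ> ?s) - ?w'))"
    using F2(2) unfolding e g h k by linarith
qed

text \<open>Groups the columns into those fixed by the exchange and pairs of distinct ones, the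
  units on which the Demazure relation can be checked.\<close>

lemma sum_Pow_pairs:
  fixes t :: "nat set \<Rightarrow> int"
  assumes "Suc i < n"
  shows "(\<Sum>S\<in>Pow {..<n}. t S) = (\<Sum>S\<in>{S \<in> Pow {..<n}. i \<in> S \<longleftrightarrow> Suc i \<in> S}. t S) +
    (\<Sum>S\<in>{S \<in> Pow {..<n}. i \<in> S \<and> Suc i \<notin> S}. t S + t (transpose i (Suc i) ` S))"
proof -
  let ?s = "transpose i (Suc i)"
  let ?A = "{S \<in> Pow {..<n}. i \<in> S \<longleftrightarrow> Suc i \<in> S}"
  let ?B = "{S \<in> Pow {..<n}. i \<in> S \<and> Suc i \<notin> S}"
  let ?C = "{S \<in> Pow {..<n}. i \<notin> S \<and> Suc i \<in> S}"
  have inv: "?s ` ?s ` S = S" for S by (simp add: image_image)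
  have sub: "?s ` S \<subseteq> {..<n}" if "S \<subseteq> {..<n}" for S
    using that assms by (auto simp: transpose_def)
  have mem: "i \<in> ?s ` S \<longleftrightarrow> Suc i \<in> S" "Suc i \<in> ?s ` S \<longleftrightarrow> i \<in> S" for S
    by (simp_all add: in_transpose_image_iff)
  have "(\<lambda>S. ?s ` S) ` ?B = ?C"
  proof (intro subset_antisym subsetI)
    fix S assume S: "S \<in> ?C"
    then have "?s ` S \<in> ?B" using sub[of S] mem[of S] by simp
    then show "S \<in> (\<lambda>S. ?s ` S) ` ?B" using inv[of S] by (intro image_eqI[of _ _ "?s ` S"]) simp_all
  next
    fix S assume "S \<in> (\<lambda>S. ?s ` S) ` ?B"
    then obtain S0 where "S = ?s ` S0" "S0 \<in> ?B" by blast
    then show "S \<in> ?C" using sub[of S0] mem[of S0] by simp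
  qed
  moreover have "inj_on (\<lambda>S. ?s ` S) ?B" by (rule inj_onI) (metis inv)
  ultimately have C: "(\<Sum>S\<in>?C. t S) = (\<Sum>S\<in>?B. t (?s ` S))"
    using sum.reindex[of "\<lambda>S. ?s ` S" ?B t] by simp
  have P: "Pow {..<n} = ?A \<union> (?B \<union> ?C)" by auto
  have 1: "(\<Sum>S\<in>?A \<union> (?B \<union> ?C). t S) = (\<Sum>S\<in>?A. t S) + (\<Sum>S\<in>?B \<union> ?C. t S)"
    by (rule sum.union_disjoint) auto
  have 2: "(\<Sum>S\<in>?B \<union> ?C. t S) = (\<Sum>S\<in>?B. t S) + (\<Sum>S\<in>?C. t S)"
    by (rule sum.union_disjoint) auto
  have "(\<Sum>S\<in>Pow {..<n}. t S) = (\<Sum>S\<in>?A. t S) + ((\<Sum>S\<in>?B. t S) + (\<Sum>S\<in>?C. t S))"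
    using 1 2 by (subst P) (simp only:)
  then show ?thesis unfolding C sum.distrib .
qed

subsection \<open>Sections of lower sets\<close>

text \<open>On lower sets, the combinatorial counterpart of the Demazure operator for positions i
  and i + 1.\<close>

definition sclosure :: "nat \<Rightarrow> nat list set \<Rightarrow> nat list set" where
  "sclosure i I = I \<union> sx i ` I"

lemma sx_sx: "Suc i < length b \<Longrightarrow> sx i (sx i b) = b"
  by simp

lemma lower_set_length: "lower_set lam I \<Longrightarrow> b \<in> I \<Longrightarrow> length b = length lam"
  using length_rearrangements by (auto simp: lower_set_def)

lemma lower_setD: "lower_set lam I \<Longrightarrow> b \<in> I \<Longrightarrow> bruhat_le c b \<Longrightarrow> c \<in> I"
  by (auto simp: lower_set_def)

lemma below_ascentE:
  assumes "bruhat_le d c" "Suc i < length c" "c ! i < c ! Suc i"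
  shows "bruhat_le d (sx i c) \<or> bruhat_le (sx i d) (sx i c)"
  using below_sx[OF assms(2,3), of d] assms(1) by (auto simp: below_def)

lemma lower_set_sclosure:
  assumes I: "lower_set lam I" and i: "Suc i < length lam"
  shows "lower_set lam (sclosure i I)"
  unfolding lower_set_def
proof (intro conjI ballI allI impI)
  show "sclosure i I \<subseteq> rearrangements lam"
    using I i exchange_in_rearrangements lower_set_length[OF I] by (fastforce simp: sclosure_def lower_set_def)
  fix b d assume b: "b \<in> sclosure i I" and d: "bruhat_le d b"
  show "d \<in> sclosure i I"
  proof (cases "b \<in> I")
    case True
    then show ?thesis using lower_setD[OF I _ d] by (simp add: sclosure_def)
  next
    case False
    then obtain c where c: "c \<in> I" "b = sx i c" using b by (auto simp: sclosure_def)
    have len: "length c = length lam" using lower_set_length[OF I c(1)] .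
    have "\<not> c ! i \<le> c ! Suc i"
      using bruhat_le_exchange_down[of i c] lower_setD[OF I c(1)] False c(2) len i by auto
    then have "b ! i < b ! Suc i" using c(2) len i by (simp add: nth_exchange)
    then have "bruhat_le d c \<or> bruhat_le (sx i d) c"
      using below_ascentE[OF d, of i] c(2) len i by simp
    then have "d \<in> I \<or> sx i d \<in> I" using lower_setD[OF I c(1)] by blast
    moreover have "length d = length lam" using bruhat_le_measure[OF d] c(2) len by simp
    ultimately show ?thesis using i sx_sx[of i d] unfolding sclosure_def by (metis UnCI imageI)
  qed
qed

lemma below_sclosure:
  assumes "Suc i < length b" "b ! i < b ! Suc i"
  shows "below b = sclosure i (below (sx i b))"
proof (intro subset_antisym subsetI)
  fix c assume c: "c \<in> below b"
  then have len: "length c = length b" using bruhat_le_measure by (auto simp: below_def)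
  have "bruhat_le c (sx i b) \<or> bruhat_le (sx i c) (sx i b)"
    using below_ascentE[OF _ assms, of c] c by (simp add: below_def)
  then show "c \<in> sclosure i (below (sx i b))"
    using sx_sx[of i c] len assms(1) unfolding sclosure_def below_def by (metis UnCI imageI mem_Collect_eq)
next
  fix c assume "c \<in> sclosure i (below (sx i b))"
  then obtain c' where c': "bruhat_le c' (sx i b)" "c = c' \<or> c = sx i c'" by (auto simp: sclosure_def below_def)
  have "bruhat_le c' b" using c'(1) bruhat_le_exchange_down[of i b] assms bruhat_le_trans by simp
  then show "c \<in> below b" using c'(2) bruhat_lift_left[of c' b i] assms by (auto simp: below_def)
qed

lemma lower_set_column_section: "lower_set lam I \<Longrightarrow> lower_set lam (column_section I k S)"
  unfolding lower_set_def column_section_def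
  using bruhat_le_trans bruhat_le_rearrangements by blast

lemma column_section_empty: "column_section {} k S = {}"
  by (simp add: column_section_def)

lemma column_section_Un: "column_section (I \<union> J) k S = column_section I k S \<union> column_section J k S"
  by (auto simp: column_section_def)

text \<open>Deodhar's lemma replaces two upper bounds with column \<open>S\<close>, one in each
  lower set, by a single one below both, which then lies in the intersection.\<close>

lemma column_section_Int:
  assumes "lower_set lam I" "lower_set lam J"
  shows "column_section (I \<inter> J) k S = column_section I k S \<inter> column_section J k S"
proof (intro subset_antisym subsetI)
  fix d assume "d \<in> column_section I k S \<inter> column_section J k S"
  then obtain c1 c2 where c: "c1 \<in> I" "c2 \<in> J" "bruhat_le d c1" "bruhat_le d c2"
    "column k c1 = S" "column k c2 = S" by (auto simp: column_section_def)
  obtain c where "bruhat_le d c" "bruhat_le c c1" "bruhat_le c c2" "column k c = S"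
    using bruhat_deodhar[OF c(3-6)] by blast
  then show "d \<in> column_section (I \<inter> J) k S"
    using c assms lower_setD unfolding column_section_def by blast
qed (auto simp: column_section_def)

lemma column_sx: "Suc i < length c \<Longrightarrow> column k (sx i c) = transpose i (Suc i) ` column k c"
  by (rule column_exchange) auto

context
  fixes lam :: "nat list" and I :: "nat list set" and i :: nat
  assumes I: "lower_set lam I" and i: "Suc i < length lam"
begin

lemma column_sectionI: "c \<in> I \<Longrightarrow> bruhat_le d c \<Longrightarrow> column k c = S \<Longrightarrow> d \<in> column_section I k S"
  by (auto simp: column_section_def)

lemma column_section_sclosure_memI:
  assumes "d \<in> column_section I k S \<or> sx i d \<in> column_section I k S" "length d = length lam"
  shows "d \<in> sclosure i (column_section I k S)"
  using assms sx_sx[of i d] i unfolding sclosure_def by (metis UnCI imageI)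

lemma len_le: "c \<in> sclosure i I \<Longrightarrow> bruhat_le d c \<Longrightarrow> length d = length lam \<and> length c = length lam"
  using lower_set_length[OF lower_set_sclosure[OF I i]] bruhat_le_measure[of d c] by metis

text \<open>This lemma and the next three trace the effect of the closure on sections, according to
  which of i and i + 1 belong to the column. They match the cases of the Demazure operator on a
  product with x^S. Here the exchange preserves the column, so it passes through the section by
  lifting.\<close>

lemma column_section_fixed:
  assumes S: "i \<in> S \<longleftrightarrow> Suc i \<in> S"
  shows "column_section (sclosure i I) k S = sclosure i (column_section I k S)"
proof (intro subset_antisym subsetI)
  have SS: "transpose i (Suc i) ` S = S" by (rule transpose_image_eq[OF S])
  fix d assume "d \<in> column_section (sclosure i I) k S"
  then obtain c where c: "c \<in> sclosure i I" "bruhat_le d c" "column k c = S"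
    by (auto simp: column_section_def)
  note len = len_le[OF c(1,2)]
  show "d \<in> sclosure i (column_section I k S)"
  proof (cases "c \<in> I")
    case True
    then show ?thesis using c column_sectionI by (auto simp: sclosure_def)
  next
    case False
    then obtain c0 where c0: "c0 \<in> I" "c = sx i c0" using c(1) by (auto simp: sclosure_def)
    have len0: "length c0 = length lam" using lower_set_length[OF I c0(1)] .
    then have "column k c0 = S"
      using c(3) c0(2) column_sx[of i c k] i len SS by simp
    moreover have "\<not> c0 ! i \<le> c0 ! Suc i"
      using bruhat_le_exchange_down[of i c0] lower_setD[OF I c0(1)] False c0(2) len0 i by auto
    then have "c ! i < c ! Suc i" using c0(2) len0 i by (simp add: nth_exchange)
    then have "bruhat_le d c0 \<or> bruhat_le (sx i d) c0"
      using below_ascentE[OF c(2), of i] c0(2) len0 i by simp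
    ultimately have "d \<in> column_section I k S \<or> sx i d \<in> column_section I k S"
      using c0(1) column_sectionI by blast
    then show ?thesis using column_section_sclosure_memI len by blast
  qed
next
  have SS: "transpose i (Suc i) ` S = S" by (rule transpose_image_eq[OF S])
  fix d assume "d \<in> sclosure i (column_section I k S)"
  then obtain d' c where c: "c \<in> I" "bruhat_le d' c" "column k c = S" "d = d' \<or> d = sx i d'"
    by (auto simp: sclosure_def column_section_def)
  have len: "length c = length lam" using lower_set_length[OF I c(1)] .
  have "bruhat_le (sx i d') c \<or> bruhat_le (sx i d') (sx i c)"
    using bruhat_lift_left[OF c(2), of i] bruhat_exchange_mono[OF c(2), of i] len i by linarith
  moreover have "column k (sx i c) = S" using column_sx[of i c k] len i SS c(3) by simp
  ultimately show "d \<in> column_section (sclosure i I) k S"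
    using c unfolding column_section_def sclosure_def by blast
qed

text \<open>An element with this column has a descent at \<open>i\<close>, so if it is the exchange
  of an element of I, it lies below that element and is in I already.\<close>

lemma column_section_low:
  assumes S: "i \<in> S" "Suc i \<notin> S"
  shows "column_section (sclosure i I) k S = column_section I k S"
proof (intro subset_antisym subsetI)
  fix d assume "d \<in> column_section (sclosure i I) k S"
  then obtain c where c: "c \<in> sclosure i I" "bruhat_le d c" "column k c = S"
    by (auto simp: column_section_def)
  note len = len_le[OF c(1,2)]
  have "i \<in> column k c" "Suc i \<notin> column k c" using S c(3) by auto
  then have gt: "c ! Suc i < c ! i" using len i by (auto simp: column_def)
  have "c \<in> I"
  proof (rule ccontr)
    assume "c \<notin> I"
    then obtain c0 where c0: "c0 \<in> I" "c = sx i c0" using c(1) by (auto simp: sclosure_def)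
    have len0: "length c0 = length lam" using lower_set_length[OF I c0(1)] .
    have "c0 ! i \<le> c0 ! Suc i" using gt c0(2) len0 i by (simp add: nth_exchange)
    then show False using bruhat_le_exchange_down[of i c0] lower_setD[OF I c0(1)] \<open>c \<notin> I\<close> c0(2) len0 i by auto
  qed
  then show "d \<in> column_section I k S" using c column_sectionI by blast
qed (auto simp: column_section_def sclosure_def)

text \<open>An element with the reflected column has an ascent at \<open>i\<close>; its exchange has
  column \<open>S\<close> and lies in I. What is below the element is, by lifting, what is below its
  exchange up to one exchange.\<close>

lemma column_section_high:
  assumes S: "i \<in> S" "Suc i \<notin> S"
  shows "column_section (sclosure i I) k (transpose i (Suc i) ` S) = sclosure i (column_section I k S)"
proof (intro subset_antisym subsetI)
  let ?S = "transpose i (Suc i) ` S"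
  have mem: "i \<notin> ?S" "Suc i \<in> ?S" using S by (simp_all add: in_transpose_image_iff)
  fix d assume "d \<in> column_section (sclosure i I) k ?S"
  then obtain c where c: "c \<in> sclosure i I" "bruhat_le d c" "column k c = ?S"
    by (auto simp: column_section_def)
  note len = len_le[OF c(1,2)]
  have "i \<notin> column k c" "Suc i \<in> column k c" using mem c(3) by auto
  then have lt: "c ! i < c ! Suc i" using len i by (auto simp: column_def)
  have "sx i c \<in> I"
  proof (cases "c \<in> I")
    case True
    then show ?thesis using bruhat_le_exchange_down[of i c] lower_setD[OF I True] len lt i by simp
  next
    case False
    then obtain c0 where "c0 \<in> I" "c = sx i c0" using c(1) by (auto simp: sclosure_def)
    then show ?thesis using lower_set_length[OF I] i by simp
  qed
  moreover have "column k (sx i c) = S" using column_sx[of i c k] len i c(3) by (simp add: image_image)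
  moreover have "bruhat_le d (sx i c) \<or> bruhat_le (sx i d) (sx i c)"
    using below_ascentE[OF c(2) _ lt] len i by simp
  ultimately have "d \<in> column_section I k S \<or> sx i d \<in> column_section I k S"
    using column_sectionI by blast
  then show "d \<in> sclosure i (column_section I k S)" using column_section_sclosure_memI len by blast
next
  fix d assume "d \<in> sclosure i (column_section I k S)"
  then obtain d' c where c: "c \<in> I" "bruhat_le d' c" "column k c = S" "d = d' \<or> d = sx i d'"
    by (auto simp: sclosure_def column_section_def)
  have len: "length c = length lam" using lower_set_length[OF I c(1)] .
  have "i \<in> column k c" "Suc i \<notin> column k c" using S c(3) by auto
  then have gt: "c ! Suc i < c ! i" using len i by (auto simp: column_def)
  have "bruhat_le d' (sx i c)"
    using bruhat_le_exchange_up[of i c] len i gt c(2) bruhat_le_trans by simp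
  moreover have "bruhat_le (sx i d') (sx i c)"
    using bruhat_exchange_mono[OF c(2), of i] len i gt by simp
  moreover have "column k (sx i c) = transpose i (Suc i) ` S" using column_sx[of i c k] len i c(3) by simp
  ultimately show "d \<in> column_section (sclosure i I) k (transpose i (Suc i) ` S)"
    using c unfolding column_section_def sclosure_def by blast
qed

text \<open>Elements with this column have an ascent at \<open>i\<close>, so by lifting the set of
  words below them is closed under the exchange. This supplies the symmetric g of
  \<open>demazure_rel_shift_pair\<close>.\<close>

lemma column_section_stable:
  assumes S: "i \<notin> S" "Suc i \<in> S"
  shows "sclosure i (column_section I k S) = column_section I k S"
proof -
  have "sx i d \<in> column_section I k S" if d: "d \<in> column_section I k S" for d
  proof -
    obtain c where c: "c \<in> I" "bruhat_le d c" "column k c = S" using d by (auto simp: column_section_def)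
    have len: "length c = length lam" using lower_set_length[OF I c(1)] .
    have "i \<notin> column k c" "Suc i \<in> column k c" using S c(3) by auto
    then have "c ! i < c ! Suc i" using len i by (auto simp: column_def)
    then have "bruhat_le (sx i d) c" using bruhat_lift_left[OF c(2), of i] len i by simp
    then show ?thesis using c column_sectionI by blast
  qed
  then show ?thesis by (auto simp: sclosure_def)
qed

end

subsection \<open>Characters of sums of Demazure modules\<close>

text \<open>Both properties go through the induction on \<open>k\<close> together: they pass from
  the characters with \<open>k\<close> columns to the lower bound for \<open>k + 1\<close>, and each
  is used to show that this bound is attained.\<close>

definition modular_chars :: "'k::field_char_0 itself \<Rightarrow> nat list \<Rightarrow> nat \<Rightarrow> bool" where
  "modular_chars ty lam k \<longleftrightarrow>
    (\<forall>I J \<nu>. lower_set lam I \<and> lower_set lam J \<longrightarrow>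
       hdim ty (I \<union> J) k \<nu> + hdim ty (I \<inter> J) k \<nu> = hdim ty I k \<nu> + hdim ty J k \<nu>) \<and>
    (\<forall>I i. lower_set lam I \<and> Suc i < length lam \<longrightarrow>
       demazure_rel i (hdim ty I k) (hdim ty (sclosure i I) k))"

lemma hdim_columns_modular:
  assumes M: "modular_chars TYPE('k::field_char_0) lam k" and "lower_set lam I" "lower_set lam J"
  shows "hdim_columns TYPE('k) n (I \<union> J) k \<nu> + hdim_columns TYPE('k) n (I \<inter> J) k \<nu> =
    hdim_columns TYPE('k) n I k \<nu> + hdim_columns TYPE('k) n J k \<nu>"
  unfolding hdim_columns_def sum.distrib[symmetric] column_section_Un column_section_Int[OF assms(2,3)]
  using M assms lower_set_column_section unfolding modular_chars_def by (intro sum.cong) auto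

lemma hdim_columns_demazure:
  assumes M: "modular_chars TYPE('k::field_char_0) lam k" and I: "lower_set lam I" and i: "Suc i < length lam"
  shows "demazure_rel i (hdim_columns TYPE('k) (length lam) I k) (hdim_columns TYPE('k) (length lam) (sclosure i I) k)"
proof -
  let ?h = "\<lambda>J. hdim TYPE('k) J k"
  let ?c = "\<lambda>I S. column_section I (Suc k) S"
  have rel: "demazure_rel i (?h J) (?h (sclosure i J))" if "lower_set lam J" for J
    using M that i by (auto simp: modular_chars_def)
  have low: "lower_set lam (?c I S)" for S using lower_set_column_section[OF I] .
  show ?thesis
    unfolding hdim_columns_def sum_Pow_pairs[OF i]
  proof (rule demazure_rel_add; rule demazure_rel_sum)
    fix S assume "S \<in> {S \<in> Pow {..<length lam}. i \<in> S \<longleftrightarrow> Suc i \<in> S}"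
    then have S: "i \<in> S \<longleftrightarrow> Suc i \<in> S" by simp
    show "demazure_rel i (\<lambda>\<nu>. ?h (?c I S) (\<nu> - indicator_weight S))
        (\<lambda>\<nu>. ?h (?c (sclosure i I) S) (\<nu> - indicator_weight S))"
      unfolding column_section_fixed[OF I i S] by (rule demazure_rel_shift_fixed[OF S rel[OF low]])
  next
    fix S assume "S \<in> {S \<in> Pow {..<length lam}. i \<in> S \<and> Suc i \<notin> S}"
    then have S: "i \<in> S" "Suc i \<notin> S" by auto
    let ?S = "transpose i (Suc i) ` S"
    have S': "i \<notin> ?S" "Suc i \<in> ?S" using S by (simp_all add: in_transpose_image_iff)
    have "demazure_rel i (?h (?c I ?S)) (?h (?c I ?S))"
      using rel[OF low, of ?S] unfolding column_section_stable[OF I i S'] .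
    from demazure_rel_shift_pair[OF S rel[OF low] this]
    show "demazure_rel i (\<lambda>\<nu>. ?h (?c I S) (\<nu> - indicator_weight S) + ?h (?c I ?S) (\<nu> - indicator_weight ?S))
        (\<lambda>\<nu>. ?h (?c (sclosure i I) S) (\<nu> - indicator_weight S) + ?h (?c (sclosure i I) ?S) (\<nu> - indicator_weight ?S))"
      unfolding column_section_low[OF I i S] column_section_high[OF I i S] .
  qed
qed

lemma hdim_empty: "hdim TYPE('k::field) {} k \<nu> = 0"
proof -
  have "demI {} k \<inter> wts \<nu> = ({0} :: (nat list \<Rightarrow> 'k) set)"
    using W.subspace_0[OF subspace_wts] by (auto simp: demI_empty)
  then show ?thesis by (simp add: hdim_def W.dim_zero_subspace)
qed

lemma hdim_nonneg: "0 \<le> hdim ty I k \<nu>"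
  by (simp add: hdim_def)

lemma hdim_columns_nonneg: "0 \<le> hdim_columns ty n I k \<nu>"
  unfolding hdim_columns_def by (intro sum_nonneg hdim_nonneg)

lemma below_lam:
  assumes "sorted_wrt (\<ge>) lam"
  shows "below lam = {lam}"
proof -
  have "c = lam" if "bruhat_le c lam" for c
  proof -
    have "c \<in> rearrangements lam" using bruhat_le_mset[OF that] by (simp add: rearrangements_def)
    then show ?thesis using bruhat_minimum[OF assms] that bruhat_le_antisym by blast
  qed
  then show ?thesis by (auto simp: below_def)
qed

lemma lam_in_lower_set:
  "sorted_wrt (\<ge>) lam \<Longrightarrow> lower_set lam I \<Longrightarrow> I \<noteq> {} \<Longrightarrow> lam \<in> I"
  using bruhat_minimum unfolding lower_set_def by blast

lemma dim_line_wts: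
  assumes "x \<noteq> 0" "x \<in> wts \<mu>"
  shows "W.dim (W.span {x} \<inter> wts \<nu>) = (if \<nu> = \<mu> then 1 else 0)"
proof (cases "\<nu> = \<mu>")
  case True
  have "W.span {x} \<subseteq> wts \<mu>" using assms subspace_wts by (intro W.span_minimal) auto
  then have "W.span {x} \<inter> wts \<nu> = W.span {x}" using True by auto
  then show ?thesis using True assms W.dim_singleton_space by simp
next
  case False
  have "W.span {x} \<inter> wts \<nu> = {0}"
  proof -
    have "W.span {x} \<subseteq> wts \<mu>" using assms subspace_wts by (intro W.span_minimal) auto
    then have "y = 0" if "y \<in> W.span {x} \<inter> wts \<nu>" for y using that wts_disjoint False by blast
    then show ?thesis using W.subspace_0[OF subspace_wts] W.span_zero by blast
  qed
  then show ?thesis using False by (simp add: W.dim_zero_subspace)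
qed

text \<open>A simple raising operator kills the tensor because, by \<open>ext_exchange\<close>, the
  tensor is at the top of the string through its exchange; the other raising operators are brackets
  of simple ones.\<close>

lemma ext_lam_raise_0:
  assumes "sorted_wrt (\<ge>) lam" "i < j" "j < length lam"
  shows "act i j (ext lam k :: nat list \<Rightarrow> 'k::field_char_0) = 0"
  using assms(2,3)
proof (induction j)
  case (Suc j)
  have ge: "lam ! Suc j \<le> lam ! j" using assms(1) Suc.prems by (auto simp: sorted_wrt_iff_nth_less)
  have simple: "act j (Suc j) (ext lam k :: nat list \<Rightarrow> 'k) = 0"
  proof -
    let ?b = "sx j lam"
    let ?m = "min (?b ! Suc j) k - min (?b ! j) k"
    have b: "?b ! j \<le> ?b ! Suc j" "length ?b = length lam" using ge Suc.prems by (auto simp: nth_exchange)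
    have "exchange (Suc j) j ?b = lam" using Suc.prems by (simp add: exchange_commute[of "Suc j"])
    then have e: "(act j (Suc j) ^^ ?m) (ext ?b k) = fscale (fact ?m) (ext lam k :: nat list \<Rightarrow> 'k)"
      "(act j (Suc j) ^^ Suc ?m) (ext ?b k :: nat list \<Rightarrow> 'k) = 0"
      using ext_exchange[of "Suc j" ?b j k, where ?'k = 'k] b Suc.prems by (simp_all del: funpow.simps)
    have "fscale (fact ?m) (act j (Suc j) (ext lam k :: nat list \<Rightarrow> 'k)) = 0"
      using e(2) unfolding funpow.simps comp_apply e(1) act_fscale .
    then show ?thesis by (metis W.scale_eq_0_iff fact_nonzero)
  qed
  show ?case
  proof (cases "i = j")
    case False
    let ?x = "ext lam k :: nat list \<Rightarrow> 'k"
    have a: "act i j ?x = 0" by (rule Suc.IH) (use False Suc.prems in auto)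
    have "act i j (act j (Suc j) ?x) - act j (Suc j) (act i j ?x) = act i (Suc j) ?x"
      using act_bracket[of i j j "Suc j" ?x] Suc.prems by simp
    then show ?thesis unfolding simple a act_zero by (simp only: diff_0_right)
  qed (use simple in simp)
qed simp

lemma dem_lam:
  assumes "sorted_wrt (\<ge>) lam"
  shows "dem lam k = W.span {ext lam k :: nat list \<Rightarrow> 'k::field_char_0}"
proof (rule antisym)
  show "dem lam k \<subseteq> W.span {ext lam k :: nat list \<Rightarrow> 'k}"
  proof (rule dem_minimal[OF W.subspace_span])
    show "ext lam k \<in> W.span {ext lam k :: nat list \<Rightarrow> 'k}" by (simp add: W.span_base)
    fix i j and y :: "nat list \<Rightarrow> 'k"
    assume ij: "i \<le> j" "j < length lam" and y: "y \<in> W.span {ext lam k}"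
    then obtain c where y: "y = fscale c (ext lam k)" by (auto simp: W.span_singleton)
    show "act i j y \<in> W.span {ext lam k}"
    proof (cases "i = j")
      case True
      then show ?thesis using act_diag_wts[OF ext_wts[of lam k], of i, where ?'a = 'k]
        by (simp add: y act_fscale W.span_scale W.span_base)
    next
      case False
      then show ?thesis using ext_lam_raise_0[OF assms, of i j k, where ?'k = 'k] ij
        by (simp add: y act_fscale W.span_zero)
    qed
  qed
  show "W.span {ext lam k} \<subseteq> (dem lam k :: (nat list \<Rightarrow> 'k) set)"
    by (rule W.span_minimal[OF _ subspace_dem]) (simp add: ext_in_dem)
qed

lemma hdim_lam:
  assumes "sorted_wrt (\<ge>) lam"
  shows "hdim TYPE('k::field_char_0) {lam} k \<nu> = of_bool (\<nu> = trunc lam k)"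
proof -
  have "demI {lam} k = (W.span {ext lam k} :: (nat list \<Rightarrow> 'k) set)"
    by (simp add: demI_def dem_lam[OF assms])
  then show ?thesis
    using dim_line_wts[OF ext_nonzero ext_wts, of lam k \<nu>, where ?'a = 'k] by (simp add: hdim_def)
qed

text \<open>Without columns every nonempty sum is the same line of weight 0. Nonempty lower sets all
  contain \<lambda>, so their intersections are nonempty too.\<close>

lemma modular_chars_0:
  assumes "sorted_wrt (\<ge>) lam"
  shows "modular_chars TYPE('k::field_char_0) lam 0"
proof -
  have h: "hdim TYPE('k) I 0 \<nu> = of_bool (I \<noteq> {} \<and> \<nu> = 0)" for I \<nu>
  proof (cases "I = {}")
    case False
    then obtain b where b: "b \<in> I" by blast
    let ?x = "\<lambda>w :: nat list. of_bool (w = []) :: 'k"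
    have ext: "ext c 0 = ?x" for c by simp
    have act0: "act i j ?x w = 0" for i j w by (cases w) auto
    have "dem c 0 \<subseteq> W.span {?x}" for c
    proof (rule dem_minimal[OF W.subspace_span])
      show "ext c 0 \<in> W.span {?x}" unfolding ext by (rule W.span_base) simp
      fix i j y assume "y \<in> W.span {?x}"
      then obtain c where y: "y = fscale c ?x" by (auto simp: W.span_singleton)
      have "act i j ?x = 0" using act0 by (simp add: fun_eq_iff)
      then show "act i j y \<in> W.span {?x}" unfolding y act_fscale by (simp add: W.span_zero)
    qed
    then have "demI I 0 \<subseteq> W.span {?x}" unfolding demI_def by (intro W.span_minimal W.subspace_span) blast
    moreover have "W.span {?x} \<subseteq> demI I 0"
      using dem_subset_demI[OF b, of 0] ext_in_dem[of b 0, where ?'a = 'k] unfolding ext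
      by (intro W.span_minimal subspace_demI) auto
    ultimately have "demI I 0 = W.span {?x}" by blast
    moreover have "?x \<noteq> 0" using ext_nonzero[of lam 0, where ?'a = 'k] unfolding ext .
    moreover have "?x \<in> wts 0" by (auto simp: wts_def)
    ultimately show ?thesis using dim_line_wts[of ?x 0 \<nu>] False by (simp add: hdim_def)
  qed (simp add: hdim_empty)
  have "I \<inter> J \<noteq> {}" if "lower_set lam I" "lower_set lam J" "I \<noteq> {}" "J \<noteq> {}" for I J
    using lam_in_lower_set[OF assms] that by blast
  moreover have "demazure_rel i (\<lambda>\<nu>. of_bool (Q \<and> \<nu> = 0)) (\<lambda>\<nu>. of_bool (Q \<and> \<nu> = 0))" for i Q
  proof -
    have 1: "\<nu> \<circ> transpose i (Suc i) = 0 \<longleftrightarrow> \<nu> = 0" for \<nu> :: "nat \<Rightarrow> int"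
    proof
      assume "\<nu> \<circ> transpose i (Suc i) = 0"
      then have "\<nu> (transpose i (Suc i) (transpose i (Suc i) x)) = 0" for x
        by (metis comp_apply zero_fun_apply)
      then show "\<nu> = 0" by (simp add: fun_eq_iff)
    qed (simp add: fun_eq_iff)
    have "rshift i (Suc i) 1 \<nu> = 0 \<longleftrightarrow> rshift i (Suc i) (-1) (\<nu> \<circ> transpose i (Suc i)) = 0" for \<nu>
      using 1[of "rshift i (Suc i) 1 \<nu>"] rshift_comp_transpose[of i "Suc i" 1 \<nu>] by simp
    then show ?thesis using 1 by (simp add: demazure_rel_def)
  qed
  then have "demazure_rel i (hdim TYPE('k) I 0) (hdim TYPE('k) (sclosure i I) 0)" for i I
    unfolding h by (simp add: sclosure_def)
  ultimately show ?thesis unfolding modular_chars_def h by (auto simp: of_bool_def)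
qed

lemma demI_Un_wts:
  "demI (I \<union> J) k \<inter> wts \<nu> =
    (W.span (demI I k \<inter> wts \<nu> \<union> demI J k \<inter> wts \<nu>) :: (nat list \<Rightarrow> 'k::field) set)"
proof (rule antisym)
  show "demI (I \<union> J) k \<inter> wts \<nu> \<subseteq> (W.span (demI I k \<inter> wts \<nu> \<union> demI J k \<inter> wts \<nu>) :: (nat list \<Rightarrow> 'k) set)"
  proof
    fix x :: "nat list \<Rightarrow> 'k" assume x: "x \<in> demI (I \<union> J) k \<inter> wts \<nu>"
    then have "x \<in> W.span (demI I k \<union> demI J k)" by (simp add: demI_Un)
    moreover have "W.span (demI I k) = (demI I k :: (nat list \<Rightarrow> 'k) set)" for I
      unfolding demI_def by (rule W.span_span)
    ultimately obtain y z where yz: "x = y + z" "y \<in> demI I k" "z \<in> demI J k"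
      by (auto simp: W.span_Un)
    interpret l: Vector_Spaces.linear fscale fscale "wproj \<nu> :: (nat list \<Rightarrow> 'k) \<Rightarrow> _" by (rule wproj_linear)
    have "x = wproj \<nu> x" using x wproj_wts[of x \<nu> \<nu>] by simp
    also have "\<dots> = wproj \<nu> y + wproj \<nu> z" by (simp add: yz(1) l.add)
    also have "\<dots> \<in> W.span (demI I k \<inter> wts \<nu> \<union> demI J k \<inter> wts \<nu>)"
      using yz graded_demI[of I k] graded_demI[of J k] wproj_in_wts[of \<nu> y] wproj_in_wts[of \<nu> z]
      unfolding graded_def by (intro W.span_add W.span_base) auto
    finally show "x \<in> W.span (demI I k \<inter> wts \<nu> \<union> demI J k \<inter> wts \<nu>)" .
  qed
  show "W.span (demI I k \<inter> wts \<nu> \<union> demI J k \<inter> wts \<nu>) \<subseteq> (demI (I \<union> J) k \<inter> wts \<nu> :: (nat list \<Rightarrow> 'k) set)"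
    using demI_mono[of I "I \<union> J" k] demI_mono[of J "I \<union> J" k]
    by (intro W.span_minimal subspace_demI_wts) auto
qed

text \<open>The weight space of D_{I \<inter> J} lies in the intersection of those of D_I and D_J;
  that it fills the intersection is what modularity will add.\<close>

lemma hdim_submodular:
  assumes "I \<subseteq> rearrangements lam" "J \<subseteq> rearrangements lam"
  shows "hdim TYPE('k::field_char_0) (I \<union> J) k \<nu> + hdim TYPE('k) (I \<inter> J) k \<nu>
    \<le> hdim TYPE('k) I k \<nu> + hdim TYPE('k) J k \<nu>"
proof -
  let ?A = "demI I k \<inter> wts \<nu> :: (nat list \<Rightarrow> 'k) set" and ?B = "demI J k \<inter> wts \<nu> :: (nat list \<Rightarrow> 'k) set"
  have "W.dim (W.span (?A \<union> ?B)) + W.dim (?A \<inter> ?B) = W.dim ?A + W.dim ?B"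
    by (rule W.dim_Un_Int_fin_dim)
       (rule subspace_demI_wts fin_dim_demI_wts[OF assms(1)] fin_dim_demI_wts[OF assms(2)])+
  moreover have "W.dim (demI (I \<inter> J) k \<inter> wts \<nu> :: (nat list \<Rightarrow> 'k) set) \<le> W.dim (?A \<inter> ?B)"
  proof (rule W.dim_subset_fin_dim)
    show "W.fin_dim (?A \<inter> ?B)" by (rule W.fin_dim_subset[OF fin_dim_demI_wts[OF assms(1)]]) blast
    show "demI (I \<inter> J) k \<inter> wts \<nu> \<subseteq> ?A \<inter> ?B"
      using demI_mono[of "I \<inter> J" I k, where ?'a = 'k] demI_mono[of "I \<inter> J" J k, where ?'a = 'k] by auto
  qed
  ultimately show ?thesis unfolding hdim_def demI_Un_wts by linarith
qed

text \<open>D_b is squeezed between the lower bound and the sl_2-module generated from the Demazure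
  module of the exchange. The inequality for the latter has the same shape as the Demazure relation
  of the lower bound, and for the exchange both sides agree by induction.\<close>

lemma hdim_principal:
  assumes sorted: "sorted_wrt (\<ge>) lam" and M: "modular_chars TYPE('k::field_char_0) lam k"
    and b: "b \<in> rearrangements lam"
  shows "hdim TYPE('k) (below b) (Suc k) = hdim_columns TYPE('k) (length lam) (below b) k"
  using sorted b
proof (induction rule: bruhat_induct)
  case base
  let ?S = "column (Suc k) lam"
  show ?case
  proof
    fix \<nu>
    have cs: "column_section {lam} (Suc k) S = (if S = ?S then {lam} else {})" for S
      using below_lam[OF sorted] by (auto simp: column_section_def below_def)
    have "hdim_columns TYPE('k) (length lam) {lam} k \<nu> =
        (\<Sum>S\<in>Pow {..<length lam}. if S = ?S then of_bool (\<nu> - indicator_weight S = trunc lam k) else 0)"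
      unfolding hdim_columns_def cs by (intro sum.cong) (auto simp: hdim_lam[OF sorted] hdim_empty)
    also have "\<dots> = of_bool (\<nu> - indicator_weight ?S = trunc lam k)"
      using column_subset[of "Suc k" lam] by simp
    also have "\<nu> - indicator_weight ?S = trunc lam k \<longleftrightarrow> \<nu> = trunc lam (Suc k)"
      unfolding trunc_Suc by (auto simp: fun_eq_iff indicator_weight_def algebra_simps)
    finally show "hdim TYPE('k) (below lam) (Suc k) \<nu> = hdim_columns TYPE('k) (length lam) (below lam) k \<nu>"
      by (simp add: below_lam[OF sorted] hdim_lam[OF sorted])
  qed
next
  case (step b i)
  let ?I = "below (sx i b)"
  let ?c = "hdim_columns TYPE('k) (length lam)"
  have len: "length b = length lam" using length_rearrangements step.hyps(1) by blast
  have i: "Suc i < length lam" using step.hyps len by simp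
  have eq: "below b = sclosure i ?I" using below_sclosure step.hyps by blast
  have I: "lower_set lam ?I"
    using lower_set_below exchange_in_rearrangements[of b lam i "Suc i"] step.hyps by simp
  define H where "H = lowering_span i (Suc i) (demI ?I (Suc k) :: (nat list \<Rightarrow> 'k) set)"
  define u where "u \<nu> = int (W.dim (H \<inter> wts \<nu>))" for \<nu>
  have sl2: "sl2_module H (length lam) (wdeg lam (Suc k)) i (Suc i)"
    and sub: "demI (below b) (Suc k) \<subseteq> H"
    using demI_exchange_upper(1,2)[OF I i, of "Suc k", where ?'k = 'k] unfolding H_def eq sclosure_def by auto
  interpret s: sl2_module H "length lam" "wdeg lam (Suc k)" i "Suc i" by (rule sl2)
  have rel: "demazure_rel i (?c ?I k) (?c (below b) k)"
    unfolding eq by (rule hdim_columns_demazure[OF M I i])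
  \<comment> \<open>On this half of the weights the relation bounds the value at \<nu> by the value
    one step up the string. Each step lowers \<nu>_{i+1}, and weights with a negative entry do not
    occur.\<close>
  have pos: "u \<nu> \<le> ?c (below b) k \<nu>" if "\<nu> (Suc i) \<le> \<nu> i" for \<nu>
    using that
  proof (induction "nat (\<nu> (Suc i) + 1)" arbitrary: \<nu> rule: less_induct)
    case less
    show ?case
    proof (cases "\<nu> (Suc i) < 0")
      case True
      then have "H \<inter> wts \<nu> = {0}"
        using wts_negative[of \<nu> "Suc i", where ?'a = 'k] W.subspace_0[OF s.sub] by auto
      then show ?thesis using hdim_columns_nonneg by (simp add: u_def W.dim_zero_subspace)
    next
      case False
      let ?\<nu> = "rshift i (Suc i) 1 \<nu>"
      have "u ?\<nu> \<le> ?c (below b) k ?\<nu>"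
        by (rule less.hyps) (use False less.prems in \<open>auto simp: rshift_at\<close>)
      moreover have "u \<nu> + hdim TYPE('k) ?I (Suc k) (rshift i (Suc i) (-1) (\<nu> \<circ> transpose i (Suc i)))
          \<le> hdim TYPE('k) ?I (Suc k) \<nu> + u ?\<nu>"
        unfolding u_def H_def
        by (rule demI_exchange_upper(3)[OF I i, of \<nu> "nat (\<nu> i - \<nu> (Suc i))"]) (use less.prems in simp)
      ultimately show ?thesis
        using demazure_relD(2)[OF rel, of \<nu>] unfolding step.IH by linarith
    qed
  qed
  \<comment> \<open>The other weights are reflections of the previous ones, and both sides are
    symmetric.\<close>
  have ub: "u \<nu> \<le> ?c (below b) k \<nu>" for \<nu>
  proof (cases "\<nu> (Suc i) \<le> \<nu> i")
    case True
    then show ?thesis by (rule pos)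
  next
    case False
    have "u (\<nu> \<circ> transpose i (Suc i)) \<le> ?c (below b) k (\<nu> \<circ> transpose i (Suc i))"
      by (rule pos) (use False in simp)
    then show ?thesis using demazure_relD(1)[OF rel, of \<nu>] s.weight_eq[of \<nu>] by (simp add: u_def)
  qed
  show ?case
  proof
    fix \<nu>
    have "hdim TYPE('k) (below b) (Suc k) \<nu> \<le> u \<nu>"
      unfolding hdim_def u_def
      using W.dim_subset_fin_dim[OF s.fin_wts[of \<nu>], of "demI (below b) (Suc k) \<inter> wts \<nu>"] sub by auto
    moreover have "?c (below b) k \<nu> \<le> hdim TYPE('k) (below b) (Suc k) \<nu>"
      by (rule hdim_lower_bound[OF sorted lower_set_below[OF step.hyps(1)]])
    ultimately show "hdim TYPE('k) (below b) (Suc k) \<nu> = ?c (below b) k \<nu>" using ub[of \<nu>] by simp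
  qed
qed

lemma lower_set_maximal:
  assumes "lower_set lam I" "I \<noteq> {}"
  obtains b where "b \<in> I" "\<And>c. c \<in> I \<Longrightarrow> bruhat_le b c \<Longrightarrow> c = b"
proof -
  have fin: "finite I" using lower_set_finite assms by blast
  let ?f = "\<lambda>c. card (below c)"
  have "Max (?f ` I) \<in> ?f ` I" using fin assms(2) by simp
  then obtain b where b: "b \<in> I" "?f b = Max (?f ` I)" by auto
  have "c = b" if c: "c \<in> I" "bruhat_le b c" for c
  proof (rule ccontr)
    assume "c \<noteq> b"
    then have "\<not> bruhat_le c b" using bruhat_le_antisym c(2) by blast
    then have "below b \<subset> below c" using c(2) bruhat_le_trans bruhat_le_refl unfolding below_def by blast
    moreover have "finite (below c)"
      using lower_set_finite[OF lower_set_below[of c lam]] c(1) assms(1) by (auto simp: lower_set_def)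
    ultimately have "?f b < ?f c" by (rule psubset_card_mono[rotated])
    moreover have "?f c \<le> ?f b" unfolding b(2) using fin c(1) by simp
    ultimately show False by simp
  qed
  then show ?thesis using that b(1) by blast
qed

lemma lower_set_remove:
  assumes "lower_set lam I" "b \<in> I" "\<And>c. c \<in> I \<Longrightarrow> bruhat_le b c \<Longrightarrow> c = b"
  shows "lower_set lam (I - {b})"
  using assms unfolding lower_set_def by blast

text \<open>For a maximal element b the set is the union of the rest with the principal set of b.
  Submodularity of dimensions, compared with modularity of the bound, gives the inequality opposite
  to \<open>hdim_lower_bound\<close>.\<close>

lemma hdim_eq_hdim_columns:
  assumes sorted: "sorted_wrt (\<ge>) lam" and M: "modular_chars TYPE('k::field_char_0) lam k"
    and I: "lower_set lam I"
  shows "hdim TYPE('k) I (Suc k) \<nu> = hdim_columns TYPE('k) (length lam) I k \<nu>"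
  using I
proof (induction "card I" arbitrary: I rule: less_induct)
  case less
  have fin: "finite I" using lower_set_finite less.prems by blast
  show ?case
  proof (cases "I = {}")
    case True
    then show ?thesis by (simp add: hdim_empty hdim_columns_def column_section_empty)
  next
    case False
    then obtain b where b: "b \<in> I" "\<And>c. c \<in> I \<Longrightarrow> bruhat_le b c \<Longrightarrow> c = b"
      using lower_set_maximal less.prems by blast
    have bP: "b \<in> rearrangements lam" using b(1) less.prems by (auto simp: lower_set_def)
    have bI: "below b \<subseteq> I" using lower_setD[OF less.prems b(1)] by (auto simp: below_def)
    show ?thesis
    proof (cases "below b = I")
      case True
      then show ?thesis using hdim_principal[OF sorted M bP] by simp
    next
      case False
      let ?J = "I - {b}" and ?B = "below b"
      have J: "lower_set lam ?J" by (rule lower_set_remove[OF less.prems b])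
      have B: "lower_set lam ?B" by (rule lower_set_below[OF bP])
      have un: "?J \<union> ?B = I" using bI b(1) by (auto simp: below_def)
      have "card ?J < card I" by (rule card_Diff1_less[OF fin b(1)])
      then have 1: "hdim TYPE('k) ?J (Suc k) \<nu> = hdim_columns TYPE('k) (length lam) ?J k \<nu>"
        using less.hyps J by blast
      have "card ?B < card I" using fin bI False by (simp add: psubset_card_mono psubset_eq)
      then have 2: "hdim TYPE('k) ?B (Suc k) \<nu> = hdim_columns TYPE('k) (length lam) ?B k \<nu>"
        using less.hyps B by blast
      have "card (?J \<inter> ?B) \<le> card ?J" using fin by (intro card_mono) auto
      then have 3: "hdim TYPE('k) (?J \<inter> ?B) (Suc k) \<nu> = hdim_columns TYPE('k) (length lam) (?J \<inter> ?B) k \<nu>"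
        using less.hyps \<open>card ?J < card I\<close> lower_set_Int[OF J B] by simp
      have "hdim TYPE('k) I (Suc k) \<nu> + hdim TYPE('k) (?J \<inter> ?B) (Suc k) \<nu>
          \<le> hdim TYPE('k) ?J (Suc k) \<nu> + hdim TYPE('k) ?B (Suc k) \<nu>"
        using hdim_submodular[of ?J lam ?B "Suc k" \<nu>, where ?'k = 'k] J B unfolding un lower_set_def by blast
      moreover have "hdim_columns TYPE('k) (length lam) I k \<nu> + hdim_columns TYPE('k) (length lam) (?J \<inter> ?B) k \<nu> =
          hdim_columns TYPE('k) (length lam) ?J k \<nu> + hdim_columns TYPE('k) (length lam) ?B k \<nu>"
        using hdim_columns_modular[OF M J B, of "length lam" \<nu>] unfolding un .
      moreover have "hdim_columns TYPE('k) (length lam) I k \<nu> \<le> hdim TYPE('k) I (Suc k) \<nu>"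
        by (rule hdim_lower_bound[OF sorted less.prems])
      ultimately show ?thesis using 1 2 3 by linarith
    qed
  qed
qed

theorem modular_chars:
  assumes sorted: "sorted_wrt (\<ge>) lam"
  shows "modular_chars TYPE('k::field_char_0) lam k"
proof (induction k)
  case 0
  show ?case by (rule modular_chars_0[OF sorted])
next
  case (Suc k)
  note eq = hdim_eq_hdim_columns[OF sorted Suc]
  show ?case
    unfolding modular_chars_def
  proof (intro conjI allI impI; elim conjE)
    fix I J \<nu> assume IJ: "lower_set lam I" "lower_set lam J"
    show "hdim TYPE('k) (I \<union> J) (Suc k) \<nu> + hdim TYPE('k) (I \<inter> J) (Suc k) \<nu> =
        hdim TYPE('k) I (Suc k) \<nu> + hdim TYPE('k) J (Suc k) \<nu>"
      unfolding eq[OF IJ(1)] eq[OF IJ(2)] eq[OF lower_set_Un[OF IJ]] eq[OF lower_set_Int[OF IJ]]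
      by (rule hdim_columns_modular[OF Suc IJ])
  next
    fix I i assume I: "lower_set lam I" and i: "Suc i < length lam"
    have "hdim TYPE('k) I (Suc k) = hdim_columns TYPE('k) (length lam) I k"
      "hdim TYPE('k) (sclosure i I) (Suc k) = hdim_columns TYPE('k) (length lam) (sclosure i I) k"
      using eq[OF I] eq[OF lower_set_sclosure[OF I i]] by (simp_all add: fun_eq_iff)
    then show "demazure_rel i (hdim TYPE('k) I (Suc k)) (hdim TYPE('k) (sclosure i I) (Suc k))"
      using hdim_columns_demazure[OF Suc I i] by simp
  qed
qed

subsection \<open>Highest weight vectors\<close>

lemma (in vspace_pair) vspace_prod: "vspace (\<lambda>c (x, y). (s1 c x, s2 c y))"
  by unfold_locales
    (auto simp: vs1.scale_right_distrib vs1.scale_left_distrib vs2.scale_right_distrib vs2.scale_left_distrib)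

definition lower_pairs :: "nat \<Rightarrow> (nat \<times> nat) set" where
  "lower_pairs n = {(i, j). j < i \<and> i < n}"

definition all_pairs :: "nat \<Rightarrow> (nat \<times> nat) set" where
  "all_pairs n = {..<n} \<times> {..<n}"

lemma lower_pairs_subset: "lower_pairs n \<subseteq> {..<n} \<times> {..<n}"
  by (auto simp: lower_pairs_def)

context gl_rep
begin

definition has_weight :: "(nat \<Rightarrow> int) \<Rightarrow> 'b \<Rightarrow> bool" where
  "has_weight \<mu> x \<longleftrightarrow> (\<forall>i<n. E i i x = of_int (\<mu> i) *s x)"

definition singular :: "(nat \<Rightarrow> int) \<Rightarrow> 'b \<Rightarrow> bool" where
  "singular \<mu> x \<longleftrightarrow> has_weight \<mu> x \<and> (\<forall>i j. i < j \<and> j < n \<longrightarrow> E i j x = 0)"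

lemma has_weight_E:
  assumes "i < n" "j < n" "has_weight \<mu> x"
  shows "has_weight (\<mu> + unit i - unit j) (E i j x)"
  unfolding has_weight_def
proof (intro allI impI)
  fix k assume k: "k < n"
  have "E k k (E i j x) = E i j (E k k x) + (if k = i then E k j x else 0) - (if j = k then E i k x else 0)"
    by (rule E_swap[OF k k assms(1,2)])
  also have "E k k x = of_int (\<mu> k) *s x" using assms(3) k by (simp add: has_weight_def)
  also have "E i j (of_int (\<mu> k) *s x) = of_int (\<mu> k) *s E i j x" using assms by (simp add: E_scale)
  finally show "E k k (E i j x) = of_int ((\<mu> + unit i - unit j) k) *s E i j x"
    by (auto simp: unit_def algebra_simps)
qed

text \<open>The operator is moved to the right until it meets the singular vector. Brackets leave
  some other matrix unit in front of a shorter product, which is why the induction quantifies over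
  all i and j.\<close>

lemma foldr_lower_closed:
  assumes v: "singular \<mu> v" and ps: "set ps \<subseteq> lower_pairs n" and "i < n" "j < n"
  shows "E i j (foldr (\<lambda>(i, j). E i j) ps v) \<in> submod (lower_pairs n) v"
  using ps assms(3,4)
proof (induction ps arbitrary: i j)
  case Nil
  consider "i < j" | "i = j" | "j < i" by linarith
  then show ?case
  proof cases
    case 1
    then show ?thesis using v Nil subspace_0[OF subspace_submod] by (simp add: singular_def)
  next
    case 2
    then show ?thesis using v Nil subspace_scale[OF subspace_submod submod_base]
      by (simp add: singular_def has_weight_def)
  next
    case 3
    then show ?thesis
      using submod_E[OF lower_pairs_subset _ submod_base, of i j] Nil by (simp add: lower_pairs_def)
  qed
next
  case (Cons pq ps)
  obtain p q where pq: "pq = (p, q)" by (cases pq)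
  let ?L = "submod (lower_pairs n) v" and ?y = "foldr (\<lambda>(i, j). E i j) ps v"
  have l: "(p, q) \<in> lower_pairs n" "q < p" "p < n" "q < n" using Cons.prems pq by (auto simp: lower_pairs_def)
  have IH: "E i j ?y \<in> ?L" if "i < n" "j < n" for i j using Cons that by simp
  have "E i j (E p q ?y) = E p q (E i j ?y) + (if j = p then E i q ?y else 0) - (if q = i then E p j ?y else 0)"
    by (rule E_swap) (use Cons.prems l in auto)
  moreover have "E p q (E i j ?y) \<in> ?L"
    using submod_E[OF lower_pairs_subset l(1)] IH Cons.prems by blast
  moreover have "(if j = p then E i q ?y else 0) \<in> ?L" "(if q = i then E p j ?y else 0) \<in> ?L"
    using IH Cons.prems l subspace_0[OF subspace_submod] by auto
  ultimately show ?case
    unfolding pq by (simp only: foldr.simps comp_apply case_prod_conv) (intro subspace_add subspace_diff subspace_submod)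
qed

lemma submod_lower_closed:
  assumes v: "singular \<mu> v" and ij: "i < n" "j < n" and y: "y \<in> submod (lower_pairs n) v"
  shows "E i j y \<in> submod (lower_pairs n) v"
proof -
  interpret l: Vector_Spaces.linear scale scale "E i j" by (rule E_linear[OF ij])
  have "submod (lower_pairs n) v \<subseteq> {y. E i j y \<in> submod (lower_pairs n) v}"
    unfolding submod_def[of "lower_pairs n" v, THEN eq_reflection, symmetric]
    by (subst submod_def, rule span_minimal)
       (use foldr_lower_closed[OF v _ ij] l.subspace_linear_preimage[OF subspace_submod] in auto)
  then show ?thesis using y by blast
qed

lemma submod_mono: "R \<subseteq> R' \<Longrightarrow> submod R x \<subseteq> submod R' x"
  unfolding submod_def by (rule span_mono) blast

lemma submod_all_eq_lower:
  assumes "singular \<mu> v"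
  shows "submod (all_pairs n) v = submod (lower_pairs n) v"
proof (rule antisym)
  show "submod (all_pairs n) v \<subseteq> submod (lower_pairs n) v"
    by (rule submod_minimal[OF subspace_submod submod_base])
       (use submod_lower_closed[OF assms] in \<open>auto simp: all_pairs_def\<close>)
  show "submod (lower_pairs n) v \<subseteq> submod (all_pairs n) v"
    by (rule submod_mono) (auto simp: lower_pairs_def all_pairs_def)
qed

text \<open>Together with \<open>v\<close> it spans everything that lowering operators generate from
  \<open>v\<close>. The empty product is left out so that the weight of \<open>v\<close> does not
  occur.\<close>

definition proper_lower :: "'b \<Rightarrow> 'b set" where
  "proper_lower v = span {foldr (\<lambda>(i, j). E i j) ps v | ps. ps \<noteq> [] \<and> set ps \<subseteq> lower_pairs n}"

lemma submod_lower_decompose: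
  assumes "x \<in> submod (lower_pairs n) v"
  shows "\<exists>c. x - c *s v \<in> proper_lower v"
proof -
  let ?Y = "{foldr (\<lambda>(i, j). E i j) ps v | ps. ps \<noteq> [] \<and> set ps \<subseteq> lower_pairs n}"
  have "{foldr (\<lambda>(i, j). E i j) ps v | ps. set ps \<subseteq> lower_pairs n} \<subseteq> insert v ?Y"
  proof
    fix y assume "y \<in> {foldr (\<lambda>(i, j). E i j) ps v | ps. set ps \<subseteq> lower_pairs n}"
    then obtain ps where ps: "y = foldr (\<lambda>(i, j). E i j) ps v" "set ps \<subseteq> lower_pairs n" by blast
    then show "y \<in> insert v ?Y" by (cases "ps = []") auto
  qed
  then have "submod (lower_pairs n) v \<subseteq> span (insert v ?Y)"
    unfolding submod_def by (rule span_mono)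
  then show ?thesis using assms unfolding proper_lower_def by (auto simp: span_insert)
qed

text \<open>Every factor of a product of lowering operators raises the weighted sum \<open>\<Sum>i. i * \<mu> i\<close>.\<close>

definition height :: "(nat \<Rightarrow> int) \<Rightarrow> int" where
  "height \<mu> = (\<Sum>i<n. int i * \<mu> i)"

lemma foldr_lower_weight:
  assumes "has_weight \<mu> v" "set ps \<subseteq> lower_pairs n"
  shows "\<exists>\<nu>. has_weight \<nu> (foldr (\<lambda>(i, j). E i j) ps v) \<and> height \<mu> \<le> height \<nu> \<and> (ps \<noteq> [] \<longrightarrow> height \<mu> < height \<nu>)"
  using assms(2)
proof (induction ps)
  case Nil
  then show ?case using assms(1) by auto
next
  case (Cons pq ps)
  obtain p q where pq: "pq = (p, q)" by (cases pq)
  obtain \<nu> where \<nu>: "has_weight \<nu> (foldr (\<lambda>(i, j). E i j) ps v)" "height \<mu> \<le> height \<nu>"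
    using Cons by auto
  have l: "q < p" "p < n" "q < n" using Cons.prems pq by (auto simp: lower_pairs_def)
  have h: "(\<Sum>i<n. int i * unit r i) = int r" if "r < n" for r
    using that by (simp add: unit_def of_bool_def if_distrib cong: if_cong)
  have "height (\<nu> + unit p - unit q) = height \<nu> + (\<Sum>i<n. int i * unit p i) - (\<Sum>i<n. int i * unit q i)"
    unfolding height_def by (simp add: algebra_simps sum.distrib sum_subtractf)
  then have "height \<nu> < height (\<nu> + unit p - unit q)" using h l by simp
  moreover have "has_weight (\<nu> + unit p - unit q) (foldr (\<lambda>(i, j). E i j) (pq # ps) v)"
    using has_weight_E[OF _ _ \<nu>(1), of p q] l pq by simp
  ultimately show ?case
    using \<nu>(2) by (intro exI[of _ "\<nu> + unit p - unit q"] conjI impI) (assumption | linarith)+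
qed

text \<open>Applying A - \<tau>, with \<tau> the eigenvalue of the first summand, removes that
  summand, keeps the others eigenvectors and multiplies the sum by \<theta> - \<tau>, which is not
  0.\<close>

lemma eigenvectors_sum_0:
  assumes A: "Vector_Spaces.linear scale scale A"
    and "\<forall>y\<in>set ys. \<exists>\<tau>. \<tau> \<noteq> \<theta> \<and> A y = \<tau> *s y" "A (sum_list ys) = \<theta> *s sum_list ys"
  shows "sum_list ys = 0"
  using assms(2,3)
proof (induction "length ys" arbitrary: ys)
  case 0
  then show ?case by simp
next
  case (Suc m)
  then obtain y zs where ys: "ys = y # zs" by (cases ys) auto
  interpret l: Vector_Spaces.linear scale scale A by (rule A)
  obtain \<tau> where \<tau>: "\<tau> \<noteq> \<theta>" "A y = \<tau> *s y" using Suc.prems(1) ys by auto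
  let ?B = "\<lambda>x. A x - \<tau> *s x"
  have B0: "?B 0 = 0" and Badd: "?B (x + z) = ?B x + ?B z" for x z by (simp_all add: l.add algebra_simps)
  have Bsum: "sum_list (map ?B zs) = ?B (sum_list zs)" for zs
    by (induction zs) (simp_all add: B0 Badd del: l.add)
  have 1: "sum_list (map ?B zs) = ?B (sum_list ys)" using \<tau>(2) unfolding Bsum ys by (simp add: Badd)
  have 2: "?B (sum_list ys) = (\<theta> - \<tau>) *s sum_list ys" using Suc.prems(2) by (simp add: scale_left_diff_distrib)
  have "sum_list (map ?B zs) = 0"
  proof (rule Suc.hyps(1))
    show "m = length (map ?B zs)" using Suc.hyps(2) ys by simp
    show "\<forall>y\<in>set (map ?B zs). \<exists>\<tau>. \<tau> \<noteq> \<theta> \<and> A y = \<tau> *s y"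
    proof
      fix x assume "x \<in> set (map ?B zs)"
      then obtain z where z: "z \<in> set zs" "x = ?B z" by auto
      obtain \<sigma> where \<sigma>: "\<sigma> \<noteq> \<theta>" "A z = \<sigma> *s z" using Suc.prems(1) z ys by auto
      have "A x = \<sigma> *s x" unfolding z(2) by (simp add: l.diff l.scale \<sigma>(2) scale_right_diff_distrib mult.commute)
      then show "\<exists>\<tau>. \<tau> \<noteq> \<theta> \<and> A x = \<tau> *s x" using \<sigma> by blast
    qed
    show "A (sum_list (map ?B zs)) = \<theta> *s sum_list (map ?B zs)"
      unfolding 1 2 by (simp add: l.scale Suc.prems(2) mult.commute)
  qed
  then show ?case using 1 2 \<tau>(1) by simp
qed

lemma span_sum_list: "x \<in> span Y \<Longrightarrow> \<exists>ys. x = sum_list ys \<and> (\<forall>y\<in>set ys. \<exists>c. \<exists>z\<in>Y. y = c *s z)"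
proof (induction rule: span_induct_alt)
  case base
  show ?case by (intro exI[of _ "[]"]) simp
next
  case (step c x y)
  then obtain ys where "y = sum_list ys" "\<forall>y\<in>set ys. \<exists>c. \<exists>z\<in>Y. y = c *s z" by blast
  then show ?case using step(1) by (intro exI[of _ "c *s x # ys"]) auto
qed

text \<open>The operator \<Sum>i. i E_ii acts on a weight vector by its height, a single scalar that
  separates the weight of \<open>v\<close> from those of all proper products. The first premise is
  characteristic 0, as the locale admits any field.\<close>

lemma proper_lower_weight_0:
  assumes char: "\<And>m. of_int m = (0::'a) \<longleftrightarrow> m = 0"
    and v: "has_weight \<mu> v" and x: "has_weight \<mu> x" "x \<in> proper_lower v"
  shows "x = 0"
proof -
  let ?A = "\<lambda>x. \<Sum>i<n. of_nat i *s E i i x"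
  have A: "Vector_Spaces.linear scale scale ?A"
    unfolding Vector_Spaces.linear_iff using vector_space_axioms
    by (auto simp: E_add E_scale scale_right_distrib sum.distrib scale_sum_right mult.commute)
  have eig: "?A y = of_int (height \<nu>) *s y" if "has_weight \<nu> y" for \<nu> y
    using that by (simp add: has_weight_def height_def scale_sum_left of_int_sum)
  obtain ys where ys: "x = sum_list ys"
    "\<forall>y\<in>set ys. \<exists>c. \<exists>z\<in>{foldr (\<lambda>(i, j). E i j) ps v | ps. ps \<noteq> [] \<and> set ps \<subseteq> lower_pairs n}. y = c *s z"
    using span_sum_list[OF x(2)[unfolded proper_lower_def]] by blast
  have "\<exists>\<tau>. \<tau> \<noteq> of_int (height \<mu>) \<and> ?A y = \<tau> *s y" if yy: "y \<in> set ys" for y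
  proof -
    obtain c ps where y: "y = c *s foldr (\<lambda>(i, j). E i j) ps v" "ps \<noteq> []" "set ps \<subseteq> lower_pairs n"
      using ys(2) yy by blast
    obtain \<nu> where \<nu>: "has_weight \<nu> (foldr (\<lambda>(i, j). E i j) ps v)" "height \<mu> < height \<nu>"
      using foldr_lower_weight[OF v y(3)] y(2) by blast
    have "has_weight \<nu> y" using \<nu>(1) unfolding y(1) has_weight_def by (simp add: E_scale mult.commute)
    moreover have "of_int (height \<nu>) \<noteq> (of_int (height \<mu>) :: 'a)"
    proof
      assume "of_int (height \<nu>) = (of_int (height \<mu>) :: 'a)"
      then have "of_int (height \<nu> - height \<mu>) = (0 :: 'a)" by simp
      then have "height \<nu> - height \<mu> = 0" unfolding char .
      then show False using \<nu>(2) by simp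
    qed
    ultimately show ?thesis using eig by blast
  qed
  then show ?thesis
    using eigenvectors_sum_0[OF A, of ys "of_int (height \<mu>)"] eig[OF x(1)] ys(1) by blast
qed

end

subsection \<open>The invariant bilinear form\<close>

definition form :: "nat \<Rightarrow> nat \<Rightarrow> (nat list \<Rightarrow> 'k::field) \<Rightarrow> (nat list \<Rightarrow> 'k) \<Rightarrow> 'k" where
  "form n d \<phi> \<psi> = (\<Sum>w\<in>words n d. \<phi> w * \<psi> w)"

lemma words_0: "words n 0 = {[]}"
  by (auto simp: words_def)

lemma form_Suc: "form n (Suc d) \<phi> \<psi> = (\<Sum>x<n. form n d (\<lambda>w. \<phi> (x # w)) (\<lambda>w. \<psi> (x # w)))"
proof -
  have "words n (Suc d) = (\<lambda>(x, w). x # w) ` ({..<n} \<times> words n d)"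
  proof (intro subset_antisym subsetI)
    fix w assume "w \<in> words n (Suc d)"
    then show "w \<in> (\<lambda>(x, w). x # w) ` ({..<n} \<times> words n d)"
      by (cases w) (auto simp: words_def)
  qed (auto simp: words_def)
  moreover have "inj_on (\<lambda>(x, w). x # w) ({..<n} \<times> words n d)" by (auto simp: inj_on_def)
  ultimately have "form n (Suc d) \<phi> \<psi> = (\<Sum>(x, w)\<in>{..<n} \<times> words n d. \<phi> (x # w) * \<psi> (x # w))"
    unfolding form_def by (simp add: sum.reindex case_prod_unfold)
  also have "\<dots> = (\<Sum>x<n. \<Sum>w\<in>words n d. \<phi> (x # w) * \<psi> (x # w))"
    by (rule sum.cartesian_product[symmetric])
  finally show ?thesis by (simp add: form_def)
qed

lemma form_add_left: "form n d (\<phi> + \<phi>') \<psi> = form n d \<phi> \<psi> + form n d \<phi>' \<psi>"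
  and form_add_right: "form n d \<phi> (\<psi> + \<psi>') = form n d \<phi> \<psi> + form n d \<phi> \<psi>'"
  and form_scale_right: "form n d \<phi> (fscale c \<psi>) = c * form n d \<phi> \<psi>"
  and form_0_left: "form n d 0 \<psi> = 0"
  and form_0_right: "form n d \<phi> 0 = 0"
  and form_commute: "form n d \<phi> \<psi> = form n d \<psi> \<phi>"
  by (simp_all add: form_def fscale_apply algebra_simps sum.distrib sum_distrib_left)

lemma form_sum_left:
  assumes "finite B"
  shows "form n d (\<Sum>b\<in>B. fscale (u b) b) \<psi> = (\<Sum>b\<in>B. u b * form n d b \<psi>)"
proof -
  have "form n d (\<Sum>b\<in>B. fscale (u b) b) \<psi> = (\<Sum>w\<in>words n d. \<Sum>b\<in>B. u b * (b w * \<psi> w))"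
    unfolding form_def sum_fun_apply[OF assms] fscale_apply sum_distrib_right mult.assoc ..
  also have "\<dots> = (\<Sum>b\<in>B. \<Sum>w\<in>words n d. u b * (b w * \<psi> w))" by (rule sum.swap)
  finally show ?thesis unfolding form_def sum_distrib_left .
qed

lemma form_act:
  assumes "i < n" "j < n"
  shows "form n d (act i j \<phi>) \<psi> = form n d \<phi> (act j i \<psi>)"
proof (induction d arbitrary: \<phi> \<psi>)
  case 0
  then show ?case by (simp add: form_def words_0)
next
  case (Suc d)
  let ?t = "\<lambda>\<phi> x w. \<phi> (x # w)"
  have e: "(\<lambda>w. act i j \<phi> (x # w)) = (if x = i then ?t \<phi> j else 0) + act i j (?t \<phi> x)" for x i j
    and \<phi> :: "nat list \<Rightarrow> 'a" by (auto simp: fun_eq_iff)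
  have f: "form n d (if b then \<phi> else 0) \<psi> = (if b then form n d \<phi> \<psi> else 0)"
    "form n d \<psi> (if b then \<phi> else 0) = (if b then form n d \<psi> \<phi> else 0)" for b and \<phi> \<psi> :: "nat list \<Rightarrow> 'a"
    by (simp_all add: form_0_left form_0_right)
  have "form n (Suc d) (act i j \<phi>) \<psi> = form n d (?t \<phi> j) (?t \<psi> i) + (\<Sum>x<n. form n d (act i j (?t \<phi> x)) (?t \<psi> x))"
    unfolding form_Suc e form_add_left f sum.distrib using assms by simp
  moreover have "form n (Suc d) \<phi> (act j i \<psi>) = form n d (?t \<phi> j) (?t \<psi> i) + (\<Sum>x<n. form n d (?t \<phi> x) (act j i (?t \<psi> x)))"
    unfolding form_Suc e form_add_right f sum.distrib using assms by simp
  ultimately show ?case using Suc by simp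
qed

definition rational_tensor :: "(nat list \<Rightarrow> 'k::field_char_0) \<Rightarrow> bool" where
  "rational_tensor \<phi> \<longleftrightarrow> (\<forall>w. \<phi> w \<in> \<rat>)"

lemma rational_act: "rational_tensor \<phi> \<Longrightarrow> rational_tensor (act i j \<phi>)"
proof -
  have "act i j \<phi> w \<in> \<rat>" if "\<forall>w. \<phi> w \<in> \<rat>" for w and \<phi> :: "nat list \<Rightarrow> 'a"
    using that by (induction w arbitrary: \<phi>) (auto intro!: Rats_add)
  then show "rational_tensor \<phi> \<Longrightarrow> rational_tensor (act i j \<phi>)" by (simp add: rational_tensor_def)
qed

lemma rational_ext: "rational_tensor (ext b k)"
proof -
  have alt: "alt S u \<in> \<rat>" for S u
    by (induction u arbitrary: S) (auto intro!: Rats_mult)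
  have "ext b k w \<in> (\<rat> :: 'a set)" for w
    by (induction k arbitrary: w) (auto simp: tens_def intro!: Rats_mult alt)
  then show ?thesis by (simp add: rational_tensor_def)
qed

lemma rational_form: "rational_tensor \<phi> \<Longrightarrow> rational_tensor \<psi> \<Longrightarrow> form n d \<phi> \<psi> \<in> \<rat>"
  unfolding form_def rational_tensor_def by (intro Rats_sum Rats_mult) auto

lemma form_definite:
  fixes \<phi> :: "nat list \<Rightarrow> 'k::field_char_0"
  assumes "rational_tensor \<phi>" "\<phi> \<in> supp_words n d" "form n d \<phi> \<phi> = 0"
  shows "\<phi> = 0"
proof -
  have "\<forall>w. \<exists>r. \<phi> w = of_rat r" using assms(1) by (auto simp: rational_tensor_def Rats_def)
  then obtain r where r: "\<And>w. \<phi> w = of_rat (r w)" by metis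
  have "form n d \<phi> \<phi> = of_rat (\<Sum>w\<in>words n d. r w * r w)"
    by (simp add: form_def r of_rat_sum of_rat_mult)
  then have "(\<Sum>w\<in>words n d. r w * r w) = 0" using assms(3) by simp
  then have "\<forall>w\<in>words n d. r w * r w = 0"
    by (subst (asm) sum_nonneg_eq_0_iff) (auto simp: finite_words)
  then have "\<phi> w = 0" for w
  proof (cases "w \<in> words n d")
    case True
    then show ?thesis using \<open>\<forall>w\<in>words n d. r w * r w = 0\<close> r[of w] by simp
  next
    case False
    then show ?thesis using assms(2) unfolding supp_words_def by blast
  qed
  then show ?thesis by (simp add: fun_eq_iff)
qed

text \<open>Gram-Schmidt. The divisors are values of the form on nonzero rational tensors, hence
  nonzero, and all coefficients stay rational.\<close>

lemma orthogonal_basis: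
  fixes X :: "(nat list \<Rightarrow> 'k::field_char_0) set"
  assumes "finite X" "\<And>x. x \<in> X \<Longrightarrow> rational_tensor x" "X \<subseteq> supp_words n d"
  shows "\<exists>B. finite B \<and> (\<forall>b\<in>B. rational_tensor b \<and> form n d b b \<noteq> 0) \<and>
    (\<forall>b\<in>B. \<forall>c\<in>B. b \<noteq> c \<longrightarrow> form n d b c = 0) \<and> B \<subseteq> supp_words n d \<and> W.span B = W.span X"
  using assms
proof (induction X rule: finite_induct)
  case empty
  then show ?case by (intro exI[of _ "{}"]) auto
next
  case (insert x X)
  have "\<exists>B. finite B \<and> (\<forall>b\<in>B. rational_tensor b \<and> form n d b b \<noteq> 0) \<and>
    (\<forall>b\<in>B. \<forall>c\<in>B. b \<noteq> c \<longrightarrow> form n d b c = 0) \<and> B \<subseteq> supp_words n d \<and> W.span B = W.span X"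
    by (rule insert.IH) (use insert.prems in auto)
  then obtain B where B': "finite B \<and> (\<forall>b\<in>B. rational_tensor b \<and> form n d b b \<noteq> 0) \<and>
    (\<forall>b\<in>B. \<forall>c\<in>B. b \<noteq> c \<longrightarrow> form n d b c = 0) \<and> B \<subseteq> supp_words n d \<and> W.span B = W.span X" ..
  then have B: "finite B" "\<And>b. b \<in> B \<Longrightarrow> rational_tensor b" "\<And>b. b \<in> B \<Longrightarrow> form n d b b \<noteq> 0"
    "\<And>b c. b \<in> B \<Longrightarrow> c \<in> B \<Longrightarrow> b \<noteq> c \<Longrightarrow> form n d b c = 0" "B \<subseteq> supp_words n d" "W.span B = W.span X"
    by simp_all
  define p where "p = (\<Sum>b\<in>B. fscale (form n d x b / form n d b b) b)"
  define y where "y = x - p"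
  have pB: "p \<in> W.span B" unfolding p_def by (intro W.span_sum W.span_scale W.span_base)
  have ratp: "rational_tensor p"
    unfolding rational_tensor_def p_def sum_fun_apply[OF B(1)] fscale_apply
  proof (intro allI Rats_sum Rats_mult Rats_divide)
    fix w b assume "b \<in> B"
    then have b: "rational_tensor b" "rational_tensor x" using B(2) insert.prems(1) by auto
    then show "form n d x b \<in> \<rat>" "form n d b b \<in> \<rat>" "b w \<in> \<rat>"
      using rational_form[OF b(2,1), of n d] rational_form[OF b(1,1), of n d] by (simp_all add: rational_tensor_def)
  qed
  have raty: "rational_tensor y" using ratp insert.prems(1) by (auto simp: y_def rational_tensor_def intro: Rats_diff)
  have suppB: "W.span B \<subseteq> supp_words n d" using B(5) subspace_supp_words by (intro W.span_minimal)
  have suppy: "y \<in> supp_words n d"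
    unfolding y_def using insert.prems(2) pB suppB by (intro W.subspace_diff[OF subspace_supp_words]) auto
  have orth: "form n d y b = 0" if b: "b \<in> B" for b
  proof -
    have "form n d p b = (\<Sum>c\<in>B. (form n d x c / form n d c c) * form n d c b)"
      unfolding p_def by (rule form_sum_left[OF B(1)])
    also have "\<dots> = (\<Sum>c\<in>B. if c = b then form n d x b else 0)"
      using B(3,4) b by (intro sum.cong) auto
    also have "\<dots> = form n d x b" using b B(1) by simp
    finally have "form n d p b = form n d x b" .
    moreover have "form n d x b = form n d y b + form n d p b" by (simp add: y_def flip: form_add_left)
    ultimately show ?thesis by simp
  qed
  have span: "W.span (insert y B) = W.span (insert x X)"
  proof -
    have "W.span (insert y B) = W.span (insert x B)"
      by (rule W.eq_span_insert_eq) (use pB in \<open>simp add: y_def W.span_neg\<close>)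
    also have "\<dots> = W.span (insert x X)" using B(6) unfolding W.span_insert by simp
    finally show ?thesis .
  qed
  show ?case
  proof (cases "y = 0")
    case True
    then have "W.span B = W.span (insert x X)" using span by simp
    then show ?thesis using B by (intro exI[of _ B]) auto
  next
    case False
    then have "form n d y y \<noteq> 0" using form_definite raty suppy by blast
    moreover have "form n d b y = 0" if "b \<in> B" for b using orth[OF that] form_commute by metis
    ultimately show ?thesis
      using B raty suppy orth span by (intro exI[of _ "insert y B"]) auto
  qed
qed

text \<open>The coordinates of \<phi> itself may be irrational, so positivity does not apply to it.
  It is expanded in an orthogonal rational basis of the tensors that span it, where the form reads
  off each coefficient.\<close>

lemma rational_span_nondegenerate:
  fixes X :: "(nat list \<Rightarrow> 'k::field_char_0) set"
  assumes X: "\<And>x. x \<in> X \<Longrightarrow> rational_tensor x" "X \<subseteq> supp_words n d"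
    and \<phi>: "\<phi> \<in> W.span X" "\<And>x. x \<in> X \<Longrightarrow> form n d \<phi> x = 0"
  shows "\<phi> = 0"
proof -
  obtain t r where t: "finite t" "t \<subseteq> X" "\<phi> = (\<Sum>a\<in>t. fscale (r a) a)"
    using \<phi>(1) unfolding W.span_explicit by blast
  have "\<phi> \<in> W.span t" unfolding t(3) by (intro W.span_sum W.span_scale W.span_base)
  have "\<exists>B. finite B \<and> (\<forall>b\<in>B. rational_tensor b \<and> form n d b b \<noteq> 0) \<and>
    (\<forall>b\<in>B. \<forall>c\<in>B. b \<noteq> c \<longrightarrow> form n d b c = 0) \<and> B \<subseteq> supp_words n d \<and> W.span B = W.span t"
    by (rule orthogonal_basis[OF t(1)]) (use t(2) X in auto)
  then obtain B where B': "finite B \<and> (\<forall>b\<in>B. rational_tensor b \<and> form n d b b \<noteq> 0) \<and>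
    (\<forall>b\<in>B. \<forall>c\<in>B. b \<noteq> c \<longrightarrow> form n d b c = 0) \<and> B \<subseteq> supp_words n d \<and> W.span B = W.span t" ..
  then have B: "finite B" "\<And>b. b \<in> B \<Longrightarrow> form n d b b \<noteq> 0"
    "\<And>b c. b \<in> B \<Longrightarrow> c \<in> B \<Longrightarrow> b \<noteq> c \<Longrightarrow> form n d b c = 0" "W.span B = W.span t"
    by simp_all
  have "W.subspace {\<psi>. form n d \<phi> \<psi> = 0}"
    by (rule W.subspaceI) (auto simp: form_0_right form_add_right form_scale_right)
  then have "W.span t \<subseteq> {\<psi>. form n d \<phi> \<psi> = 0}"
    by (rule W.span_minimal[rotated]) (use \<phi>(2) t(2) in auto)
  then have orth: "form n d \<phi> b = 0" if "b \<in> B" for b using that B(4) W.span_base by blast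
  have "\<phi> \<in> W.span B" using \<open>\<phi> \<in> W.span t\<close> B(4) by simp
  then obtain u where u: "\<phi> = (\<Sum>b\<in>B. fscale (u b) b)" unfolding W.span_finite[OF B(1)] by blast
  have "u b = 0" if b: "b \<in> B" for b
  proof -
    have "form n d (\<Sum>c\<in>B. fscale (u c) c) b = (\<Sum>c\<in>B. u c * form n d c b)"
      by (rule form_sum_left[OF B(1)])
    also have "\<dots> = (\<Sum>c\<in>B. if c = b then u b * form n d b b else 0)"
      using B(3) b by (intro sum.cong) auto
    also have "\<dots> = u b * form n d b b" using b B(1) by simp
    finally show ?thesis using orth[OF b] B(2)[OF b] u by simp
  qed
  then show ?thesis unfolding u by (intro sum.neutral) (simp add: fun_eq_iff fscale_apply)
qed

subsection \<open>Realization of an irreducible module inside a tensor power\<close>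

locale irreducible_gl_rep = gl_rep scale E n
  for scale :: "'k::field_char_0 \<Rightarrow> 'v::ab_group_add \<Rightarrow> 'v" (infixr \<open>*s\<close> 75)
    and E :: "nat \<Rightarrow> nat \<Rightarrow> 'v \<Rightarrow> 'v" and n :: nat +
  fixes lam :: "nat list" and v0 :: 'v
  assumes irreducible: "subspace S \<Longrightarrow> (\<And>i j x. i < n \<Longrightarrow> j < n \<Longrightarrow> x \<in> S \<Longrightarrow> E i j x \<in> S) \<Longrightarrow> S = {0} \<or> S = UNIV"
    and v0: "v0 \<noteq> 0" "singular (\<lambda>i. int (lam ! i)) v0"
    and lam: "length lam = n" "sorted_wrt (\<ge>) lam"
begin

text \<open>A bound for all entries of \<lambda>, so that truncation at \<open>K\<close> leaves
  every rearrangement unchanged.\<close>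

definition K :: nat where "K = sum_list lam"

definition w0 :: "nat list \<Rightarrow> 'k" where "w0 = ext lam K"

definition tensor_module :: "(nat list \<Rightarrow> 'k) set" where
  "tensor_module = W.submod (all_pairs n) w0"

lemma trunc_K: "b \<in> rearrangements lam \<Longrightarrow> trunc b K = (\<lambda>i. if i < n then int (b ! i) else 0)"
proof -
  assume b: "b \<in> rearrangements lam"
  have len: "length b = n" using length_rearrangements[OF b] lam by simp
  have "sum_list b = K" using b unfolding K_def rearrangements_def by (metis mem_Collect_eq sum_mset_sum_list)
  then have "b ! i \<le> K" if "i < n" for i using that len member_le_sum_list[of "b ! i" b] by simp
  then show ?thesis by (auto simp: trunc_def len fun_eq_iff)
qed

lemma lam_rearrangement: "lam \<in> rearrangements lam"
  by (simp add: rearrangements_def)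

lemma w0_wts: "w0 \<in> wts (trunc lam K)"
  by (simp add: w0_def ext_wts)

sublocale Z: gl_rep "\<lambda>c (x, \<phi>). (c *s x, fscale c \<phi>)" "\<lambda>i j (x, \<phi>). (E i j x, act i j \<phi>)" n
proof (rule gl_rep.intro)
  have vs: "vspace_pair scale fscale" by (intro vspace_pair.intro vspace_axioms vspace_fscale)
  show Z: "vspace (\<lambda>c (x, \<phi>). (c *s x, fscale c \<phi>))" by (rule vspace_pair.vspace_prod[OF vs])
  show "gl_rep_axioms (\<lambda>c (x, \<phi>). (c *s x, fscale c \<phi>)) (\<lambda>i j (x, \<phi>). (E i j x, act i j \<phi>)) n"
  proof -
    have L: "Vector_Spaces.linear (\<lambda>c (x, \<phi>). (c *s x, fscale c \<phi>)) (\<lambda>c (x, \<phi>). (c *s x, fscale c \<phi>))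
        (\<lambda>(x, \<phi>). (E i j x, act i j \<phi>))" if "i < n" "j < n" for i j
      unfolding Vector_Spaces.linear_iff using Z[unfolded vspace_def] that
      by (auto simp: E_add E_scale act_add act_fscale)
    have B: "(case case x of (x, \<phi>) \<Rightarrow> (E k l x, act k l \<phi>) of (x, \<phi>) \<Rightarrow> (E i j x, act i j \<phi>)) -
        (case case x of (x, \<phi>) \<Rightarrow> (E i j x, act i j \<phi>) of (x, \<phi>) \<Rightarrow> (E k l x, act k l \<phi>)) =
        (if j = k then case x of (x, \<phi>) \<Rightarrow> (E i l x, act i l \<phi>) else 0) -
        (if l = i then case x of (x, \<phi>) \<Rightarrow> (E k j x, act k j \<phi>) else 0)"
      if "i < n" "j < n" "k < n" "l < n" for i j k l and x :: "'v \<times> (nat list \<Rightarrow> 'k)"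
      using E_bracket[OF that, of "fst x"] act_bracket[of i j k l "snd x"]
      by (auto simp: case_prod_unfold prod_eq_iff)
    show ?thesis by (intro gl_rep_axioms.intro L B)
  qed
qed

text \<open>Lowering operators are enough, because the pair is singular; in this form every element
  splits into a multiple of the pair and a proper part.\<close>

definition graph :: "('v \<times> (nat list \<Rightarrow> 'k)) set" where
  "graph = Z.submod (lower_pairs n) (v0, w0)"

lemma singular_pair: "Z.singular (\<lambda>i. int (lam ! i)) (v0, w0)"
  unfolding Z.singular_def Z.has_weight_def
proof (intro conjI allI impI)
  fix i assume i: "i < n"
  have "act i i w0 = fscale (of_int (trunc lam K i)) w0" by (rule act_diag_wts[OF w0_wts])
  then show "(case (v0, w0) of (x, \<phi>) \<Rightarrow> (E i i x, act i i \<phi>)) =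
      (case (v0, w0) of (x, \<phi>) \<Rightarrow> (of_int (int (lam ! i)) *s x, fscale (of_int (int (lam ! i))) \<phi>))"
    using v0 i trunc_K[OF lam_rearrangement] by (simp add: singular_def has_weight_def)
next
  fix i j assume ij: "i < j \<and> j < n"
  then show "(case (v0, w0) of (x, \<phi>) \<Rightarrow> (E i j x, act i j \<phi>)) = 0"
    using v0 ext_lam_raise_0[OF lam(2), of i j K, where ?'k = 'k] lam(1)
    by (simp add: singular_def w0_def zero_prod_def)
qed

lemma subspace_graph: "Z.subspace graph"
  by (simp add: graph_def Z.subspace_submod)

lemma graph_E: "i < n \<Longrightarrow> j < n \<Longrightarrow> (x, \<phi>) \<in> graph \<Longrightarrow> (E i j x, act i j \<phi>) \<in> graph"
  using Z.submod_lower_closed[OF singular_pair, of i j "(x, \<phi>)"] by (simp add: graph_def)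

lemma graph_base: "(v0, w0) \<in> graph"
  by (simp add: graph_def Z.submod_base)

lemma graph_add: "(x, \<phi>) \<in> graph \<Longrightarrow> (y, \<psi>) \<in> graph \<Longrightarrow> (x + y, \<phi> + \<psi>) \<in> graph"
  using Z.subspace_add[OF subspace_graph, of "(x, \<phi>)" "(y, \<psi>)"] by simp

lemma graph_scale: "(x, \<phi>) \<in> graph \<Longrightarrow> (c *s x, fscale c \<phi>) \<in> graph"
  using Z.subspace_scale[OF subspace_graph, of "(x, \<phi>)" c] by simp

lemma graph_0: "(0, 0) \<in> graph"
  using Z.subspace_0[OF subspace_graph] by (simp add: zero_prod_def)

lemma graph_total: "\<exists>\<phi>. (x, \<phi>) \<in> graph"
proof -
  let ?S = "{x. \<exists>\<phi>. (x, \<phi>) \<in> graph}"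
  have "subspace ?S"
    by (rule subspaceI) (auto intro: graph_add graph_scale graph_0)
  then have "?S = {0} \<or> ?S = UNIV" by (rule irreducible) (auto intro: graph_E)
  moreover have "v0 \<in> ?S" using graph_base by blast
  ultimately have "?S = UNIV" using v0(1) by blast
  then show ?thesis by blast
qed

lemma foldr_pair:
  "foldr (\<lambda>(i, j) (x, \<phi>). (E i j x, act i j \<phi>)) ps (x, \<phi>) =
    (foldr (\<lambda>(i, j). E i j) ps x, foldr (\<lambda>(i, j). act i j) ps \<phi>)"
  by (induction ps) auto

lemma proper_lower_pair:
  assumes "(x, \<phi>) \<in> Z.proper_lower (v0, w0)"
  shows "x \<in> proper_lower v0 \<and> \<phi> \<in> W.proper_lower n w0"
proof -
  have "Z.proper_lower (v0, w0) \<subseteq> proper_lower v0 \<times> W.proper_lower n w0"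
    unfolding Z.proper_lower_def
  proof (rule Z.span_minimal)
    show "{foldr (\<lambda>(i, j) (x, \<phi>). (E i j x, act i j \<phi>)) ps (v0, w0) |ps. ps \<noteq> [] \<and> set ps \<subseteq> lower_pairs n}
        \<subseteq> proper_lower v0 \<times> W.proper_lower n w0"
      unfolding proper_lower_def W.proper_lower_def foldr_pair
      by (auto intro!: span_base W.span_base)
    have 1: "subspace (proper_lower v0)" by (simp add: proper_lower_def)
    have 2: "W.subspace (W.proper_lower n w0)" by (simp add: W.proper_lower_def)
    show "Z.subspace (proper_lower v0 \<times> W.proper_lower n w0)"
      by (rule Z.subspaceI)
         (auto simp: zero_prod_def subspace_0[OF 1] W.subspace_0[OF 2] subspace_add[OF 1] W.subspace_add[OF 2]
           subspace_scale[OF 1] W.subspace_scale[OF 2])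
  qed
  then show ?thesis using assms by blast
qed

lemma w0_proper_lower:
  assumes "\<phi> \<in> W.proper_lower n w0"
  shows "wproj (trunc lam K) \<phi> = 0"
proof -
  interpret l: Vector_Spaces.linear fscale fscale "wproj (trunc lam K) :: (nat list \<Rightarrow> 'k) \<Rightarrow> _" by (rule wproj_linear)
  have wt: "\<exists>\<nu>. foldr (\<lambda>(i, j). act i j) ps w0 \<in> wts \<nu> \<and> W.height n (trunc lam K) \<le> W.height n \<nu> \<and>
      (ps \<noteq> [] \<longrightarrow> W.height n (trunc lam K) < W.height n \<nu>)" if "set ps \<subseteq> lower_pairs n" for ps
    using that
  proof (induction ps)
    case Nil
    then show ?case using w0_wts by auto
  next
    case (Cons pq ps)
    obtain p q where pq: "pq = (p, q)" by (cases pq)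
    obtain \<nu> where \<nu>: "foldr (\<lambda>(i, j). act i j) ps w0 \<in> wts \<nu>" "W.height n (trunc lam K) \<le> W.height n \<nu>"
      using Cons by auto
    have l: "q < p" "p < n" "q < n" using Cons.prems pq by (auto simp: lower_pairs_def)
    have h: "(\<Sum>i<n. int i * unit r i) = int r" if "r < n" for r
      using that by (simp add: unit_def of_bool_def if_distrib cong: if_cong)
    have "W.height n (\<nu> + unit p - unit q) = W.height n \<nu> + (\<Sum>i<n. int i * unit p i) - (\<Sum>i<n. int i * unit q i)"
      unfolding W.height_def by (simp add: algebra_simps sum.distrib sum_subtractf)
    then have "W.height n \<nu> < W.height n (\<nu> + unit p - unit q)" using h l by simp
    moreover have "foldr (\<lambda>(i, j). act i j) (pq # ps) w0 \<in> wts (\<nu> + unit p - unit q)"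
      using act_wts[OF \<nu>(1), of p q] pq by simp
    ultimately show ?case
      using \<nu>(2) by (intro exI[of _ "\<nu> + unit p - unit q"] conjI impI) (assumption | linarith)+
  qed
  have "W.proper_lower n w0 \<subseteq> {\<phi>. wproj (trunc lam K) \<phi> = 0}"
    unfolding W.proper_lower_def
  proof (rule W.span_minimal[OF _ l.subspace_kernel], clarify)
    fix ps assume "ps \<noteq> []" "set ps \<subseteq> lower_pairs n"
    then obtain \<nu> where "foldr (\<lambda>(i, j). act i j) ps w0 \<in> wts \<nu>" "\<nu> \<noteq> trunc lam K" using wt[of ps] by auto
    then show "wproj (trunc lam K) (foldr (\<lambda>(i, j). act i j) ps w0) = 0" by (simp add: wproj_wts)
  qed
  then show ?thesis using assms by blast
qed

lemma tensor_module_supp: "tensor_module \<subseteq> supp_words n (wdeg lam K)"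
  unfolding tensor_module_def
proof (rule W.submod_minimal[OF subspace_supp_words])
  show "w0 \<in> supp_words n (wdeg lam K)"
    using ext_supp_words[of lam K, where ?'a = 'k] lam by (simp add: w0_def wdeg_def)
qed (auto simp: all_pairs_def intro: act_supp_words)

lemma graph_snd: "(x, \<phi>) \<in> graph \<Longrightarrow> \<phi> \<in> tensor_module"
proof -
  have "graph \<subseteq> UNIV \<times> tensor_module"
    unfolding graph_def
  proof (rule Z.submod_minimal)
    have 2: "W.subspace tensor_module" by (simp add: tensor_module_def W.subspace_submod)
    show "Z.subspace (UNIV \<times> tensor_module)"
      by (rule Z.subspaceI) (auto simp: zero_prod_def W.subspace_0[OF 2] W.subspace_add[OF 2] W.subspace_scale[OF 2])
    show "(v0, w0) \<in> UNIV \<times> tensor_module" by (simp add: tensor_module_def W.submod_base)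
    fix i j and y :: "'v \<times> (nat list \<Rightarrow> 'k)"
    assume "(i, j) \<in> lower_pairs n" "y \<in> UNIV \<times> tensor_module"
    then show "(case y of (x, \<phi>) \<Rightarrow> (E i j x, act i j \<phi>)) \<in> UNIV \<times> tensor_module"
      unfolding tensor_module_def
      using W.submod_E[of "all_pairs n" n i j "snd y" w0] by (auto simp: all_pairs_def lower_pairs_def)
  qed
  then show "(x, \<phi>) \<in> graph \<Longrightarrow> \<phi> \<in> tensor_module" by blast
qed

text \<open>Split (0, \<phi>) into a multiple of (v0, w0) and a proper part. The first component
  shows that the multiple is 0, so \<phi> has no component of the highest weight and is orthogonal
  to w0. The \<phi> with (0, \<phi>) in the graph are stable under gl_n; by adjointness they are
  orthogonal to the module generated by w0, in which they lie.\<close>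

lemma graph_single_valued:
  assumes "(0, \<phi>) \<in> graph"
  shows "\<phi> = 0"
proof -
  let ?d = "wdeg lam K"
  let ?X = "{foldr (\<lambda>(i, j). act i j) ps w0 | ps. set ps \<subseteq> all_pairs n}"
  have low: "form n ?d \<phi> w0 = 0" if \<phi>: "(0, \<phi>) \<in> graph" for \<phi>
  proof -
    obtain c where "(0, \<phi>) - (case (v0, w0) of (x, \<psi>) \<Rightarrow> (c *s x, fscale c \<psi>)) \<in> Z.proper_lower (v0, w0)"
      using Z.submod_lower_decompose[of "(0, \<phi>)" "(v0, w0)"] \<phi> unfolding graph_def by blast
    then have "(- (c *s v0), \<phi> - fscale c w0) \<in> Z.proper_lower (v0, w0)" by simp
    then have p: "- (c *s v0) \<in> proper_lower v0" "\<phi> - fscale c w0 \<in> W.proper_lower n w0"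
      using proper_lower_pair by blast+
    have hw: "has_weight (\<lambda>i. int (lam ! i)) v0" using v0(2) by (simp add: singular_def)
    have "- (c *s v0) = (- c) *s v0" by simp
    moreover have "has_weight (\<lambda>i. int (lam ! i)) ((- c) *s v0)"
      using hw by (auto simp: has_weight_def E_scale mult.commute simp del: scale_minus_left)
    ultimately have "- (c *s v0) = 0" using proper_lower_weight_0[OF _ hw _ p(1)] by simp
    then have "c = 0" using v0(1) by simp
    then have "\<phi> \<in> W.proper_lower n w0" using p(2) by simp
    then have z: "wproj (trunc lam K) \<phi> = 0" by (rule w0_proper_lower)
    have "\<phi> w * w0 w = 0" for w
    proof (cases "w0 w = 0")
      case False
      then have "wcont w = trunc lam K" using w0_wts by (auto simp: wts_def)
      then have "\<phi> w = wproj (trunc lam K) \<phi> w" by (simp add: wproj_def)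
      then show ?thesis using z by simp
    qed simp
    then show ?thesis unfolding form_def by (intro sum.neutral ballI)
  qed
  have orth: "form n ?d \<phi> (foldr (\<lambda>(i, j). act i j) ps w0) = 0"
    if "set ps \<subseteq> all_pairs n" "(0, \<phi>) \<in> graph" for ps \<phi>
    using that
  proof (induction ps arbitrary: \<phi>)
    case Nil
    then show ?case using low by simp
  next
    case (Cons pq ps)
    obtain p q where pq: "pq = (p, q)" by (cases pq)
    have l: "p < n" "q < n" using Cons.prems pq by (auto simp: all_pairs_def)
    have "(0, act q p \<phi>) \<in> graph" using graph_E[OF l(2,1) Cons.prems(2)] E_0[OF l(2,1)] by simp
    then have "form n ?d (act q p \<phi>) (foldr (\<lambda>(i, j). act i j) ps w0) = 0" using Cons by simp
    then show ?case
      using form_act[OF l(2,1), of ?d \<phi> "foldr (\<lambda>(i, j). act i j) ps w0"] by (simp add: pq)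
  qed
  show ?thesis
  proof (rule rational_span_nondegenerate[of ?X n ?d])
    have "rational_tensor (foldr (\<lambda>(i, j). act i j) ps w0)" for ps
      by (induction ps) (auto simp: w0_def rational_ext intro: rational_act)
    then show "rational_tensor x" if "x \<in> ?X" for x using that by blast
    show "?X \<subseteq> supp_words n ?d"
      using tensor_module_supp W.span_superset[of ?X] unfolding tensor_module_def W.submod_def by blast
    show "\<phi> \<in> W.span ?X" using graph_snd[OF assms] unfolding tensor_module_def W.submod_def .
    show "form n ?d \<phi> x = 0" if "x \<in> ?X" for x using that orth[OF _ assms] by blast
  qed
qed

definition \<Phi> :: "'v \<Rightarrow> nat list \<Rightarrow> 'k" where
  "\<Phi> x = (SOME \<phi>. (x, \<phi>) \<in> graph)"

lemma \<Phi>_graph: "(x, \<Phi> x) \<in> graph"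
  unfolding \<Phi>_def by (rule someI_ex[OF graph_total])

lemma \<Phi>_eqI: "(x, \<phi>) \<in> graph \<Longrightarrow> \<Phi> x = \<phi>"
proof -
  assume "(x, \<phi>) \<in> graph"
  then have "(x + (-1) *s x, \<phi> + fscale (-1) (\<Phi> x)) \<in> graph" using \<Phi>_graph graph_add graph_scale by blast
  then have "\<phi> + fscale (-1) (\<Phi> x) = 0" by (intro graph_single_valued) simp
  then show ?thesis by (simp add: fun_eq_iff fscale_apply)
qed

lemma \<Phi>_linear: "Vector_Spaces.linear scale fscale \<Phi>"
  unfolding Vector_Spaces.linear_iff
  using vector_space_axioms W.vector_space_axioms graph_add[OF \<Phi>_graph \<Phi>_graph] graph_scale[OF \<Phi>_graph] \<Phi>_eqI
  by blast

lemma \<Phi>_E: "i < n \<Longrightarrow> j < n \<Longrightarrow> \<Phi> (E i j x) = act i j (\<Phi> x)"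
  by (intro \<Phi>_eqI graph_E \<Phi>_graph)

lemma \<Phi>_v0: "\<Phi> v0 = w0"
  by (rule \<Phi>_eqI[OF graph_base])

lemma \<Phi>_inj: "\<Phi> x = 0 \<Longrightarrow> x = 0"
proof -
  interpret l: Vector_Spaces.linear scale fscale \<Phi> by (rule \<Phi>_linear)
  have "{x. \<Phi> x = 0} = {0} \<or> {x. \<Phi> x = 0} = UNIV"
    by (rule irreducible[OF l.subspace_kernel]) (simp add: \<Phi>_E)
  moreover have "\<Phi> v0 \<noteq> 0" using ext_nonzero[of lam K, where ?'a = 'k] by (simp add: \<Phi>_v0 w0_def)
  ultimately show "\<Phi> x = 0 \<Longrightarrow> x = 0" by blast
qed

lemma \<Phi>_range: "\<Phi> x \<in> tensor_module"
  using graph_snd[OF \<Phi>_graph] .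

lemma \<Phi>_supp: "\<Phi> x \<in> supp_words n (wdeg lam K)"
  using \<Phi>_range tensor_module_supp by blast

lemma \<Phi>_submod:
  assumes "R \<subseteq> {..<n} \<times> {..<n}"
  shows "\<Phi> ` submod R x = W.submod R (\<Phi> x)"
proof -
  interpret l: Vector_Spaces.linear scale fscale \<Phi> by (rule \<Phi>_linear)
  have f: "\<Phi> (foldr (\<lambda>(i, j). E i j) ps x) = foldr (\<lambda>(i, j). act i j) ps (\<Phi> x)" if "set ps \<subseteq> R" for ps
    using that assms by (induction ps) (auto simp: \<Phi>_E)
  have "\<Phi> ` {foldr (\<lambda>(i, j). E i j) ps x |ps. set ps \<subseteq> R} = {foldr (\<lambda>(i, j). act i j) ps (\<Phi> x) |ps. set ps \<subseteq> R}"
    using f by (auto simp: image_iff) (metis f)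
  then show ?thesis unfolding submod_def W.submod_def by (simp flip: l.span_image)
qed

lemma tensor_module_act: "i < n \<Longrightarrow> j < n \<Longrightarrow> x \<in> tensor_module \<Longrightarrow> act i j x \<in> tensor_module"
  unfolding tensor_module_def by (rule W.submod_E[of _ n]) (auto simp: all_pairs_def)

lemma subspace_tensor_module: "W.subspace tensor_module"
  by (simp add: tensor_module_def W.subspace_submod)

text \<open>For \<lambda> itself, proper products of lowering operators leave the weight space.
  Exchanges of neighbours carry both facts to the other rearrangements, the dimension by
  sl_2-symmetry and the tensor by a power of a lowering operator.\<close>

lemma tensor_module_weight_dim:
  assumes "b \<in> rearrangements lam"
  shows "W.dim (tensor_module \<inter> wts (trunc b K)) = 1 \<and> ext b K \<in> tensor_module"
  using lam(2) assms
proof (induction rule: bruhat_induct)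
  case base
  have sing: "W.singular n (\<lambda>i. int (lam ! i)) w0"
    unfolding W.singular_def W.has_weight_def
    using act_diag_wts[OF w0_wts] trunc_K[OF lam_rearrangement] ext_lam_raise_0[OF lam(2), where ?'k = 'k] lam(1)
    by (auto simp: w0_def)
  have "tensor_module \<inter> wts (trunc lam K) = W.span {w0}"
  proof (rule antisym)
    show "tensor_module \<inter> wts (trunc lam K) \<subseteq> W.span {w0}"
    proof
      fix x assume x: "x \<in> tensor_module \<inter> wts (trunc lam K)"
      interpret l: Vector_Spaces.linear fscale fscale "wproj (trunc lam K) :: (nat list \<Rightarrow> 'k) \<Rightarrow> _" by (rule wproj_linear)
      have "x \<in> W.submod (lower_pairs n) w0"
        using x W.submod_all_eq_lower[OF sing] by (simp add: tensor_module_def)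
      then obtain c where "x - fscale c w0 \<in> W.proper_lower n w0"
        using W.submod_lower_decompose by blast
      then have "wproj (trunc lam K) (x - fscale c w0) = 0" by (rule w0_proper_lower)
      moreover have "wproj (trunc lam K) x = x" "wproj (trunc lam K) w0 = w0"
        using x w0_wts wproj_wts[of _ "trunc lam K" "trunc lam K", where ?'a = 'k] by simp_all
      ultimately have "x = fscale c w0" by (simp add: l.diff l.scale)
      then show "x \<in> W.span {w0}" by (simp add: W.span_scale W.span_base)
    qed
    show "W.span {w0} \<subseteq> tensor_module \<inter> wts (trunc lam K)"
      using w0_wts by (intro W.span_minimal W.subspace_inter subspace_tensor_module subspace_wts)
        (auto simp: tensor_module_def W.submod_base)
  qed
  moreover have "w0 \<noteq> 0" using ext_nonzero[of lam K, where ?'a = 'k] by (simp add: w0_def)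
  ultimately show ?case
    using W.dim_singleton_space[of w0] W.submod_base[of w0] by (simp add: tensor_module_def flip: w0_def)
next
  case (step b i)
  have len: "length b = n" using length_rearrangements[OF step.hyps(1)] lam by simp
  interpret s: sl2_module tensor_module n "wdeg lam K" i "Suc i"
    by unfold_locales (use subspace_tensor_module tensor_module_supp tensor_module_act step.hyps(2) len in auto)
  have "trunc b K = trunc (sx i b) K \<circ> transpose i (Suc i)"
    using step.hyps(2) by (auto simp: trunc_def fun_eq_iff nth_exchange transpose_def)
  then have "W.dim (tensor_module \<inter> wts (trunc b K)) = 1"
    using s.weight_eq[of "trunc (sx i b) K"] step.IH by simp
  moreover have "ext (exchange i (Suc i) (sx i b)) K \<in> tensor_module"
    by (rule ext_exchange_in_dem[OF _ _ _ _ subspace_tensor_module])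
       (use step len tensor_module_act in \<open>auto simp: nth_exchange\<close>)
  then have "ext b K \<in> tensor_module" using step.hyps by simp
  ultimately show ?case by blast
qed

text \<open>Weights are functions on all natural numbers, but the operators see only the first
  \<open>n\<close> values; the premise fixes the others in agreement with the contents of words over
  n letters.\<close>

lemma has_weight_\<Phi>:
  assumes "\<And>i. \<not> i < n \<Longrightarrow> \<mu> i = 0"
  shows "has_weight \<mu> x \<longleftrightarrow> \<Phi> x \<in> wts \<mu>"
proof -
  interpret l: Vector_Spaces.linear scale fscale \<Phi> by (rule \<Phi>_linear)
  have inj: "\<Phi> x = \<Phi> y \<longleftrightarrow> x = y" for x y using \<Phi>_inj[of "x - y"] by (auto simp: l.diff)
  have "has_weight \<mu> x \<longleftrightarrow> (\<forall>i<n. act i i (\<Phi> x) = fscale (of_int (\<mu> i)) (\<Phi> x))"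
    unfolding has_weight_def by (auto simp flip: \<Phi>_E l.scale simp: inj)
  also have "\<dots> \<longleftrightarrow> \<Phi> x \<in> wts \<mu>"
  proof
    assume a: "\<forall>i<n. act i i (\<Phi> x) = fscale (of_int (\<mu> i)) (\<Phi> x)"
    show "\<Phi> x \<in> wts \<mu>"
      unfolding wts_def
    proof safe
      fix w assume w: "\<Phi> x w \<noteq> 0"
      have "wcont w i = \<mu> i" for i
      proof (cases "i < n")
        case True
        then have "act i i (\<Phi> x) w = fscale (of_int (\<mu> i)) (\<Phi> x) w" using a by simp
        then have "of_nat (count_list w i) * \<Phi> x w = of_int (\<mu> i) * \<Phi> x w"
          unfolding act_diag fscale_apply .
        then have "(of_int (int (count_list w i)) :: 'k) = of_int (\<mu> i)"
          using w by (metis mult_cancel_right of_int_of_nat_eq)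
        then show ?thesis unfolding of_int_eq_iff by (simp add: wcont_def)
      next
        case False
        have "set w \<subseteq> {..<n}" using w \<Phi>_supp[of x] by (auto simp: supp_words_def words_def)
        then have "count_list w i = 0" using False by (auto simp: count_list_0_iff)
        then show ?thesis using assms[OF False] by (simp add: wcont_def)
      qed
      then show "wcont w = \<mu>" by (simp add: fun_eq_iff)
    qed
  qed (use act_diag_wts in blast)
  finally show ?thesis .
qed

lemma \<Phi>_extremal:
  assumes "b \<in> rearrangements lam" "v \<noteq> 0" "has_weight (trunc b K) v"
  shows "\<exists>c. c \<noteq> 0 \<and> \<Phi> v = fscale c (ext b K)"
proof -
  have out: "trunc b K i = 0" if "\<not> i < n" for i
    using that length_rearrangements[OF assms(1)] lam by (simp add: trunc_def)
  let ?U = "tensor_module \<inter> wts (trunc b K)"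
  have "\<Phi> v \<in> wts (trunc b K)" using has_weight_\<Phi>[of "trunc b K" v] out assms(3) by blast
  then have "\<Phi> v \<in> ?U" using \<Phi>_range by blast
  have sub: "W.subspace ?U" by (intro W.subspace_inter subspace_tensor_module subspace_wts)
  have fin: "W.fin_dim ?U"
    by (rule W.fin_dim_subset[OF fin_dim_supp_words]) (use tensor_module_supp in auto)
  have e: "ext b K \<in> ?U" using tensor_module_weight_dim[OF assms(1)] ext_wts by blast
  have "W.span {ext b K} = ?U"
  proof (rule W.dim_eq_imp_eq[OF fin W.subspace_span])
    show "W.span {ext b K} \<subseteq> ?U" using e by (intro W.span_minimal sub) auto
    show "W.dim ?U \<le> W.dim (W.span {ext b K :: nat list \<Rightarrow> 'k})"
      using tensor_module_weight_dim[OF assms(1)] W.dim_singleton_space[OF ext_nonzero[of b K, where ?'a = 'k]] by simp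
  qed
  then obtain c where c: "\<Phi> v = fscale c (ext b K)" using \<open>\<Phi> v \<in> ?U\<close> by (auto simp: W.span_singleton)
  moreover have "c \<noteq> 0"
  proof
    assume "c = 0"
    then have "\<Phi> v = 0" using c by (simp add: fun_eq_iff fscale_apply)
    then show False using \<Phi>_inj assms(2) by blast
  qed
  ultimately show ?thesis by blast
qed

lemma W_submod_scale:
  assumes "c \<noteq> 0"
  shows "W.submod R (fscale c x) = W.submod R (x :: nat list \<Rightarrow> 'k)"
proof -
  have f: "foldr (\<lambda>(i, j). act i j) ps (fscale c x) = fscale c (foldr (\<lambda>(i, j). act i j) ps x)"
    for ps c and x :: "nat list \<Rightarrow> 'k" by (induction ps) (auto simp: act_fscale)
  have le: "W.submod R (fscale c x) \<subseteq> W.submod R x" for c and x :: "nat list \<Rightarrow> 'k"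
    unfolding W.submod_def f
  proof (rule W.span_minimal[OF _ W.subspace_span], clarify)
    fix ps assume "set ps \<subseteq> R"
    then show "fscale c (foldr (\<lambda>(i, j). act i j) ps x) \<in> W.span {foldr (\<lambda>(i, j). act i j) ps x |ps. set ps \<subseteq> R}"
      by (intro W.span_scale W.span_base) blast
  qed
  have "x = fscale (inverse c) (fscale c x)" using assms by (simp add: fun_eq_iff fscale_apply)
  then have "W.submod R x \<subseteq> W.submod R (fscale c x)" using le[of "inverse c" "fscale c x"] by simp
  then show ?thesis using le by blast
qed

lemma \<Phi>_demazure:
  assumes "b \<in> rearrangements lam" "v \<noteq> 0" "has_weight (trunc b K) v"
  shows "\<Phi> ` submod (borel_pairs n) v = dem b K"
proof -
  obtain c where "c \<noteq> 0" "\<Phi> v = fscale c (ext b K)" using \<Phi>_extremal[OF assms] by blast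
  then show ?thesis
    using \<Phi>_submod[OF borel_pairs_subset] W_submod_scale length_rearrangements[OF assms(1)] lam
    by (simp add: dem_def)
qed

end

subsection \<open>Moebius inversion\<close>

lemma moebius_self: "finite_poset P leq \<Longrightarrow> x \<in> P \<Longrightarrow> moebius P leq x x = 1"
  by (subst moebius.simps) (auto simp: finite_poset_def reflp_on_def)

lemma moebius_not_le: "\<not> leq x y \<Longrightarrow> moebius P leq x y = 0"
  by (subst moebius.simps) auto

lemma sum_moebius_right:
  assumes P: "finite_poset P leq" and x: "x \<in> P" and y: "y \<in> P"
  shows "(\<Sum>z\<in>{z \<in> P. leq z y}. moebius P leq x z) = of_bool (x = y)"
proof -
  have fin: "finite P" and refl: "leq y y" using P y by (auto simp: finite_poset_def reflp_on_def)
  have "(\<Sum>z\<in>{z \<in> P. leq z y}. moebius P leq x z) =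
      moebius P leq x y + (\<Sum>z\<in>{z \<in> P. leq z y} - {y}. moebius P leq x z)"
    using fin y refl by (intro sum.remove) auto
  also have "(\<Sum>z\<in>{z \<in> P. leq z y} - {y}. moebius P leq x z) =
      (\<Sum>z\<in>{z \<in> P. leq x z \<and> leq z y \<and> z \<noteq> y}. moebius P leq x z)"
    using fin by (intro sum.mono_neutral_right) (auto, metis moebius_not_le)
  also have "moebius P leq x y + \<dots> = of_bool (x = y)"
  proof (cases "leq x y \<and> x \<noteq> y")
    case True
    have "moebius P leq x y = - (\<Sum>z\<in>{z \<in> P. leq x z \<and> leq z y \<and> z \<noteq> y}. moebius P leq x z)"
      by (subst moebius.simps) (use P x y True in simp)
    then show ?thesis using True by simp
  next
    case False
    have "{z \<in> P. leq x z \<and> leq z y \<and> z \<noteq> y} = {}"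
      using False P x y unfolding finite_poset_def transp_on_def antisymp_on_def by blast
    moreover have "moebius P leq x y = of_bool (x = y)"
      using False P x refl by (cases "x = y") (auto simp: moebius_self moebius_not_le)
    ultimately show ?thesis by (simp only: sum.empty add_0_right)
  qed
  finally show ?thesis .
qed

text \<open>A left inverse of the zeta matrix is a right inverse.\<close>

lemma sum_moebius_left:
  assumes P: "finite_poset P leq" and "x \<in> P" and y: "y \<in> P"
  shows "(\<Sum>z\<in>{z \<in> P. leq x z}. moebius P leq z y) = of_bool (x = y)"
  using assms(2)
proof (induction "card {w \<in> P. leq x w}" arbitrary: x rule: less_induct)
  case less
  have fin: "finite P" and xx: "leq x x" using P less.prems by (auto simp: finite_poset_def reflp_on_def)
  let ?\<mu> = "moebius P leq"
  let ?f = "\<lambda>x. \<Sum>z\<in>{z \<in> P. leq x z}. ?\<mu> z y"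
  have IH: "?f w = of_bool (w = y)" if w: "w \<in> P" "leq x w" "w \<noteq> x" for w
  proof (rule less.hyps)
    have "{z \<in> P. leq w z} \<subset> {z \<in> P. leq x z}"
    proof
      show "{z \<in> P. leq w z} \<subseteq> {z \<in> P. leq x z}"
        using P w less.prems unfolding finite_poset_def transp_on_def by blast
      have "\<not> leq w x" using P w less.prems unfolding finite_poset_def antisymp_on_def by blast
      then show "{z \<in> P. leq w z} \<noteq> {z \<in> P. leq x z}" using less.prems xx by blast
    qed
    then show "card {z \<in> P. leq w z} < card {z \<in> P. leq x z}" using fin by (intro psubset_card_mono) auto
  qed (rule w)
  \<comment> \<open>Associativity of the product of \<mu>, \<zeta> and \<mu>: summing over w first
    collapses \<mu> \<zeta> to the identity. The induction hypothesis evaluates every term with w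
    \<noteq> x, which isolates the one for x.\<close>
  have ex: "(\<Sum>w\<in>P. ?\<mu> x w * ?f w) = ?\<mu> x y"
  proof -
    have "(\<Sum>w\<in>P. ?\<mu> x w * ?f w) = (\<Sum>w\<in>P. \<Sum>z\<in>P. if leq w z then ?\<mu> x w * ?\<mu> z y else 0)"
      using fin by (simp add: sum_distrib_left sum.If_cases Int_def conj_commute)
    also have "\<dots> = (\<Sum>z\<in>P. \<Sum>w\<in>P. if leq w z then ?\<mu> x w * ?\<mu> z y else 0)" by (rule sum.swap)
    also have "\<dots> = (\<Sum>z\<in>P. (\<Sum>w\<in>{w \<in> P. leq w z}. ?\<mu> x w) * ?\<mu> z y)"
      using fin by (simp add: sum_distrib_right sum.If_cases Int_def conj_commute)
    also have "\<dots> = (\<Sum>z\<in>P. if z = x then ?\<mu> x y else 0)"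
      using sum_moebius_right[OF P less.prems] by (intro sum.cong) auto
    also have "\<dots> = ?\<mu> x y" using fin less.prems by simp
    finally show ?thesis .
  qed
  have "(\<Sum>w\<in>P. ?\<mu> x w * ?f w) = ?\<mu> x x * ?f x + (\<Sum>w\<in>P - {x}. ?\<mu> x w * ?f w)"
    using fin less.prems by (intro sum.remove) auto
  also have "(\<Sum>w\<in>P - {x}. ?\<mu> x w * ?f w) = (\<Sum>w\<in>P - {x}. if w = y then ?\<mu> x y else 0)"
  proof (rule sum.cong[OF refl])
    fix w assume w: "w \<in> P - {x}"
    show "?\<mu> x w * ?f w = (if w = y then ?\<mu> x y else 0)"
    proof (cases "leq x w")
      case True
      have "?f w = of_bool (w = y)" by (rule IH) (use w True in auto)
      then show ?thesis by (simp only: of_bool_def split: if_split) simp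
    next
      case False
      then have "?\<mu> x w = 0" by (rule moebius_not_le)
      then show ?thesis by (cases "w = y") simp_all
    qed
  qed
  also have "\<dots> = (if x = y then 0 else ?\<mu> x y)" using fin y by auto
  finally have "?f x + (if x = y then 0 else ?\<mu> x y) = ?\<mu> x y"
    using ex moebius_self[OF P less.prems] by simp
  then show ?case using moebius_self[OF P less.prems] by (auto split: if_splits)
qed

lemma moebius_inversion:
  fixes f g :: "'a \<Rightarrow> int"
  assumes P: "finite_poset P leq" and a: "a \<in> P"
    and g: "\<And>c. c \<in> P \<Longrightarrow> g c = (\<Sum>b\<in>{b \<in> P. leq b c}. f b)"
  shows "(\<Sum>c\<in>{c \<in> P. leq c a}. moebius P leq c a * g c) = f a"
proof -
  have fin: "finite P" using P by (simp add: finite_poset_def)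
  let ?\<mu> = "moebius P leq"
  have "(\<Sum>c\<in>{c \<in> P. leq c a}. ?\<mu> c a * g c) = (\<Sum>c\<in>P. ?\<mu> c a * g c)"
    using fin by (intro sum.mono_neutral_left) (auto, metis moebius_not_le)
  also have "\<dots> = (\<Sum>c\<in>P. \<Sum>b\<in>P. if leq b c then ?\<mu> c a * f b else 0)"
    using fin g by (simp add: sum_distrib_left sum.If_cases Int_def conj_commute)
  also have "\<dots> = (\<Sum>b\<in>P. \<Sum>c\<in>P. if leq b c then ?\<mu> c a * f b else 0)" by (rule sum.swap)
  also have "\<dots> = (\<Sum>b\<in>P. (\<Sum>c\<in>{c \<in> P. leq b c}. ?\<mu> c a) * f b)"
    using fin by (simp add: sum_distrib_right sum.If_cases Int_def conj_commute)
  also have "\<dots> = (\<Sum>b\<in>P. if b = a then f a else 0)"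
    using sum_moebius_left[OF P _ a] by (intro sum.cong) auto
  also have "\<dots> = f a" using fin a by simp
  finally show ?thesis .
qed

subsection \<open>Atoms of a modular function on lower sets\<close>

definition atom :: "(nat list set \<Rightarrow> int) \<Rightarrow> nat list \<Rightarrow> int" where
  "atom H b = H (below b) - H (below b - {b})"

definition modular_on :: "nat list \<Rightarrow> (nat list set \<Rightarrow> int) \<Rightarrow> bool" where
  "modular_on lam H \<longleftrightarrow> H {} = 0 \<and>
    (\<forall>I J. lower_set lam I \<and> lower_set lam J \<longrightarrow> H (I \<union> J) + H (I \<inter> J) = H I + H J)"

text \<open>For b maximal in \<open>I\<close>, the sets I - {b} and \<open>below b\<close> have
  union \<open>I\<close> and meet in \<open>below b\<close> without b, so modularity says that
  removing b costs exactly its atom.\<close>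

lemma modular_sum_atoms:
  assumes H: "modular_on lam H" and I: "lower_set lam I"
  shows "H I = (\<Sum>b\<in>I. atom H b)"
  using I
proof (induction "card I" arbitrary: I rule: less_induct)
  case less
  have fin: "finite I" using lower_set_finite less.prems by blast
  show ?case
  proof (cases "I = {}")
    case True
    then show ?thesis using H by (simp add: modular_on_def)
  next
    case False
    obtain b where b: "b \<in> I" "\<And>c. c \<in> I \<Longrightarrow> bruhat_le b c \<Longrightarrow> c = b"
      using lower_set_maximal[OF less.prems False] by blast
    have bP: "b \<in> rearrangements lam" using b(1) less.prems by (auto simp: lower_set_def)
    have J: "lower_set lam (I - {b})" by (rule lower_set_remove[OF less.prems b])
    have B: "lower_set lam (below b)" by (rule lower_set_below[OF bP])
    have bI: "below b \<subseteq> I" using lower_setD[OF less.prems b(1)] by (auto simp: below_def)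
    have "(I - {b}) \<union> below b = I" "(I - {b}) \<inter> below b = below b - {b}"
      using bI b(1) by (auto simp: below_def)
    then have "H I + H (below b - {b}) = H (I - {b}) + H (below b)"
      using H J B unfolding modular_on_def by metis
    moreover have "H (I - {b}) = (\<Sum>b\<in>I - {b}. atom H b)"
      by (rule less.hyps[OF _ J]) (rule card_Diff1_less[OF fin b(1)])
    moreover have "(\<Sum>b\<in>I. atom H b) = atom H b + (\<Sum>b\<in>I - {b}. atom H b)"
      using fin b(1) by (rule sum.remove)
    ultimately show ?thesis by (simp add: atom_def)
  qed
qed

text \<open>The indices c of the modules divided out need not form a lower set. By monotonicity
  their sum does not change when everything below them is added, and the modular function applies to
  the result.\<close>

definition strictly_below :: "nat list set \<Rightarrow> nat list \<Rightarrow> nat list set" where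
  "strictly_below C b = (\<Union>c\<in>{c \<in> C. bruhat_less c b}. below c)"

lemma lower_set_strictly_below:
  assumes "C \<subseteq> rearrangements lam"
  shows "lower_set lam (strictly_below C b)"
proof -
  have "lower_set lam (below c)" if "c \<in> C" for c using lower_set_below that assms by blast
  then show ?thesis unfolding strictly_below_def lower_set_def by blast
qed

lemma strictly_below_rearrangements:
  assumes "b \<in> rearrangements lam"
  shows "strictly_below (rearrangements lam) b = below b - {b}"
proof (intro subset_antisym subsetI)
  fix c assume "c \<in> strictly_below (rearrangements lam) b"
  then obtain c' where "bruhat_le c c'" "bruhat_le c' b" "c' \<noteq> b"
    by (auto simp: strictly_below_def below_def bruhat_less_def)
  then show "c \<in> below b - {b}" using bruhat_le_trans bruhat_le_antisym unfolding below_def by blast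
next
  fix c assume c: "c \<in> below b - {b}"
  then have "c \<in> rearrangements lam" using assms bruhat_le_rearrangements by (auto simp: below_def)
  then show "c \<in> strictly_below (rearrangements lam) b"
    using c by (auto simp: strictly_below_def below_def bruhat_less_def)
qed

section \<open>Fibres of the sort over the dominant rearrangements\<close>

locale dominant_poset = linearized_poset n T h for n :: nat and T :: "'t::order set" and h :: "'t \<Rightarrow> nat" +
  fixes lam :: "nat list"
  assumes length_lam: "length lam = n"
begin

abbreviation "\<D> \<equiv> dominant_rearrangements n T h lam"

definition fibre :: "nat list \<Rightarrow> nat list set" where
  "fibre a = {b \<in> rearrangements lam. admissible n T h (rev b) \<and> bs_op n T h b = a}"

lemma dominant_subset: "\<D> \<subseteq> rearrangements lam"
  by (auto simp: dominant_rearrangements_def)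

lemma finite_dominant: "finite \<D>"
  using dominant_subset finite_rearrangements finite_subset by blast

lemma finite_poset_dominant: "finite_poset \<D> bruhat_le"
  unfolding finite_poset_def reflp_on_def antisymp_on_def transp_on_def
  using finite_dominant bruhat_le_antisym bruhat_le_trans by auto

text \<open>Leastness of the sorted word among the dominant elements above \<open>b\<close>; a
  single dominant element above \<open>b\<close> already puts \<open>b\<close> into the domain of
  the sort.\<close>

lemma below_dominant_iff:
  assumes "c \<in> \<D>" "b \<in> rearrangements lam"
  shows "bruhat_le b c \<longleftrightarrow> admissible n T h (rev b) \<and> bs_op n T h b \<in> \<D> \<and> bruhat_le (bs_op n T h b) c"
proof
  have len: "length b = n" using assms(2) length_rearrangements length_lam by simp
  assume le: "bruhat_le b c"
  have dc: "T_dominant n T h c" using assms(1) by (simp add: dominant_rearrangements_def)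
  have adm: "admissible n T h (rev b)" by (rule admissible_below_dominant[OF len dc le])
  note least = bs_op_least[OF len adm]
  have "bs_op n T h b \<in> rearrangements lam"
    using bruhat_le_rearrangements[OF least(2)] assms(2) by blast
  then show "admissible n T h (rev b) \<and> bs_op n T h b \<in> \<D> \<and> bruhat_le (bs_op n T h b) c"
    using adm least(1) least(3)[OF dc le] by (simp add: dominant_rearrangements_def)
next
  have len: "length b = n" using assms(2) length_rearrangements length_lam by simp
  assume "admissible n T h (rev b) \<and> bs_op n T h b \<in> \<D> \<and> bruhat_le (bs_op n T h b) c"
  then show "bruhat_le b c" using bs_op_least(2)[OF len] bruhat_le_trans by blast
qed

lemma below_dominant:
  assumes "c \<in> \<D>"
  shows "below c = (\<Union>a\<in>{a \<in> \<D>. bruhat_le a c}. fibre a)"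
proof (intro subset_antisym subsetI)
  fix b assume b: "b \<in> below c"
  then have "b \<in> rearrangements lam"
    using assms bruhat_le_rearrangements dominant_subset unfolding below_def by blast
  then show "b \<in> (\<Union>a\<in>{a \<in> \<D>. bruhat_le a c}. fibre a)"
    using b below_dominant_iff[OF assms] by (auto simp: below_def fibre_def)
next
  fix b assume "b \<in> (\<Union>a\<in>{a \<in> \<D>. bruhat_le a c}. fibre a)"
  then show "b \<in> below c" using below_dominant_iff[OF assms] by (auto simp: below_def fibre_def)
qed

lemma fibre_disjoint: "a \<noteq> a' \<Longrightarrow> fibre a \<inter> fibre a' = {}"
  by (auto simp: fibre_def)

lemma finite_fibre: "finite (fibre a)"
  unfolding fibre_def using finite_rearrangements by auto

text \<open>The fibres over dominant elements at most \<open>a\<close> partition the principal set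
  of \<open>a\<close>, and those over strictly smaller ones make up the part that is divided
  out.\<close>

lemma fibre_difference:
  assumes "a \<in> \<D>"
  shows "below a - strictly_below \<D> a = fibre a" "strictly_below \<D> a \<subseteq> below a"
proof -
  have sb: "strictly_below \<D> a = (\<Union>a'\<in>{a' \<in> \<D>. bruhat_less a' a}. fibre a')"
  proof (intro subset_antisym subsetI)
    fix b assume "b \<in> strictly_below \<D> a"
    then obtain c where c: "c \<in> \<D>" "bruhat_less c a" "b \<in> below c" by (auto simp: strictly_below_def)
    then obtain a' where a': "a' \<in> \<D>" "bruhat_le a' c" "b \<in> fibre a'" using below_dominant by blast
    then have "bruhat_less a' a"
      using c bruhat_le_trans bruhat_le_antisym unfolding bruhat_less_def by blast
    then show "b \<in> (\<Union>a'\<in>{a' \<in> \<D>. bruhat_less a' a}. fibre a')" using a' by blast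
  next
    fix b assume "b \<in> (\<Union>a'\<in>{a' \<in> \<D>. bruhat_less a' a}. fibre a')"
    then obtain a' where a': "a' \<in> \<D>" "bruhat_less a' a" "b \<in> fibre a'" by blast
    then have "b \<in> below a'" using below_dominant[OF a'(1)] bruhat_le_refl by blast
    then show "b \<in> strictly_below \<D> a" using a' by (auto simp: strictly_below_def)
  qed
  have split: "{a' \<in> \<D>. bruhat_le a' a} = insert a {a' \<in> \<D>. bruhat_less a' a}"
    using assms by (auto simp: bruhat_less_def)
  have "below a = fibre a \<union> strictly_below \<D> a"
    unfolding below_dominant[OF assms] split sb by simp
  moreover have "fibre a \<inter> strictly_below \<D> a = {}"
    unfolding sb using fibre_disjoint by (auto simp: bruhat_less_def)
  ultimately show "below a - strictly_below \<D> a = fibre a" "strictly_below \<D> a \<subseteq> below a" by auto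
qed

lemma sum_atoms_fibre:
  assumes H: "modular_on lam H" and a: "a \<in> \<D>"
  shows "H (below a) - H (strictly_below \<D> a) = (\<Sum>b\<in>fibre a. atom H b)"
proof -
  have A: "lower_set lam (below a)" using lower_set_below a dominant_subset by blast
  have S: "lower_set lam (strictly_below \<D> a)" by (rule lower_set_strictly_below[OF dominant_subset])
  have "(\<Sum>b\<in>below a. atom H b) = (\<Sum>b\<in>fibre a. atom H b) + (\<Sum>b\<in>strictly_below \<D> a. atom H b)"
    using sum.subset_diff[OF fibre_difference(2)[OF a] lower_set_finite[OF A]] fibre_difference(1)[OF a] by metis
  then show ?thesis using modular_sum_atoms[OF H A] modular_sum_atoms[OF H S] by simp
qed

lemma moebius_sum_fibre:
  assumes H: "modular_on lam H" and a: "a \<in> \<D>"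
  shows "(\<Sum>c\<in>{c \<in> \<D>. bruhat_le c a}. moebius \<D> bruhat_le c a * H (below c)) =
    H (below a) - H (strictly_below \<D> a)"
proof (rule moebius_inversion[OF finite_poset_dominant a])
  fix c assume c: "c \<in> \<D>"
  have "H (below c) = (\<Sum>b\<in>below c. atom H b)"
    using modular_sum_atoms[OF H lower_set_below] c dominant_subset by blast
  also have "\<dots> = (\<Sum>a\<in>{a \<in> \<D>. bruhat_le a c}. \<Sum>b\<in>fibre a. atom H b)"
    unfolding below_dominant[OF c] using finite_dominant finite_fibre fibre_disjoint
    by (intro sum.UNION_disjoint) auto
  also have "\<dots> = (\<Sum>a\<in>{a \<in> \<D>. bruhat_le a c}. H (below a) - H (strictly_below \<D> a))"
    using sum_atoms_fibre[OF H] by (intro sum.cong) auto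
  finally show "H (below c) = (\<Sum>b\<in>{b \<in> \<D>. bruhat_le b c}. H (below b) - H (strictly_below \<D> b))" .
qed

end

subsection \<open>Matrix units\<close>

definition mat_unit :: "nat \<Rightarrow> nat \<Rightarrow> nat \<Rightarrow> 'k::field mat" where
  "mat_unit n i j = mat n n (\<lambda>p. of_bool (p = (i, j)))"

lemma mat_unit_carrier [simp]: "mat_unit n i j \<in> carrier_mat n n"
  by (simp add: mat_unit_def)

lemma mat_unit_mult:
  assumes "i < n" "j < n" "k < n" "l < n"
  shows "mat_unit n i j * mat_unit n k l = (if j = k then mat_unit n i l else 0\<^sub>m n n :: 'k::field mat)"
proof (rule eq_matI)
  fix a b assume "a < dim_row (if j = k then mat_unit n i l else 0\<^sub>m n n :: 'k mat)"
    "b < dim_col (if j = k then mat_unit n i l else 0\<^sub>m n n :: 'k mat)"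
  then have ab: "a < n" "b < n" by (auto simp: mat_unit_def split: if_splits)
  have "(mat_unit n i j * mat_unit n k l :: 'k mat) $$ (a, b) =
      (\<Sum>c\<in>{0..<n}. of_bool ((a, c) = (i, j)) * of_bool ((c, b) = (k, l)))"
    using ab by (simp add: mat_unit_def scalar_prod_def)
  also have "\<dots> = (\<Sum>c\<in>{0..<n}. if c = j then of_bool (a = i \<and> j = k \<and> b = l) else 0)"
    by (intro sum.cong) auto
  also have "\<dots> = of_bool (a = i \<and> j = k \<and> b = l)" using assms by simp
  finally show "(mat_unit n i j * mat_unit n k l :: 'k mat) $$ (a, b) =
      (if j = k then mat_unit n i l else 0\<^sub>m n n) $$ (a, b)"
    using ab by (auto simp: mat_unit_def)
qed (auto simp: mat_unit_def)

context gl_module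
begin

lemma rho_zero: "rho (0\<^sub>m n n) w = 0"
proof -
  have "rho (0 \<cdot>\<^sub>m 0\<^sub>m n n) w = 0 *s rho (0\<^sub>m n n) w" by (rule rho_smult) simp
  then show ?thesis by simp
qed

lemma rho_diff:
  assumes "X \<in> carrier_mat n n" "Y \<in> carrier_mat n n"
  shows "rho (X - Y) w = rho X w - rho Y w"
proof -
  have "X - Y = X + (-1) \<cdot>\<^sub>m Y" using assms by (intro eq_matI) auto
  then show ?thesis using assms rho_add[of X "(-1) \<cdot>\<^sub>m Y" w] rho_smult[of Y "-1" w] by simp
qed

lemma gl_rep_rho: "gl_rep scale (\<lambda>i j. rho (mat_unit n i j)) n"
proof (intro gl_rep.intro gl_rep_axioms.intro)
  show "vspace scale" by (simp add: vspace_def vector_space_axioms)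
  show "Vector_Spaces.linear scale scale (rho (mat_unit n i j))" for i j by (rule rho_linear) simp
  fix i j k l x assume ijkl: "i < n" "j < n" "k < n" "l < n"
  have c: "(if b then mat_unit n i j else 0\<^sub>m n n) \<in> carrier_mat n n" for b i j by simp
  have "rho (mat_unit n i j) (rho (mat_unit n k l) x) - rho (mat_unit n k l) (rho (mat_unit n i j) x) =
      rho ((if j = k then mat_unit n i l else 0\<^sub>m n n) - (if l = i then mat_unit n k j else 0\<^sub>m n n)) x"
    using rho_bracket[of "mat_unit n i j" "mat_unit n k l" x]
    by (simp only: mat_unit_mult[OF ijkl] mat_unit_mult[OF ijkl(3,4,1,2)] mat_unit_carrier)
  also have "\<dots> = (if j = k then rho (mat_unit n i l) x else 0) - (if l = i then rho (mat_unit n k j) x else 0)"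
    by (subst rho_diff[OF c c]) (simp add: rho_zero)
  finally show "rho (mat_unit n i j) (rho (mat_unit n k l) x) - rho (mat_unit n k l) (rho (mat_unit n i j) x) =
      (if j = k then rho (mat_unit n i l) x else 0) - (if l = i then rho (mat_unit n k j) x else 0)" .
qed

lemma rho_expand:
  assumes X: "X \<in> carrier_mat n n"
  shows "rho X w = (\<Sum>(i, j)\<in>{..<n} \<times> {..<n}. X $$ (i, j) *s rho (mat_unit n i j) w)"
proof -
  define M where "M A = mat n n (\<lambda>p. if p \<in> A then X $$ p else 0)" for A
  have sum: "rho (M A) w = (\<Sum>(i, j)\<in>A. X $$ (i, j) *s rho (mat_unit n i j) w)"
    if "finite A" "A \<subseteq> {..<n} \<times> {..<n}" for A
    using that
  proof (induction A rule: finite_induct)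
    case empty
    have "M {} = 0\<^sub>m n n" by (intro eq_matI) (auto simp: M_def)
    then show ?case by (simp add: rho_zero)
  next
    case (insert p A)
    obtain i j where p: "p = (i, j)" by (cases p)
    have "M (insert p A) = X $$ p \<cdot>\<^sub>m mat_unit n i j + M A"
      using insert.hyps p by (intro eq_matI) (auto simp: M_def mat_unit_def)
    then have "rho (M (insert p A)) w = X $$ p *s rho (mat_unit n i j) w + rho (M A) w"
      using rho_add[of "X $$ p \<cdot>\<^sub>m mat_unit n i j" "M A" w] rho_smult[of "mat_unit n i j" "X $$ p" w]
      by (simp add: M_def)
    then show ?case using insert p by simp
  qed
  have "M ({..<n} \<times> {..<n}) = X" using X by (intro eq_matI) (auto simp: M_def)
  then show ?thesis using sum[of "{..<n} \<times> {..<n}"] by simp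
qed

lemma rho_in_subspace:
  assumes "X \<in> carrier_mat n n" "subspace S"
    and "\<And>i j. i < n \<Longrightarrow> j < n \<Longrightarrow> X $$ (i, j) \<noteq> 0 \<Longrightarrow> rho (mat_unit n i j) w \<in> S"
  shows "rho X w \<in> S"
  unfolding rho_expand[OF assms(1)]
proof (rule subspace_sum[OF assms(2)], clarsimp)
  fix i j assume "i < n" "j < n"
  then show "X $$ (i, j) *s rho (mat_unit n i j) w \<in> S"
    using assms(3)[of i j] subspace_scale[OF assms(2)] subspace_0[OF assms(2)]
    by (cases "X $$ (i, j) = 0") auto
qed

lemma coset_eq_iff:
  assumes "subspace N"
  shows "w +o N = w' +o N \<longleftrightarrow> w - w' \<in> N"
proof
  assume "w +o N = w' +o N"
  moreover have "w \<in> w +o N" using subspace_0[OF assms] by (force simp: elt_set_plus_def)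
  ultimately obtain x where "x \<in> N" "w = w' + x" by (auto simp: elt_set_plus_def)
  then show "w - w' \<in> N" by simp
next
  have sub: "w +o N \<subseteq> w' +o N" if "w - w' \<in> N" for w w'
  proof
    fix x assume "x \<in> w +o N"
    then obtain y where "y \<in> N" "x = w' + ((w - w') + y)" by (auto simp: elt_set_plus_def)
    then show "x \<in> w' +o N" using subspace_add[OF assms that] unfolding elt_set_plus_def by blast
  qed
  assume a: "w - w' \<in> N"
  then have "w' - w \<in> N" using subspace_neg[OF assms a] by simp
  then show "w +o N = w' +o N" using sub[OF a] sub by blast
qed

text \<open>A linear map with kernel \<open>N\<close> identifies cosets with vectors of its image,
  so the least number of generators among cosets is the dimension of the image of
  \<open>A\<close>.\<close>

lemma quot_dim_eq:
  assumes A: "subspace A" "vspace.fin_dim scale A" and N: "subspace N"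
  shows "int (quot_dim N ((\<lambda>w. w +o N) ` A)) = int (dim A) - int (dim (A \<inter> N))"
proof -
  interpret V: vspace scale by (simp add: vspace_def vector_space_axioms)
  interpret VV: vspace_pair scale scale ..
  obtain g where g: "Vector_Spaces.linear scale scale g" "{x. g x = 0} = N"
    using V.complement_map[OF N] by metis
  interpret g: Vector_Spaces.linear scale scale g by (rule g(1))
  have coset: "w +o N = w' +o N \<longleftrightarrow> g w = g w'" for w w'
  proof -
    have "w - w' \<in> N \<longleftrightarrow> g (w - w') = 0" using g(2) by blast
    then show ?thesis by (simp add: coset_eq_iff[OF N] g.diff)
  qed
  have "(\<lambda>w. w +o N) ` S \<subseteq> (\<lambda>w. w +o N) ` S' \<longleftrightarrow> g ` S \<subseteq> g ` S'" for S S'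
    by (simp add: image_subset_iff image_iff coset)
  then have image: "(\<lambda>w. w +o N) ` S = (\<lambda>w. w +o N) ` A \<longleftrightarrow> g ` S = g ` A" for S
    by (simp only: set_eq_subset)
  have dim: "dim (A \<inter> N) + dim (g ` A) = dim A"
    using VV.rank_nullity_fin_dim(1)[OF g(1) A] unfolding g(2) .
  have fin: "V.fin_dim (g ` A)" using VV.rank_nullity_fin_dim(2)[OF g(1) A] .
  have "quot_dim N ((\<lambda>w. w +o N) ` A) = dim (g ` A)"
    unfolding quot_dim_def
  proof (rule Least_equality)
    obtain B where B: "finite B" "independent B" "B \<subseteq> g ` A" "g ` A \<subseteq> span B" "card B = dim (g ` A)"
      using V.fin_dim_basis[OF fin] by metis
    obtain S where S: "S \<subseteq> A" "inj_on g S" "g ` S = B" using B(3) subset_image_inj[of B g A] by metis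
    have "finite S" "card S = dim (g ` A)" using S B finite_imageD card_image[OF S(2)] by auto
    moreover have "g ` span S = g ` A"
    proof -
      have "g ` span S = span B" using g.span_image[of S] S(3) by simp
      also have "\<dots> = g ` A" by (rule span_subspace[OF B(3,4) g.subspace_image[OF A(1)]])
      finally show ?thesis .
    qed
    ultimately show "\<exists>S. finite S \<and> card S = dim (g ` A) \<and> (\<lambda>w. w +o N) ` span S = (\<lambda>w. w +o N) ` A"
      unfolding image by blast
  next
    fix k assume "\<exists>S. finite S \<and> card S = k \<and> (\<lambda>w. w +o N) ` span S = (\<lambda>w. w +o N) ` A"
    then obtain S where S: "finite S" "card S = k" "g ` span S = g ` A" unfolding image by blast
    have "dim (g ` A) \<le> card (g ` S)" using S g.span_image[of S] by (intro dim_le_card) auto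
    then show "dim (g ` A) \<le> k" using card_image_le[OF S(1), of g] S(2) by simp
  qed
  then show ?thesis using dim by linarith
qed

end

subsection \<open>Characters\<close>

lemma lookup_sum_single:
  assumes "finite A"
  shows "Poly_Mapping.lookup (\<Sum>\<mu>\<in>A. Poly_Mapping.single \<mu> (f \<mu>)) \<nu> = (if \<nu> \<in> A then f \<nu> else (0::int))"
  using assms by (induction rule: finite_induct) (auto simp: lookup_add lookup_single when_def)

text \<open>Multiplication by the image of an integer is repeated addition, up to sign, which can be
  done coefficientwise.\<close>

lemma lookup_of_int_mult: "Poly_Mapping.lookup (of_int m * p) \<mu> = m * (Poly_Mapping.lookup p \<mu> :: int)"
proof -
  have nat: "Poly_Mapping.lookup (of_nat k * p) \<mu> = int k * Poly_Mapping.lookup p \<mu>" for k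
    by (induction k) (simp_all add: lookup_add algebra_simps)
  show ?thesis
  proof (cases "0 \<le> m")
    case True
    then show ?thesis using nat[of "nat m"] by (simp add: of_nat_nat)
  next
    case False
    then have "of_int m * p = - (of_nat (nat (- m)) * p)" by (simp add: of_nat_nat)
    then show ?thesis using nat[of "nat (- m)"] False by simp
  qed
qed

section \<open>Characters of the abstract module, computed in the tensor power\<close>

locale demazure_setting = gl_module scale n rho
  for scale :: "'k::field_char_0 \<Rightarrow> 'v::ab_group_add \<Rightarrow> 'v" (infixr \<open>*s\<close> 75)
    and n :: nat and rho :: "'k mat \<Rightarrow> 'v \<Rightarrow> 'v" +
  fixes lam :: "nat list" and v0 :: 'v and ev :: "nat list \<Rightarrow> 'v"
  assumes irreducible_module: "irreducible_module"
    and v0: "v0 \<noteq> 0" "v0 \<in> weight_space UNIV (\<lambda>i. int (lam ! i))"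
      "\<And>X. X \<in> carrier_mat n n \<Longrightarrow> \<forall>i<n. \<forall>j\<le>i. X $$ (i, j) = 0 \<Longrightarrow> rho X v0 = 0"
    and lam: "length lam = n" "sorted_wrt (\<ge>) lam"
    and ev: "\<And>b. b \<in> rearrangements lam \<Longrightarrow> extremal_vector b (ev b)"
begin

interpretation R: gl_rep scale "\<lambda>i j. rho (mat_unit n i j)" n
  by (rule gl_rep_rho)

lemma weight_space_iff: "w \<in> weight_space U \<mu> \<longleftrightarrow> w \<in> U \<and> R.has_weight \<mu> w"
proof -
  have "R.has_weight \<mu> w" if w: "\<forall>H\<in>diagonal_subalgebra. rho H w = wt_eval \<mu> H *s w"
    unfolding R.has_weight_def
  proof (intro allI impI)
    fix i assume i: "i < n"
    have "mat_unit n i i \<in> diagonal_subalgebra"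
      by (auto simp: diagonal_subalgebra_def diagonal_mat_def mat_unit_def)
    moreover have "wt_eval \<mu> (mat_unit n i i) = of_int (\<mu> i)"
    proof -
      have "wt_eval \<mu> (mat_unit n i i) = (\<Sum>l<n. if l = i then of_int (\<mu> i) else 0)"
        unfolding wt_eval_def by (intro sum.cong) (auto simp: mat_unit_def)
      then show ?thesis using i by simp
    qed
    ultimately show "rho (mat_unit n i i) w = of_int (\<mu> i) *s w" using w by force
  qed
  moreover have "rho H w = wt_eval \<mu> H *s w" if w: "R.has_weight \<mu> w" and H: "H \<in> diagonal_subalgebra" for H
  proof -
    have Hc: "H \<in> carrier_mat n n" and Hd: "\<And>i j. i < n \<Longrightarrow> j < n \<Longrightarrow> i \<noteq> j \<Longrightarrow> H $$ (i, j) = 0"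
      using H by (auto simp: diagonal_subalgebra_def diagonal_mat_def)
    have "rho H w = (\<Sum>i<n. \<Sum>j<n. H $$ (i, j) *s rho (mat_unit n i j) w)"
      unfolding rho_expand[OF Hc] by (rule sum.cartesian_product[symmetric])
    also have "\<dots> = (\<Sum>i<n. \<Sum>j<n. if j = i then (of_int (\<mu> i) * H $$ (i, i)) *s w else 0)"
      using Hd w by (intro sum.cong) (auto simp: R.has_weight_def mult.commute)
    also have "\<dots> = (\<Sum>i<n. (of_int (\<mu> i) * H $$ (i, i)) *s w)" by simp
    also have "\<dots> = wt_eval \<mu> H *s w" by (simp add: wt_eval_def scale_sum_left)
    finally show ?thesis .
  qed
  ultimately show ?thesis unfolding weight_space_def by blast
qed

sublocale R: irreducible_gl_rep scale "\<lambda>i j. rho (mat_unit n i j)" n lam v0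
proof (intro irreducible_gl_rep.intro irreducible_gl_rep_axioms.intro gl_rep_rho)
  fix S assume S: "subspace S" "\<And>i j x. i < n \<Longrightarrow> j < n \<Longrightarrow> x \<in> S \<Longrightarrow> rho (mat_unit n i j) x \<in> S"
  have "rho X ` S \<subseteq> S" if "X \<in> carrier_mat n n" for X
    using rho_in_subspace[OF that S(1)] S(2) by blast
  then show "S = {0} \<or> S = UNIV" using irreducible_module S(1) unfolding irreducible_module_def by blast
next
  have "R.has_weight (\<lambda>i. int (lam ! i)) v0" using v0(2) by (simp add: weight_space_iff)
  moreover have "rho (mat_unit n i j) v0 = 0" if "i < j" "j < n" for i j
    by (rule v0(3)) (use that in \<open>auto simp: mat_unit_def\<close>)
  ultimately show "R.singular (\<lambda>i. int (lam ! i)) v0" by (simp add: R.singular_def)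
qed (use v0 lam in auto)

abbreviation "K \<equiv> R.K"

lemma vspace_scale: "vspace scale"
  by (simp add: vspace_def vector_space_axioms)

lemma borel_submodule_eq: "borel_submodule v = R.submod (borel_pairs n) v"
proof (rule antisym)
  have "foldr rho Xs v \<in> R.submod (borel_pairs n) v" if "set Xs \<subseteq> upper_borel" for Xs
    using that
  proof (induction Xs)
    case Nil
    then show ?case by (simp add: R.submod_base)
  next
    case (Cons X Xs)
    then have X: "X \<in> carrier_mat n n" "upper_triangular X" by (auto simp: upper_borel_def)
    have "rho X (foldr rho Xs v) \<in> R.submod (borel_pairs n) v"
    proof (rule rho_in_subspace[OF X(1) R.subspace_submod])
      fix i j assume ij: "i < n" "j < n" "X $$ (i, j) \<noteq> 0"
      then have "i \<le> j" using X by (metis carrier_matD(1) not_le upper_triangularD)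
      then show "rho (mat_unit n i j) (foldr rho Xs v) \<in> R.submod (borel_pairs n) v"
        by (intro R.submod_E[OF borel_pairs_subset]) (use Cons ij in \<open>auto simp: borel_pairs_def\<close>)
    qed
    then show ?case by simp
  qed
  then show "borel_submodule v \<subseteq> R.submod (borel_pairs n) v"
    unfolding borel_submodule_def by (intro span_minimal R.subspace_submod) auto
  have unit: "mat_unit n i j \<in> upper_borel" if "(i, j) \<in> borel_pairs n" for i j
    using that by (auto simp: upper_borel_def borel_pairs_def mat_unit_def upper_triangular_def)
  show "R.submod (borel_pairs n) v \<subseteq> borel_submodule v"
    unfolding R.submod_def borel_submodule_def
  proof (rule span_mono, clarify)
    fix ps assume ps: "set ps \<subseteq> borel_pairs n"
    have "foldr (\<lambda>(i, j). rho (mat_unit n i j)) ps v = foldr rho (map (\<lambda>(i, j). mat_unit n i j) ps) v"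
      by (induction ps) auto
    moreover have "set (map (\<lambda>(i, j). mat_unit n i j) ps) \<subseteq> upper_borel" using ps unit by auto
    ultimately show "\<exists>Xs. foldr (\<lambda>(i, j). rho (mat_unit n i j)) ps v = foldr rho Xs v \<and> set Xs \<subseteq> upper_borel"
      by blast
  qed
qed

abbreviation "\<Phi> \<equiv> R.\<Phi>"

abbreviation "D \<equiv> demazure scale n rho ev"

lemma subspace_D: "subspace (D b)"
  by (simp add: demazure_def borel_submodule_def)

lemma \<Phi>_D:
  assumes b: "b \<in> rearrangements lam"
  shows "\<Phi> ` D b = dem b K"
proof -
  have e: "ev b \<noteq> 0" "R.has_weight (\<lambda>i. int (b ! i)) (ev b)"
    using ev[OF b] by (simp_all add: extremal_vector_def weight_space_iff)
  then have "R.has_weight (trunc b K) (ev b)" unfolding R.has_weight_def R.trunc_K[OF b] by simp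
  then show ?thesis using R.\<Phi>_demazure[OF b e(1)] by (simp add: demazure_def borel_submodule_eq)
qed

definition N :: "nat list set \<Rightarrow> 'v set" where
  "N C = span (\<Union>c\<in>C. D c)"

lemma subspace_N: "subspace (N C)"
  by (simp add: N_def)

lemma \<Phi>_N:
  assumes C: "C \<subseteq> rearrangements lam"
  shows "\<Phi> ` N C = demI C K"
proof -
  interpret l: Vector_Spaces.linear scale fscale \<Phi> by (rule R.\<Phi>_linear)
  have "\<Phi> ` (\<Union>c\<in>C. D c) = (\<Union>c\<in>C. dem c K)" using \<Phi>_D C by blast
  then show ?thesis unfolding N_def demI_def by (simp flip: l.span_image)
qed

lemma demI_strictly_below:
  assumes "C \<subseteq> rearrangements lam"
  shows "demI {c \<in> C. bruhat_less c b} k = (demI (strictly_below C b) k :: (nat list \<Rightarrow> 'k) set)"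
proof (rule antisym)
  have "{c \<in> C. bruhat_less c b} \<subseteq> strictly_below C b"
    using bruhat_le_refl unfolding strictly_below_def below_def by blast
  then show "demI {c \<in> C. bruhat_less c b} k \<subseteq> (demI (strictly_below C b) k :: (nat list \<Rightarrow> 'k) set)"
    by (rule demI_mono)
  show "demI (strictly_below C b) k \<subseteq> (demI {c \<in> C. bruhat_less c b} k :: (nat list \<Rightarrow> 'k) set)"
    unfolding demI_def[of "strictly_below C b"]
  proof (rule W.span_minimal[OF _ subspace_demI], rule UN_least)
    fix d assume "d \<in> strictly_below C b"
    then obtain c where c: "c \<in> {c \<in> C. bruhat_less c b}" "bruhat_le d c"
      by (auto simp: strictly_below_def below_def)
    have "dem d k \<subseteq> (dem c k :: (nat list \<Rightarrow> 'k) set)"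
      by (rule dem_mono[OF lam(2) _ c(2)]) (use c(1) assms in auto)
    then show "dem d k \<subseteq> (demI {c \<in> C. bruhat_less c b} k :: (nat list \<Rightarrow> 'k) set)"
      using dem_subset_demI[OF c(1), of k, where ?'a = 'k] by blast
  qed
qed

text \<open>The embedding takes a basis to independent tensors supported on a finite set of
  words.\<close>

lemma fin_dim_V: "vspace.fin_dim scale (S :: 'v set)"
proof -
  interpret l: Vector_Spaces.linear scale fscale \<Phi> by (rule R.\<Phi>_linear)
  obtain B where B: "independent B" "UNIV \<subseteq> span B" using maximal_independent_subset[of UNIV] by metis
  have inj: "inj_on \<Phi> (span B)" unfolding l.inj_on_iff_eq_0[OF subspace_span] using R.\<Phi>_inj by blast
  have ind: "W.independent (\<Phi> ` B)" by (rule l.independent_injective_image[OF B(1) inj])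
  have "\<Phi> ` B \<subseteq> W.span (supp_words n (wdeg lam K))" using R.\<Phi>_supp by (auto intro: W.span_base)
  then have "finite (\<Phi> ` B)" using W.fin_dim_independent_card[OF fin_dim_supp_words ind] by blast
  moreover have "inj_on \<Phi> B" using inj_on_subset[OF inj] span_superset by blast
  ultimately have "finite B" by (rule finite_imageD)
  then show ?thesis using B(2) unfolding R.fin_dim_def by blast
qed

lemma \<Phi>_dim:
  assumes "subspace S"
  shows "W.dim (\<Phi> ` S) = dim S"
proof -
  have "vspace_pair scale fscale" by (intro vspace_pair.intro vspace_scale vspace_fscale)
  then show ?thesis
    by (rule vspace_pair.dim_image_inj_fin_dim[OF _ R.\<Phi>_linear assms fin_dim_V]) (rule R.\<Phi>_inj)
qed

lemma subspace_weight_space: "subspace U \<Longrightarrow> subspace (weight_space U \<mu>)"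
  by (rule subspaceI)
    (auto simp: weight_space_iff R.has_weight_def subspace_0 subspace_add subspace_scale R.E_0 R.E_add R.E_scale
      scale_right_distrib mult.commute)

lemma \<Phi>_weight_space:
  assumes "\<And>i. \<not> i < n \<Longrightarrow> \<mu> i = 0"
  shows "\<Phi> ` weight_space U \<mu> = \<Phi> ` U \<inter> wts \<mu>"
  using R.has_weight_\<Phi>[of \<mu>] assms by (auto simp: weight_space_iff)

lemma dim_weight_space:
  assumes "subspace U" "\<And>i. \<not> i < n \<Longrightarrow> \<mu> i = 0"
  shows "dim (weight_space U \<mu>) = W.dim (\<Phi> ` U \<inter> wts \<mu>)"
  using \<Phi>_dim[OF subspace_weight_space[OF assms(1), of \<mu>]] \<Phi>_weight_space[OF assms(2)] by simp

lemma keys_out: "Poly_Mapping.keys \<mu> \<subseteq> {..<n} \<Longrightarrow> \<not> i < n \<Longrightarrow> Poly_Mapping.lookup \<mu> i = 0"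
  by (auto simp: in_keys_iff)

text \<open>Without finiteness the sum that defines a character would be 0 by convention.\<close>

lemma finite_weights: "finite {\<mu>. Poly_Mapping.keys \<mu> \<subseteq> {..<n} \<and> (\<exists>w. w \<noteq> 0 \<and> R.has_weight (Poly_Mapping.lookup \<mu>) w)}"
proof (rule finite_imageD)
  let ?S = "{\<mu> :: nat \<Rightarrow>\<^sub>0 int. Poly_Mapping.keys \<mu> \<subseteq> {..<n} \<and> (\<exists>w. w \<noteq> 0 \<and> R.has_weight (Poly_Mapping.lookup \<mu>) w)}"
  have "Poly_Mapping.lookup ` ?S \<subseteq> wcont ` words n (wdeg lam K)"
  proof (clarify)
    fix \<mu> :: "nat \<Rightarrow>\<^sub>0 int" and w assume \<mu>: "Poly_Mapping.keys \<mu> \<subseteq> {..<n}" "w \<noteq> 0" "R.has_weight (Poly_Mapping.lookup \<mu>) w"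
    then have "\<Phi> w \<in> wts (Poly_Mapping.lookup \<mu>)" using R.has_weight_\<Phi> keys_out by blast
    moreover have "\<Phi> w \<noteq> 0" using \<mu>(2) R.\<Phi>_inj by blast
    then obtain u where "\<Phi> w u \<noteq> 0" by (auto simp: fun_eq_iff)
    ultimately have "u \<in> words n (wdeg lam K)" "wcont u = Poly_Mapping.lookup \<mu>"
      using R.\<Phi>_supp[of w] by (auto simp: wts_def supp_words_def)
    then show "Poly_Mapping.lookup \<mu> \<in> wcont ` words n (wdeg lam K)" by (metis imageI)
  qed
  then show "finite (Poly_Mapping.lookup ` ?S)" using finite_words finite_subset by blast
  show "inj_on Poly_Mapping.lookup ?S" by (auto simp: inj_on_def)
qed

lemma lookup_character:
  assumes U: "subspace U"
  shows "Poly_Mapping.lookup (character U) \<mu> =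
    (if Poly_Mapping.keys \<mu> \<subseteq> {..<n} then int (W.dim (\<Phi> ` U \<inter> wts (Poly_Mapping.lookup \<mu>))) else 0)"
proof -
  let ?A = "{\<mu>. Poly_Mapping.keys \<mu> \<subseteq> {..<n} \<and> weight_space U (Poly_Mapping.lookup \<mu>) \<noteq> {0}}"
  have "finite ?A"
  proof (rule finite_subset[OF _ finite_weights], clarify)
    fix \<mu> :: "nat \<Rightarrow>\<^sub>0 int" assume "weight_space U (Poly_Mapping.lookup \<mu>) \<noteq> {0}"
    then show "\<exists>w. w \<noteq> 0 \<and> R.has_weight (Poly_Mapping.lookup \<mu>) w"
      using subspace_0[OF subspace_weight_space[OF U]] weight_space_iff by blast
  qed
  then have l: "Poly_Mapping.lookup (character U) \<mu> =
      (if \<mu> \<in> ?A then int (dim (weight_space U (Poly_Mapping.lookup \<mu>))) else 0)"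
    unfolding character_def by (rule lookup_sum_single)
  show ?thesis
  proof (cases "Poly_Mapping.keys \<mu> \<subseteq> {..<n}")
    case True
    have "dim (weight_space U (Poly_Mapping.lookup \<mu>)) = W.dim (\<Phi> ` U \<inter> wts (Poly_Mapping.lookup \<mu>))"
      by (rule dim_weight_space[OF U keys_out[OF True]])
    moreover have "weight_space U (Poly_Mapping.lookup \<mu>) = {0} \<Longrightarrow> dim (weight_space U (Poly_Mapping.lookup \<mu>)) = 0"
      using R.dim_zero_subspace by simp
    ultimately show ?thesis using l True by auto
  qed (use l in auto)
qed

text \<open>Given a coset of weight \<mu> with representative w, and \<nu> \<noteq> \<mu>, choose i
  with \<nu>_i \<noteq> \<mu>_i. The vector (E_ii - \<mu>_i) w lies in M, and its component of
  weight \<nu> is a nonzero multiple of that of w. As M is graded, all components of w but the one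
  of weight \<mu> lie in M, and the latter represents the coset.\<close>

lemma quot_weight_space_eq:
  assumes U: "subspace U" "graded (\<Phi> ` U)" and M: "subspace M" "M \<subseteq> U" "graded (\<Phi> ` M)"
    and \<mu>: "\<And>i. \<not> i < n \<Longrightarrow> \<mu> i = 0"
  shows "quot_weight_space U M \<mu> = (\<lambda>w. w +o M) ` weight_space U \<mu>"
proof (intro subset_antisym subsetI)
  interpret l: Vector_Spaces.linear scale fscale \<Phi> by (rule R.\<Phi>_linear)
  have inj: "inj \<Phi>" unfolding l.inj_iff_eq_0 using R.\<Phi>_inj by blast
  fix Q assume "Q \<in> quot_weight_space U M \<mu>"
  then obtain w where w: "Q = w +o M" "w \<in> U"
    "\<And>H. H \<in> diagonal_subalgebra \<Longrightarrow> rho H w +o M = (wt_eval \<mu> H *s w) +o M"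
    by (auto simp: quot_weight_space_def)
  let ?\<phi> = "\<Phi> w" and ?C = "wcont ` words n (wdeg lam K)"
  have subM: "W.subspace (\<Phi> ` M)" by (rule l.subspace_image[OF M(1)])
  have comp: "wproj \<nu> ?\<phi> \<in> \<Phi> ` M" if \<nu>: "\<nu> \<in> ?C" "\<nu> \<noteq> \<mu>" for \<nu>
  proof -
    obtain i where i: "\<nu> i \<noteq> \<mu> i" using \<nu>(2) by (auto simp: fun_eq_iff)
    have "i < n"
    proof (rule ccontr)
      assume ni: "\<not> i < n"
      obtain u where "u \<in> words n (wdeg lam K)" "\<nu> = wcont u" using \<nu>(1) by blast
      then have "\<nu> i = 0" using ni by (auto simp: words_def wcont_def count_list_0_iff)
      then show False using i \<mu>[OF ni] by simp
    qed
    have d: "mat_unit n i i \<in> diagonal_subalgebra"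
      by (auto simp: diagonal_subalgebra_def diagonal_mat_def mat_unit_def)
    have wt: "wt_eval \<mu> (mat_unit n i i) = of_int (\<mu> i)"
    proof -
      have "wt_eval \<mu> (mat_unit n i i) = (\<Sum>l<n. if l = i then of_int (\<mu> i) else 0)"
        unfolding wt_eval_def by (intro sum.cong) (auto simp: mat_unit_def)
      then show ?thesis using \<open>i < n\<close> by simp
    qed
    have "rho (mat_unit n i i) w - of_int (\<mu> i) *s w \<in> M"
      using w(3)[OF d] unfolding wt coset_eq_iff[OF M(1)] .
    then have "\<Phi> (rho (mat_unit n i i) w - of_int (\<mu> i) *s w) \<in> \<Phi> ` M" by blast
    then have "act i i ?\<phi> - fscale (of_int (\<mu> i)) ?\<phi> \<in> \<Phi> ` M"
      by (simp add: l.diff l.scale R.\<Phi>_E[OF \<open>i < n\<close> \<open>i < n\<close>])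
    then have "wproj \<nu> (act i i ?\<phi> - fscale (of_int (\<mu> i)) ?\<phi>) \<in> \<Phi> ` M" using M(3) unfolding graded_def by blast
    moreover have "wproj \<nu> (act i i ?\<phi> - fscale (of_int (\<mu> i)) ?\<phi>) = fscale (of_int (\<nu> i - \<mu> i)) (wproj \<nu> ?\<phi>)"
    proof
      fix u
      show "wproj \<nu> (act i i ?\<phi> - fscale (of_int (\<mu> i)) ?\<phi>) u = fscale (of_int (\<nu> i - \<mu> i)) (wproj \<nu> ?\<phi>) u"
      proof (cases "wcont u = \<nu>")
        case True
        then have "\<nu> i = int (count_list u i)" by (auto simp: wcont_def)
        then show ?thesis using True by (simp add: wproj_def fscale_apply act_diag algebra_simps)
      qed (simp add: wproj_def fscale_apply)
    qed
    ultimately have "fscale (of_int (\<nu> i - \<mu> i)) (wproj \<nu> ?\<phi>) \<in> \<Phi> ` M" by simp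
    then have "fscale (inverse (of_int (\<nu> i - \<mu> i))) (fscale (of_int (\<nu> i - \<mu> i)) (wproj \<nu> ?\<phi>)) \<in> \<Phi> ` M"
      by (rule W.subspace_scale[OF subM])
    moreover have "(of_int (\<nu> i - \<mu> i) :: 'k) \<noteq> 0" using i by (simp del: of_int_diff)
    then have "fscale (inverse (of_int (\<nu> i - \<mu> i))) (fscale (of_int (\<nu> i - \<mu> i)) (wproj \<nu> ?\<phi>)) = wproj \<nu> ?\<phi>"
      by (simp add: fun_eq_iff fscale_apply mult.assoc[symmetric] del: of_int_diff)
    ultimately show ?thesis by simp
  qed
  have "wproj \<mu> ?\<phi> \<in> \<Phi> ` U" using U(2) w(2) by (auto simp: graded_def)
  then obtain w' where "wproj \<mu> ?\<phi> = \<Phi> w'" "w' \<in> U" by (rule imageE)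
  then have w': "w' \<in> U" "\<Phi> w' = wproj \<mu> ?\<phi>" by simp_all
  have fin: "finite ?C" using finite_words by blast
  have "?\<phi> - wproj \<mu> ?\<phi> \<in> \<Phi> ` M"
  proof -
    have s: "?\<phi> = (\<Sum>\<nu>\<in>?C. wproj \<nu> ?\<phi>)" by (rule wproj_sum[OF R.\<Phi>_supp])
    have "(\<Sum>\<nu>\<in>?C - {\<mu>}. wproj \<nu> ?\<phi>) \<in> \<Phi> ` M"
      using comp by (intro W.subspace_sum[OF subM]) auto
    moreover have "?\<phi> - wproj \<mu> ?\<phi> = (\<Sum>\<nu>\<in>?C - {\<mu>}. wproj \<nu> ?\<phi>)"
    proof (cases "\<mu> \<in> ?C")
      case True
      have sum: "(\<Sum>\<nu>\<in>?C. wproj \<nu> ?\<phi>) = wproj \<mu> ?\<phi> + (\<Sum>\<nu>\<in>?C - {\<mu>}. wproj \<nu> ?\<phi>)"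
        by (rule sum.remove[OF fin True])
      have diff: "x - y = z" if "x = y + z" for x y z :: "nat list \<Rightarrow> 'k" using that by simp
      show ?thesis by (rule diff) (rule trans[OF s sum])
    next
      case False
      have "wproj \<mu> ?\<phi> u = 0" for u
        using False R.\<Phi>_supp[of w] by (auto simp: wproj_def supp_words_def)
      then have zero: "wproj \<mu> ?\<phi> = 0" by (simp add: fun_eq_iff)
      have C: "?C - {\<mu>} = ?C" using False by simp
      show ?thesis unfolding zero diff_zero C by (rule s)
    qed
    ultimately show ?thesis by simp
  qed
  then have "\<Phi> (w - w') \<in> \<Phi> ` M" by (simp add: l.diff w'(2))
  then have "w - w' \<in> M" by (simp only: inj_image_mem_iff[OF inj])
  then have "w +o M = w' +o M" by (simp only: coset_eq_iff[OF M(1)])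
  then have "Q = w' +o M" using w(1) by (rule trans[rotated])
  moreover have "w' \<in> weight_space U \<mu>"
    using w' wproj_in_wts[of \<mu> ?\<phi>] R.has_weight_\<Phi>[of \<mu> w'] \<mu> by (simp add: weight_space_iff)
  ultimately show "Q \<in> (\<lambda>w. w +o M) ` weight_space U \<mu>" by blast
next
  fix Q assume "Q \<in> (\<lambda>w. w +o M) ` weight_space U \<mu>"
  then obtain w where w: "Q = w +o M" "w \<in> weight_space U \<mu>" by (rule imageE)
  then have "w \<in> U" "\<forall>H\<in>diagonal_subalgebra. rho H w +o M = (wt_eval \<mu> H *s w) +o M"
    by (simp_all add: weight_space_def)
  with w(1) show "Q \<in> quot_weight_space U M \<mu>"
    unfolding quot_weight_space_def by (intro CollectI exI[of _ w] conjI)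
qed

lemma lookup_quot_character:
  assumes U: "subspace U" "graded (\<Phi> ` U)" and M: "subspace M" "M \<subseteq> U" "graded (\<Phi> ` M)"
  shows "Poly_Mapping.lookup (quot_character U M) \<mu> =
    (if Poly_Mapping.keys \<mu> \<subseteq> {..<n} then int (W.dim (\<Phi> ` U \<inter> wts (Poly_Mapping.lookup \<mu>)))
      - int (W.dim (\<Phi> ` M \<inter> wts (Poly_Mapping.lookup \<mu>))) else 0)"
proof -
  let ?Q = "\<lambda>\<mu>. quot_weight_space U M (Poly_Mapping.lookup \<mu>)"
  let ?A = "{\<mu>. Poly_Mapping.keys \<mu> \<subseteq> {..<n} \<and> ?Q \<mu> \<noteq> {M}}"
  have Q: "?Q \<mu> = (\<lambda>w. w +o M) ` weight_space U (Poly_Mapping.lookup \<mu>)"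
    if "Poly_Mapping.keys \<mu> \<subseteq> {..<n}" for \<mu>
    by (rule quot_weight_space_eq[OF U M keys_out[OF that]])
  have "finite ?A"
  proof (rule finite_subset[OF _ finite_weights], clarify)
    fix \<mu> :: "nat \<Rightarrow>\<^sub>0 int" assume \<mu>: "Poly_Mapping.keys \<mu> \<subseteq> {..<n}" "?Q \<mu> \<noteq> {M}"
    have "weight_space U (Poly_Mapping.lookup \<mu>) \<noteq> {0}"
    proof
      assume "weight_space U (Poly_Mapping.lookup \<mu>) = {0}"
      then have "?Q \<mu> = {M}" unfolding Q[OF \<mu>(1)] by simp
      then show False using \<mu>(2) by simp
    qed
    then show "\<exists>w. w \<noteq> 0 \<and> R.has_weight (Poly_Mapping.lookup \<mu>) w"
      using subspace_0[OF subspace_weight_space[OF U(1)]] weight_space_iff by blast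
  qed
  then have l: "Poly_Mapping.lookup (quot_character U M) \<mu> = (if \<mu> \<in> ?A then int (quot_dim M (?Q \<mu>)) else 0)"
    unfolding quot_character_def by (rule lookup_sum_single)
  show ?thesis
  proof (cases "Poly_Mapping.keys \<mu> \<subseteq> {..<n}")
    case True
    let ?\<mu> = "Poly_Mapping.lookup \<mu>"
    have "int (quot_dim M (?Q \<mu>)) = int (dim (weight_space U ?\<mu>)) - int (dim (weight_space U ?\<mu> \<inter> M))"
      unfolding Q[OF True] by (rule quot_dim_eq[OF subspace_weight_space[OF U(1)] fin_dim_V M(1)])
    also have "weight_space U ?\<mu> \<inter> M = weight_space M ?\<mu>" using M(2) by (auto simp: weight_space_iff)
    also have "int (dim (weight_space U ?\<mu>)) - int (dim (weight_space M ?\<mu>)) =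
        int (W.dim (\<Phi> ` U \<inter> wts ?\<mu>)) - int (W.dim (\<Phi> ` M \<inter> wts ?\<mu>))"
      using dim_weight_space[OF U(1) keys_out[OF True]] dim_weight_space[OF M(1) keys_out[OF True]] by simp
    finally have eq: "int (quot_dim M (?Q \<mu>)) = int (W.dim (\<Phi> ` U \<inter> wts ?\<mu>)) - int (W.dim (\<Phi> ` M \<inter> wts ?\<mu>))" .
    \<comment> \<open>Weights with trivial quotient space are left out of the sum that defines the
      character, so the difference of dimensions has to vanish for them.\<close>
    have "quot_dim M {M} = 0"
    proof -
      have "(\<lambda>w. w +o M) ` {0} = {M}" by simp
      then show ?thesis
        using quot_dim_eq[of "{0}" M] M(1) fin_dim_V[of "{0}"] R.dim_zero_subspace subspace_0[OF M(1)] by simp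
    qed
    then show ?thesis using l eq True by (cases "?Q \<mu> = {M}") auto
  qed (use l in auto)
qed

text \<open>One modular function of lower sets for each exponent; identities between characters
  become identities between its values.\<close>

definition H :: "(nat \<Rightarrow>\<^sub>0 int) \<Rightarrow> nat list set \<Rightarrow> int" where
  "H \<mu> I = hdim TYPE('k) I K (Poly_Mapping.lookup \<mu>)"

lemma modular_H: "modular_on lam (H \<mu>)"
  using modular_chars[OF lam(2), of K, where ?'k = 'k] hdim_empty[where ?'k = 'k]
  unfolding modular_on_def modular_chars_def H_def by blast

lemma lookup_key_polynomial:
  assumes b: "b \<in> rearrangements lam"
  shows "Poly_Mapping.lookup (key_polynomial scale n rho ev b) \<mu> =
    (if Poly_Mapping.keys \<mu> \<subseteq> {..<n} then H \<mu> (below b) else 0)"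
  unfolding key_polynomial_def lookup_character[OF subspace_D] \<Phi>_D[OF b] H_def hdim_def
    demI_below[OF lam(2) b, of K, where ?'k = 'k] ..

lemma lookup_subquotient_character:
  assumes b: "b \<in> rearrangements lam" and C: "C \<subseteq> rearrangements lam"
  shows "Poly_Mapping.lookup (subquotient_character scale n rho ev C b) \<mu> =
    (if Poly_Mapping.keys \<mu> \<subseteq> {..<n} then H \<mu> (below b) - H \<mu> (strictly_below C b) else 0)"
proof -
  let ?C = "{c \<in> C. bruhat_less c b}"
  have CP: "?C \<subseteq> rearrangements lam" using C by blast
  have \<Phi>N: "\<Phi> ` N ?C = demI (strictly_below C b) K"
    using \<Phi>_N[OF CP] demI_strictly_below[OF C] by simp
  have sub: "N ?C \<subseteq> D b"
    unfolding N_def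
  proof (rule span_minimal[OF _ subspace_D], rule UN_least)
    fix c assume c: "c \<in> ?C"
    have "\<Phi> ` D c \<subseteq> \<Phi> ` D b"
      using \<Phi>_D[of c] \<Phi>_D[OF b] dem_mono[OF lam(2) b, of c K, where ?'k = 'k] c CP
      by (auto simp: bruhat_less_def)
    then show "D c \<subseteq> D b"
    proof -
      interpret l: Vector_Spaces.linear scale fscale \<Phi> by (rule R.\<Phi>_linear)
      have "inj \<Phi>" unfolding l.inj_iff_eq_0 using R.\<Phi>_inj by blast
      then show ?thesis using \<open>\<Phi> ` D c \<subseteq> \<Phi> ` D b\<close> by (simp add: inj_image_subset_iff)
    qed
  qed
  have "Poly_Mapping.lookup (quot_character (D b) (N ?C)) \<mu> =
    (if Poly_Mapping.keys \<mu> \<subseteq> {..<n} then int (W.dim (\<Phi> ` D b \<inter> wts (Poly_Mapping.lookup \<mu>)))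
      - int (W.dim (\<Phi> ` N ?C \<inter> wts (Poly_Mapping.lookup \<mu>))) else 0)"
    by (rule lookup_quot_character[OF subspace_D _ subspace_N sub])
       (simp_all add: \<Phi>N \<Phi>_D[OF b] graded_dem graded_demI)
  then show ?thesis
    unfolding subquotient_character_def N_def[symmetric] \<Phi>N \<Phi>_D[OF b] H_def hdim_def
      demI_below[OF lam(2) b, of K, where ?'k = 'k] .
qed

lemma lookup_demazure_atom:
  assumes b: "b \<in> rearrangements lam"
  shows "Poly_Mapping.lookup (demazure_atom scale n rho ev lam b) \<mu> =
    (if Poly_Mapping.keys \<mu> \<subseteq> {..<n} then atom (H \<mu>) b else 0)"
  unfolding demazure_atom_def lookup_subquotient_character[OF b order_refl] strictly_below_rearrangements[OF b]
    atom_def ..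

end

theorem corollary3p16:
  fixes scale :: "'k::{alg_closed_field, field_char_0} \<Rightarrow> 'v::ab_group_add \<Rightarrow> 'v"
    and rho :: "'k mat \<Rightarrow> 'v \<Rightarrow> 'v"
    and ev :: "nat list \<Rightarrow> 'v"
    and n :: nat
    and T :: "'t::order set"
    and h :: "'t \<Rightarrow> nat"
    and lam a :: "nat list"
  assumes "arborescent T"
    and "consistent_linearization n T h"
    and "partition_of_length n lam"
    and "num_parts lam \<le> card T"
    and "a \<in> dominant_rearrangements n T h lam"
    and "gl_module scale n rho"
    and "gl_module.irreducible_module scale n rho"
    and "gl_module.has_highest_weight scale n rho lam"
    and "\<forall>b\<in>rearrangements lam. gl_module.extremal_vector scale n rho b (ev b)"
  shows "subquotient_character scale n rho ev (dominant_rearrangements n T h lam) a =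
           (\<Sum>c \<in> {c \<in> dominant_rearrangements n T h lam. bruhat_le c a}.
              of_int (moebius (dominant_rearrangements n T h lam) bruhat_le c a) *
              key_polynomial scale n rho ev c) \<and>
         subquotient_character scale n rho ev (dominant_rearrangements n T h lam) a =
           (\<Sum>b \<in> {b \<in> rearrangements lam. admissible n T h (rev b) \<and> bs_op n T h b = a}.
              demazure_atom scale n rho ev lam b)"
proof -
  interpret G: gl_module scale n rho by fact
  obtain v0 where v0: "v0 \<noteq> 0" "v0 \<in> G.weight_space UNIV (\<lambda>i. int (lam ! i))"
    "\<forall>X\<in>carrier_mat n n. (\<forall>i<n. \<forall>j\<le>i. X $$ (i, j) = 0) \<longrightarrow> rho X v0 = 0"
    using assms(8) unfolding G.has_highest_weight_def by blast
  have lam: "length lam = n" "sorted_wrt (\<ge>) lam" using assms(3) by (auto simp: partition_of_length_def)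
  interpret S: demazure_setting scale n rho lam v0 ev
    by (intro demazure_setting.intro demazure_setting_axioms.intro assms(6,7) v0(1,2) lam)
       (use v0(3) assms(9) in auto)
  interpret P: dominant_poset n T h lam
    by unfold_locales (use assms(2) lam in auto)
  have aD: "a \<in> P.\<D>" by fact
  have aP: "a \<in> rearrangements lam" using aD P.dominant_subset by blast
  note sub = S.lookup_subquotient_character[OF aP P.dominant_subset]
  show ?thesis
  \<comment> \<open>Both identities are checked one coefficient at a time. Exponents that involve
    other variables than the first \<open>n\<close> have coefficient 0 on both sides.\<close>
  proof (intro conjI poly_mapping_eqI)
    fix \<mu> :: "nat \<Rightarrow>\<^sub>0 int"
    show "Poly_Mapping.lookup (subquotient_character scale n rho ev P.\<D> a) \<mu> =
        Poly_Mapping.lookup (\<Sum>c\<in>{c \<in> P.\<D>. bruhat_le c a}. of_int (moebius P.\<D> bruhat_le c a) * key_polynomial scale n rho ev c) \<mu>"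
    proof -
      have "Poly_Mapping.lookup (\<Sum>c\<in>{c \<in> P.\<D>. bruhat_le c a}. of_int (moebius P.\<D> bruhat_le c a) * key_polynomial scale n rho ev c) \<mu> =
          (\<Sum>c\<in>{c \<in> P.\<D>. bruhat_le c a}. if Poly_Mapping.keys \<mu> \<subseteq> {..<n} then moebius P.\<D> bruhat_le c a * S.H \<mu> (below c) else 0)"
        unfolding lookup_sum lookup_of_int_mult
        by (intro sum.cong) (auto simp: S.lookup_key_polynomial[OF subsetD[OF P.dominant_subset]])
      then show ?thesis using P.moebius_sum_fibre[OF S.modular_H aD, of \<mu>] by (simp add: sub)
    qed
    show "Poly_Mapping.lookup (subquotient_character scale n rho ev P.\<D> a) \<mu> =
        Poly_Mapping.lookup (\<Sum>b\<in>{b \<in> rearrangements lam. admissible n T h (rev b) \<and> bs_op n T h b = a}. demazure_atom scale n rho ev lam b) \<mu>"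
    proof -
      have "Poly_Mapping.lookup (\<Sum>b\<in>P.fibre a. demazure_atom scale n rho ev lam b) \<mu> =
          (\<Sum>b\<in>P.fibre a. if Poly_Mapping.keys \<mu> \<subseteq> {..<n} then atom (S.H \<mu>) b else 0)"
        unfolding lookup_sum using S.lookup_demazure_atom by (intro sum.cong) (auto simp: P.fibre_def)
      then show ?thesis using P.sum_atoms_fibre[OF S.modular_H aD, of \<mu>] by (simp add: sub P.fibre_def[symmetric])
    qed
  qed
qed

end
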